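(* Let $G$ be a connected real Lie group of dimension $n$, let $\{e^1,\dots,e^n\}$ be a global coframe of left-invariant $1$-forms on $G$, let $M=G\times G$ with projections $\pi_1,\pi_2:M\to G$, and let $J$ be the left-invariant almost complex structure on $M$ whose bundle of $(1,0)$-forms is generated by $\varphi^i=\pi_1^*e^i+\sqrt{-1}\,\pi_2^*e^i$, $i=1,\dots,n$. Let $X=(M,J)$. Then $G$ is unimodular if and only if $\bar\partial(\varphi^1\wedge\dots\wedge\varphi^n)=0$. In particular, in this case the canonical bundle of $X$ is pseudoholomorphically trivial and $\mathrm{kod}(X)=0$.
   Context: $J$ need not be integrable. $\omega_X=\bigwedge^{n,0}X$, the bundle of $(n,0)$-forms, is the canonical bundle. On forms, $\bar\partial$ is the component of $d$ mapping $(p,q)$-forms to $(p,q+1)$-forms. Identifying $\bigwedge^{n,1}X$ with $\bigwedge^{0,1}X\otimes\omega_X$ (via $\eta\wedge s\leftrightarrow\eta\otimes s$), $\bar\partial$ acts on sections of $\omega_X$, and it is extended by the Leibniz rule to $\bar\partial:\Gamma(X,\omega_X^{\otimes m})\to\Gamma(X,\bigwedge^{0,1}X\otimes\omega_X^{\otimes m})$. A section $s$ is pseudoholomorphic if $\bar\partial s=0$, and $H^0(X,\omega_X^{\otimes m})$ denotes the space of pseudoholomorphic sections. The canonical bundle is pseudoholomorphically trivial if there is a pseudoholomorphic isomorphism of $\omega_X$ with the trivial line bundle; a nowhere vanishing pseudoholomorphic section of $\omega_X$ gives one. The Kodaira dimension is $\mathrm{kod}(X)=-\infty$ if $H^0(X,\omega_X^{\otimes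 m})=0$ for all $m\ge1$, and otherwise $\mathrm{kod}(X)=\limsup_{m\to+\infty}\frac{\log\dim H^0(X,\omega_X^{\otimes m})}{\log m}$. $G$ is unimodular when $\mathrm{tr}(\mathrm{ad}(Y))=0$ for every $Y$ in its Lie algebra.
   Formalization: kod(X)=0 is claimed only if X is compact or all spaces H^0(X,ω_X^m), m≥1, are finite-dimensional; otherwise it fails: for G=ℝ, X=ℂ and H^0 is the infinite-dimensional space of entire functions. Dimension n≥1 is assumed. *)

theory Defs
  imports
    "HOL-Analysis.Analysis"
    "HOL-Algebra.Group"
    "HOL-Library.Function_Algebras"
    "HOL-Combinatorics.Permutations"
begin

section \<open>Smooth manifolds\<close>

fun Ck_on :: "nat \<Rightarrow> ('a::real_normed_vector \<Rightarrow> 'b::real_normed_vector) \<Rightarrow> 'a set \<Rightarrow> bool" where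
  "Ck_on 0 f S \<longleftrightarrow> continuous_on S f"
| "Ck_on (Suc k) f S \<longleftrightarrow>
     (\<forall>x\<in>S. f differentiable (at x)) \<and> (\<forall>v. Ck_on k (\<lambda>x. frechet_derivative f (at x) v) S)"

text \<open>Only used for open sets \<open>S\<close>.\<close>

definition smooth_on :: "'a set \<Rightarrow> ('a::real_normed_vector \<Rightarrow> 'b::real_normed_vector) \<Rightarrow> bool" where
  "smooth_on S f \<longleftrightarrow> (\<forall>k. Ck_on k f S)"

text \<open>The points of a manifold are all elements of a type \<open>'m\<close>; the type class carries its topology.
  A chart is a domain together with a coordinate map, of which only the values on the domain
  matter.\<close>

type_synonym ('m, 'e) chart = "'m set \<times> ('m \<Rightarrow> 'e)"

definition is_chart :: "('m::topological_space, 'e::euclidean_space) chart \<Rightarrow> bool" where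
  "is_chart c \<longleftrightarrow> (case c of (U, \<psi>) \<Rightarrow>
     open U \<and> open (\<psi> ` U) \<and> homeomorphism U (\<psi> ` U) \<psi> (inv_into U \<psi>))"

definition smooth_atlas :: "('m::topological_space, 'e::euclidean_space) chart set \<Rightarrow> bool" where
  "smooth_atlas A \<longleftrightarrow>
     (\<forall>c\<in>A. is_chart c) \<and> (\<Union>c\<in>A. fst c) = UNIV \<and>
     (\<forall>(U, \<psi>)\<in>A. \<forall>(V, \<theta>)\<in>A. smooth_on (\<psi> ` (U \<inter> V)) (\<theta> \<circ> inv_into U \<psi>))"

definition prod_atlas ::
  "('m, 'e) chart set \<Rightarrow> ('k, 'f) chart set \<Rightarrow> ('m \<times> 'k, 'e \<times> 'f) chart set" where
  "prod_atlas A B = {(U \<times> V, map_prod \<psi> \<theta>) | U \<psi> V \<theta>. (U, \<psi>) \<in> A \<and> (V, \<theta>) \<in> B}"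

definition smooth_map ::
  "('m::topological_space, 'e::euclidean_space) chart set \<Rightarrow>
   ('k::topological_space, 'f::euclidean_space) chart set \<Rightarrow> ('m \<Rightarrow> 'k) \<Rightarrow> bool" where
  "smooth_map A B f \<longleftrightarrow> continuous_on UNIV f \<and>
     (\<forall>(U, \<psi>)\<in>A. \<forall>(V, \<theta>)\<in>B. smooth_on (\<psi> ` (U \<inter> f -` V)) (\<theta> \<circ> f \<circ> inv_into U \<psi>))"

definition smooth_near ::
  "('m::topological_space, 'e::euclidean_space) chart set \<Rightarrow> 'm \<Rightarrow> ('m \<Rightarrow> complex) \<Rightarrow> bool" where
  "smooth_near A p f \<longleftrightarrow> (\<exists>W. open W \<and> p \<in> W \<and>
     (\<forall>(U, \<psi>)\<in>A. smooth_on (\<psi> ` (U \<inter> W)) (f \<circ> inv_into U \<psi>)))"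

definition smooth_fun ::
  "('m::topological_space, 'e::euclidean_space) chart set \<Rightarrow> ('m \<Rightarrow> complex) \<Rightarrow> bool" where
  "smooth_fun A f \<longleftrightarrow> (\<forall>p. smooth_near A p f)"

section \<open>Tangent vectors and vector fields\<close>

text \<open>A tangent vector at \<open>p\<close> is identified with its directional derivative on complex-valued
  functions that are smooth near \<open>p\<close>; by convention it returns \<open>0\<close> on all other functions,
  so that equal tangent vectors are equal as HOL functions.\<close>

type_synonym 'm tvec = "('m \<Rightarrow> complex) \<Rightarrow> complex"
type_synonym 'm vfield = "'m \<Rightarrow> 'm tvec"

definition smooth_curve_at ::
  "('m::topological_space, 'e::euclidean_space) chart set \<Rightarrow> 'm \<Rightarrow> (real \<Rightarrow> 'm) \<Rightarrow> bool" where
  "smooth_curve_at A p c \<longleftrightarrow> c 0 = p \<and>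
     (\<exists>(U, \<psi>)\<in>A. \<exists>\<epsilon>>0. c ` {-\<epsilon><..<\<epsilon>} \<subseteq> U \<and> smooth_on {-\<epsilon><..<\<epsilon>} (\<psi> \<circ> c))"

definition velocity ::
  "('m::topological_space, 'e::euclidean_space) chart set \<Rightarrow> 'm \<Rightarrow> (real \<Rightarrow> 'm) \<Rightarrow> 'm tvec" where
  "velocity A p c = (\<lambda>f. if smooth_near A p f then vector_derivative (f \<circ> c) (at 0) else 0)"

definition tangent ::
  "('m::topological_space, 'e::euclidean_space) chart set \<Rightarrow> 'm \<Rightarrow> 'm tvec set" where
  "tangent A p = {velocity A p c | c. smooth_curve_at A p c}"

text \<open>Complexified tangent space.\<close>

definition ctangent ::
  "('m::topological_space, 'e::euclidean_space) chart set \<Rightarrow> 'm \<Rightarrow> 'm tvec set" where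
  "ctangent A p = {\<lambda>f. u f + \<i> * v f | u v. u \<in> tangent A p \<and> v \<in> tangent A p}"

definition push_forward ::
  "('k::topological_space, 'f::euclidean_space) chart set \<Rightarrow> ('m \<Rightarrow> 'k) \<Rightarrow> 'm \<Rightarrow> 'm tvec \<Rightarrow> 'k tvec"
  where
  "push_forward B f p v = (\<lambda>h. if smooth_near B (f p) h then v (h \<circ> f) else 0)"

definition smooth_vfield ::
  "('m::topological_space, 'e::euclidean_space) chart set \<Rightarrow> 'm vfield \<Rightarrow> bool" where
  "smooth_vfield A X \<longleftrightarrow> (\<forall>p. X p \<in> ctangent A p) \<and>
     (\<forall>p f. smooth_near A p f \<longrightarrow> smooth_near A p (\<lambda>q. X q f))"

definition bracket ::
  "('m::topological_space, 'e::euclidean_space) chart set \<Rightarrow> 'm vfield \<Rightarrow> 'm vfield \<Rightarrow> 'm vfield" where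
  "bracket A X Y = (\<lambda>p f. if smooth_near A p f
     then X p (\<lambda>q. Y q f) - Y p (\<lambda>q. X q f) else 0)"

section \<open>Complex differential forms\<close>

text \<open>The value of a \<open>k\<close>-form at a point is a function on lists of \<open>k\<close> complex tangent vectors,
  and is \<open>0\<close> on all other lists.\<close>

type_synonym 'm form = "'m \<Rightarrow> 'm tvec list \<Rightarrow> complex"

definition tvecs ::
  "('m::topological_space, 'e::euclidean_space) chart set \<Rightarrow> nat \<Rightarrow> 'm \<Rightarrow> 'm tvec list set" where
  "tvecs A k p = {vs. length vs = k \<and> set vs \<subseteq> ctangent A p}"

definition alt_forms ::
  "('m::topological_space, 'e::euclidean_space) chart set \<Rightarrow> nat \<Rightarrow> 'm \<Rightarrow>
   ('m tvec list \<Rightarrow> complex) set" where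
  "alt_forms A k p = {a.
     (\<forall>vs. vs \<notin> tvecs A k p \<longrightarrow> a vs = 0) \<and>
     (\<forall>vs\<in>tvecs A k p. \<forall>i<k. \<forall>u\<in>ctangent A p. \<forall>v\<in>ctangent A p. \<forall>c.
        a (vs[i := (\<lambda>f. u f + c * v f)]) = a (vs[i := u]) + c * a (vs[i := v])) \<and>
     (\<forall>vs\<in>tvecs A k p. \<forall>i<k. \<forall>j<k. i \<noteq> j \<and> vs ! i = vs ! j \<longrightarrow> a vs = 0)}"

abbreviation at_point :: "'m vfield list \<Rightarrow> 'm \<Rightarrow> 'm tvec list" where
  "at_point Xs p \<equiv> map (\<lambda>X. X p) Xs"

definition smooth_form ::
  "('m::topological_space, 'e::euclidean_space) chart set \<Rightarrow> nat \<Rightarrow> 'm form \<Rightarrow> bool" where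
  "smooth_form A k \<omega> \<longleftrightarrow> (\<forall>p. \<omega> p \<in> alt_forms A k p) \<and>
     (\<forall>Xs. length Xs = k \<and> (\<forall>X\<in>set Xs. smooth_vfield A X) \<longrightarrow>
        smooth_fun A (\<lambda>p. \<omega> p (at_point Xs p)))"

definition real_form ::
  "('m::topological_space, 'e::euclidean_space) chart set \<Rightarrow> 'm form \<Rightarrow> bool" where
  "real_form A \<omega> \<longleftrightarrow> (\<forall>p vs. set vs \<subseteq> tangent A p \<longrightarrow> \<omega> p vs \<in> \<real>)"

definition pullback ::
  "('m::topological_space, 'e::euclidean_space) chart set \<Rightarrow>
   ('k::topological_space, 'f::euclidean_space) chart set \<Rightarrow> ('m \<Rightarrow> 'k) \<Rightarrow> 'k form \<Rightarrow> 'm form" where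
  "pullback A B f \<omega> = (\<lambda>p vs. if set vs \<subseteq> ctangent A p
     then \<omega> (f p) (map (push_forward B f p) vs) else 0)"

text \<open>Wedge product of a list of 1-forms, in the determinant convention
  \<open>(\<alpha> \<and> \<beta>)(v, w) = \<alpha>(v) \<beta>(w) - \<alpha>(w) \<beta>(v)\<close>.\<close>

definition wedge_list ::
  "('m::topological_space, 'e::euclidean_space) chart set \<Rightarrow> 'm form list \<Rightarrow> 'm form" where
  "wedge_list A \<alpha>s = (\<lambda>p vs. if vs \<in> tvecs A (length \<alpha>s) p
     then (\<Sum>\<sigma> | \<sigma> permutes {..<length \<alpha>s}.
        of_int (sign \<sigma>) * (\<Prod>i<length \<alpha>s. (\<alpha>s ! i) p [vs ! \<sigma> i]))
     else 0)"

definition delete_nth :: "nat \<Rightarrow> 'a list \<Rightarrow> 'a list" where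
  "delete_nth i xs = take i xs @ drop (Suc i) xs"

text \<open>The invariant formula for the exterior derivative (no factor \<open>1/(k+1)\<close>, in agreement with the
  convention chosen for the wedge product).  Its value at \<open>p\<close> depends only on the values of the
  vector fields at \<open>p\<close>, so the choice of extensions made in \<open>ext_d\<close> is immaterial.\<close>

definition koszul ::
  "('m::topological_space, 'e::euclidean_space) chart set \<Rightarrow> 'm form \<Rightarrow> 'm vfield list \<Rightarrow>
   'm \<Rightarrow> complex" where
  "koszul A \<omega> Xs p =
     (\<Sum>i<length Xs. (-1) ^ i * (Xs ! i) p (\<lambda>q. \<omega> q (at_point (delete_nth i Xs) q))) +
     (\<Sum>(i, j) | i < j \<and> j < length Xs. (-1) ^ (i + j) *
        \<omega> p (bracket A (Xs ! i) (Xs ! j) p # at_point (delete_nth i (delete_nth j Xs)) p))"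

definition ext_d ::
  "('m::topological_space, 'e::euclidean_space) chart set \<Rightarrow> nat \<Rightarrow> 'm form \<Rightarrow> 'm form" where
  "ext_d A k \<omega> = (\<lambda>p vs. if vs \<in> tvecs A (Suc k) p
     then koszul A \<omega>
       (SOME Xs. length Xs = Suc k \<and> (\<forall>X\<in>set Xs. smooth_vfield A X) \<and> at_point Xs p = vs) p
     else 0)"

section \<open>Almost complex structures\<close>

text \<open>\<open>J p\<close> denotes the complex-linear extension to the complexified tangent space of the
  endomorphism of the real tangent space.\<close>

definition almost_complex ::
  "('m::topological_space, 'e::euclidean_space) chart set \<Rightarrow> ('m \<Rightarrow> 'm tvec \<Rightarrow> 'm tvec) \<Rightarrow> bool" where
  "almost_complex A J \<longleftrightarrow>
     (\<forall>p. \<forall>u\<in>tangent A p. J p u \<in> tangent A p) \<and>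
     (\<forall>p. \<forall>u\<in>ctangent A p. \<forall>v\<in>ctangent A p. \<forall>c.
        J p (\<lambda>f. u f + c * v f) = (\<lambda>f. J p u f + c * J p v f)) \<and>
     (\<forall>p. \<forall>u\<in>ctangent A p. J p (J p u) = (\<lambda>f. - u f)) \<and>
     (\<forall>X. smooth_vfield A X \<longrightarrow> smooth_vfield A (\<lambda>p. J p (X p)))"

definition proj10 :: "('m \<Rightarrow> 'm tvec \<Rightarrow> 'm tvec) \<Rightarrow> 'm \<Rightarrow> 'm tvec \<Rightarrow> 'm tvec" where
  "proj10 J p v = (\<lambda>f. (v f - \<i> * J p v f) / 2)"

definition proj01 :: "('m \<Rightarrow> 'm tvec \<Rightarrow> 'm tvec) \<Rightarrow> 'm \<Rightarrow> 'm tvec \<Rightarrow> 'm tvec" where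
  "proj01 J p v = (\<lambda>f. (v f + \<i> * J p v f) / 2)"

text \<open>The component of bidegree \<open>(r, q)\<close> of a form of degree \<open>r + q\<close>.\<close>

definition pq_part ::
  "('m::topological_space, 'e::euclidean_space) chart set \<Rightarrow> ('m \<Rightarrow> 'm tvec \<Rightarrow> 'm tvec) \<Rightarrow>
   nat \<Rightarrow> nat \<Rightarrow> 'm \<Rightarrow> ('m tvec list \<Rightarrow> complex) \<Rightarrow> ('m tvec list \<Rightarrow> complex)" where
  "pq_part A J r q p a = (\<lambda>vs. if vs \<in> tvecs A (r + q) p
     then (\<Sum>S | S \<subseteq> {..<r + q} \<and> card S = r.
        a (map (\<lambda>i. if i \<in> S then proj10 J p (vs ! i) else proj01 J p (vs ! i)) [0..<r + q]))
     else 0)"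

definition pq_forms ::
  "('m::topological_space, 'e::euclidean_space) chart set \<Rightarrow> ('m \<Rightarrow> 'm tvec \<Rightarrow> 'm tvec) \<Rightarrow>
   nat \<Rightarrow> nat \<Rightarrow> 'm \<Rightarrow> ('m tvec list \<Rightarrow> complex) set" where
  "pq_forms A J r q p = {a \<in> alt_forms A (r + q) p. pq_part A J r q p a = a}"

definition dbar ::
  "('m::topological_space, 'e::euclidean_space) chart set \<Rightarrow> ('m \<Rightarrow> 'm tvec \<Rightarrow> 'm tvec) \<Rightarrow>
   nat \<Rightarrow> nat \<Rightarrow> 'm form \<Rightarrow> 'm form" where
  "dbar A J r q \<alpha> = (\<lambda>p. pq_part A J r (Suc q) p (ext_d A (r + q) \<alpha> p))"

section \<open>The canonical bundle and its tensor powers\<close>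

text \<open>For a manifold modelled on \<open>'e\<close>, the complex dimension is half the dimension of \<open>'e\<close>.\<close>

definition cdim :: "('m, 'e::euclidean_space) chart set \<Rightarrow> nat" where
  "cdim A = DIM('e) div 2"

definition canonical_section ::
  "('m::topological_space, 'e::euclidean_space) chart set \<Rightarrow> ('m \<Rightarrow> 'm tvec \<Rightarrow> 'm tvec) \<Rightarrow>
   'm form \<Rightarrow> bool" where
  "canonical_section A J s \<longleftrightarrow>
     (\<forall>p. s p \<in> pq_forms A J (cdim A) 0 p) \<and> smooth_form A (cdim A) s"

text \<open>\<open>\<beta> = dbar s\<close> is an \<open>(n,1)\<close>-form, here viewed as a section of \<open>\<Lambda>\<^sup>0\<^sup>,\<^sup>1 \<otimes> \<omega>\<close> under
  \<open>\<eta> \<and> s \<leftrightarrow> \<eta> \<otimes> s\<close>.  As \<open>s\<close> annihilates \<open>(0,1)\<close>-vectors,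
  \<open>(\<eta> \<and> s)(w'', v\<^sub>1, \<dots>, v\<^sub>n) = \<eta>(w) s(v\<^sub>1, \<dots>, v\<^sub>n)\<close>, where \<open>w''\<close> is the \<open>(0,1)\<close>-part of \<open>w\<close>.\<close>

definition dbar_canonical ::
  "('m::topological_space, 'e::euclidean_space) chart set \<Rightarrow> ('m \<Rightarrow> 'm tvec \<Rightarrow> 'm tvec) \<Rightarrow>
   'm form \<Rightarrow> 'm \<Rightarrow> 'm tvec \<Rightarrow> 'm tvec list \<Rightarrow> complex" where
  "dbar_canonical A J s = (\<lambda>p w vs. if w \<in> ctangent A p
     then dbar A J (cdim A) 0 s p (proj01 J p w # vs) else 0)"

text \<open>Sections of the \<open>m\<close>-th tensor power are covariant tensors in \<open>m\<close> blocks of \<open>n\<close> vectors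
  which are \<open>(n,0)\<close>-forms in each block.\<close>

type_synonym 'm power_section = "'m \<Rightarrow> 'm tvec list list \<Rightarrow> complex"

definition blocks ::
  "('m::topological_space, 'e::euclidean_space) chart set \<Rightarrow> nat \<Rightarrow> 'm \<Rightarrow> 'm tvec list list set" where
  "blocks A m p = {vss. length vss = m \<and> set vss \<subseteq> tvecs A (cdim A) p}"

definition canonical_power_section ::
  "('m::topological_space, 'e::euclidean_space) chart set \<Rightarrow> ('m \<Rightarrow> 'm tvec \<Rightarrow> 'm tvec) \<Rightarrow>
   nat \<Rightarrow> 'm power_section \<Rightarrow> bool" where
  "canonical_power_section A J m s \<longleftrightarrow>
     (\<forall>p vss. vss \<notin> blocks A m p \<longrightarrow> s p vss = 0) \<and>
     (\<forall>p. \<forall>vss\<in>blocks A m p. \<forall>i<m.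
        (\<lambda>vs. s p (vss[i := vs])) \<in> pq_forms A J (cdim A) 0 p) \<and>
     (\<forall>Xss. length Xss = m \<and>
        (\<forall>Xs\<in>set Xss. length Xs = cdim A \<and> (\<forall>X\<in>set Xs. smooth_vfield A X)) \<longrightarrow>
        smooth_fun A (\<lambda>p. s p (map (\<lambda>Xs. at_point Xs p) Xss)))"

definition tensor :: "'m form list \<Rightarrow> 'm power_section" where
  "tensor \<alpha>s = (\<lambda>p vss. if length vss = length \<alpha>s
     then (\<Prod>j<length \<alpha>s. (\<alpha>s ! j) p (vss ! j)) else 0)"

text \<open>The graph of the extension of \<open>dbar\<close> to the \<open>m\<close>-th tensor power by the Leibniz rule.  Every
  section of the power is a finite sum of tensor products of sections of the canonical bundle.\<close>

inductive dbar_power_graph ::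
  "('m::topological_space, 'e::euclidean_space) chart set \<Rightarrow> ('m \<Rightarrow> 'm tvec \<Rightarrow> 'm tvec) \<Rightarrow> nat \<Rightarrow>
   'm power_section \<Rightarrow> ('m \<Rightarrow> 'm tvec \<Rightarrow> 'm tvec list list \<Rightarrow> complex) \<Rightarrow> bool"
  for A J m where
  leibniz: "length \<alpha>s = m \<Longrightarrow> \<forall>\<alpha>\<in>set \<alpha>s. canonical_section A J \<alpha> \<Longrightarrow>
    dbar_power_graph A J m (tensor \<alpha>s)
      (\<lambda>p w vss. if length vss = m
         then (\<Sum>i<m. dbar_canonical A J (\<alpha>s ! i) p w (vss ! i) *
                (\<Prod>j\<in>{..<m} - {i}. (\<alpha>s ! j) p (vss ! j)))
         else 0)"
| add: "dbar_power_graph A J m s t \<Longrightarrow> dbar_power_graph A J m s' t' \<Longrightarrow>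
    dbar_power_graph A J m (\<lambda>p vss. s p vss + s' p vss) (\<lambda>p w vss. t p w vss + t' p w vss)"

definition dbar_power ::
  "('m::topological_space, 'e::euclidean_space) chart set \<Rightarrow> ('m \<Rightarrow> 'm tvec \<Rightarrow> 'm tvec) \<Rightarrow> nat \<Rightarrow>
   'm power_section \<Rightarrow> ('m \<Rightarrow> 'm tvec \<Rightarrow> 'm tvec list list \<Rightarrow> complex)" where
  "dbar_power A J m s = (THE t. dbar_power_graph A J m s t)"

definition H0 ::
  "('m::topological_space, 'e::euclidean_space) chart set \<Rightarrow> ('m \<Rightarrow> 'm tvec \<Rightarrow> 'm tvec) \<Rightarrow> nat \<Rightarrow>
   'm power_section set" where
  "H0 A J m = {s. canonical_power_section A J m s \<and> dbar_power A J m s = (\<lambda>p w vss. 0)}"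

text \<open>A pseudoholomorphic isomorphism from the canonical bundle to the trivial line bundle: a smooth
  fibrewise linear isomorphism \<open>\<tau>\<close> which intertwines the two \<open>dbar\<close>-operators.\<close>

definition pseudoholomorphically_trivial ::
  "('m::topological_space, 'e::euclidean_space) chart set \<Rightarrow> ('m \<Rightarrow> 'm tvec \<Rightarrow> 'm tvec) \<Rightarrow> bool" where
  "pseudoholomorphically_trivial A J \<longleftrightarrow>
     (\<exists>\<tau> :: 'm \<Rightarrow> ('m tvec list \<Rightarrow> complex) \<Rightarrow> complex.
       (\<forall>p. bij_betw (\<tau> p) (pq_forms A J (cdim A) 0 p) UNIV) \<and>
       (\<forall>p. \<forall>a\<in>pq_forms A J (cdim A) 0 p. \<forall>b\<in>pq_forms A J (cdim A) 0 p. \<forall>c.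
          \<tau> p (\<lambda>vs. a vs + c * b vs) = \<tau> p a + c * \<tau> p b) \<and>
       (\<forall>s. (\<forall>p. s p \<in> pq_forms A J (cdim A) 0 p) \<longrightarrow>
          (canonical_section A J s \<longleftrightarrow> smooth_fun A (\<lambda>p. \<tau> p (s p)))) \<and>
       (\<forall>s. canonical_section A J s \<longrightarrow> (\<forall>p. \<forall>w\<in>ctangent A p.
          \<tau> p (dbar_canonical A J s p w) = proj01 J p w (\<lambda>q. \<tau> q (s q)))))"

section \<open>Kodaira dimension\<close>

definition fun_scale :: "complex \<Rightarrow> ('a \<Rightarrow> 'b \<Rightarrow> complex) \<Rightarrow> ('a \<Rightarrow> 'b \<Rightarrow> complex)" where
  "fun_scale c s = (\<lambda>p x. c * s p x)"

global_interpretation complex_fun: vector_space fun_scale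
  by unfold_locales (auto simp: fun_scale_def fun_eq_iff algebra_simps)

global_interpretation real_fun: vector_space "\<lambda>r. fun_scale (complex_of_real r)"
  by unfold_locales (auto simp: fun_scale_def fun_eq_iff algebra_simps)

definition finite_dim :: "('a \<Rightarrow> 'b \<Rightarrow> complex) set \<Rightarrow> bool" where
  "finite_dim V \<longleftrightarrow> (\<exists>B. finite B \<and> V \<subseteq> complex_fun.span B)"

text \<open>\<open>log (dim V)\<close>, with \<open>log 0 = -\<infinity>\<close> and \<open>log \<infinity> = \<infinity>\<close>.\<close>

definition log_dim :: "('a \<Rightarrow> 'b \<Rightarrow> complex) set \<Rightarrow> ereal" where
  "log_dim V = (if \<not> finite_dim V then \<infinity>
     else if complex_fun.dim V = 0 then -\<infinity>
     else ereal (ln (real (complex_fun.dim V))))"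

definition kod ::
  "('m::topological_space, 'e::euclidean_space) chart set \<Rightarrow> ('m \<Rightarrow> 'm tvec \<Rightarrow> 'm tvec) \<Rightarrow> ereal" where
  "kod A J = (if \<forall>m\<ge>1. H0 A J m = {\<lambda>p vss. 0} then -\<infinity>
     else limsup (\<lambda>m. log_dim (H0 A J m) / ereal (ln (real m))))"

section \<open>Lie groups\<close>

definition lie_group ::
  "('g::topological_space, 'e::euclidean_space) chart set \<Rightarrow> ('g, 'x) monoid_scheme \<Rightarrow> bool" where
  "lie_group A G \<longleftrightarrow> group G \<and> carrier G = UNIV \<and> smooth_atlas A \<and>
     smooth_map (prod_atlas A A) A (\<lambda>(x, y). x \<otimes>\<^bsub>G\<^esub> y) \<and> smooth_map A A (\<lambda>x. inv\<^bsub>G\<^esub> x)"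

definition left_invariant_form ::
  "('g::topological_space, 'e::euclidean_space) chart set \<Rightarrow> ('g, 'x) monoid_scheme \<Rightarrow>
   'g form \<Rightarrow> bool" where
  "left_invariant_form A G \<omega> \<longleftrightarrow> (\<forall>g. pullback A A (\<lambda>x. g \<otimes>\<^bsub>G\<^esub> x) \<omega> = \<omega>)"

definition left_invariant_endo ::
  "('g::topological_space, 'e::euclidean_space) chart set \<Rightarrow> ('g, 'x) monoid_scheme \<Rightarrow>
   ('g \<Rightarrow> 'g tvec \<Rightarrow> 'g tvec) \<Rightarrow> bool" where
  "left_invariant_endo A G J \<longleftrightarrow> (\<forall>g x. \<forall>v\<in>ctangent A x.
     J (g \<otimes>\<^bsub>G\<^esub> x) (push_forward A (\<lambda>y. g \<otimes>\<^bsub>G\<^esub> y) x v) =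
     push_forward A (\<lambda>y. g \<otimes>\<^bsub>G\<^esub> y) x (J x v))"

text \<open>The Lie algebra: real left-invariant vector fields.\<close>

definition lie_algebra ::
  "('g::topological_space, 'e::euclidean_space) chart set \<Rightarrow> ('g, 'x) monoid_scheme \<Rightarrow>
   'g vfield set" where
  "lie_algebra A G = {X. smooth_vfield A X \<and> (\<forall>p. X p \<in> tangent A p) \<and>
     (\<forall>g x. X (g \<otimes>\<^bsub>G\<^esub> x) = push_forward A (\<lambda>y. g \<otimes>\<^bsub>G\<^esub> y) x (X x))}"

text \<open>Trace of an endomorphism of a finite-dimensional real vector space, computed in any basis.\<close>

definition real_trace ::
  "('a \<Rightarrow> 'b \<Rightarrow> complex) set \<Rightarrow> (('a \<Rightarrow> 'b \<Rightarrow> complex) \<Rightarrow> ('a \<Rightarrow> 'b \<Rightarrow> complex)) \<Rightarrow> real" where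
  "real_trace V T =
     (let B = (SOME B. real_fun.independent B \<and> real_fun.span B = V)
      in \<Sum>b\<in>B. real_fun.representation B (T b) b)"

definition unimodular ::
  "('g::topological_space, 'e::euclidean_space) chart set \<Rightarrow> ('g, 'x) monoid_scheme \<Rightarrow> bool" where
  "unimodular A G \<longleftrightarrow> (\<forall>Y\<in>lie_algebra A G. real_trace (lie_algebra A G) (bracket A Y) = 0)"

text \<open>\<open>e 1, \<dots>, e n\<close> are real left-invariant 1-forms, whose values at each point form a basis of the
  real cotangent space.\<close>

definition left_invariant_coframe ::
  "('g::topological_space, 'e::euclidean_space) chart set \<Rightarrow> ('g, 'x) monoid_scheme \<Rightarrow>
   nat \<Rightarrow> (nat \<Rightarrow> 'g form) \<Rightarrow> bool" where
  "left_invariant_coframe A G n e \<longleftrightarrow>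
     (\<forall>i\<in>{1..n}. smooth_form A 1 (e i) \<and> real_form A (e i) \<and> left_invariant_form A G (e i)) \<and>
     (\<forall>p. \<forall>a\<in>alt_forms A 1 p. (\<forall>v\<in>tangent A p. a [v] \<in> \<real>) \<longrightarrow>
        (\<exists>!c :: nat \<Rightarrow> real. (\<forall>i. i \<notin> {1..n} \<longrightarrow> c i = 0) \<and>
           a = (\<lambda>vs. \<Sum>i=1..n. complex_of_real (c i) * e i p vs)))"

definition phi ::
  "('g::topological_space, 'e::euclidean_space) chart set \<Rightarrow> (nat \<Rightarrow> 'g form) \<Rightarrow> nat \<Rightarrow>
   ('g \<times> 'g) form" where
  "phi A e i = (\<lambda>p vs. pullback (prod_atlas A A) A fst (e i) p vs +
     \<i> * pullback (prod_atlas A A) A snd (e i) p vs)"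

end

theory Submission
  imports Defs
begin

text \<open>Let \<open>E\<^sub>i\<close> be the left-invariant frame of \<open>G\<close> dual to \<open>e\<^sup>i\<close>, with \<open>[E\<^sub>i, E\<^sub>j] = \<Sum>\<^sub>k C\<^sub>i\<^sub>j\<^sup>k E\<^sub>k\<close>, and let
  \<open>Z\<^sub>i = (E\<^sub>i\<^sup>(\<^sup>1\<^sup>) - \<i> E\<^sub>i\<^sup>(\<^sup>2\<^sup>)) / 2\<close>, where \<open>E\<^sub>i\<^sup>(\<^sup>1\<^sup>)\<close> and \<open>E\<^sub>i\<^sup>(\<^sup>2\<^sup>)\<close> are the two lifts of \<open>E\<^sub>i\<close> to \<open>G \<times> G\<close>.  The \<open>Z\<^sub>i\<close> and their
  conjugates form the frame dual to \<open>\<phi>\<^sup>i\<close> and their conjugates, and since the two families of lifts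
  commute, the \<open>\<phi>\<^sup>m\<close>-component of the bracket of the conjugate of \<open>Z\<^sub>l\<close> with \<open>Z\<^sub>k\<close> is \<open>(1 + \<i>) C\<^sub>l\<^sub>k\<^sup>m / 4\<close>.
  Hence the invariant formula for \<open>d\<close> shows that \<open>dbar\<close> of \<open>\<Phi> = \<phi>\<^sup>1 \<and> \<dots> \<and> \<phi>\<^sup>n\<close> is governed by the numbers
  \<open>\<Sum>\<^sub>k C\<^sub>l\<^sub>k\<^sup>k = tr (ad E\<^sub>l)\<close>.  If they vanish, \<open>\<Phi>\<close> trivialises the canonical bundle, and the pluricanonical
  sections are \<open>f \<Phi>\<^sup>m\<close> with \<open>f\<close> pseudoholomorphic.  Such an \<open>f\<close> is constant: if the space of these
  functions is finite-dimensional, because the powers of \<open>f\<close> are linearly dependent, so that \<open>f\<close> has finitely many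
  values; and if \<open>G \<times> G\<close> is compact, by a maximum principle for the operators
  \<open>(E\<^sub>i\<^sup>(\<^sup>1\<^sup>))\<^sup>2 + (E\<^sub>i\<^sup>(\<^sup>2\<^sup>))\<^sup>2\<close>, which annihilate \<open>f\<close>.\<close>

text \<open>The condition attached to \<open>kod\<close> is forced. For the additive group of the
  reals \<open>X\<close> is the complex plane, its pluricanonical sections are all entire functions
  times a power of \<Phi>, and \<open>kod\<close> is infinite. Two definitions rest on a choice.
  \<open>ext_d\<close> extends vectors to fields by \<open>SOME\<close>; the independence of the
  extension is usually a local matter, but here the global frame settles it, because two extensions
  differ by frame fields whose coefficients vanish at the point. Afterwards vectors are extended
  with constant coefficients, so that apart from the derivative of the coefficient of \<Phi> only
  brackets with one (0,1)-field survive, and these add up to a trace. \<open>dbar_power\<close> is a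
  \<open>THE\<close>; it is single-valued because \<Phi> turns a section of a power into one
  function and the Leibniz rule into the derivative of that function. In the compact case the
  operators \<open>X^2 + Y^2\<close> involve only two directions at each point, so they are not
  elliptic in general and give no strict maximum principle by themselves. Transitive translations
  repair this: enough translates of a square are strictly subharmonic in sum.\<close>

section \<open>Calculus of functions of class C^k\<close>

lemmas frechet_derivative_worksI = frechet_derivative_works[THEN iffD1]

text \<open>The derivative at \<open>x\<close> looks at a whole neighbourhood of \<open>x\<close>,
  so agreement on \<open>S\<close> is enough only because \<open>S\<close> is open. The later
  closure properties inherit their openness hypothesis from here.\<close>

lemma Ck_on_cong:
  assumes "open S" "\<And>x. x \<in> S \<Longrightarrow> f x = g x" "Ck_on k f S"
  shows "Ck_on k g S"
  using assms(2,3)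
proof (induction k arbitrary: f g)
  case 0
  then show ?case by (simp cong: continuous_on_cong)
next
  case (Suc k)
  have d: "(g has_derivative frechet_derivative f (at x)) (at x)" if "x \<in> S" for x
  proof (rule has_derivative_transform_within_open[of f _ x UNIV S g])
    show "(f has_derivative frechet_derivative f (at x)) (at x)"
      using Suc.prems(2) that by (auto intro: frechet_derivative_worksI)
  qed (use assms(1) that Suc.prems in auto)
  have e: "frechet_derivative f (at x) = frechet_derivative g (at x)" if "x \<in> S" for x
    using frechet_derivative_at[OF d[OF that]] by simp
  show ?case
    unfolding Ck_on.simps
  proof (intro conjI ballI allI)
    fix x assume "x \<in> S"
    then show "g differentiable at x" using d by (auto simp: differentiable_def)
  next
    fix v
    show "Ck_on k (\<lambda>x. frechet_derivative g (at x) v) S"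
      by (rule Suc.IH[of "\<lambda>x. frechet_derivative f (at x) v"]) (use e Suc.prems(2) in auto)
  qed
qed

lemma Ck_on_Suc_imp: "Ck_on (Suc k) f S \<Longrightarrow> Ck_on k f S"
proof (induction k arbitrary: f)
  case 0
  then show ?case
    by (auto intro!: continuous_at_imp_continuous_on differentiable_imp_continuous_within)
next
  case (Suc k)
  then show ?case by (metis Ck_on.simps(2))
qed

lemma Ck_on_subset: "Ck_on k f S \<Longrightarrow> T \<subseteq> S \<Longrightarrow> Ck_on k f T"
  by (induction k arbitrary: f) (auto intro: continuous_on_subset)

lemma Ck_on_const: "Ck_on k (\<lambda>x. c) S"
  by (induction k arbitrary: c) auto

lemma Ck_on_bounded_linear:
  assumes "bounded_linear L" "open S" "Ck_on k f S"
  shows "Ck_on k (\<lambda>x. L (f x)) S"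
  using assms(3)
proof (induction k arbitrary: f)
  case 0
  then show ?case using assms(1) by (simp add: bounded_linear.continuous_on)
next
  case (Suc k)
  have d: "((\<lambda>x. L (f x)) has_derivative (\<lambda>v. L (frechet_derivative f (at x) v))) (at x)" if "x \<in> S" for x
    using Suc.prems that by (auto intro!: bounded_linear.has_derivative[OF assms(1)] frechet_derivative_worksI)
  have e: "frechet_derivative (\<lambda>x. L (f x)) (at x) = (\<lambda>v. L (frechet_derivative f (at x) v))" if "x \<in> S" for x
    using frechet_derivative_at[OF d[OF that]] by simp
  show ?case unfolding Ck_on.simps
  proof (intro conjI ballI allI)
    fix x assume "x \<in> S"
    then show "(\<lambda>x. L (f x)) differentiable at x" using d by (auto simp: differentiable_def)
  next
    fix v
    have "Ck_on k (\<lambda>x. L (frechet_derivative f (at x) v)) S"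
      by (rule Suc.IH) (use Suc.prems in auto)
    then show "Ck_on k (\<lambda>x. frechet_derivative (\<lambda>x. L (f x)) (at x) v) S"
      by (rule Ck_on_cong[OF assms(2), rotated]) (simp add: e)
  qed
qed

lemma Ck_on_add:
  assumes "open S" "Ck_on k f S" "Ck_on k g S"
  shows "Ck_on k (\<lambda>x. f x + g x) S"
  using assms(2,3)
proof (induction k arbitrary: f g)
  case 0
  then show ?case by (simp add: continuous_on_add)
next
  case (Suc k)
  have d: "((\<lambda>x. f x + g x) has_derivative
      (\<lambda>v. frechet_derivative f (at x) v + frechet_derivative g (at x) v)) (at x)" if "x \<in> S" for x
    using Suc.prems that by (auto intro!: frechet_derivative_worksI has_derivative_add)
  have e: "frechet_derivative (\<lambda>x. f x + g x) (at x) =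
      (\<lambda>v. frechet_derivative f (at x) v + frechet_derivative g (at x) v)" if "x \<in> S" for x
    using frechet_derivative_at[OF d[OF that]] by simp
  show ?case unfolding Ck_on.simps
  proof (intro conjI ballI allI)
    fix x assume "x \<in> S"
    then show "(\<lambda>x. f x + g x) differentiable at x" using d by (auto simp: differentiable_def)
  next
    fix v
    have "Ck_on k (\<lambda>x. frechet_derivative f (at x) v + frechet_derivative g (at x) v) S"
      by (rule Suc.IH) (use Suc.prems in auto)
    then show "Ck_on k (\<lambda>x. frechet_derivative (\<lambda>x. f x + g x) (at x) v) S"
      by (rule Ck_on_cong[OF assms(1), rotated]) (simp add: e)
  qed
qed

lemma Ck_on_bilinear:
  assumes "bounded_bilinear B" "open S" "Ck_on k f S" "Ck_on k g S"
  shows "Ck_on k (\<lambda>x. B (f x) (g x)) S"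
  using assms(3,4)
proof (induction k arbitrary: f g)
  case 0
  then show ?case using assms(1) by (simp add: bounded_bilinear.continuous_on)
next
  case (Suc k)
  have d: "((\<lambda>x. B (f x) (g x)) has_derivative
      (\<lambda>v. B (f x) (frechet_derivative g (at x) v) + B (frechet_derivative f (at x) v) (g x))) (at x)" if "x \<in> S" for x
    using Suc.prems that by (auto intro!: frechet_derivative_worksI bounded_bilinear.FDERIV[OF assms(1)])
  have e: "frechet_derivative (\<lambda>x. B (f x) (g x)) (at x) =
      (\<lambda>v. B (f x) (frechet_derivative g (at x) v) + B (frechet_derivative f (at x) v) (g x))" if "x \<in> S" for x
    using frechet_derivative_at[OF d[OF that]] by simp
  show ?case unfolding Ck_on.simps
  proof (intro conjI ballI allI)
    fix x assume "x \<in> S"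
    then show "(\<lambda>x. B (f x) (g x)) differentiable at x" using d by (auto simp: differentiable_def)
  next
    fix v
    have "Ck_on k f S" "Ck_on k g S" using Suc.prems Ck_on_Suc_imp by blast+
    then have "Ck_on k (\<lambda>x. B (f x) (frechet_derivative g (at x) v) + B (frechet_derivative f (at x) v) (g x)) S"
      using Suc.prems by (intro Ck_on_add assms(2) Suc.IH) auto
    then show "Ck_on k (\<lambda>x. frechet_derivative (\<lambda>x. B (f x) (g x)) (at x) v) S"
      by (rule Ck_on_cong[OF assms(2), rotated]) (simp add: e)
  qed
qed

lemma Ck_on_sum:
  assumes "open S" "finite I" "\<And>i. i \<in> I \<Longrightarrow> Ck_on k (f i) S"
  shows "Ck_on k (\<lambda>x. \<Sum>i\<in>I. f i x) S"
  using assms(2,3) by (induction I rule: finite_induct) (auto intro!: Ck_on_const Ck_on_add assms(1))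

text \<open>\<open>Ck_on\<close> controls derivatives in fixed directions only, whereas the chain
  rule evaluates the derivative of the outer map in a direction that moves with the point. Expanding
  this direction in a basis turns the moving part into scalar coefficients.\<close>

lemma frechet_derivative_Basis_sum:
  fixes f :: "'a::euclidean_space \<Rightarrow> 'b::real_normed_vector"
  assumes "f differentiable at x"
  shows "frechet_derivative f (at x) v = (\<Sum>b\<in>Basis. (v \<bullet> b) *\<^sub>R frechet_derivative f (at x) b)"
proof -
  interpret linear "frechet_derivative f (at x)" using assms by (rule linear_frechet_derivative)
  have "frechet_derivative f (at x) v = frechet_derivative f (at x) (\<Sum>b\<in>Basis. (v \<bullet> b) *\<^sub>R b)"
    by (simp add: euclidean_representation)
  also have "\<dots> = (\<Sum>b\<in>Basis. (v \<bullet> b) *\<^sub>R frechet_derivative f (at x) b)"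
    by (simp add: sum scale)
  finally show ?thesis .
qed

lemma Ck_on_compose:
  fixes g :: "'b::euclidean_space \<Rightarrow> 'c::real_normed_vector"
  assumes "open S" "open T" "f ` S \<subseteq> T" "Ck_on k f S" "Ck_on k g T"
  shows "Ck_on k (\<lambda>x. g (f x)) S"
  using assms(4,5)
proof (induction k arbitrary: g)
  case 0
  then show ?case using continuous_on_compose2[of T g S f] assms(3) by auto
next
  case (Suc k)
  let ?D = "\<lambda>x v. \<Sum>b\<in>Basis. (frechet_derivative f (at x) v \<bullet> b) *\<^sub>R frechet_derivative g (at (f x)) b"
  have d: "((\<lambda>x. g (f x)) has_derivative ?D x) (at x)" if "x \<in> S" for x
  proof -
    have fx: "f x \<in> T" using assms(3) that by auto
    have "(f has_derivative frechet_derivative f (at x)) (at x)"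
      using Suc.prems that by (auto intro: frechet_derivative_worksI)
    moreover have "(g has_derivative frechet_derivative g (at (f x))) (at (f x))"
      using Suc.prems fx by (auto intro: frechet_derivative_worksI)
    ultimately have "((\<lambda>x. g (f x)) has_derivative
         (\<lambda>v. frechet_derivative g (at (f x)) (frechet_derivative f (at x) v))) (at x)"
      using has_derivative_compose by blast
    moreover have "(\<lambda>v. frechet_derivative g (at (f x)) (frechet_derivative f (at x) v)) = ?D x"
      by (rule ext, rule frechet_derivative_Basis_sum) (use Suc.prems fx in auto)
    ultimately show ?thesis by simp
  qed
  have e: "frechet_derivative (\<lambda>x. g (f x)) (at x) = ?D x" if "x \<in> S" for x
    using frechet_derivative_at[OF d[OF that]] by simp
  show ?case unfolding Ck_on.simps
  proof (intro conjI ballI allI)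
    fix x assume "x \<in> S"
    then show "(\<lambda>x. g (f x)) differentiable at x" using d by (auto simp: differentiable_def)
  next
    fix v
    have "Ck_on k f S" using Suc.prems Ck_on_Suc_imp by blast
    then have "Ck_on k (\<lambda>x. ?D x v) S"
      using Suc.prems
      by (intro Ck_on_sum assms(1) finite_Basis Ck_on_bilinear[OF bounded_bilinear_scaleR] Suc.IH
          Ck_on_bounded_linear[OF bounded_linear_inner_left]) auto
    then show "Ck_on k (\<lambda>x. frechet_derivative (\<lambda>x. g (f x)) (at x) v) S"
      by (rule Ck_on_cong[OF assms(1), rotated]) (simp add: e)
  qed
qed

lemma smooth_on_cong:
  assumes "open S" "\<And>x. x \<in> S \<Longrightarrow> f x = g x" "smooth_on S f"
  shows "smooth_on S g"
  using assms Ck_on_cong unfolding smooth_on_def by blast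

lemma smooth_on_subset: "smooth_on S f \<Longrightarrow> T \<subseteq> S \<Longrightarrow> smooth_on T f"
  unfolding smooth_on_def using Ck_on_subset by blast

lemma smooth_on_const: "smooth_on S (\<lambda>x. c)"
  by (simp add: smooth_on_def Ck_on_const)

lemma smooth_on_bounded_linear:
  "bounded_linear L \<Longrightarrow> open S \<Longrightarrow> smooth_on S f \<Longrightarrow> smooth_on S (\<lambda>x. L (f x))"
  by (simp add: smooth_on_def Ck_on_bounded_linear)

lemma smooth_on_bilinear:
  "bounded_bilinear B \<Longrightarrow> open S \<Longrightarrow> smooth_on S f \<Longrightarrow> smooth_on S g \<Longrightarrow> smooth_on S (\<lambda>x. B (f x) (g x))"
  by (simp add: smooth_on_def Ck_on_bilinear)

lemma smooth_on_add:
  "open S \<Longrightarrow> smooth_on S f \<Longrightarrow> smooth_on S g \<Longrightarrow> smooth_on S (\<lambda>x. f x + g x)"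
  by (simp add: smooth_on_def Ck_on_add)

lemma smooth_on_compose:
  fixes g :: "'b::euclidean_space \<Rightarrow> 'c::real_normed_vector"
  shows "open S \<Longrightarrow> open T \<Longrightarrow> f ` S \<subseteq> T \<Longrightarrow> smooth_on S f \<Longrightarrow> smooth_on T g \<Longrightarrow>
    smooth_on S (\<lambda>x. g (f x))"
  by (simp add: smooth_on_def Ck_on_compose)

lemma smooth_on_imp_differentiable: "smooth_on S f \<Longrightarrow> x \<in> S \<Longrightarrow> f differentiable at x"
  unfolding smooth_on_def by (metis Ck_on.simps(2))

lemma smooth_on_imp_continuous_on: "smooth_on S f \<Longrightarrow> continuous_on S f"
  unfolding smooth_on_def by (metis Ck_on.simps(1))

lemma smooth_on_frechet_derivative:
  "smooth_on S f \<Longrightarrow> smooth_on S (\<lambda>x. frechet_derivative f (at x) v)"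
  unfolding smooth_on_def by (metis Ck_on.simps(2))

lemma Ck_on_ident: "Ck_on k (\<lambda>x. x) S"
  by (cases k) (auto simp: Ck_on_const continuous_on_id)

lemma smooth_on_ident: "smooth_on S (\<lambda>x. x)"
  by (simp add: smooth_on_def Ck_on_ident)

lemma smooth_on_Pair:
  assumes "open S" "smooth_on S f" "smooth_on S g"
  shows "smooth_on S (\<lambda>x. (f x, g x))"
proof -
  have "bounded_linear (\<lambda>x. (x, 0))" "bounded_linear (\<lambda>x. (0, x))"
    by (intro bounded_linear_Pair bounded_linear_ident bounded_linear_zero)+
  from this[THEN smooth_on_bounded_linear, OF assms(1)] assms
  have "smooth_on S (\<lambda>x. (f x, 0) + (0, g x))"
    by (intro smooth_on_add) auto
  then show ?thesis by simp
qed

section \<open>Symmetry of second derivatives\<close>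

text \<open>Two applications of the mean value theorem: along \<open>u\<close> to the difference of
  two parallel restrictions, then along \<open>v\<close> to the derivative obtained. The second
  difference itself is symmetric in \<open>u\<close> and \<open>v\<close>, which makes the two mixed
  derivatives comparable.\<close>

lemma second_difference_mean_value:
  fixes f :: "'a::real_normed_vector \<Rightarrow> real"
  assumes d1: "\<And>y. y \<in> ball x r \<Longrightarrow> f differentiable at y"
    and d2: "\<And>y. y \<in> ball x r \<Longrightarrow> (\<lambda>z. frechet_derivative f (at z) u) differentiable at y"
    and t: "0 < t" "t * (norm u + norm v) < r"
  shows "\<exists>y. dist x y \<le> t * (norm u + norm v) \<and>
    f (x + t *\<^sub>R u + t *\<^sub>R v) - f (x + t *\<^sub>R u) - f (x + t *\<^sub>R v) + f x =
    t * t * frechet_derivative (\<lambda>z. frechet_derivative f (at z) u) (at y) v"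
proof -
  have inball: "x + a *\<^sub>R u + b *\<^sub>R v \<in> ball x r" and
    near: "dist x (x + a *\<^sub>R u + b *\<^sub>R v) \<le> t * (norm u + norm v)"
    if "0 \<le> a" "a \<le> t" "0 \<le> b" "b \<le> t" for a b
  proof -
    have that0: "dist x (x + w) = norm w" for w by (simp add: dist_norm)
    have "dist x (x + a *\<^sub>R u + b *\<^sub>R v) = norm (a *\<^sub>R u + b *\<^sub>R v)"
      using that0[of "a *\<^sub>R u + b *\<^sub>R v"] by (simp only: add.assoc)
    also have "\<dots> \<le> a * norm u + b * norm v"
      using norm_triangle_ineq[of "a *\<^sub>R u" "b *\<^sub>R v"] that by simp
    also have "\<dots> \<le> t * norm u + t * norm v"
      by (intro add_mono mult_right_mono) (use that in auto)
    finally show "dist x (x + a *\<^sub>R u + b *\<^sub>R v) \<le> t * (norm u + norm v)"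
      by (simp add: algebra_simps)
    then show "x + a *\<^sub>R u + b *\<^sub>R v \<in> ball x r" using t by simp
  qed
  define g where "g s = f (x + s *\<^sub>R u + t *\<^sub>R v) - f (x + s *\<^sub>R u)" for s
  have fd: "((\<lambda>s. f (x + s *\<^sub>R u + b *\<^sub>R v)) has_real_derivative
      frechet_derivative f (at (x + s *\<^sub>R u + b *\<^sub>R v)) u) (at s)"
    if "0 \<le> s" "s \<le> t" "0 \<le> b" "b \<le> t" for s b
  proof -
    have df: "f differentiable at (x + s *\<^sub>R u + b *\<^sub>R v)" using d1 inball that by blast
    have 1: "((\<lambda>s. x + s *\<^sub>R u + b *\<^sub>R v) has_derivative (\<lambda>h. h *\<^sub>R u)) (at s)"
      by (auto intro!: derivative_eq_intros)
    have "((\<lambda>s. f (x + s *\<^sub>R u + b *\<^sub>R v)) has_derivative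
        (\<lambda>h. frechet_derivative f (at (x + s *\<^sub>R u + b *\<^sub>R v)) (h *\<^sub>R u))) (at s)"
      using has_derivative_compose[OF 1] df frechet_derivative_works by blast
    moreover have "(\<lambda>h. frechet_derivative f (at (x + s *\<^sub>R u + b *\<^sub>R v)) (h *\<^sub>R u)) =
        (*) (frechet_derivative f (at (x + s *\<^sub>R u + b *\<^sub>R v)) u)"
      by (rule ext) (simp add: linear_scale[OF linear_frechet_derivative[OF df]])
    ultimately show ?thesis by (simp add: has_field_derivative_def)
  qed
  have gd: "(g has_real_derivative (frechet_derivative f (at (x + s *\<^sub>R u + t *\<^sub>R v)) u -
      frechet_derivative f (at (x + s *\<^sub>R u)) u)) (at s)" if "0 \<le> s" "s \<le> t" for s
    unfolding g_def using fd[OF that, of t] fd[OF that, of 0] t by (auto intro!: derivative_eq_intros)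
  have "\<exists>s>0. s < t \<and> g t - g 0 = (t - 0) * (frechet_derivative f (at (x + s *\<^sub>R u + t *\<^sub>R v)) u -
      frechet_derivative f (at (x + s *\<^sub>R u)) u)"
    by (rule MVT2[OF t(1)]) (rule gd)
  then obtain s where s: "0 < s" "s < t" and
    gs: "g t - g 0 = (t - 0) * (frechet_derivative f (at (x + s *\<^sub>R u + t *\<^sub>R v)) u -
      frechet_derivative f (at (x + s *\<^sub>R u)) u)"
    by blast
  define h where "h b = frechet_derivative f (at (x + s *\<^sub>R u + b *\<^sub>R v)) u" for b
  have hd: "(h has_real_derivative
     frechet_derivative (\<lambda>z. frechet_derivative f (at z) u) (at (x + s *\<^sub>R u + b *\<^sub>R v)) v) (at b)"
    if "0 \<le> b" "b \<le> t" for b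
  proof -
    let ?F = "\<lambda>z. frechet_derivative f (at z) u"
    have df: "?F differentiable at (x + s *\<^sub>R u + b *\<^sub>R v)" using d2 inball that s by auto
    have 1: "((\<lambda>b. x + s *\<^sub>R u + b *\<^sub>R v) has_derivative (\<lambda>h. h *\<^sub>R v)) (at b)"
      by (auto intro!: derivative_eq_intros)
    have "((\<lambda>b. ?F (x + s *\<^sub>R u + b *\<^sub>R v)) has_derivative
        (\<lambda>h. frechet_derivative ?F (at (x + s *\<^sub>R u + b *\<^sub>R v)) (h *\<^sub>R v))) (at b)"
      using has_derivative_compose[OF 1, of ?F] df frechet_derivative_works by blast
    moreover have "(\<lambda>h. frechet_derivative ?F (at (x + s *\<^sub>R u + b *\<^sub>R v)) (h *\<^sub>R v)) =
        (*) (frechet_derivative ?F (at (x + s *\<^sub>R u + b *\<^sub>R v)) v)"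
      by (rule ext) (simp add: linear_scale[OF linear_frechet_derivative[OF df]])
    ultimately show ?thesis by (simp add: has_field_derivative_def h_def[abs_def])
  qed
  have "\<exists>b>0. b < t \<and> h t - h 0 =
      (t - 0) * frechet_derivative (\<lambda>z. frechet_derivative f (at z) u) (at (x + s *\<^sub>R u + b *\<^sub>R v)) v"
    by (rule MVT2[OF t(1)]) (rule hd)
  then obtain b where b: "0 < b" "b < t" and
    hb: "h t - h 0 = (t - 0) * frechet_derivative (\<lambda>z. frechet_derivative f (at z) u) (at (x + s *\<^sub>R u + b *\<^sub>R v)) v"
    by blast
  have "f (x + t *\<^sub>R u + t *\<^sub>R v) - f (x + t *\<^sub>R u) - f (x + t *\<^sub>R v) + f x = g t - g 0"
    by (simp add: g_def)
  also have "\<dots> = t * (h t - h 0)" using gs by (simp add: h_def)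
  also have "\<dots> = t * t * frechet_derivative (\<lambda>z. frechet_derivative f (at z) u) (at (x + s *\<^sub>R u + b *\<^sub>R v)) v"
    using hb by simp
  finally show ?thesis using near[of s b] s b by (intro exI[of _ "x + s *\<^sub>R u + b *\<^sub>R v"]) auto
qed

text \<open>One and the same second difference is a value of either mixed derivative at points close
  to \<open>x\<close>; continuity of both then forces equality at \<open>x\<close>.\<close>

lemma symmetric_second_derivative_real:
  fixes f :: "'a::real_normed_vector \<Rightarrow> real"
  assumes S: "open S" "x \<in> S" and f: "smooth_on S f"
  shows "frechet_derivative (\<lambda>z. frechet_derivative f (at z) u) (at x) v =
    frechet_derivative (\<lambda>z. frechet_derivative f (at z) v) (at x) u"
proof (rule ccontr)
  let ?A = "\<lambda>y. frechet_derivative (\<lambda>z. frechet_derivative f (at z) u) (at y) v"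
  let ?B = "\<lambda>y. frechet_derivative (\<lambda>z. frechet_derivative f (at z) v) (at y) u"
  assume ne: "?A x \<noteq> ?B x"
  \<comment> \<open>Half the gap: a common value cannot lie within \<open>e\<close> of both mixed
    derivatives at \<open>x\<close>.\<close>
  define e where "e = \<bar>?A x - ?B x\<bar> / 2"
  have e: "e > 0" using ne by (simp add: e_def)
  have "smooth_on S ?A" "smooth_on S ?B"
    by (intro smooth_on_frechet_derivative f)+
  then have "isCont ?A x" "isCont ?B x"
    using S smooth_on_imp_continuous_on continuous_on_eq_continuous_at by blast+
  then obtain r1 r2 where r: "r1 > 0" "r2 > 0"
    "\<And>y. dist y x < r1 \<Longrightarrow> dist (?A y) (?A x) < e" "\<And>y. dist y x < r2 \<Longrightarrow> dist (?B y) (?B x) < e"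
    using e unfolding continuous_at_eps_delta by metis
  obtain r0 where r0: "r0 > 0" "ball x r0 \<subseteq> S" using S open_contains_ball by blast
  define r where "r = min r0 (min r1 r2)"
  have rp: "r > 0" using r r0 by (simp add: r_def)
  \<comment> \<open>Small enough that both intermediate points stay within \<open>r\<close> of
    \<open>x\<close>; the summand 1 keeps the denominator positive when \<open>u\<close> and
    \<open>v\<close> vanish.\<close>
  define t where "t = r / (2 * (norm u + norm v + 1))"
  have t0: "t > 0" using rp by (simp add: t_def add_nonneg_pos)
  have "t * (norm u + norm v) \<le> t * (norm u + norm v + 1)" using t0 by simp
  also have "\<dots> = r / 2"
  proof -
    have "norm u + norm v + 1 \<noteq> 0" using norm_ge_zero[of u] norm_ge_zero[of v] by linarith
    moreover have "r / (2 * a) * a = r / 2" if "a \<noteq> 0" for a :: real using that by simp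
    ultimately show ?thesis unfolding t_def by blast
  qed
  also have "\<dots> < r" using rp by simp
  finally have tr: "t * (norm u + norm v) < r" .
  have bS: "ball x r \<subseteq> S" using r0 by (auto simp: r_def)
  have d: "f differentiable at y" "(\<lambda>z. frechet_derivative f (at z) w) differentiable at y"
    if "y \<in> ball x r" for y w
    using smooth_on_imp_differentiable bS that f smooth_on_frechet_derivative by blast+
  obtain y1 where y1: "dist x y1 \<le> t * (norm u + norm v)"
    "f (x + t *\<^sub>R u + t *\<^sub>R v) - f (x + t *\<^sub>R u) - f (x + t *\<^sub>R v) + f x = t * t * ?A y1"
    using second_difference_mean_value[of x r f u t v] d t0 tr by blast
  obtain y2 where y2: "dist x y2 \<le> t * (norm v + norm u)"
    "f (x + t *\<^sub>R v + t *\<^sub>R u) - f (x + t *\<^sub>R v) - f (x + t *\<^sub>R u) + f x = t * t * ?B y2"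
    using second_difference_mean_value[of x r f v t u] d t0 tr by (metis add.commute)
  have "x + t *\<^sub>R v + t *\<^sub>R u = x + t *\<^sub>R u + t *\<^sub>R v" by (simp add: algebra_simps)
  then have "f (x + t *\<^sub>R v + t *\<^sub>R u) = f (x + t *\<^sub>R u + t *\<^sub>R v)" by (rule arg_cong)
  then have "t * t * ?A y1 = t * t * ?B y2" using y1(2) y2(2) by linarith
  then have AB: "?A y1 = ?B y2" using t0 by simp
  have "dist y1 x < r1" "dist y2 x < r2"
    using y1(1) y2(1) tr by (auto simp: r_def dist_commute add.commute)
  then have "\<bar>?A y1 - ?A x\<bar> < e" "\<bar>?B y2 - ?B x\<bar> < e"
    using r by (auto simp: dist_real_def)
  moreover have False if "\<bar>b - a\<bar> < \<bar>a - c\<bar> / 2" "\<bar>b - c\<bar> < \<bar>a - c\<bar> / 2" for a b c :: real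
    using that by (auto simp: abs_if split: if_splits)
  ultimately show False unfolding AB e_def by blast
qed

text \<open>The mean value theorem needs real values, so real and imaginary parts are treated
  separately.\<close>

lemma symmetric_second_derivative:
  fixes f :: "'a::real_normed_vector \<Rightarrow> complex"
  assumes S: "open S" "x \<in> S" and f: "smooth_on S f"
  shows "frechet_derivative (\<lambda>z. frechet_derivative f (at z) u) (at x) v =
    frechet_derivative (\<lambda>z. frechet_derivative f (at z) v) (at x) u"
proof -
  have dL: "frechet_derivative (\<lambda>z. L (g z)) (at y) w = L (frechet_derivative g (at y) w)"
    if "bounded_linear L" "g differentiable at y" for L :: "complex \<Rightarrow> real" and g y w
  proof -
    have "((\<lambda>z. L (g z)) has_derivative (\<lambda>w. L (frechet_derivative g (at y) w))) (at y)"
      using bounded_linear.has_derivative[OF that(1)] that(2) frechet_derivative_works by blast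
    from frechet_derivative_at[OF this] show ?thesis by (metis)
  qed
  have main: "L (frechet_derivative (\<lambda>z. frechet_derivative f (at z) u) (at x) v) =
      L (frechet_derivative (\<lambda>z. frechet_derivative f (at z) v) (at x) u)"
    if L: "bounded_linear L" for L :: "complex \<Rightarrow> real"
  proof -
    have 2: "L (frechet_derivative (\<lambda>z. frechet_derivative f (at z) w) (at x) w') =
       frechet_derivative (\<lambda>z. frechet_derivative (\<lambda>y. L (f y)) (at z) w) (at x) w'" for w w'
    proof -
      have df: "(\<lambda>z. frechet_derivative f (at z) w) differentiable at x"
        using smooth_on_imp_differentiable smooth_on_frechet_derivative f S by blast
      have "((\<lambda>z. L (frechet_derivative f (at z) w)) has_derivative
          (\<lambda>w'. L (frechet_derivative (\<lambda>z. frechet_derivative f (at z) w) (at x) w'))) (at x)"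
        using bounded_linear.has_derivative[OF L] df frechet_derivative_works by blast
      then have "((\<lambda>z. frechet_derivative (\<lambda>y. L (f y)) (at z) w) has_derivative
          (\<lambda>w'. L (frechet_derivative (\<lambda>z. frechet_derivative f (at z) w) (at x) w'))) (at x)"
        by (rule has_derivative_transform_within_open[OF _ S])
          (use dL[OF L smooth_on_imp_differentiable[OF f]] in auto)
      from frechet_derivative_at[OF this] show ?thesis by metis
    qed
    show ?thesis unfolding 2
      by (rule symmetric_second_derivative_real[OF S]) (rule smooth_on_bounded_linear[OF L S(1) f])
  qed
  show ?thesis
    using main[OF bounded_linear_Re] main[OF bounded_linear_Im] by (simp add: complex_eq_iff)
qed

section \<open>Smooth functions on a manifold\<close>

abbreviation cinv :: "('m, 'e) chart \<Rightarrow> 'e \<Rightarrow> 'm" where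
  "cinv c \<equiv> inv_into (fst c) (snd c)"

text \<open>Since the charts are compatible, one chart suffices; unlike \<open>smooth_near\<close>, this covers functions
  with values in any normed space.\<close>

definition smooth_at :: "('m::topological_space, 'e::euclidean_space) chart set \<Rightarrow> 'm \<Rightarrow>
    ('m \<Rightarrow> 'b::real_normed_vector) \<Rightarrow> bool" where
  "smooth_at A p f \<longleftrightarrow> (\<exists>c\<in>A. p \<in> fst c \<and>
     (\<exists>W. open W \<and> snd c p \<in> W \<and> W \<subseteq> snd c ` fst c \<and> smooth_on W (f \<circ> cinv c)))"

text \<open>The tangent vector with components \<open>v\<close> in the chart \<open>c\<close>. The
  default 0 on functions that are not smooth at \<open>p\<close> copies the convention for tangent
  vectors, so that the two can be equal as HOL functions.\<close>

definition chart_vec :: "('m::topological_space, 'e::euclidean_space) chart set \<Rightarrow> ('m, 'e) chart \<Rightarrow>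
    'm \<Rightarrow> 'e \<Rightarrow> 'm tvec" where
  "chart_vec A c p v = (\<lambda>f. if smooth_at A p f then frechet_derivative (f \<circ> cinv c) (at (snd c p)) v else 0)"

text \<open>Cast to \<open>complex\<close> because tangent vectors act on complex functions. Off the
  domain of the chart the values are arbitrary; only the germs at points of the domain are ever
  used.\<close>

definition coord :: "('m, 'e::euclidean_space) chart \<Rightarrow> 'e \<Rightarrow> 'm \<Rightarrow> complex" where
  "coord c b = (\<lambda>q. complex_of_real (snd c q \<bullet> b))"

locale smooth_manifold =
  fixes A :: "('m::topological_space, 'e::euclidean_space) chart set"
  assumes atlas: "smooth_atlas A"
begin

lemma chart_at: obtains c where "c \<in> A" "p \<in> fst c"
  using atlas unfolding smooth_atlas_def by (metis UNIV_I UN_iff)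

lemma chart:
  assumes "c \<in> A"
  shows chart_open: "open (fst c)" and chart_open_img: "open (snd c ` fst c)"
    and chart_cont: "continuous_on (fst c) (snd c)"
    and cinv_cont: "continuous_on (snd c ` fst c) (cinv c)"
    and cinv_snd: "\<And>x. x \<in> fst c \<Longrightarrow> cinv c (snd c x) = x"
    and snd_cinv: "\<And>y. y \<in> snd c ` fst c \<Longrightarrow> snd c (cinv c y) = y"
    and cinv_in: "\<And>y. y \<in> snd c ` fst c \<Longrightarrow> cinv c y \<in> fst c"
proof -
  have "is_chart c" using atlas assms by (auto simp: smooth_atlas_def)
  then have h: "open (fst c)" "open (snd c ` fst c)"
      "homeomorphism (fst c) (snd c ` fst c) (snd c) (cinv c)"
    by (auto simp: is_chart_def split: prod.splits)
  then show "open (fst c)" "open (snd c ` fst c)" by auto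
  show "continuous_on (fst c) (snd c)" "continuous_on (snd c ` fst c) (cinv c)"
    "\<And>x. x \<in> fst c \<Longrightarrow> cinv c (snd c x) = x"
    using h(3) by (auto simp: homeomorphism_def)
  show "\<And>y. y \<in> snd c ` fst c \<Longrightarrow> snd c (cinv c y) = y" by (rule f_inv_into_f)
  show "\<And>y. y \<in> snd c ` fst c \<Longrightarrow> cinv c y \<in> fst c" by (rule inv_into_into)
qed

lemma transition:
  assumes "c \<in> A" "d \<in> A"
  shows "smooth_on (snd c ` (fst c \<inter> fst d)) (snd d \<circ> cinv c)"
  using atlas assms unfolding smooth_atlas_def by (cases c; cases d) fastforce

lemma chart_preimage_open: "c \<in> A \<Longrightarrow> open V \<Longrightarrow> open (fst c \<inter> snd c -` V)"
  using chart_cont chart_open continuous_open_preimage by blast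

lemma chart_image_open:
  assumes "c \<in> A" "open W"
  shows "open (snd c ` (fst c \<inter> W))"
proof -
  have "snd c ` (fst c \<inter> W) = snd c ` fst c \<inter> cinv c -` W"
    using cinv_snd[OF assms(1)] by (auto simp: image_iff)
  then show ?thesis
    using continuous_open_preimage[OF cinv_cont chart_open_img] assms by simp
qed

text \<open>Composition with a smooth transition map moves the witness of smoothness from the chart
  in which it is given to any chart around \<open>p\<close>.\<close>

lemma smooth_at_chart:
  assumes "smooth_at A p f" "c \<in> A" "p \<in> fst c"
  obtains W where "open W" "snd c p \<in> W" "W \<subseteq> snd c ` fst c" "smooth_on W (f \<circ> cinv c)"
proof -
  obtain d V where d: "d \<in> A" "p \<in> fst d" and V: "open V" "snd d p \<in> V" "smooth_on V (f \<circ> cinv d)"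
    using assms(1) unfolding smooth_at_def by blast
  let ?t = "snd d \<circ> cinv c" and ?S = "snd c ` (fst c \<inter> fst d)"
  define W where "W = ?S \<inter> ?t -` V"
  have oS: "open ?S" using chart_image_open[OF assms(2) chart_open[OF d(1)]] .
  have oW: "open W" unfolding W_def
    by (rule continuous_open_preimage[OF smooth_on_imp_continuous_on[OF transition[OF assms(2) d(1)]] oS V(1)])
  have "smooth_on W (\<lambda>x. (f \<circ> cinv d) (?t x))"
    by (rule smooth_on_compose[OF oW V(1) _ smooth_on_subset[OF transition[OF assms(2) d(1)]] V(3)])
      (auto simp: W_def)
  then have "smooth_on W (f \<circ> cinv c)"
    by (rule smooth_on_cong[OF oW, rotated])
      (auto simp: W_def cinv_snd[OF d(1)] cinv_snd[OF assms(2)])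
  moreover have "snd c p \<in> W" using assms d V by (auto simp: W_def cinv_snd[OF assms(2)])
  moreover have "W \<subseteq> snd c ` fst c" by (auto simp: W_def)
  ultimately show ?thesis using that oW by blast
qed

text \<open>Replaces the condition of the definitions, which runs over all charts with one common
  neighbourhood, by the one-chart condition that is easier to prove and to use.\<close>

lemma smooth_near_iff: "smooth_near A p f \<longleftrightarrow> smooth_at A p f"
proof
  assume "smooth_near A p f"
  then obtain W where W: "open W" "p \<in> W" "\<And>c. c \<in> A \<Longrightarrow> smooth_on (snd c ` (fst c \<inter> W)) (f \<circ> cinv c)"
    unfolding smooth_near_def by fastforce
  obtain c where "c \<in> A" "p \<in> fst c" by (rule chart_at)
  then show "smooth_at A p f" unfolding smooth_at_def
    using W chart_image_open by (intro bexI[of _ c] conjI exI[of _ "snd c ` (fst c \<inter> W)"]) auto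
next
  assume "smooth_at A p f"
  then obtain c W where c: "c \<in> A" "p \<in> fst c" and W: "open W" "snd c p \<in> W" "W \<subseteq> snd c ` fst c" "smooth_on W (f \<circ> cinv c)"
    unfolding smooth_at_def by blast
  define U where "U = fst c \<inter> snd c -` W"
  have oU: "open U" "p \<in> U" unfolding U_def using chart_preimage_open c W by auto
  have "smooth_on (snd d ` (fst d \<inter> U)) (f \<circ> cinv d)" if d: "d \<in> A" for d
  proof -
    let ?S = "snd d ` (fst d \<inter> U)"
    have oS: "open ?S" using chart_image_open d oU by auto
    have "smooth_on ?S (\<lambda>x. (f \<circ> cinv c) ((snd c \<circ> cinv d) x))"
      by (rule smooth_on_compose[OF oS W(1) _ smooth_on_subset[OF transition[OF d c(1)]] W(4)])
        (auto simp: U_def cinv_snd[OF d])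
    then show ?thesis
      by (rule smooth_on_cong[OF oS, rotated]) (auto simp: U_def cinv_snd[OF c(1)] cinv_snd[OF d])
  qed
  then show "smooth_near A p f" unfolding smooth_near_def using oU by auto
qed

lemma smooth_at_eventually:
  assumes "smooth_at A p f"
  shows "\<forall>\<^sub>F q in nhds p. smooth_at A q f"
proof -
  obtain c W where c: "c \<in> A" "p \<in> fst c" and W: "open W" "snd c p \<in> W" "W \<subseteq> snd c ` fst c" "smooth_on W (f \<circ> cinv c)"
    using assms unfolding smooth_at_def by blast
  have "open (fst c \<inter> snd c -` W)" using chart_preimage_open c W by auto
  moreover have "smooth_at A q f" if "q \<in> fst c \<inter> snd c -` W" for q
    unfolding smooth_at_def using that c W by auto
  ultimately show ?thesis unfolding eventually_nhds using c W by auto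
qed

lemma chart_eventually: "c \<in> A \<Longrightarrow> p \<in> fst c \<Longrightarrow> \<forall>\<^sub>F q in nhds p. q \<in> fst c"
  using chart_open eventually_nhds by blast

lemma eventually_chart:
  assumes "c \<in> A" "p \<in> fst c" "\<forall>\<^sub>F q in nhds p. P q"
  shows "\<exists>W. open W \<and> snd c p \<in> W \<and> W \<subseteq> snd c ` fst c \<and> (\<forall>x\<in>W. P (cinv c x))"
proof -
  obtain V where V: "open V" "p \<in> V" "\<forall>q\<in>V. P q" using assms(3) eventually_nhds by metis
  show ?thesis
    using V assms chart_image_open[OF assms(1) V(1)]
    by (intro exI[of _ "snd c ` (fst c \<inter> V)"]) (auto simp: cinv_snd[OF assms(1)])
qed

lemma smooth_at_cong:
  assumes "smooth_at A p f" "\<forall>\<^sub>F q in nhds p. f q = g q"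
  shows "smooth_at A p g"
proof -
  obtain c W where c: "c \<in> A" "p \<in> fst c" and W: "open W" "snd c p \<in> W" "W \<subseteq> snd c ` fst c" "smooth_on W (f \<circ> cinv c)"
    using assms unfolding smooth_at_def by blast
  obtain V where V: "open V" "snd c p \<in> V" "\<forall>x\<in>V. f (cinv c x) = g (cinv c x)"
    using eventually_chart[OF c assms(2)] by blast
  have "smooth_on (W \<inter> V) (g \<circ> cinv c)"
    by (rule smooth_on_cong[of _ "f \<circ> cinv c"]) (use V W in \<open>auto intro: smooth_on_subset\<close>)
  then show ?thesis unfolding smooth_at_def using c W V
    by (intro bexI[of _ c] conjI exI[of _ "W \<inter> V"]) auto
qed

lemma smooth_at_tendsto:
  assumes "smooth_at A p f"
  shows "(f \<longlongrightarrow> f p) (nhds p)"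
proof -
  obtain c W where c: "c \<in> A" "p \<in> fst c" and W: "open W" "snd c p \<in> W" "W \<subseteq> snd c ` fst c" "smooth_on W (f \<circ> cinv c)"
    using assms unfolding smooth_at_def by blast
  let ?U = "fst c \<inter> snd c -` W"
  have U: "open ?U" "p \<in> ?U" using chart_preimage_open c W by auto
  have "continuous_on ?U (\<lambda>x. (f \<circ> cinv c) (snd c x))"
    by (rule continuous_on_compose2[OF smooth_on_imp_continuous_on[OF W(4)]])
      (use continuous_on_subset[OF chart_cont[OF c(1)]] in auto)
  then have "continuous_on ?U f"
    by (rule continuous_on_cong[THEN iffD1, rotated -1]) (auto simp: cinv_snd[OF c(1)])
  then have *: "open (f -` B \<inter> ?U)" if "open B" for B
    using continuous_on_open_vimage[OF U(1)] that by blast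
  show ?thesis
  proof (rule topological_tendstoI)
    fix S assume "open S" "f p \<in> S"
    then show "\<forall>\<^sub>F x in nhds p. f x \<in> S"
      unfolding eventually_nhds using U *[of S] by (intro exI[of _ "f -` S \<inter> ?U"]) auto
  qed
qed

lemma smooth_at_const: "smooth_at A p (\<lambda>q. k)"
proof -
  obtain c where "c \<in> A" "p \<in> fst c" by (rule chart_at)
  then show ?thesis unfolding smooth_at_def
    using chart_open_img by (intro bexI[of _ c] conjI exI[of _ "snd c ` fst c"]) (auto simp: comp_def smooth_on_const)
qed

lemma smooth_at_compose:
  fixes u :: "'m \<Rightarrow> 'b::euclidean_space"
  assumes "smooth_at A p u" "open V" "u p \<in> V" "smooth_on V H"
  shows "smooth_at A p (\<lambda>q. H (u q))"
proof -
  obtain c W where c: "c \<in> A" "p \<in> fst c" and W: "open W" "snd c p \<in> W" "W \<subseteq> snd c ` fst c" "smooth_on W (u \<circ> cinv c)"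
    using assms unfolding smooth_at_def by blast
  let ?W = "W \<inter> (u \<circ> cinv c) -` V"
  have oW: "open ?W" using continuous_open_preimage smooth_on_imp_continuous_on W assms by blast
  have "smooth_on ?W (\<lambda>x. H ((u \<circ> cinv c) x))"
    by (rule smooth_on_compose[OF oW assms(2) _ smooth_on_subset[OF W(4)] assms(4)]) auto
  then show ?thesis unfolding smooth_at_def using c W oW assms
    by (intro bexI[of _ c] conjI exI[of _ ?W]) (auto simp: cinv_snd comp_def)
qed

lemma smooth_at_chartmap: 
  assumes "c \<in> A" "p \<in> fst c"
  shows "smooth_at A p (snd c)"
proof -
  have "smooth_on (snd c ` fst c) (snd c \<circ> cinv c)"
    by (rule smooth_on_cong[of _ "\<lambda>x. x"]) (use assms chart_open_img snd_cinv smooth_on_ident in auto)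
  then show ?thesis unfolding smooth_at_def
    using assms chart_open_img by (intro bexI[of _ c] conjI exI[of _ "snd c ` fst c"]) auto
qed

lemma smooth_at_bounded_linear:
  assumes "bounded_linear L" "smooth_at A p f"
  shows "smooth_at A p (\<lambda>q. L (f q))"
proof -
  obtain c W where c: "c \<in> A" "p \<in> fst c" and W: "open W" "snd c p \<in> W" "W \<subseteq> snd c ` fst c" "smooth_on W (f \<circ> cinv c)"
    using assms unfolding smooth_at_def by blast
  have "smooth_on W ((\<lambda>q. L (f q)) \<circ> cinv c)"
    using smooth_on_bounded_linear[OF assms(1) W(1,4)] by (simp add: comp_def)
  then show ?thesis unfolding smooth_at_def using c W by blast
qed

lemma smooth_at_bilinear:
  assumes "bounded_bilinear B" "smooth_at A p f" "smooth_at A p g"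
  shows "smooth_at A p (\<lambda>q. B (f q) (g q))"
proof -
  obtain c where c: "c \<in> A" "p \<in> fst c" by (rule chart_at)
  obtain W where W: "open W" "snd c p \<in> W" "W \<subseteq> snd c ` fst c" "smooth_on W (f \<circ> cinv c)"
    by (rule smooth_at_chart[OF assms(2) c])
  obtain V where V: "open V" "snd c p \<in> V" "V \<subseteq> snd c ` fst c" "smooth_on V (g \<circ> cinv c)"
    by (rule smooth_at_chart[OF assms(3) c])
  have fg: "smooth_on (W \<inter> V) (f \<circ> cinv c)" "smooth_on (W \<inter> V) (g \<circ> cinv c)" "open (W \<inter> V)"
    using W V smooth_on_subset by blast+
  then have "smooth_on (W \<inter> V) (\<lambda>x. B ((f \<circ> cinv c) x) ((g \<circ> cinv c) x))"
    by (intro smooth_on_bilinear[OF assms(1)])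
  then show ?thesis unfolding smooth_at_def using c W V
    by (intro bexI[of _ c] conjI exI[of _ "W \<inter> V"]) (auto simp: comp_def)
qed

lemma smooth_at_add:
  assumes "smooth_at A p f" "smooth_at A p g"
  shows "smooth_at A p (\<lambda>q. f q + g q)"
proof -
  obtain c where c: "c \<in> A" "p \<in> fst c" by (rule chart_at)
  obtain W where W: "open W" "snd c p \<in> W" "W \<subseteq> snd c ` fst c" "smooth_on W (f \<circ> cinv c)"
    by (rule smooth_at_chart[OF assms(1) c])
  obtain V where V: "open V" "snd c p \<in> V" "V \<subseteq> snd c ` fst c" "smooth_on V (g \<circ> cinv c)"
    by (rule smooth_at_chart[OF assms(2) c])
  have fg: "smooth_on (W \<inter> V) (f \<circ> cinv c)" "smooth_on (W \<inter> V) (g \<circ> cinv c)" "open (W \<inter> V)"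
    using W V smooth_on_subset by blast+
  then have "smooth_on (W \<inter> V) (\<lambda>x. (f \<circ> cinv c) x + (g \<circ> cinv c) x)"
    by (intro smooth_on_add)
  then show ?thesis unfolding smooth_at_def using c W V
    by (intro bexI[of _ c] conjI exI[of _ "W \<inter> V"]) (auto simp: comp_def)
qed

lemma smooth_at_Pair:
  assumes "smooth_at A p f" "smooth_at A p g"
  shows "smooth_at A p (\<lambda>q. (f q, g q))"
proof -
  have "bounded_linear (\<lambda>x. (x, 0))" "bounded_linear (\<lambda>x. (0, x))"
    by (intro bounded_linear_Pair bounded_linear_ident bounded_linear_zero)+
  from smooth_at_bounded_linear[OF this(1) assms(1)] smooth_at_bounded_linear[OF this(2) assms(2)]
  have "smooth_at A p (\<lambda>q. (f q, 0) + (0, g q))" by (rule smooth_at_add)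
  then show ?thesis by simp
qed

lemma smooth_at_mult:
  fixes f :: "'m \<Rightarrow> 'b::real_normed_algebra"
  shows "smooth_at A p f \<Longrightarrow> smooth_at A p g \<Longrightarrow> smooth_at A p (\<lambda>q. f q * g q)"
  by (rule smooth_at_bilinear[OF bounded_bilinear_mult])

lemma smooth_at_cmult: 
  fixes f :: "'m \<Rightarrow> 'b::real_normed_algebra"
  shows "smooth_at A p f \<Longrightarrow> smooth_at A p (\<lambda>q. k * f q)"
  by (rule smooth_at_mult[OF smooth_at_const])

lemma smooth_at_uminus: "smooth_at A p f \<Longrightarrow> smooth_at A p (\<lambda>q. - f q)"
  by (rule smooth_at_bounded_linear[OF bounded_linear_minus[OF bounded_linear_ident]])

lemma smooth_at_diff: "smooth_at A p f \<Longrightarrow> smooth_at A p g \<Longrightarrow> smooth_at A p (\<lambda>q. f q - g q)"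
  using smooth_at_add[OF _ smooth_at_uminus, of p f g] by simp

lemma smooth_at_sum: "(\<And>i. i \<in> I \<Longrightarrow> smooth_at A p (f i)) \<Longrightarrow> smooth_at A p (\<lambda>q. \<Sum>i\<in>I. f i q)"
  by (induction I rule: infinite_finite_induct) (auto intro: smooth_at_const smooth_at_add)

lemma smooth_at_prod:
  fixes f :: "'i \<Rightarrow> 'm \<Rightarrow> 'b::{real_normed_algebra, comm_ring_1}"
  shows "(\<And>i. i \<in> I \<Longrightarrow> smooth_at A p (f i)) \<Longrightarrow> smooth_at A p (\<lambda>q. \<Prod>i\<in>I. f i q)"
  by (induction I rule: infinite_finite_induct) (auto intro: smooth_at_const smooth_at_mult)

lemma smooth_at_coord: "c \<in> A \<Longrightarrow> p \<in> fst c \<Longrightarrow> smooth_at A p (coord c b)"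
  unfolding coord_def
  by (intro smooth_at_bounded_linear[OF bounded_linear_of_real] smooth_at_bounded_linear[OF bounded_linear_inner_left]
      smooth_at_chartmap)

lemma chart_vec_has_derivative:
  assumes "c \<in> A" "p \<in> fst c" "smooth_at A p f"
  shows "((f \<circ> cinv c) has_derivative (\<lambda>v. chart_vec A c p v f)) (at (snd c p))"
proof -
  obtain W where W: "open W" "snd c p \<in> W" "W \<subseteq> snd c ` fst c" "smooth_on W (f \<circ> cinv c)"
    by (rule smooth_at_chart[OF assms(3,1,2)])
  have "(f \<circ> cinv c) differentiable (at (snd c p))" by (rule smooth_on_imp_differentiable[OF W(4,2)])
  then show ?thesis using assms(3) by (simp add: chart_vec_def frechet_derivative_worksI)
qed

lemma chart_vec_eqI:
  assumes "c \<in> A" "p \<in> fst c" "smooth_at A p f" "((f \<circ> cinv c) has_derivative D) (at (snd c p))"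
  shows "chart_vec A c p v f = D v"
  using has_derivative_unique[OF chart_vec_has_derivative[OF assms(1-3)] assms(4)] by metis

lemma chart_vec_not_sm: "\<not> smooth_at A p f \<Longrightarrow> chart_vec A c p v f = 0"
  by (simp add: chart_vec_def)

lemma chart_vec_Basis:
  assumes "c \<in> A" "p \<in> fst c"
  shows "chart_vec A c p v f = (\<Sum>b\<in>Basis. complex_of_real (v \<bullet> b) * chart_vec A c p b f)"
proof (cases "smooth_at A p f")
  case True
  have "(f \<circ> cinv c) differentiable (at (snd c p))"
    using chart_vec_has_derivative[OF assms True] by (rule differentiableI)
  from frechet_derivative_Basis_sum[OF this, of v] True show ?thesis
    by (simp add: chart_vec_def scaleR_conv_of_real)
qed (simp add: chart_vec_not_sm)

lemma chart_vec_linear: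
  assumes "c \<in> A" "p \<in> fst c"
  shows "chart_vec A c p (v + w) f = chart_vec A c p v f + chart_vec A c p w f"
    "chart_vec A c p (r *\<^sub>R v) f = complex_of_real r * chart_vec A c p v f"
  by (simp_all add: chart_vec_Basis[OF assms, of "v + w"] chart_vec_Basis[OF assms, of "r *\<^sub>R v"]
     chart_vec_Basis[OF assms, of v] chart_vec_Basis[OF assms, of w] inner_add_left distrib_right sum.distrib sum_distrib_left mult.assoc)

lemma chart_vec_coord:
  assumes "c \<in> A" "p \<in> fst c"
  shows "chart_vec A c p v (coord c b) = complex_of_real (v \<bullet> b)"
proof (rule chart_vec_eqI[OF assms smooth_at_coord[OF assms]])
  have "((\<lambda>x. complex_of_real (x \<bullet> b)) has_derivative (\<lambda>v. complex_of_real (v \<bullet> b))) (at (snd c p))"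
    by (auto intro!: derivative_eq_intros)
  then show "((coord c b \<circ> cinv c) has_derivative (\<lambda>v. complex_of_real (v \<bullet> b))) (at (snd c p))"
    by (rule has_derivative_transform_within_open[OF _ chart_open_img[OF assms(1)]])
      (use assms snd_cinv in \<open>auto simp: coord_def\<close>)
qed

lemma chart_vec_cong:
  assumes "c \<in> A" "p \<in> fst c" "\<forall>\<^sub>F q in nhds p. f q = g q"
  shows "chart_vec A c p v f = chart_vec A c p v g"
proof (cases "smooth_at A p f")
  case True
  then have g: "smooth_at A p g" using smooth_at_cong assms(3) by blast
  obtain V where V: "open V" "snd c p \<in> V" "\<forall>x\<in>V. f (cinv c x) = g (cinv c x)"
    using eventually_chart[OF assms] by blast
  show ?thesis
    by (rule chart_vec_eqI[OF assms(1,2) True])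
      (rule has_derivative_transform_within_open[OF chart_vec_has_derivative[OF assms(1,2) g] V(1,2)], use V in auto)
next
  case False
  have "\<forall>\<^sub>F q in nhds p. g q = f q" using assms(3) by eventually_elim simp
  then have "\<not> smooth_at A p g" using False smooth_at_cong by blast
  then show ?thesis using False by (simp add: chart_vec_not_sm)
qed

lemma chart_vec_const: "c \<in> A \<Longrightarrow> p \<in> fst c \<Longrightarrow> chart_vec A c p v (\<lambda>q. k) = 0"
  by (rule chart_vec_eqI[OF _ _ smooth_at_const]) (auto simp: comp_def)

lemma chart_vec_add:
  assumes "c \<in> A" "p \<in> fst c" "smooth_at A p f" "smooth_at A p g"
  shows "chart_vec A c p v (\<lambda>q. f q + g q) = chart_vec A c p v f + chart_vec A c p v g"
  by (rule chart_vec_eqI[OF assms(1,2) smooth_at_add[OF assms(3,4)]])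
    (use has_derivative_add[OF chart_vec_has_derivative[OF assms(1-3)] chart_vec_has_derivative[OF assms(1,2,4)]]
     in \<open>simp add: comp_def\<close>)

lemma chart_vec_mult:
  assumes "c \<in> A" "p \<in> fst c" "smooth_at A p f" "smooth_at A p g"
  shows "chart_vec A c p v (\<lambda>q. f q * g q) = f p * chart_vec A c p v g + chart_vec A c p v f * g p"
  by (rule chart_vec_eqI[OF assms(1,2) smooth_at_mult[OF assms(3,4)]])
    (use has_derivative_mult[OF chart_vec_has_derivative[OF assms(1-3)] chart_vec_has_derivative[OF assms(1,2,4)]]
     in \<open>simp add: comp_def cinv_snd[OF assms(1,2)]\<close>)

lemma chart_vec_real:
  assumes "c \<in> A" "p \<in> fst c" "\<forall>\<^sub>F q in nhds p. f q \<in> \<real>"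
  shows "chart_vec A c p v f \<in> \<real>"
proof (cases "smooth_at A p f")
  case True
  obtain V where V: "open V" "snd c p \<in> V" "\<forall>x\<in>V. f (cinv c x) \<in> \<real>"
    using eventually_chart[OF assms] by blast
  have "((\<lambda>x. Im ((f \<circ> cinv c) x)) has_derivative (\<lambda>v. Im (chart_vec A c p v f))) (at (snd c p))"
    by (rule bounded_linear.has_derivative[OF bounded_linear_Im chart_vec_has_derivative[OF assms(1,2) True]])
  moreover have "((\<lambda>x. Im ((f \<circ> cinv c) x)) has_derivative (\<lambda>v. 0)) (at (snd c p))"
    by (rule has_derivative_transform_within_open[OF has_derivative_const[of 0] V(1,2)])
      (use V in \<open>auto simp: complex_is_Real_iff\<close>)
  ultimately have "(\<lambda>v. Im (chart_vec A c p v f)) = (\<lambda>v. 0)" by (rule has_derivative_unique)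
  then show ?thesis by (metis complex_is_Real_iff)
qed (simp add: chart_vec_not_sm)

lemma smooth_at_chart_vec:
  assumes "c \<in> A" "p \<in> fst c" "smooth_at A p f"
  shows "smooth_at A p (\<lambda>q. chart_vec A c q v f)"
proof -
  obtain W where W: "open W" "snd c p \<in> W" "W \<subseteq> snd c ` fst c" "smooth_on W (f \<circ> cinv c)"
    by (rule smooth_at_chart[OF assms(3,1,2)])
  have s: "smooth_at A (cinv c x) f" if "x \<in> W" for x
    unfolding smooth_at_def using assms(1) W that cinv_in[OF assms(1)] snd_cinv[OF assms(1)]
    by (intro bexI[of _ c] conjI exI[of _ W]) auto
  have "smooth_on W ((\<lambda>q. chart_vec A c q v f) \<circ> cinv c)"
    by (rule smooth_on_cong[OF W(1) _ smooth_on_frechet_derivative[OF W(4), of v]])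
      (use W s snd_cinv[OF assms(1)] in \<open>auto simp: chart_vec_def\<close>)
  then show ?thesis unfolding smooth_at_def using assms W by blast
qed

text \<open>Symmetry of second derivatives, read in the chart. It is the reason why second-order
  terms cancel in a bracket.\<close>

lemma chart_vec_commute:
  assumes "c \<in> A" "p \<in> fst c" "smooth_at A p f"
  shows "chart_vec A c p v (\<lambda>q. chart_vec A c q w f) = chart_vec A c p w (\<lambda>q. chart_vec A c q v f)"
proof -
  obtain W where W: "open W" "snd c p \<in> W" "W \<subseteq> snd c ` fst c" "smooth_on W (f \<circ> cinv c)"
    by (rule smooth_at_chart[OF assms(3,1,2)])
  let ?F = "f \<circ> cinv c"
  have s: "smooth_at A (cinv c x) f" if "x \<in> W" for x
    unfolding smooth_at_def using assms(1) W that cinv_in[OF assms(1)] snd_cinv[OF assms(1)]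
    by (intro bexI[of _ c] conjI exI[of _ W]) auto
  have e: "chart_vec A c p v (\<lambda>q. chart_vec A c q w f) =
      frechet_derivative (\<lambda>z. frechet_derivative ?F (at z) w) (at (snd c p)) v" for v w
  proof (rule chart_vec_eqI[OF assms(1,2) smooth_at_chart_vec[OF assms]])
    have "((\<lambda>z. frechet_derivative ?F (at z) w) has_derivative
       frechet_derivative (\<lambda>z. frechet_derivative ?F (at z) w) (at (snd c p))) (at (snd c p))"
      using smooth_on_imp_differentiable[OF smooth_on_frechet_derivative[OF W(4)] W(2)]
      by (rule frechet_derivative_worksI)
    then show "((\<lambda>q. chart_vec A c q w f) \<circ> cinv c has_derivative
       frechet_derivative (\<lambda>z. frechet_derivative ?F (at z) w) (at (snd c p))) (at (snd c p))"
      by (rule has_derivative_transform_within_open[OF _ W(1,2)])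
        (use W s snd_cinv[OF assms(1)] in \<open>auto simp: chart_vec_def\<close>)
  qed
  show ?thesis unfolding e by (rule symmetric_second_derivative[OF W(1,2,4)])
qed

end

section \<open>Tangent vectors, vector fields and their brackets\<close>

context smooth_manifold
begin

text \<open>A curve may be smooth in a chart other than \<open>c\<close>; the transition map carries
  its velocity over to \<open>c\<close>. Conversely, a coordinate vector is the velocity of a
  straight segment in the chart. This exhibits the linear structure, which the definition by
  velocities hides.\<close>

lemma tangent_eq:
  assumes c: "c \<in> A" "p \<in> fst c"
  shows "tangent A p = range (chart_vec A c p)"
proof (intro equalityI subsetI)
  fix u assume "u \<in> tangent A p"
  then obtain \<gamma> where u: "u = velocity A p \<gamma>" and "smooth_curve_at A p \<gamma>"
    unfolding tangent_def by blast
  then obtain d \<epsilon> where d: "d \<in> A" and g0: "\<gamma> 0 = p" and e: "\<epsilon> > 0"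
    and sub: "\<gamma> ` {-\<epsilon><..<\<epsilon>} \<subseteq> fst d" and g: "smooth_on {-\<epsilon><..<\<epsilon>} (snd d \<circ> \<gamma>)"
    unfolding smooth_curve_at_def by fastforce
  let ?I = "{-\<epsilon><..<\<epsilon>}"
  have zI: "0 \<in> ?I" using e by simp
  have pd: "p \<in> fst d" using sub zI g0 by blast
  let ?S = "snd d ` (fst d \<inter> fst c)" and ?t = "snd c \<circ> cinv d"
  have oS: "open ?S" by (rule chart_image_open[OF d chart_open[OF c(1)]])
  \<comment> \<open>The parameters at which the curve also lies in \<open>c\<close>; there its
    coordinates in \<open>c\<close> are those in \<open>d\<close> followed by the transition
    map.\<close>
  define I where "I = ?I \<inter> (snd d \<circ> \<gamma>) -` ?S"
  have oI: "open I" unfolding I_def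
    by (rule continuous_open_preimage[OF smooth_on_imp_continuous_on[OF g] _ oS]) simp
  have inI: "\<gamma> t \<in> fst c" "\<gamma> t \<in> fst d" if "t \<in> I" for t
  proof -
    have gd: "\<gamma> t \<in> fst d" using that sub by (auto simp: I_def)
    then show "\<gamma> t \<in> fst d" .
    have "snd d (\<gamma> t) \<in> ?S" using that by (auto simp: I_def)
    then obtain x where x: "x \<in> fst d" "x \<in> fst c" "snd d (\<gamma> t) = snd d x" by blast
    then have "\<gamma> t = x" using cinv_snd[OF d] gd by metis
    then show "\<gamma> t \<in> fst c" using x by simp
  qed
  have 0: "0 \<in> I" using zI pd c g0 by (auto simp: I_def)
  have "(snd d \<circ> \<gamma>) differentiable at 0" using smooth_on_imp_differentiable[OF g zI] .
  then obtain D1 where D1: "((snd d \<circ> \<gamma>) has_derivative D1) (at 0)" by (auto simp: differentiable_def)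
  have "?t differentiable at (snd d p)"
    by (rule smooth_on_imp_differentiable[OF transition[OF d c(1)]]) (use pd c in auto)
  then obtain D2 where D2: "(?t has_derivative D2) (at (snd d p))" by (auto simp: differentiable_def)
  have "((\<lambda>t. ?t ((snd d \<circ> \<gamma>) t)) has_derivative (\<lambda>h. D2 (D1 h))) (at 0)"
    by (rule has_derivative_compose[OF D1]) (use D2 g0 in \<open>simp add: comp_def\<close>)
  then have cg: "((\<lambda>t. snd c (\<gamma> t)) has_derivative (\<lambda>h. D2 (D1 h))) (at 0)"
    by (rule has_derivative_transform_within_open[OF _ oI 0]) (use inI cinv_snd[OF d] in auto)
  define v where "v = D2 (D1 1)"
  have lin: "D2 (D1 h) = h *\<^sub>R v" for h
    using linear_scale[OF has_derivative_linear[OF cg], of h 1] by (simp add: v_def)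
  have "u f = chart_vec A c p v f" for f
  proof (cases "smooth_at A p f")
    case True
    have "((\<lambda>t. (f \<circ> cinv c) (snd c (\<gamma> t))) has_derivative (\<lambda>h. chart_vec A c p (D2 (D1 h)) f)) (at 0)"
      by (rule has_derivative_compose[OF cg]) (use chart_vec_has_derivative[OF c True] g0 in \<open>simp add: comp_def\<close>)
    then have "(f \<circ> \<gamma> has_derivative (\<lambda>h. chart_vec A c p (D2 (D1 h)) f)) (at 0)"
      by (rule has_derivative_transform_within_open[OF _ oI 0]) (use inI cinv_snd[OF c(1)] in auto)
    then have "(f \<circ> \<gamma> has_vector_derivative chart_vec A c p v f) (at 0)"
      unfolding has_vector_derivative_def lin chart_vec_linear[OF c] by (simp add: scaleR_conv_of_real)
    then show ?thesis using True by (simp add: u velocity_def smooth_near_iff vector_derivative_at)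
  qed (simp add: u velocity_def smooth_near_iff chart_vec_not_sm)
  then show "u \<in> range (chart_vec A c p)" by blast
next
  fix u assume "u \<in> range (chart_vec A c p)"
  then obtain v where u: "u = chart_vec A c p v" by blast
  let ?a = "\<lambda>t::real. snd c p + t *\<^sub>R v"
  define \<gamma> where "\<gamma> t = cinv c (?a t)" for t
  have "open (?a -` (snd c ` fst c))"
    by (rule open_vimage[OF chart_open_img[OF c(1)]]) (intro continuous_intros)
  moreover have "0 \<in> ?a -` (snd c ` fst c)" using c by simp
  ultimately obtain \<epsilon> where e: "\<epsilon> > 0" "ball 0 \<epsilon> \<subseteq> ?a -` (snd c ` fst c)"
    using open_contains_ball by metis
  have I: "?a t \<in> snd c ` fst c" if "t \<in> {-\<epsilon><..<\<epsilon>}" for t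
    using e(2) that by (force simp: subset_iff dist_real_def)
  have sa: "smooth_on {-\<epsilon><..<\<epsilon>} ?a"
    by (intro smooth_on_add smooth_on_const smooth_on_bounded_linear[OF bounded_linear_scaleR_left]
       smooth_on_ident) auto
  have "smooth_on {-\<epsilon><..<\<epsilon>} (snd c \<circ> \<gamma>)"
    by (rule smooth_on_cong[OF _ _ sa]) (use I snd_cinv[OF c(1)] in \<open>auto simp: \<gamma>_def\<close>)
  moreover have "\<gamma> ` {-\<epsilon><..<\<epsilon>} \<subseteq> fst c" using I cinv_in[OF c(1)] by (auto simp: \<gamma>_def)
  moreover have "\<gamma> 0 = p" using cinv_snd[OF c] by (simp add: \<gamma>_def)
  ultimately have "smooth_curve_at A p \<gamma>"
    unfolding smooth_curve_at_def using e(1) c(1) by (auto intro!: bexI[of _ c])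
  moreover have "velocity A p \<gamma> f = u f" for f
  proof (cases "smooth_at A p f")
    case True
    have a: "(?a has_derivative (\<lambda>h. h *\<^sub>R v)) (at 0)" by (auto intro!: derivative_eq_intros)
    have "((\<lambda>t. (f \<circ> cinv c) (?a t)) has_derivative (\<lambda>h. chart_vec A c p (h *\<^sub>R v) f)) (at 0)"
      by (rule has_derivative_compose[OF a]) (use chart_vec_has_derivative[OF c True] in \<open>simp add: comp_def\<close>)
    then have "(f \<circ> \<gamma> has_vector_derivative chart_vec A c p v f) (at 0)"
      unfolding has_vector_derivative_def chart_vec_linear[OF c]
      by (simp add: scaleR_conv_of_real comp_def \<gamma>_def)
    then show ?thesis using True by (simp add: u velocity_def smooth_near_iff vector_derivative_at)
  qed (simp add: u velocity_def smooth_near_iff chart_vec_not_sm)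
  then have "velocity A p \<gamma> = u" by blast
  ultimately show "u \<in> tangent A p" unfolding tangent_def by blast
qed

lemma chart_vec_tangent: "c \<in> A \<Longrightarrow> p \<in> fst c \<Longrightarrow> chart_vec A c p v \<in> tangent A p"
  by (simp add: tangent_eq)

lemma ctangent_rep:
  assumes c: "c \<in> A" "p \<in> fst c"
  shows "u \<in> ctangent A p \<longleftrightarrow> (\<exists>z. u = (\<lambda>f. \<Sum>b\<in>Basis. z b * chart_vec A c p b f))"
proof
  assume "u \<in> ctangent A p"
  then obtain v w where u: "u = (\<lambda>f. chart_vec A c p v f + \<i> * chart_vec A c p w f)"
    unfolding ctangent_def tangent_eq[OF c] by blast
  have "u = (\<lambda>f. \<Sum>b\<in>Basis. (complex_of_real (v \<bullet> b) + \<i> * complex_of_real (w \<bullet> b)) * chart_vec A c p b f)"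
    unfolding u
    by (rule ext, subst chart_vec_Basis[OF c, of v], subst chart_vec_Basis[OF c, of w])
      (simp add: sum_distrib_left distrib_right sum.distrib mult.assoc)
  then show "\<exists>z. u = (\<lambda>f. \<Sum>b\<in>Basis. z b * chart_vec A c p b f)"
    by (intro exI[of _ "\<lambda>b. complex_of_real (v \<bullet> b) + \<i> * complex_of_real (w \<bullet> b)"])
next
  assume "\<exists>z. u = (\<lambda>f. \<Sum>b\<in>Basis. z b * chart_vec A c p b f)"
  then obtain z where u: "u = (\<lambda>f. \<Sum>b\<in>Basis. z b * chart_vec A c p b f)" by blast
  let ?v = "\<Sum>b\<in>Basis. Re (z b) *\<^sub>R b" and ?w = "\<Sum>b\<in>Basis. Im (z b) *\<^sub>R b"
  have "u = (\<lambda>f. chart_vec A c p ?v f + \<i> * chart_vec A c p ?w f)"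
  proof
    fix f
    have "chart_vec A c p ?v f = (\<Sum>b\<in>Basis. complex_of_real (Re (z b)) * chart_vec A c p b f)"
      by (subst chart_vec_Basis[OF c]) (simp add: inner_sum_left_Basis)
    moreover have "chart_vec A c p ?w f = (\<Sum>b\<in>Basis. complex_of_real (Im (z b)) * chart_vec A c p b f)"
      by (subst chart_vec_Basis[OF c]) (simp add: inner_sum_left_Basis)
    moreover have "z b * chart_vec A c p b f = complex_of_real (Re (z b)) * chart_vec A c p b f +
        \<i> * (complex_of_real (Im (z b)) * chart_vec A c p b f)" for b
      by (subst complex_eq[of "z b"]) (simp add: algebra_simps)
    ultimately show "u f = chart_vec A c p ?v f + \<i> * chart_vec A c p ?w f"
      by (simp add: u sum.distrib sum_distrib_left)
  qed
  then show "u \<in> ctangent A p" unfolding ctangent_def using chart_vec_tangent[OF c] by blast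
qed

lemma sum_chart_vec_coord:
  assumes c: "c \<in> A" "p \<in> fst c" and "b \<in> Basis"
  shows "(\<Sum>b'\<in>Basis. z b' * chart_vec A c p b' (coord c b)) = z b"
proof -
  have "(\<Sum>b'\<in>Basis. z b' * chart_vec A c p b' (coord c b)) = (\<Sum>b'\<in>Basis. if b' = b then z b' else 0)"
    by (rule sum.cong) (auto simp: chart_vec_coord[OF c] inner_Basis assms(3))
  then show ?thesis using assms(3) by simp
qed

text \<open>Membership becomes a fixed-point equation: a vector is rebuilt from its values on the
  coordinate functions. Closure properties and equality tests thereby reduce to computations with
  coordinates.\<close>

lemma ctangent_iff:
  assumes c: "c \<in> A" "p \<in> fst c"
  shows "u \<in> ctangent A p \<longleftrightarrow> u = (\<lambda>f. \<Sum>b\<in>Basis. u (coord c b) * chart_vec A c p b f)"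
proof
  assume "u \<in> ctangent A p"
  then obtain z where u: "u = (\<lambda>f. \<Sum>b\<in>Basis. z b * chart_vec A c p b f)"
    using ctangent_rep[OF c] by blast
  then have "u (coord c b) = z b" if "b \<in> Basis" for b using sum_chart_vec_coord[OF c that] by simp
  then show "u = (\<lambda>f. \<Sum>b\<in>Basis. u (coord c b) * chart_vec A c p b f)"
    unfolding u by (intro ext sum.cong) auto
next
  assume "u = (\<lambda>f. \<Sum>b\<in>Basis. u (coord c b) * chart_vec A c p b f)"
  then show "u \<in> ctangent A p"
    unfolding ctangent_rep[OF c] by (intro exI[of _ "\<lambda>b. u (coord c b)"])
qed

lemma ctangent_apply:
  "c \<in> A \<Longrightarrow> p \<in> fst c \<Longrightarrow> u \<in> ctangent A p \<Longrightarrow> u f = (\<Sum>b\<in>Basis. u (coord c b) * chart_vec A c p b f)"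
  by (rule fun_cong[OF ctangent_iff[THEN iffD1]])

lemma ctangent_eqI:
  assumes "c \<in> A" "p \<in> fst c" "u \<in> ctangent A p" "v \<in> ctangent A p"
    and "\<And>b. b \<in> Basis \<Longrightarrow> u (coord c b) = v (coord c b)"
  shows "u = v"
proof
  fix f
  show "u f = v f" unfolding ctangent_apply[OF assms(1,2,3), of f] ctangent_apply[OF assms(1,2,4), of f]
    using assms(5) by simp
qed

lemma ctangent_zero: "(\<lambda>f. 0) \<in> ctangent A p"
proof -
  obtain c where c: "c \<in> A" "p \<in> fst c" by (rule chart_at)
  show ?thesis by (simp add: ctangent_iff[OF c])
qed

lemma ctangent_lin:
  assumes "u \<in> ctangent A p" "v \<in> ctangent A p"
  shows "(\<lambda>f. u f + k * v f) \<in> ctangent A p"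
proof -
  obtain c where c: "c \<in> A" "p \<in> fst c" by (rule chart_at)
  show ?thesis
    unfolding ctangent_iff[OF c]
  proof
    fix f
    show "u f + k * v f = (\<Sum>b\<in>Basis. (u (coord c b) + k * v (coord c b)) * chart_vec A c p b f)"
      unfolding ctangent_apply[OF c assms(1), of f] ctangent_apply[OF c assms(2), of f]
      by (simp add: distrib_right sum.distrib sum_distrib_left mult.assoc)
  qed
qed

lemma ctangent_cmult: "u \<in> ctangent A p \<Longrightarrow> (\<lambda>f. k * u f) \<in> ctangent A p"
  using ctangent_lin[OF ctangent_zero, of u p k] by simp

lemma ctangent_add: "u \<in> ctangent A p \<Longrightarrow> v \<in> ctangent A p \<Longrightarrow> (\<lambda>f. u f + v f) \<in> ctangent A p"
  using ctangent_lin[of u p v 1] by simp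

lemma ctangent_sum: "(\<And>i. i \<in> I \<Longrightarrow> u i \<in> ctangent A p) \<Longrightarrow> (\<lambda>f. \<Sum>i\<in>I. k i * u i f) \<in> ctangent A p"
proof (induction I rule: infinite_finite_induct)
  case (insert i I)
  then show ?case using ctangent_lin[of "\<lambda>f. \<Sum>i\<in>I. k i * u i f" p "u i" "k i"] by (simp add: add.commute)
qed (auto intro: ctangent_zero)

lemma tangent_subset: "tangent A p \<subseteq> ctangent A p"
proof -
  obtain c where c: "c \<in> A" "p \<in> fst c" by (rule chart_at)
  have "chart_vec A c p 0 = (\<lambda>f. 0)" using chart_vec_linear(2)[OF c, of 0] by auto
  then have "(\<lambda>f. 0) \<in> tangent A p" using chart_vec_tangent[OF c, of 0] by simp
  then have "\<exists>v w. u = (\<lambda>f. v f + \<i> * w f) \<and> v \<in> tangent A p \<and> w \<in> tangent A p" if "u \<in> tangent A p" for u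
    using that by (intro exI[of _ u] exI[of _ "\<lambda>f. 0"]) simp
  then show ?thesis unfolding ctangent_def by blast
qed

lemma ctangent_real:
  assumes "u \<in> tangent A p" "\<forall>\<^sub>F q in nhds p. f q \<in> \<real>"
  shows "u f \<in> \<real>"
proof -
  obtain c where c: "c \<in> A" "p \<in> fst c" by (rule chart_at)
  obtain v where u: "u = chart_vec A c p v" using assms(1)[unfolded tangent_eq[OF c]] by (rule rangeE)
  show ?thesis unfolding u by (rule chart_vec_real[OF c assms(2)])
qed

lemma tangent_iff:
  assumes c: "c \<in> A" "p \<in> fst c"
  shows "u \<in> tangent A p \<longleftrightarrow> u \<in> ctangent A p \<and> (\<forall>b\<in>Basis. u (coord c b) \<in> \<real>)"
proof
  assume u: "u \<in> tangent A p"
  have "u (coord c b) \<in> \<real>" for b by (rule ctangent_real[OF u]) (simp add: coord_def)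
  then show "u \<in> ctangent A p \<and> (\<forall>b\<in>Basis. u (coord c b) \<in> \<real>)"
    using tangent_subset u by blast
next
  assume a: "u \<in> ctangent A p \<and> (\<forall>b\<in>Basis. u (coord c b) \<in> \<real>)"
  have r: "u (coord c b) = complex_of_real (Re (u (coord c b)))" if "b \<in> Basis" for b
    by (rule of_real_Re[symmetric]) (use a that in blast)
  let ?v = "\<Sum>b\<in>Basis. Re (u (coord c b)) *\<^sub>R b"
  have "u = chart_vec A c p ?v"
  proof (rule ctangent_eqI[OF c])
    fix b :: 'e assume b: "b \<in> Basis"
    show "u (coord c b) = chart_vec A c p ?v (coord c b)"
      unfolding chart_vec_coord[OF c] inner_sum_left_Basis[OF b] by (rule r[OF b])
  qed (use a chart_vec_tangent[OF c] tangent_subset in blast)+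
  then show "u \<in> tangent A p" by (rule ssubst[where P = "\<lambda>u. u \<in> tangent A p"]) (rule chart_vec_tangent[OF c])
qed

lemma tangent_lin:
  assumes "u \<in> tangent A p" "v \<in> tangent A p" "k \<in> \<real>"
  shows "(\<lambda>f. u f + k * v f) \<in> tangent A p"
proof -
  obtain c where c: "c \<in> A" "p \<in> fst c" by (rule chart_at)
  show ?thesis using assms ctangent_lin unfolding tangent_iff[OF c] by (simp add: Reals_add Reals_mult)
qed

lemma tangent_zero: "(\<lambda>f. 0) \<in> tangent A p"
proof -
  obtain c where c: "c \<in> A" "p \<in> fst c" by (rule chart_at)
  show ?thesis using ctangent_zero unfolding tangent_iff[OF c] by simp
qed

lemma ctangent_split:
  assumes "u \<in> ctangent A p"
  obtains v w where "v \<in> tangent A p" "w \<in> tangent A p" "u = (\<lambda>f. v f + \<i> * w f)"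
  using assms unfolding ctangent_def by blast

lemma ctangent_not_sm:
  assumes "u \<in> ctangent A p" "\<not> smooth_at A p f"
  shows "u f = 0"
proof -
  obtain c where c: "c \<in> A" "p \<in> fst c" by (rule chart_at)
  show ?thesis unfolding ctangent_apply[OF c assms(1), of f] by (simp add: chart_vec_not_sm[OF assms(2)])
qed

lemma ctangent_cong:
  assumes "u \<in> ctangent A p" "\<forall>\<^sub>F q in nhds p. f q = g q"
  shows "u f = u g"
proof -
  obtain c where c: "c \<in> A" "p \<in> fst c" by (rule chart_at)
  show ?thesis unfolding ctangent_apply[OF c assms(1), of f] ctangent_apply[OF c assms(1), of g]
    using chart_vec_cong[OF c assms(2)] by simp
qed

lemma ctangent_const:
  assumes "u \<in> ctangent A p"
  shows "u (\<lambda>q. k) = 0"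
proof -
  obtain c where c: "c \<in> A" "p \<in> fst c" by (rule chart_at)
  show ?thesis unfolding ctangent_apply[OF c assms, of "\<lambda>q. k"] by (simp add: chart_vec_const[OF c])
qed

lemma ctangent_fun_add:
  assumes "u \<in> ctangent A p" "smooth_at A p f" "smooth_at A p g"
  shows "u (\<lambda>q. f q + g q) = u f + u g"
proof -
  obtain c where c: "c \<in> A" "p \<in> fst c" by (rule chart_at)
  show ?thesis
    unfolding ctangent_apply[OF c assms(1), of "\<lambda>q. f q + g q"] ctangent_apply[OF c assms(1), of f]
      ctangent_apply[OF c assms(1), of g]
    by (simp add: chart_vec_add[OF c assms(2,3)] distrib_left sum.distrib)
qed

lemma ctangent_fun_mult:
  assumes "u \<in> ctangent A p" "smooth_at A p f" "smooth_at A p g"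
  shows "u (\<lambda>q. f q * g q) = f p * u g + u f * g p"
proof -
  obtain c where c: "c \<in> A" "p \<in> fst c" by (rule chart_at)
  show ?thesis
    unfolding ctangent_apply[OF c assms(1), of "\<lambda>q. f q * g q"] ctangent_apply[OF c assms(1), of f]
      ctangent_apply[OF c assms(1), of g]
    by (simp add: chart_vec_mult[OF c assms(2,3)] algebra_simps sum.distrib sum_distrib_left)
qed

lemma ctangent_fun_cmult: "u \<in> ctangent A p \<Longrightarrow> smooth_at A p f \<Longrightarrow> u (\<lambda>q. k * f q) = k * u f"
  using ctangent_fun_mult[OF _ smooth_at_const[of p k], of u f] ctangent_const by simp

lemma ctangent_fun_sum:
  assumes "u \<in> ctangent A p" "\<And>i. i \<in> I \<Longrightarrow> smooth_at A p (f i)"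
  shows "u (\<lambda>q. \<Sum>i\<in>I. f i q) = (\<Sum>i\<in>I. u (f i))"
  using assms(2)
proof (induction I rule: infinite_finite_induct)
  case (insert i I)
  then show ?case using ctangent_fun_add[OF assms(1), of "f i" "\<lambda>q. \<Sum>i\<in>I. f i q"] smooth_at_sum[of I p f] by simp
qed (auto intro: ctangent_const[OF assms(1)])

lemma vfield_ct: "smooth_vfield A X \<Longrightarrow> X p \<in> ctangent A p"
  by (simp add: smooth_vfield_def)

lemma vfield_sm: "smooth_vfield A X \<Longrightarrow> smooth_at A p f \<Longrightarrow> smooth_at A p (\<lambda>q. X q f)"
  by (simp add: smooth_vfield_def smooth_near_iff)

text \<open>In a chart the field is a combination of coordinate fields whose coefficients are its
  values on the coordinate functions, so testing these is enough.\<close>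

lemma smooth_vfieldI:
  assumes "\<And>p. X p \<in> ctangent A p"
    and "\<And>p. \<exists>c\<in>A. p \<in> fst c \<and> (\<forall>b\<in>Basis. smooth_at A p (\<lambda>q. X q (coord c b)))"
  shows "smooth_vfield A X"
  unfolding smooth_vfield_def smooth_near_iff
proof (intro conjI allI impI assms(1))
  fix p and f :: "'m \<Rightarrow> complex" assume f: "smooth_at A p f"
  obtain c where c: "c \<in> A" "p \<in> fst c \<and> (\<forall>b\<in>Basis. smooth_at A p (\<lambda>q. X q (coord c b)))"
    using assms(2)[of p] by (rule bexE)
  note X = bspec[OF conjunct2[OF c(2)]] and c = c(1) conjunct1[OF c(2)]
  have "smooth_at A p (\<lambda>q. \<Sum>b\<in>Basis. X q (coord c b) * chart_vec A c q b f)"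
    by (intro smooth_at_sum smooth_at_mult X smooth_at_chart_vec[OF c f])
  moreover have "\<forall>\<^sub>F q in nhds p. (\<Sum>b\<in>Basis. X q (coord c b) * chart_vec A c q b f) = X q f"
    using chart_eventually[OF c] by eventually_elim (rule ctangent_apply[OF c(1) _ assms(1), symmetric])
  ultimately show "smooth_at A p (\<lambda>q. X q f)" by (rule smooth_at_cong)
qed

lemma vfield_sum:
  assumes "\<And>i. i \<in> I \<Longrightarrow> smooth_vfield A (X i)" "\<And>i p. i \<in> I \<Longrightarrow> smooth_at A p (a i)"
  shows "smooth_vfield A (\<lambda>p f. \<Sum>i\<in>I. a i p * X i p f)"
  unfolding smooth_vfield_def smooth_near_iff
proof (intro conjI allI impI)
  fix p show "(\<lambda>f. \<Sum>i\<in>I. a i p * X i p f) \<in> ctangent A p"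
    by (rule ctangent_sum) (rule vfield_ct[OF assms(1)])
  fix f :: "'m \<Rightarrow> complex" assume f: "smooth_at A p f"
  show "smooth_at A p (\<lambda>q. \<Sum>i\<in>I. a i q * X i q f)"
    by (intro smooth_at_sum smooth_at_mult assms(2) vfield_sm[OF assms(1) f])
qed

lemma bracket_apply:
  "smooth_at A p f \<Longrightarrow> bracket A X Y p f = X p (\<lambda>q. Y q f) - Y p (\<lambda>q. X q f)"
  by (simp add: bracket_def smooth_near_iff)

text \<open>Splits the composite of two fields into a first-order and a second-order part. The
  second is symmetric in \<open>X\<close> and \<open>Y\<close>, so the bracket is again a vector; at
  a critical point of \<open>f\<close> the first vanishes, which gives the second derivative test
  below.\<close>

lemma vfield_second_order:
  assumes X: "smooth_vfield A X" and Y: "smooth_vfield A Y" and c: "c \<in> A" "p \<in> fst c" and f: "smooth_at A p f"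
  shows "X p (\<lambda>q. Y q f) = (\<Sum>b\<in>Basis. X p (\<lambda>q. Y q (coord c b)) * chart_vec A c p b f) +
    (\<Sum>b\<in>Basis. \<Sum>d\<in>Basis. Y p (coord c b) * X p (coord c d) * chart_vec A c p d (\<lambda>q. chart_vec A c q b f))"
proof -
  have Yb: "smooth_at A p (\<lambda>q. Y q (coord c b))" for b by (rule vfield_sm[OF Y smooth_at_coord[OF c]])
  have "X p (\<lambda>q. Y q f) = X p (\<lambda>q. \<Sum>b\<in>Basis. Y q (coord c b) * chart_vec A c q b f)"
  proof (rule ctangent_cong[OF vfield_ct[OF X]])
    show "\<forall>\<^sub>F q in nhds p. Y q f = (\<Sum>b\<in>Basis. Y q (coord c b) * chart_vec A c q b f)"
      using chart_eventually[OF c] by eventually_elim (rule ctangent_apply[OF c(1) _ vfield_ct[OF Y]])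
  qed
  also have "\<dots> = (\<Sum>b\<in>Basis. Y p (coord c b) * X p (\<lambda>q. chart_vec A c q b f) + X p (\<lambda>q. Y q (coord c b)) * chart_vec A c p b f)"
    by (simp add: ctangent_fun_sum[OF vfield_ct[OF X]] smooth_at_mult ctangent_fun_mult[OF vfield_ct[OF X]] Yb smooth_at_chart_vec[OF c f])
  also have "\<dots> = (\<Sum>b\<in>Basis. X p (\<lambda>q. Y q (coord c b)) * chart_vec A c p b f) +
    (\<Sum>b\<in>Basis. Y p (coord c b) * (\<Sum>d\<in>Basis. X p (coord c d) * chart_vec A c p d (\<lambda>q. chart_vec A c q b f)))"
    unfolding ctangent_apply[OF c vfield_ct[OF X], of "\<lambda>q. chart_vec A c q _ f"] sum.distrib
    by (rule add.commute)
  finally show ?thesis by (simp add: sum_distrib_left mult.assoc)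
qed

lemma bracket_ct:
  assumes X: "smooth_vfield A X" and Y: "smooth_vfield A Y"
  shows "bracket A X Y p \<in> ctangent A p"
proof -
  obtain c where c: "c \<in> A" "p \<in> fst c" by (rule chart_at)
  have "bracket A X Y p f = (\<Sum>b\<in>Basis. bracket A X Y p (coord c b) * chart_vec A c p b f)" for f
  proof (cases "smooth_at A p f")
    case True
    let ?C = "\<lambda>d b. chart_vec A c p d (\<lambda>q. chart_vec A c q b f)"
    have "(\<Sum>b\<in>Basis. \<Sum>d\<in>Basis. Y p (coord c b) * X p (coord c d) * ?C d b) =
        (\<Sum>d\<in>Basis. \<Sum>b\<in>Basis. Y p (coord c b) * X p (coord c d) * ?C d b)" by (rule sum.swap)
    also have "\<dots> = (\<Sum>b\<in>Basis. \<Sum>d\<in>Basis. X p (coord c b) * Y p (coord c d) * ?C d b)"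
      by (intro sum.cong refl) (simp add: chart_vec_commute[OF c True] mult.commute)
    finally show ?thesis
      using vfield_second_order[OF X Y c True] vfield_second_order[OF Y X c True]
      by (simp add: bracket_apply[OF True] bracket_apply[OF smooth_at_coord[OF c]] left_diff_distrib sum_subtractf)
  qed (simp add: bracket_def smooth_near_iff chart_vec_not_sm)
  then show ?thesis unfolding ctangent_iff[OF c] by (rule ext)
qed

lemma bracket_smooth:
  assumes X: "smooth_vfield A X" and Y: "smooth_vfield A Y"
  shows "smooth_vfield A (bracket A X Y)"
proof (rule smooth_vfieldI[OF bracket_ct[OF X Y]])
  fix p
  obtain c where c: "c \<in> A" "p \<in> fst c" by (rule chart_at)
  have "smooth_at A p (\<lambda>q. bracket A X Y q (coord c b))" for b
  proof (rule smooth_at_cong)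
    show "smooth_at A p (\<lambda>q. X q (\<lambda>r. Y r (coord c b)) - Y q (\<lambda>r. X r (coord c b)))"
      by (intro smooth_at_diff vfield_sm[OF X] vfield_sm[OF Y] smooth_at_coord[OF c])
    show "\<forall>\<^sub>F q in nhds p. X q (\<lambda>r. Y r (coord c b)) - Y q (\<lambda>r. X r (coord c b)) = bracket A X Y q (coord c b)"
      using chart_eventually[OF c] by eventually_elim (simp add: bracket_apply smooth_at_coord[OF c(1)])
  qed
  then show "\<exists>c\<in>A. p \<in> fst c \<and> (\<forall>b\<in>Basis. smooth_at A p (\<lambda>q. bracket A X Y q (coord c b)))" using c by blast
qed

lemma bracket_tangent:
  assumes X: "smooth_vfield A X" and Y: "smooth_vfield A Y"
    and r: "\<And>p. X p \<in> tangent A p" "\<And>p. Y p \<in> tangent A p"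
  shows "bracket A X Y p \<in> tangent A p"
proof -
  obtain c where c: "c \<in> A" "p \<in> fst c" by (rule chart_at)
  have 1: "Z q (coord c b) \<in> \<real>" if "\<And>p. Z p \<in> tangent A p" for Z q b
    by (rule ctangent_real[OF that]) (simp add: coord_def)
  have "bracket A X Y p (coord c b) \<in> \<real>" for b
    unfolding bracket_apply[OF smooth_at_coord[OF c]]
    by (intro Reals_diff ctangent_real[OF r(1)] ctangent_real[OF r(2)] always_eventually allI 1 r)
  then show ?thesis unfolding tangent_iff[OF c] using bracket_ct[OF X Y] by blast
qed

text \<open>The coefficients are numbers, so no derivative of a coefficient appears. This is the
  case needed for invariant frames.\<close>

lemma bracket_sum_left:
  assumes "\<And>i. i \<in> I \<Longrightarrow> smooth_vfield A (X i)" and Y: "smooth_vfield A Y"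
  shows "bracket A (\<lambda>p f. \<Sum>i\<in>I. k i * X i p f) Y p f = (\<Sum>i\<in>I. k i * bracket A (X i) Y p f)"
proof (cases "smooth_at A p f")
  case True
  have "Y p (\<lambda>q. \<Sum>i\<in>I. k i * X i q f) = (\<Sum>i\<in>I. k i * Y p (\<lambda>q. X i q f))"
    using assms True
    by (simp add: ctangent_fun_sum[OF vfield_ct[OF Y]] ctangent_fun_cmult[OF vfield_ct[OF Y]] smooth_at_cmult vfield_sm)
  then show ?thesis by (simp add: bracket_apply[OF True] right_diff_distrib sum_subtractf)
qed (simp add: bracket_def smooth_near_iff)

lemma bracket_anticomm: "bracket A X Y p f = - bracket A Y X p f"
  by (simp add: bracket_def)

lemma bracket_sum_right:
  assumes "\<And>i. i \<in> I \<Longrightarrow> smooth_vfield A (X i)" and Y: "smooth_vfield A Y"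
  shows "bracket A Y (\<lambda>p f. \<Sum>i\<in>I. k i * X i p f) p f = (\<Sum>i\<in>I. k i * bracket A Y (X i) p f)"
  by (simp add: bracket_anticomm[of Y] sum_negf bracket_sum_left[OF assms])

end

section \<open>Smooth maps and products\<close>

text \<open>That \<open>F\<close> sends a neighbourhood of \<open>p\<close> into the domain of one
  chart takes the place of a continuity assumption; continuity at \<open>p\<close> is recovered in
  \<open>smooth_map_at_tendsto\<close>.\<close>

definition smooth_map_at :: "('m::topological_space, 'e::euclidean_space) chart set \<Rightarrow>
    ('k::topological_space, 'f::euclidean_space) chart set \<Rightarrow> 'm \<Rightarrow> ('m \<Rightarrow> 'k) \<Rightarrow> bool" where
  "smooth_map_at A B p F \<longleftrightarrow> (\<exists>d\<in>B. F p \<in> fst d \<and> (\<forall>\<^sub>F q in nhds p. F q \<in> fst d) \<and> smooth_at A p (\<lambda>q. snd d (F q)))"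

definition prod_chart :: "('m, 'e) chart \<Rightarrow> ('k, 'f) chart \<Rightarrow> ('m \<times> 'k, 'e \<times> 'f) chart" where
  "prod_chart c d = (fst c \<times> fst d, map_prod (snd c) (snd d))"

lemma fst_prod_chart [simp]: "fst (prod_chart c d) = fst c \<times> fst d"
  and snd_prod_chart [simp]: "snd (prod_chart c d) = map_prod (snd c) (snd d)"
  by (simp_all add: prod_chart_def)

lemma prod_atlas_eq: "prod_atlas A B = {prod_chart c d | c d. c \<in> A \<and> d \<in> B}"
  by (force simp: prod_atlas_def prod_chart_def)

lemma prod_chart_in: "c \<in> A \<Longrightarrow> d \<in> B \<Longrightarrow> prod_chart c d \<in> prod_atlas A B"
  unfolding prod_atlas_eq by blast

lemma coord_prod_chart:
  "coord (prod_chart c d) (b, 0) = (\<lambda>z. coord c b (fst z))"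
  "coord (prod_chart c d) (0, b') = (\<lambda>z. coord d b' (snd z))"
  by (auto simp: coord_def fun_eq_iff)

lemma smooth_map_at_const:
  assumes "smooth_manifold A" "smooth_manifold B"
  shows "smooth_map_at A B p (\<lambda>q. k)"
proof -
  interpret A: smooth_manifold A by fact
  interpret B: smooth_manifold B by fact
  obtain d where "d \<in> B" "k \<in> fst d" by (rule B.chart_at)
  then show ?thesis unfolding smooth_map_at_def by (intro bexI[of _ d]) (auto intro: A.smooth_at_const)
qed

lemma smooth_map_at_id:
  assumes "smooth_manifold A"
  shows "smooth_map_at A A p (\<lambda>q. q)"
proof -
  interpret A: smooth_manifold A by fact
  obtain d where "d \<in> A" "p \<in> fst d" by (rule A.chart_at)
  then show ?thesis unfolding smooth_map_at_def
    by (intro bexI[of _ d]) (auto intro: A.smooth_at_chartmap A.chart_eventually)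
qed

lemma smooth_map_at_Pair:
  assumes "smooth_manifold A" "smooth_map_at A B p F" "smooth_map_at A C p H"
  shows "smooth_map_at A (prod_atlas B C) p (\<lambda>q. (F q, H q))"
proof -
  interpret A: smooth_manifold A by fact
  obtain d where d: "d \<in> B" "F p \<in> fst d" "\<forall>\<^sub>F q in nhds p. F q \<in> fst d" "smooth_at A p (\<lambda>q. snd d (F q))"
    using assms(2) unfolding smooth_map_at_def by blast
  obtain d' where d': "d' \<in> C" "H p \<in> fst d'" "\<forall>\<^sub>F q in nhds p. H q \<in> fst d'" "smooth_at A p (\<lambda>q. snd d' (H q))"
    using assms(3) unfolding smooth_map_at_def by blast
  have "\<forall>\<^sub>F q in nhds p. (F q, H q) \<in> fst (prod_chart d d')"
    using d(3) d'(3) by eventually_elim simp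
  moreover have "smooth_at A p (\<lambda>q. snd (prod_chart d d') (F q, H q))"
    using A.smooth_at_Pair[OF d(4) d'(4)] by simp
  moreover have "prod_chart d d' \<in> prod_atlas B C" using d d' by (intro prod_chart_in)
  ultimately show ?thesis unfolding smooth_map_at_def using d d' by (intro bexI[of _ "prod_chart d d'"]) auto
qed

locale two_manifolds = A: smooth_manifold A + B: smooth_manifold B
  for A :: "('m::topological_space, 'e::euclidean_space) chart set"
    and B :: "('k::topological_space, 'f::euclidean_space) chart set"
begin

lemma smooth_map_at_tendsto:
  assumes "smooth_map_at A B p F"
  shows "(F \<longlongrightarrow> F p) (nhds p)"
proof -
  obtain d where d: "d \<in> B" "F p \<in> fst d" "\<forall>\<^sub>F q in nhds p. F q \<in> fst d" "smooth_at A p (\<lambda>q. snd d (F q))"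
    using assms unfolding smooth_map_at_def by blast
  show ?thesis
  proof (rule topological_tendstoI)
    fix S assume S: "open S" "F p \<in> S"
    have "open (snd d ` (fst d \<inter> S))" by (rule B.chart_image_open[OF d(1) S(1)])
    moreover have "snd d (F p) \<in> snd d ` (fst d \<inter> S)" using d S by blast
    ultimately have "\<forall>\<^sub>F q in nhds p. snd d (F q) \<in> snd d ` (fst d \<inter> S)"
      using topological_tendstoD[OF A.smooth_at_tendsto[OF d(4)]] by blast
    then show "\<forall>\<^sub>F q in nhds p. F q \<in> S"
      using d(3)
    proof eventually_elim
      fix q assume a: "snd d (F q) \<in> snd d ` (fst d \<inter> S)" "F q \<in> fst d"
      then obtain y where y: "y \<in> fst d" "y \<in> S" "snd d (F q) = snd d y" by blast
      have "F q = y"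
        using trans[OF B.cinv_snd[OF d(1) a(2), symmetric] arg_cong[OF y(3), of "cinv d"]]
        unfolding B.cinv_snd[OF d(1) y(1)] .
      then show "F q \<in> S" using y(2) by simp
    qed
  qed
qed

lemma smooth_at_comp:
  fixes h :: "'k \<Rightarrow> 'b::real_normed_vector"
  assumes "smooth_map_at A B p F" "smooth_at B (F p) h"
  shows "smooth_at A p (\<lambda>q. h (F q))"
proof -
  obtain d where d: "d \<in> B" "F p \<in> fst d" "\<forall>\<^sub>F q in nhds p. F q \<in> fst d" "smooth_at A p (\<lambda>q. snd d (F q))"
    using assms(1) unfolding smooth_map_at_def by blast
  obtain W where W: "open W" "snd d (F p) \<in> W" "W \<subseteq> snd d ` fst d" "smooth_on W (h \<circ> cinv d)"
    by (rule B.smooth_at_chart[OF assms(2) d(1,2)])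
  have "smooth_at A p (\<lambda>q. (h \<circ> cinv d) (snd d (F q)))"
    by (rule A.smooth_at_compose[OF d(4) W(1,2,4)])
  moreover have "\<forall>\<^sub>F q in nhds p. (h \<circ> cinv d) (snd d (F q)) = h (F q)"
    using d(3) by eventually_elim (simp add: B.cinv_snd[OF d(1)])
  ultimately show ?thesis by (rule A.smooth_at_cong)
qed

lemma push_apply: "smooth_at B (F p) h \<Longrightarrow> push_forward B F p u h = u (\<lambda>q. h (F q))"
  by (simp add: push_forward_def B.smooth_near_iff comp_def)

lemma push_not_sm: "\<not> smooth_at B (F p) h \<Longrightarrow> push_forward B F p u h = 0"
  by (simp add: push_forward_def B.smooth_near_iff)

text \<open>By the chain rule a pushed-forward coordinate vector is a combination of the coordinate
  vectors at \<open>F p\<close>, with coefficients that do not depend on the function it acts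
  on.\<close>

lemma push_ct:
  assumes F: "smooth_map_at A B p F" and u: "u \<in> ctangent A p"
  shows "push_forward B F p u \<in> ctangent B (F p)"
proof -
  obtain d where d: "d \<in> B" "F p \<in> fst d" "\<forall>\<^sub>F q in nhds p. F q \<in> fst d" "smooth_at A p (\<lambda>q. snd d (F q))"
    using F unfolding smooth_map_at_def by blast
  obtain c where c: "c \<in> A" "p \<in> fst c" by (rule A.chart_at)
  obtain W where W: "open W" "snd c p \<in> W" "W \<subseteq> snd c ` fst c" "smooth_on W ((\<lambda>q. snd d (F q)) \<circ> cinv c)"
    by (rule A.smooth_at_chart[OF d(4) c])
  have "((\<lambda>q. snd d (F q)) \<circ> cinv c) differentiable (at (snd c p))"
    by (rule smooth_on_imp_differentiable[OF W(4,2)])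
  then obtain D where D: "((\<lambda>q. snd d (F q)) \<circ> cinv c has_derivative D) (at (snd c p))"
    unfolding differentiable_def by blast
  have Fd: "smooth_at A p (\<lambda>q. coord d b (F q))" for b
    by (rule smooth_at_comp[OF F B.smooth_at_coord[OF d(1,2)]])
  have Db: "chart_vec A c p v (\<lambda>q. coord d b (F q)) = complex_of_real (D v \<bullet> b)" for v b
  proof (rule A.chart_vec_eqI[OF c Fd])
    have "((\<lambda>x. complex_of_real (((\<lambda>q. snd d (F q)) \<circ> cinv c) x \<bullet> b)) has_derivative
        (\<lambda>v. complex_of_real (D v \<bullet> b))) (at (snd c p))"
      by (rule bounded_linear.has_derivative[OF bounded_linear_of_real
        bounded_linear.has_derivative[OF bounded_linear_inner_left D]])
    then show "((\<lambda>q. coord d b (F q)) \<circ> cinv c has_derivative (\<lambda>v. complex_of_real (D v \<bullet> b))) (at (snd c p))"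
      by (simp add: coord_def comp_def)
  qed
  have chain: "chart_vec A c p v (\<lambda>q. h (F q)) = (\<Sum>b\<in>Basis. chart_vec A c p v (\<lambda>q. coord d b (F q)) * chart_vec B d (F p) b h)"
    if h: "smooth_at B (F p) h" for v h
  proof -
    have "chart_vec A c p v (\<lambda>q. h (F q)) = chart_vec B d (F p) (D v) h"
    proof (rule A.chart_vec_eqI[OF c smooth_at_comp[OF F h]])
      have at: "((\<lambda>q. snd d (F q)) \<circ> cinv c) (snd c p) = snd d (F p)" by (simp add: A.cinv_snd[OF c])
      have "((\<lambda>x. (h \<circ> cinv d) (((\<lambda>q. snd d (F q)) \<circ> cinv c) x)) has_derivative
          (\<lambda>v. chart_vec B d (F p) (D v) h)) (at (snd c p))"
        by (rule has_derivative_compose[OF D, unfolded at, OF B.chart_vec_has_derivative[OF d(1,2) h]])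
      moreover obtain V where V: "open V" "snd c p \<in> V" "\<forall>x\<in>V. F (cinv c x) \<in> fst d"
        using A.eventually_chart[OF c d(3)] by blast
      ultimately show "((\<lambda>q. h (F q)) \<circ> cinv c has_derivative (\<lambda>v. chart_vec B d (F p) (D v) h)) (at (snd c p))"
        by (elim has_derivative_transform_within_open) (auto simp: B.cinv_snd[OF d(1)])
    qed
    then show ?thesis unfolding Db B.chart_vec_Basis[OF d(1,2), of "D v"] .
  qed
  have "push_forward B F p u h = (\<Sum>b\<in>Basis. push_forward B F p u (coord d b) * chart_vec B d (F p) b h)" for h
  proof (cases "smooth_at B (F p) h")
    case True
    have "push_forward B F p u h = (\<Sum>b'\<in>Basis. u (coord c b') *
        (\<Sum>b\<in>Basis. chart_vec A c p b' (\<lambda>q. coord d b (F q)) * chart_vec B d (F p) b h))"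
      unfolding push_apply[of F p h u, OF True] A.ctangent_apply[OF c u, of "\<lambda>q. h (F q)"] chain[OF True] ..
    also have "\<dots> = (\<Sum>b\<in>Basis. \<Sum>b'\<in>Basis. u (coord c b') *
        chart_vec A c p b' (\<lambda>q. coord d b (F q)) * chart_vec B d (F p) b h)"
      unfolding sum_distrib_left mult.assoc by (rule sum.swap)
    also have "\<dots> = (\<Sum>b\<in>Basis. u (\<lambda>q. coord d b (F q)) * chart_vec B d (F p) b h)"
      unfolding A.ctangent_apply[OF c u, of "\<lambda>q. coord d _ (F q)"] sum_distrib_right ..
    finally show ?thesis by (simp add: push_apply[of F p "coord d _" u, OF B.smooth_at_coord[OF d(1,2)]])
  qed (simp add: push_not_sm B.chart_vec_not_sm)
  then show ?thesis unfolding B.ctangent_iff[OF d(1,2)] by (rule ext)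
qed

lemma push_tangent:
  assumes F: "smooth_map_at A B p F" and u: "u \<in> tangent A p"
  shows "push_forward B F p u \<in> tangent B (F p)"
proof -
  obtain d where d: "d \<in> B" "F p \<in> fst d" by (rule B.chart_at)
  have "push_forward B F p u (coord d b) \<in> \<real>" for b
    unfolding push_apply[of F p "coord d _" u, OF B.smooth_at_coord[OF d]] by (rule A.ctangent_real[OF u]) (simp add: coord_def)
  then show ?thesis unfolding B.tangent_iff[OF d]
    using push_ct[OF F] u A.tangent_subset by blast
qed

lemma push_lin:
  "push_forward B F p (\<lambda>f. u f + k * v f) = (\<lambda>f. push_forward B F p u f + k * push_forward B F p v f)"
  by (auto simp: push_forward_def)

lemma smooth_map_at_smooth_map:
  assumes "smooth_map A B F"
  shows "smooth_map_at A B p F"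
proof -
  obtain c where c: "c \<in> A" "p \<in> fst c" by (rule A.chart_at)
  obtain d where d: "d \<in> B" "F p \<in> fst d" by (rule B.chart_at)
  have o: "open (F -` fst d)"
    using assms B.chart_open[OF d(1)] continuous_on_open_vimage[OF open_UNIV, of F] by (auto simp: smooth_map_def)
  have "smooth_on (snd c ` (fst c \<inter> F -` fst d)) (snd d \<circ> F \<circ> cinv c)"
    using assms c d unfolding smooth_map_def by (cases c; cases d) fastforce
  then have "smooth_on (snd c ` (fst c \<inter> F -` fst d)) ((\<lambda>q. snd d (F q)) \<circ> cinv c)"
    by (simp add: comp_def)
  then have "smooth_at A p (\<lambda>q. snd d (F q))"
    unfolding smooth_at_def using c d A.chart_image_open[OF c(1) o]
    by (intro bexI[of _ c] conjI exI[of _ "snd c ` (fst c \<inter> F -` fst d)"]) auto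
  moreover have "\<forall>\<^sub>F q in nhds p. F q \<in> fst d"
    unfolding eventually_nhds using o d by (intro exI[of _ "F -` fst d"]) auto
  ultimately show ?thesis unfolding smooth_map_at_def using d by blast
qed

lemma cinv_prod_chart:
  assumes "c \<in> A" "d \<in> B" "x \<in> snd c ` fst c" "y \<in> snd d ` fst d"
  shows "cinv (prod_chart c d) (x, y) = (cinv c x, cinv d y)"
proof (rule inv_into_f_eq)
  have "inj_on (snd c) (fst c)" "inj_on (snd d) (fst d)"
    using A.cinv_snd[OF assms(1)] B.cinv_snd[OF assms(2)] by (auto intro: inj_on_inverseI)
  then show "inj_on (snd (prod_chart c d)) (fst (prod_chart c d))"
    by (simp add: map_prod_inj_on)
qed (use assms A.cinv_in B.cinv_in A.snd_cinv B.snd_cinv in auto)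

lemma prod_chart_is_chart:
  assumes c: "c \<in> A" and d: "d \<in> B"
  shows "is_chart (prod_chart c d)"
proof -
  let ?I = "snd c ` fst c \<times> snd d ` fst d"
  have img: "map_prod (snd c) (snd d) ` (fst c \<times> fst d) = ?I" by (rule map_prod_image)
  have "homeomorphism (fst c \<times> fst d) ?I (map_prod (snd c) (snd d)) (cinv (prod_chart c d))"
  proof (rule homeomorphismI)
    have "continuous_on (fst c \<times> fst d) (\<lambda>z. (snd c (fst z), snd d (snd z)))"
      by (intro continuous_on_Pair continuous_on_compose2[OF A.chart_cont[OF c]]
         continuous_on_compose2[OF B.chart_cont[OF d]] continuous_intros) auto
    then show "continuous_on (fst c \<times> fst d) (map_prod (snd c) (snd d))"
      by (simp add: map_prod_def case_prod_unfold)
    have "continuous_on ?I (\<lambda>z. (cinv c (fst z), cinv d (snd z)))"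
      by (intro continuous_on_Pair continuous_on_compose2[OF A.cinv_cont[OF c]]
         continuous_on_compose2[OF B.cinv_cont[OF d]] continuous_intros) auto
    then show "continuous_on ?I (cinv (prod_chart c d))"
      by (rule continuous_on_cong[THEN iffD1, rotated -1]) (auto simp: cinv_prod_chart[OF c d, simplified])
  qed (use A.cinv_in[OF c] B.cinv_in[OF d] A.snd_cinv[OF c] B.snd_cinv[OF d] A.cinv_snd[OF c] B.cinv_snd[OF d]
      in \<open>auto simp: cinv_prod_chart[OF c d, simplified]\<close>)
  then show ?thesis
    unfolding is_chart_def
    using open_Times[OF A.chart_open[OF c] B.chart_open[OF d]] open_Times[OF A.chart_open_img[OF c] B.chart_open_img[OF d]]
    by (simp add: prod_chart_def img)
qed

lemma prod_transition:
  assumes c: "c \<in> A" "c' \<in> A" and d: "d \<in> B" "d' \<in> B"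
  shows "smooth_on (snd (prod_chart c d) ` (fst (prod_chart c d) \<inter> fst (prod_chart c' d')))
    (snd (prod_chart c' d') \<circ> cinv (prod_chart c d))"
proof -
  let ?S = "snd c ` (fst c \<inter> fst c')" and ?T = "snd d ` (fst d \<inter> fst d')"
  have oS: "open ?S" "open ?T" using A.chart_image_open A.chart_open B.chart_image_open B.chart_open c d by blast+
  have o: "open (?S \<times> ?T)" using oS by (rule open_Times)
  have "smooth_on (?S \<times> ?T) (\<lambda>z. (snd c' \<circ> cinv c) (fst z))"
    by (rule smooth_on_compose[OF o oS(1) _ smooth_on_bounded_linear[OF bounded_linear_fst o smooth_on_ident]
       A.transition[OF c]]) auto
  moreover have "smooth_on (?S \<times> ?T) (\<lambda>z. (snd d' \<circ> cinv d) (snd z))"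
    by (rule smooth_on_compose[OF o oS(2) _ smooth_on_bounded_linear[OF bounded_linear_snd o smooth_on_ident]
       B.transition[OF d]]) auto
  ultimately have "smooth_on (?S \<times> ?T) (\<lambda>z. ((snd c' \<circ> cinv c) (fst z), (snd d' \<circ> cinv d) (snd z)))"
    by (rule smooth_on_Pair[OF o])
  then have "smooth_on (?S \<times> ?T) (snd (prod_chart c' d') \<circ> cinv (prod_chart c d))"
    by (rule smooth_on_cong[OF o, rotated]) (auto simp: cinv_prod_chart[OF c(1) d(1), simplified])
  moreover have "snd (prod_chart c d) ` (fst (prod_chart c d) \<inter> fst (prod_chart c' d')) = ?S \<times> ?T"
    by (simp add: Times_Int_Times map_prod_image)
  ultimately show ?thesis by simp
qed

sublocale P: smooth_manifold "prod_atlas A B"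
proof
  have "\<exists>c\<in>prod_atlas A B. z \<in> fst c" for z
  proof -
    obtain c where c: "c \<in> A" "fst z \<in> fst c" by (rule A.chart_at)
    obtain d where d: "d \<in> B" "snd z \<in> fst d" by (rule B.chart_at)
    show ?thesis using c d by (intro bexI[of _ "prod_chart c d"]) (auto simp: prod_chart_in mem_Times_iff)
  qed
  then have "(\<Union>c\<in>prod_atlas A B. fst c) = UNIV" by auto
  moreover have charts: "is_chart u" if "u \<in> prod_atlas A B" for u
    using that prod_chart_is_chart unfolding prod_atlas_eq by blast
  moreover have "smooth_on (snd u ` (fst u \<inter> fst v)) (snd v \<circ> cinv u)"
    if "u \<in> prod_atlas A B" "v \<in> prod_atlas A B" for u v
    using that prod_transition unfolding prod_atlas_eq by blast
  ultimately show "smooth_atlas (prod_atlas A B)"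
    unfolding smooth_atlas_def case_prod_unfold using charts by blast
qed

lemma smooth_map_at_fst: "smooth_map_at (prod_atlas A B) A z fst"
proof -
  obtain c where c: "c \<in> A" "fst z \<in> fst c" by (rule A.chart_at)
  obtain d where d: "d \<in> B" "snd z \<in> fst d" by (rule B.chart_at)
  have z: "z \<in> fst (prod_chart c d)" using c d by (auto simp: mem_Times_iff)
  have "smooth_at (prod_atlas A B) z (\<lambda>q. fst (snd (prod_chart c d) q))"
    by (rule P.smooth_at_bounded_linear[OF bounded_linear_fst P.smooth_at_chartmap[OF prod_chart_in[OF c(1) d(1)] z]])
  moreover have "\<forall>\<^sub>F q in nhds z. fst q \<in> fst c"
    using P.chart_eventually[OF prod_chart_in[OF c(1) d(1)] z] by eventually_elim auto
  ultimately show ?thesis unfolding smooth_map_at_def using c by (intro bexI[of _ c]) auto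
qed

lemma smooth_map_at_snd: "smooth_map_at (prod_atlas A B) B z snd"
proof -
  obtain c where c: "c \<in> A" "fst z \<in> fst c" by (rule A.chart_at)
  obtain d where d: "d \<in> B" "snd z \<in> fst d" by (rule B.chart_at)
  have z: "z \<in> fst (prod_chart c d)" using c d by (auto simp: mem_Times_iff)
  have "smooth_at (prod_atlas A B) z (\<lambda>q. snd (snd (prod_chart c d) q))"
    by (rule P.smooth_at_bounded_linear[OF bounded_linear_snd P.smooth_at_chartmap[OF prod_chart_in[OF c(1) d(1)] z]])
  moreover have "\<forall>\<^sub>F q in nhds z. snd q \<in> fst d"
    using P.chart_eventually[OF prod_chart_in[OF c(1) d(1)] z] by eventually_elim auto
  ultimately show ?thesis unfolding smooth_map_at_def using d by (intro bexI[of _ d]) auto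
qed

lemma smooth_map_at_slice: "smooth_map_at A (prod_atlas A B) p (\<lambda>x. (x, q))" "smooth_map_at B (prod_atlas A B) q (\<lambda>y. (p, y))"
  by (intro smooth_map_at_Pair smooth_map_at_id smooth_map_at_const A.smooth_manifold_axioms B.smooth_manifold_axioms)+

text \<open>Serves to show smooth dependence on a parameter: differentiating in \<open>y\<close>
  with \<open>p\<close> held fixed is a coordinate derivative on the product, hence smooth in both
  variables together.\<close>

lemma chart_vec_slice2:
  assumes c: "c \<in> A" "p \<in> fst c" and d: "d \<in> B" "q \<in> fst d" and H: "smooth_at (prod_atlas A B) (p, q) H"
  shows "chart_vec B d q v (\<lambda>y. H (p, y)) = chart_vec (prod_atlas A B) (prod_chart c d) (p, q) (0, v) H"
proof (rule B.chart_vec_eqI[OF d])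
  interpret BP: two_manifolds B "prod_atlas A B" ..
  show "smooth_at B q (\<lambda>y. H (p, y))" by (rule BP.smooth_at_comp[OF smooth_map_at_slice(2) H])
  have z: "(p, q) \<in> fst (prod_chart c d)" using c d by simp
  have 1: "((\<lambda>y. (snd c p, y)) has_derivative (\<lambda>v. (0, v))) (at (snd d q))"
    by (intro has_derivative_Pair has_derivative_ident has_derivative_const)
  have "((\<lambda>y. (H \<circ> cinv (prod_chart c d)) (snd c p, y)) has_derivative
    (\<lambda>v. chart_vec (prod_atlas A B) (prod_chart c d) (p, q) (0, v) H)) (at (snd d q))"
    by (rule has_derivative_compose[OF 1])
      (use P.chart_vec_has_derivative[OF prod_chart_in[OF c(1) d(1)] z H] in \<open>simp add: comp_def\<close>)
  then show "((\<lambda>y. H (p, y)) \<circ> cinv d has_derivative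
    (\<lambda>v. chart_vec (prod_atlas A B) (prod_chart c d) (p, q) (0, v) H)) (at (snd d q))"
    by (rule has_derivative_transform_within_open[OF _ B.chart_open_img[OF d(1)]])
      (use c d in \<open>auto simp: cinv_prod_chart[simplified] A.cinv_snd B.cinv_snd\<close>)
qed

end

lemma smooth_map_at_compose:
  assumes "two_manifolds A B" "smooth_manifold C" "smooth_map_at A B p F" "smooth_map_at B C (F p) H"
  shows "smooth_map_at A C p (\<lambda>q. H (F q))"
proof -
  interpret AB: two_manifolds A B by fact
  obtain d where d: "d \<in> C" "H (F p) \<in> fst d" "\<forall>\<^sub>F q in nhds (F p). H q \<in> fst d" "smooth_at B (F p) (\<lambda>q. snd d (H q))"
    using assms(4) unfolding smooth_map_at_def by blast
  have "\<forall>\<^sub>F q in nhds p. H (F q) \<in> fst d"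
    using eventually_compose_filterlim[OF d(3) AB.smooth_map_at_tendsto[OF assms(3)]] .
  then show ?thesis unfolding smooth_map_at_def using d AB.smooth_at_comp[OF assms(3) d(4)] by blast
qed

section \<open>Left-invariant vector fields and forms\<close>

context smooth_manifold
begin

lemma alt1_lin:
  assumes "a \<in> alt_forms A 1 p" "u \<in> ctangent A p" "v \<in> ctangent A p"
  shows "a [\<lambda>f. u f + k * v f] = a [u] + k * a [v]"
proof -
  have t: "[u] \<in> tvecs A 1 p" using assms(2) by (simp add: tvecs_def)
  have "\<forall>vs\<in>tvecs A 1 p. \<forall>i<1. \<forall>u\<in>ctangent A p. \<forall>v\<in>ctangent A p. \<forall>c.
        a (vs[i := (\<lambda>f. u f + c * v f)]) = a (vs[i := u]) + c * a (vs[i := v])"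
    using assms(1) by (simp add: alt_forms_def)
  then have "a ([u][0 := (\<lambda>f. u f + k * v f)]) = a ([u][0 := u]) + k * a ([u][0 := v])"
    using t assms(2,3) by blast
  then show ?thesis by simp
qed

lemma alt1_zero: "a \<in> alt_forms A 1 p \<Longrightarrow> a [\<lambda>f. 0] = 0"
  using alt1_lin[OF _ ctangent_zero ctangent_zero, of a p "-1"] by simp

lemma alt1_sum:
  assumes "a \<in> alt_forms A 1 p" "\<And>i. i \<in> I \<Longrightarrow> u i \<in> ctangent A p"
  shows "a [\<lambda>f. \<Sum>i\<in>I. k i * u i f] = (\<Sum>i\<in>I. k i * a [u i])"
  using assms(2)
proof (induction I rule: infinite_finite_induct)
  case (insert i I)
  have "a [\<lambda>f. (\<Sum>i\<in>I. k i * u i f) + k i * u i f] = a [\<lambda>f. \<Sum>i\<in>I. k i * u i f] + k i * a [u i]"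
    by (rule alt1_lin[OF assms(1)]) (use insert.prems ctangent_sum[of I u] in auto)
  then show ?case using insert by (simp add: add.commute)
qed (simp_all add: alt1_zero[OF assms(1)])

end

locale lie_grp =
  fixes G :: "('g::topological_space) monoid"
    and A :: "('g, 'e::euclidean_space) chart set"
  assumes lie: "lie_group A G"
begin

abbreviation mul :: "'g \<Rightarrow> 'g \<Rightarrow> 'g" (infixl "\<odot>" 70) where "x \<odot> y \<equiv> x \<otimes>\<^bsub>G\<^esub> y"
abbreviation one :: 'g where "one \<equiv> \<one>\<^bsub>G\<^esub>"
abbreviation M :: "('g \<times> 'g, 'e \<times> 'e) chart set" where "M \<equiv> prod_atlas A A"

sublocale smooth_manifold A
  by unfold_locales (use lie in \<open>simp add: lie_group_def\<close>)

sublocale AA: two_manifolds A A ..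
sublocale AM: two_manifolds A M ..
sublocale MA: two_manifolds M A ..

lemma grp: "group G" and carrier_UNIV: "carrier G = UNIV"
  using lie by (auto simp: lie_group_def)

lemma mul_assoc: "x \<odot> y \<odot> z = x \<odot> (y \<odot> z)"
  and one_mul: "one \<odot> x = x" and mul_one: "x \<odot> one = x" and inv_mul: "inv\<^bsub>G\<^esub> x \<odot> x = one"
  and mul_inv: "x \<odot> inv\<^bsub>G\<^esub> x = one"
proof -
  interpret group G by (rule grp)
  show "x \<odot> y \<odot> z = x \<odot> (y \<odot> z)" "one \<odot> x = x" "x \<odot> one = x" "inv\<^bsub>G\<^esub> x \<odot> x = one" "x \<odot> inv\<^bsub>G\<^esub> x = one"
    using carrier_UNIV by (auto simp: m_assoc)
qed

lemma smooth_map_at_mul: "smooth_map_at M A z (\<lambda>z. fst z \<odot> snd z)"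
proof -
  have "smooth_map M A (\<lambda>(x, y). x \<odot> y)" using lie by (simp add: lie_group_def)
  then have "smooth_map M A (\<lambda>z. fst z \<odot> snd z)" by (simp add: case_prod_unfold)
  then show ?thesis by (rule MA.smooth_map_at_smooth_map)
qed

lemma smooth_map_at_mult2:
  assumes "two_manifolds B M" "smooth_map_at B A p F" "smooth_map_at B A p H"
  shows "smooth_map_at B A p (\<lambda>x. F x \<odot> H x)"
proof -
  interpret BM: two_manifolds B M by fact
  show ?thesis
    using smooth_map_at_compose[OF assms(1) smooth_manifold_axioms smooth_map_at_Pair[OF BM.A.smooth_manifold_axioms assms(2,3)] smooth_map_at_mul]
    by simp
qed

lemma smooth_map_at_L: "smooth_map_at A A x (\<lambda>y. g \<odot> y)"
  by (rule smooth_map_at_mult2[OF AM.two_manifolds_axioms smooth_map_at_const smooth_map_at_id])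
    (rule smooth_manifold_axioms)+

lemma smooth_map_at_inv: "smooth_map_at A A x (\<lambda>x. inv\<^bsub>G\<^esub> x)"
  by (rule AA.smooth_map_at_smooth_map) (use lie in \<open>simp add: lie_group_def\<close>)

lemma smooth_map_at_div: "smooth_map_at M A z (\<lambda>z. inv\<^bsub>G\<^esub> (fst z) \<odot> snd z)"
proof (rule smooth_map_at_mult2)
  show "two_manifolds M M" ..
  show "smooth_map_at M A z (\<lambda>z. inv\<^bsub>G\<^esub> (fst z))"
    by (rule smooth_map_at_compose[OF MA.two_manifolds_axioms smooth_manifold_axioms AA.smooth_map_at_fst smooth_map_at_inv])
qed (rule AA.smooth_map_at_snd)

definition left_field :: "'g tvec \<Rightarrow> 'g vfield" where
  "left_field v g = push_forward A (\<lambda>y. g \<odot> y) one v"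

definition left_inv :: "'g vfield \<Rightarrow> bool" where
  "left_inv X \<longleftrightarrow> (\<forall>g x. X (g \<odot> x) = push_forward A (\<lambda>y. g \<odot> y) x (X x))"

lemma left_field_ct: "v \<in> ctangent A one \<Longrightarrow> left_field v g \<in> ctangent A g"
  using AA.push_ct[OF smooth_map_at_L, of v one g] by (simp add: left_field_def mul_one)

lemma left_field_tangent: "v \<in> tangent A one \<Longrightarrow> left_field v g \<in> tangent A g"
  using AA.push_tangent[OF smooth_map_at_L, of v one g] by (simp add: left_field_def mul_one)

lemma left_field_apply: "smooth_at A g h \<Longrightarrow> left_field v g h = v (\<lambda>y. h (g \<odot> y))"
  unfolding left_field_def by (rule AA.push_apply) (simp add: mul_one)

text \<open>The value of the field at \<open>g\<close> on a coordinate function is the derivative,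
  in the second variable at the unit, of that coordinate of the product \<open>g \<odot> y\<close>.
  As a coordinate derivative of a smooth function on \<open>G \<times> G\<close> it is smooth in
  \<open>g\<close>.\<close>

lemma left_field_smooth:
  assumes v: "v \<in> ctangent A one"
  shows "smooth_vfield A (left_field v)"
proof (rule smooth_vfieldI)
  fix p
  show "left_field v p \<in> ctangent A p" by (rule left_field_ct[OF v])
  obtain c where c: "c \<in> A" "p \<in> fst c" by (rule chart_at)
  obtain d where d: "d \<in> A" "one \<in> fst d" by (rule chart_at)
  have pin: "(p, one) \<in> fst (prod_chart c d)" using c d by simp
  have "smooth_at A p (\<lambda>g. left_field v g (coord c b))" for b
  proof -
    define H where "H z = coord c b (fst z \<odot> snd z)" for z
    have H: "smooth_at M (g, one) H" if "g \<in> fst c" for g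
      unfolding H_def by (rule MA.smooth_at_comp[OF smooth_map_at_mul smooth_at_coord[OF c(1)]]) (simp add: mul_one that)
    have "smooth_at A p (\<lambda>g. \<Sum>b\<in>Basis. v (coord d b) * chart_vec M (prod_chart c d) (g, one) (0, b) H)"
      by (intro smooth_at_sum smooth_at_cmult AM.smooth_at_comp[OF AA.smooth_map_at_slice(1) AA.P.smooth_at_chart_vec[OF prod_chart_in[OF c(1) d(1)] pin H[OF c(2)]]])
    moreover have "\<forall>\<^sub>F g in nhds p.
      (\<Sum>b\<in>Basis. v (coord d b) * chart_vec M (prod_chart c d) (g, one) (0, b) H) = left_field v g (coord c b)"
      using chart_eventually[OF c]
    proof eventually_elim
      fix g assume g: "g \<in> fst c"
      have "left_field v g (coord c b) = v (\<lambda>y. H (g, y))"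
        unfolding left_field_apply[OF smooth_at_coord[OF c(1) g]] H_def by simp
      also have "\<dots> = (\<Sum>b\<in>Basis. v (coord d b) * chart_vec A d one b (\<lambda>y. H (g, y)))"
        by (rule ctangent_apply[OF d v])
      finally show "(\<Sum>b\<in>Basis. v (coord d b) * chart_vec M (prod_chart c d) (g, one) (0, b) H) = left_field v g (coord c b)"
        unfolding AA.chart_vec_slice2[OF c(1) g d H[OF g]] by simp
    qed
    ultimately show ?thesis by (rule smooth_at_cong)
  qed
  then show "\<exists>c\<in>A. p \<in> fst c \<and> (\<forall>b\<in>Basis. smooth_at A p (\<lambda>q. left_field v q (coord c b)))" using c by blast
qed

lemma push_L_apply: "smooth_at A (g \<odot> x) h \<Longrightarrow> push_forward A (\<lambda>y. g \<odot> y) x u h = u (\<lambda>y. h (g \<odot> y))"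
  by (rule AA.push_apply)

lemma smooth_at_L: "smooth_at A (g \<odot> x) h \<Longrightarrow> smooth_at A x (\<lambda>y. h (g \<odot> y))"
  by (rule AA.smooth_at_comp[OF smooth_map_at_L])

lemma left_field_left_inv:
  assumes v: "v \<in> ctangent A one"
  shows "left_inv (left_field v)"
  unfolding left_inv_def
proof (intro allI ext)
  fix g x h
  show "left_field v (g \<odot> x) h = push_forward A (\<lambda>y. g \<odot> y) x (left_field v x) h"
  proof (cases "smooth_at A (g \<odot> x) h")
    case True
    then show ?thesis by (simp add: left_field_apply push_L_apply smooth_at_L mul_assoc)
  qed (simp add: AA.push_not_sm ctangent_not_sm[OF left_field_ct[OF v]])
qed

lemma left_inv_apply: "left_inv X \<Longrightarrow> smooth_at A (g \<odot> x) h \<Longrightarrow> X (g \<odot> x) h = X x (\<lambda>y. h (g \<odot> y))"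
  unfolding left_inv_def by (simp add: push_L_apply)

text \<open>Invariance means that each field is related to itself by every left translation, and
  brackets of related fields are related.\<close>

lemma left_inv_bracket:
  assumes X: "smooth_vfield A X" "left_inv X" and Y: "smooth_vfield A Y" "left_inv Y"
  shows "left_inv (bracket A X Y)"
  unfolding left_inv_def
proof (intro allI ext)
  fix g x h
  have main: "X (g \<odot> x) (\<lambda>q. Y q h) = X x (\<lambda>q. Y q (\<lambda>y. h (g \<odot> y)))"
    if h: "smooth_at A (g \<odot> x) h" and X: "smooth_vfield A X" "left_inv X" and Y: "smooth_vfield A Y" "left_inv Y" for X Y
  proof -
    have "X (g \<odot> x) (\<lambda>q. Y q h) = X x (\<lambda>y. Y (g \<odot> y) h)"
      by (rule left_inv_apply[OF X(2) vfield_sm[OF Y(1) h]])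
    also have "\<dots> = X x (\<lambda>q. Y q (\<lambda>y. h (g \<odot> y)))"
    proof (rule ctangent_cong[OF vfield_ct[OF X(1)]])
      have "\<forall>\<^sub>F q in nhds x. smooth_at A (g \<odot> q) h"
        by (rule eventually_compose_filterlim[OF smooth_at_eventually[OF h] AA.smooth_map_at_tendsto[OF smooth_map_at_L]])
      then show "\<forall>\<^sub>F q in nhds x. Y (g \<odot> q) h = Y q (\<lambda>y. h (g \<odot> y))"
        by eventually_elim (rule left_inv_apply[OF Y(2)])
    qed
    finally show ?thesis .
  qed
  show "bracket A X Y (g \<odot> x) h = push_forward A (\<lambda>y. g \<odot> y) x (bracket A X Y x) h"
  proof (cases "smooth_at A (g \<odot> x) h")
    case True
    then show ?thesis
      by (simp add: push_L_apply bracket_apply smooth_at_L main[OF True X Y] main[OF True Y X])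
  qed (simp add: AA.push_not_sm ctangent_not_sm[OF bracket_ct[OF X(1) Y(1)]])
qed

lemma left_inv_form_apply:
  assumes "left_invariant_form A G \<omega>" "u \<in> ctangent A x"
  shows "\<omega> x [u] = \<omega> (g \<odot> x) [push_forward A (\<lambda>y. g \<odot> y) x u]"
proof -
  have "pullback A A (\<lambda>y. g \<odot> y) \<omega> = \<omega>" using assms(1) by (simp add: left_invariant_form_def)
  then have "\<omega> x [u] = pullback A A (\<lambda>y. g \<odot> y) \<omega> x [u]" by simp
  then show ?thesis using assms(2) by (simp add: pullback_def)
qed

text \<open>The Maurer-Cartan trick: moving a vector at \<open>q\<close> to the unit by the translation with \<open>q\<^sup>-\<^sup>1\<close>
  expresses the coefficients of an invariant form through the smooth map \<open>(x, y) \<mapsto> x\<^sup>-\<^sup>1 y\<close>.\<close>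

lemma left_inv_form_smooth:
  assumes w: "left_invariant_form A G \<omega>" and alt: "\<And>p. \<omega> p \<in> alt_forms A 1 p"
    and c: "c \<in> A" "p \<in> fst c"
  shows "smooth_at A p (\<lambda>q. \<omega> q [chart_vec A c q b])"
proof -
  obtain d where d: "d \<in> A" "one \<in> fst d" by (rule chart_at)
  define H where "H b' z = coord d b' (inv\<^bsub>G\<^esub> (fst z) \<odot> snd z)" for b' and z :: "'g \<times> 'g"
  have H: "smooth_at M (q, q) (H b')" for q b'
    unfolding H_def by (rule MA.smooth_at_comp[OF smooth_map_at_div smooth_at_coord[OF d(1)]]) (simp add: inv_mul d)
  have pin: "(q, q) \<in> fst (prod_chart c c)" if "q \<in> fst c" for q using that by simp
  have diag: "smooth_map_at A M p (\<lambda>q. (q, q))"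
    by (intro smooth_map_at_Pair smooth_map_at_id smooth_manifold_axioms)
  have "smooth_at A p (\<lambda>q. \<Sum>b'\<in>Basis. chart_vec M (prod_chart c c) (q, q) (0, b) (H b') * \<omega> one [chart_vec A d one b'])"
    by (intro smooth_at_sum smooth_at_mult smooth_at_const AM.smooth_at_comp[OF diag AA.P.smooth_at_chart_vec[OF prod_chart_in[OF c(1) c(1)] pin[OF c(2)] H]])
  moreover have "\<forall>\<^sub>F q in nhds p. (\<Sum>b'\<in>Basis. chart_vec M (prod_chart c c) (q, q) (0, b) (H b') * \<omega> one [chart_vec A d one b'])
    = \<omega> q [chart_vec A c q b]"
    using chart_eventually[OF c]
  proof eventually_elim
    fix q assume q: "q \<in> fst c"
    let ?L = "\<lambda>y. inv\<^bsub>G\<^esub> q \<odot> y" and ?u = "chart_vec A c q b"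
    have u: "?u \<in> ctangent A q" using chart_vec_tangent[OF c(1) q] tangent_subset by blast
    have pu: "push_forward A ?L q ?u \<in> ctangent A one"
      using AA.push_ct[OF smooth_map_at_L u, of "inv\<^bsub>G\<^esub> q"] by (simp add: inv_mul)
    have "\<omega> q [?u] = \<omega> one [push_forward A ?L q ?u]"
      using left_inv_form_apply[OF w u, of "inv\<^bsub>G\<^esub> q"] by (simp add: inv_mul)
    also have "\<dots> = \<omega> one [\<lambda>f. \<Sum>b'\<in>Basis. push_forward A ?L q ?u (coord d b') * chart_vec A d one b' f]"
      using ctangent_iff[OF d, THEN iffD1, OF pu] by (rule arg_cong)
    also have "\<dots> = (\<Sum>b'\<in>Basis. push_forward A ?L q ?u (coord d b') * \<omega> one [chart_vec A d one b'])"
      by (rule alt1_sum[OF alt]) (use chart_vec_tangent[OF d] tangent_subset in blast)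
    finally have eq: "\<omega> q [?u] = (\<Sum>b'\<in>Basis. push_forward A ?L q ?u (coord d b') * \<omega> one [chart_vec A d one b'])" .
    have "push_forward A ?L q ?u (coord d b') = chart_vec M (prod_chart c c) (q, q) (0, b) (H b')" for b'
    proof -
      have "push_forward A ?L q ?u (coord d b') = ?u (\<lambda>y. coord d b' (?L y))"
        by (rule push_L_apply) (simp add: inv_mul smooth_at_coord[OF d])
      also have "\<dots> = ?u (\<lambda>y. H b' (q, y))" by (simp add: H_def)
      finally show ?thesis unfolding AA.chart_vec_slice2[OF c(1) q c(1) q H] .
    qed
    then show "(\<Sum>b'\<in>Basis. chart_vec M (prod_chart c c) (q, q) (0, b) (H b') * \<omega> one [chart_vec A d one b'])
       = \<omega> q [?u]" unfolding eq by simp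
  qed
  ultimately show ?thesis by (rule smooth_at_cong)
qed

end

section \<open>The dual frame and the structure constants\<close>

locale lie_coframe = lie_grp G A
  for G :: "('g::topological_space) monoid" and A :: "('g, 'e::euclidean_space) chart set" +
  fixes n :: nat and e :: "nat \<Rightarrow> 'g form"
  assumes n_DIM: "n = DIM('e)" and coframe: "left_invariant_coframe A G n e"
begin

lemma e_facts:
  assumes "i \<in> {1..n}"
  shows e_alt: "e i p \<in> alt_forms A 1 p" and e_real_form: "real_form A (e i)"
    and e_left: "left_invariant_form A G (e i)"
  using assms coframe by (auto simp: left_invariant_coframe_def smooth_form_def)

lemma e_real: "i \<in> {1..n} \<Longrightarrow> u \<in> tangent A p \<Longrightarrow> e i p [u] \<in> \<real>"
  using e_real_form by (auto simp: real_form_def)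

text \<open>The \<open>e i\<close> span the real covectors at \<open>p\<close>. The covector that
  reads off one coordinate is therefore a combination of them and vanishes on \<open>u\<close> as
  well.\<close>

lemma e_nondegenerate_real:
  assumes u: "u \<in> tangent A p" and z: "\<And>i. i \<in> {1..n} \<Longrightarrow> e i p [u] = 0"
  shows "u = (\<lambda>f. 0)"
proof -
  obtain c where c: "c \<in> A" "p \<in> fst c" by (rule chart_at)
  have uc: "u \<in> ctangent A p" using u tangent_subset by blast
  show ?thesis
  proof (rule ctangent_eqI[OF c uc ctangent_zero])
    fix b
    define a where "a vs = (if vs \<in> tvecs A 1 p then hd vs (coord c b) else 0)" for vs
    have "a \<in> alt_forms A 1 p"
      by (auto simp: alt_forms_def a_def tvecs_def length_Suc_conv ctangent_lin)
    moreover have "\<forall>v\<in>tangent A p. a [v] \<in> \<real>"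
    proof
      fix v assume v: "v \<in> tangent A p"
      have "v (coord c b) \<in> \<real>" by (rule ctangent_real[OF v]) (simp add: coord_def)
      then show "a [v] \<in> \<real>" by (simp add: a_def)
    qed
    ultimately obtain k :: "nat \<Rightarrow> real" where k: "a = (\<lambda>vs. \<Sum>i=1..n. complex_of_real (k i) * e i p vs)"
      using coframe unfolding left_invariant_coframe_def by blast
    have "u (coord c b) = a [u]" using uc by (simp add: a_def tvecs_def)
    also have "\<dots> = 0" unfolding k using z by simp
    finally show "u (coord c b) = 0" .
  qed
qed

lemma e_nondegenerate:
  assumes u: "u \<in> ctangent A p" and z: "\<And>i. i \<in> {1..n} \<Longrightarrow> e i p [u] = 0"
  shows "u = (\<lambda>f. 0)"
proof -
  obtain v w where vw: "v \<in> tangent A p" "w \<in> tangent A p" "u = (\<lambda>f. v f + \<i> * w f)"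
    by (rule ctangent_split[OF u])
  have vw': "v \<in> ctangent A p" "w \<in> ctangent A p" using vw tangent_subset by blast+
  have "e i p [v] = 0 \<and> e i p [w] = 0" if i: "i \<in> {1..n}" for i
  proof -
    have "e i p [v] + \<i> * e i p [w] = 0"
      using alt1_lin[OF e_alt[OF i] vw', of \<i>] z[OF i] vw(3) by simp
    moreover have "e i p [v] \<in> \<real>" "e i p [w] \<in> \<real>" using e_real[OF i] vw by auto
    ultimately show ?thesis by (auto simp: complex_is_Real_iff complex_eq_iff)
  qed
  then have "v = (\<lambda>f. 0)" "w = (\<lambda>f. 0)" using e_nondegenerate_real vw by blast+
  then show ?thesis using vw(3) by simp
qed

text \<open>After matching the \<open>n\<close> basis vectors of the model space with
  \<open>{1..n}\<close>, the values of the \<open>e i\<close> at the unit become a linear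
  endomorphism \<open>T\<close> of that space. It is injective by nondegeneracy, hence surjective,
  and a preimage of a basis vector is the dual vector.\<close>

lemma dual_exists:
  assumes i: "i \<in> {1..n}"
  shows "\<exists>v. v \<in> tangent A one \<and> (\<forall>j\<in>{1..n}. e j one [v] = (if i = j then 1 else 0))"
proof -
  obtain c where c: "c \<in> A" "one \<in> fst c" by (rule chart_at)
  have "card (Basis :: 'e set) = card {1..n}" using n_DIM by simp
  then obtain h where h: "bij_betw h (Basis :: 'e set) {1..n}"
    using finite_same_card_bij[OF finite_Basis] by blast
  have cv: "chart_vec A c one v \<in> tangent A one" "chart_vec A c one v \<in> ctangent A one" for v
    using chart_vec_tangent[OF c] tangent_subset by blast+
  have hin: "h b \<in> {1..n}" if "b \<in> Basis" for b using h that bij_betwE by blast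
  define T where "T v = (\<Sum>b\<in>Basis. Re (e (h b) one [chart_vec A c one v]) *\<^sub>R b)" for v :: 'e
  have Tb: "T v \<bullet> b = Re (e (h b) one [chart_vec A c one v])" if "b \<in> Basis" for v b
    unfolding T_def using that by (simp add: inner_sum_left_Basis)
  have lin: "e j one [chart_vec A c one (v + r *\<^sub>R w)] = e j one [chart_vec A c one v] + complex_of_real r * e j one [chart_vec A c one w]"
    if "j \<in> {1..n}" for j v w r
  proof -
    have "chart_vec A c one (v + r *\<^sub>R w) = (\<lambda>f. chart_vec A c one v f + complex_of_real r * chart_vec A c one w f)"
      by (rule ext) (simp add: chart_vec_linear[OF c])
    then show ?thesis using alt1_lin[OF e_alt[OF that] cv(2) cv(2)] by simp
  qed
  have "linear T"
  proof (rule linearI)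
    fix v w :: 'e and r :: real
    show "T (v + w) = T v + T w"
    proof (rule euclidean_eqI)
      fix b :: 'e assume b: "b \<in> Basis"
      show "T (v + w) \<bullet> b = (T v + T w) \<bullet> b"
        unfolding inner_add_left Tb[OF b] using lin[OF hin[OF b], of v 1 w] by simp
    qed
    show "T (r *\<^sub>R v) = r *\<^sub>R T v"
    proof (rule euclidean_eqI)
      fix b :: 'e assume b: "b \<in> Basis"
      show "T (r *\<^sub>R v) \<bullet> b = (r *\<^sub>R T v) \<bullet> b"
        unfolding inner_scaleR_left Tb[OF b] using lin[OF hin[OF b], of 0 r v] lin[OF hin[OF b], of 0 1 0] by simp
    qed
  qed
  moreover have "v = 0" if "T v = 0" for v
  proof -
    have "e j one [chart_vec A c one v] = 0" if j: "j \<in> {1..n}" for j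
    proof -
      obtain b where b: "b \<in> Basis" "h b = j" using h j by (metis bij_betw_iff_bijections)
      have "Re (e j one [chart_vec A c one v]) = 0" using Tb[OF b(1), of v] b \<open>T v = 0\<close> by simp
      then show ?thesis using e_real[OF j cv(1)] by (auto simp: complex_is_Real_iff complex_eq_iff)
    qed
    then have "chart_vec A c one v = (\<lambda>f. 0)" by (rule e_nondegenerate_real[OF cv(1)])
    then have z: "chart_vec A c one v (coord c b) = 0" for b by simp
    show "v = 0"
    proof (rule euclidean_eqI)
      fix b :: 'e
      show "v \<bullet> b = 0 \<bullet> b" using z[of b] chart_vec_coord[OF c, of v b] by simp
    qed
  qed
  ultimately have "inj T" using linear_injective_0 by blast
  then have "surj T" using linear_injective_imp_surjective[OF \<open>linear T\<close>] by blast
  obtain b where b: "b \<in> Basis" "h b = i" using h i by (metis bij_betw_iff_bijections)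
  obtain v where v: "T v = b" using \<open>surj T\<close> by (metis surjD)
  have "e j one [chart_vec A c one v] = (if i = j then 1 else 0)" if j: "j \<in> {1..n}" for j
  proof -
    obtain b' where b': "b' \<in> Basis" "h b' = j" using h j by (metis bij_betw_iff_bijections)
    have "i = j \<longleftrightarrow> b = b'" using b b' h by (metis bij_betw_iff_bijections)
    moreover have "Re (e j one [chart_vec A c one v]) = b \<bullet> b'" using Tb[OF b'(1), of v] b' v by simp
    ultimately show ?thesis using e_real[OF j cv(1)] b b'
      by (auto simp: complex_is_Real_iff complex_eq_iff inner_Basis)
  qed
  then show ?thesis using cv(1) by blast
qed

definition E :: "nat \<Rightarrow> 'g vfield" where
  "E i = left_field (SOME v. v \<in> tangent A one \<and> (\<forall>j\<in>{1..n}. e j one [v] = (if i = j then 1 else 0)))"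

lemma E_facts:
  assumes "i \<in> {1..n}"
  shows E_smooth: "smooth_vfield A (E i)" and E_tangent: "E i p \<in> tangent A p"
    and E_left: "left_inv (E i)" and E_ct: "E i p \<in> ctangent A p"
    and E_dual: "\<And>j. j \<in> {1..n} \<Longrightarrow> e j p [E i p] = (if i = j then 1 else 0)"
proof -
  define v where "v = (SOME v. v \<in> tangent A one \<and> (\<forall>j\<in>{1..n}. e j one [v] = (if i = j then 1 else 0)))"
  have v: "v \<in> tangent A one" "\<And>j. j \<in> {1..n} \<Longrightarrow> e j one [v] = (if i = j then 1 else 0)"
    using someI_ex[OF dual_exists[OF assms]] unfolding v_def by blast+
  have vc: "v \<in> ctangent A one" using v tangent_subset by blast
  have Ei: "E i = left_field v" by (simp add: E_def v_def)
  show "smooth_vfield A (E i)" "E i p \<in> tangent A p" "left_inv (E i)" "E i p \<in> ctangent A p"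
    unfolding Ei using left_field_smooth[OF vc] left_field_tangent[OF v(1)] left_field_left_inv[OF vc] left_field_ct[OF vc] by auto
  show "e j p [E i p] = (if i = j then 1 else 0)" if j: "j \<in> {1..n}" for j
    using left_inv_form_apply[OF e_left[OF j] vc, of p] v(2)[OF j] by (simp add: Ei left_field_def mul_one)
qed

lemma E_expand:
  assumes u: "u \<in> ctangent A p"
  shows "u f = (\<Sum>i=1..n. e i p [u] * E i p f)"
proof -
  let ?s = "\<lambda>f. \<Sum>i=1..n. e i p [u] * E i p f"
  have s: "?s \<in> ctangent A p" by (rule ctangent_sum) (rule E_ct)
  have "(\<lambda>f. u f + (-1) * ?s f) = (\<lambda>f. 0)"
  proof (rule e_nondegenerate[OF ctangent_lin[OF u s]])
    fix j assume j: "j \<in> {1..n}"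
    have "e j p [?s] = (\<Sum>i=1..n. e i p [u] * e j p [E i p])" by (rule alt1_sum[OF e_alt[OF j] E_ct])
    also have "\<dots> = (\<Sum>i=1..n. if i = j then e i p [u] else 0)"
      by (rule sum.cong) (auto simp: E_dual[OF _ j])
    also have "\<dots> = e j p [u]" using j by simp
    finally show "e j p [\<lambda>f. u f + (-1) * ?s f] = 0" using alt1_lin[OF e_alt[OF j] u s, of "-1"] by simp
  qed
  from fun_cong[OF this, of f] show ?thesis by simp
qed

definition C :: "nat \<Rightarrow> nat \<Rightarrow> nat \<Rightarrow> complex" where
  "C i j k = e k one [bracket A (E i) (E j) one]"

text \<open>Both the form and the bracket are left invariant, so the coefficient at the unit is the
  coefficient everywhere.\<close>

lemma bracket_E_coeff:
  assumes "i \<in> {1..n}" "j \<in> {1..n}" "k \<in> {1..n}"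
  shows "e k p [bracket A (E i) (E j) p] = C i j k"
proof -
  have "left_inv (bracket A (E i) (E j))" using assms by (intro left_inv_bracket E_smooth E_left)
  then have "bracket A (E i) (E j) (p \<odot> one) = push_forward A (\<lambda>y. p \<odot> y) one (bracket A (E i) (E j) one)"
    unfolding left_inv_def by blast
  then show ?thesis unfolding C_def
    using left_inv_form_apply[OF e_left[OF assms(3)] bracket_ct[OF E_smooth[OF assms(1)] E_smooth[OF assms(2)]], of one p]
    by (simp add: mul_one)
qed

lemma C_real: "i \<in> {1..n} \<Longrightarrow> j \<in> {1..n} \<Longrightarrow> k \<in> {1..n} \<Longrightarrow> C i j k \<in> \<real>"
  unfolding C_def by (rule e_real) (auto intro!: bracket_tangent E_smooth E_tangent)

section \<open>The Lie algebra and the trace of the adjoint representation\<close>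

abbreviation LA :: "'g vfield set" where "LA \<equiv> lie_algebra A G"

lemma LA_iff: "X \<in> LA \<longleftrightarrow> smooth_vfield A X \<and> (\<forall>p. X p \<in> tangent A p) \<and> left_inv X"
  by (simp add: lie_algebra_def left_inv_def)

lemma E_LA: "i \<in> {1..n} \<Longrightarrow> E i \<in> LA"
  unfolding LA_iff using E_smooth E_tangent E_left by blast

lemma bracket_LA: "X \<in> LA \<Longrightarrow> Y \<in> LA \<Longrightarrow> bracket A X Y \<in> LA"
  unfolding LA_iff using bracket_smooth bracket_tangent left_inv_bracket by blast

definition E_coeff :: "nat \<Rightarrow> 'g vfield \<Rightarrow> real" where
  "E_coeff i X = Re (e i one [X one])"

lemma LA_expand:
  assumes X: "X \<in> LA"
  shows "X = (\<lambda>p f. \<Sum>i=1..n. complex_of_real (E_coeff i X) * E i p f)"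
proof (intro ext)
  fix p f
  have Xt: "X p \<in> tangent A p" "X p \<in> ctangent A p" for p
    using X tangent_subset unfolding LA_iff by blast+
  have "e i p [X p] = complex_of_real (E_coeff i X)" if i: "i \<in> {1..n}" for i
  proof -
    have "X (p \<odot> one) = push_forward A (\<lambda>y. p \<odot> y) one (X one)" using X unfolding LA_iff left_inv_def by blast
    then have "e i p [X p] = e i one [X one]"
      using left_inv_form_apply[OF e_left[OF i] Xt(2), of one p] by (simp add: mul_one)
    then show ?thesis unfolding E_coeff_def using e_real[OF i Xt(1)] by simp
  qed
  then show "X p f = (\<Sum>i=1..n. complex_of_real (E_coeff i X) * E i p f)"
    unfolding E_expand[OF Xt(2), of p f] by simp
qed

lemma real_fun_sum: "(\<Sum>i\<in>I. fun_scale (k i) (X i)) = (\<lambda>p f. \<Sum>i\<in>I. k i * X i p f)"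
  by (induction I rule: infinite_finite_induct) (auto simp: fun_scale_def fun_eq_iff)

lemma LA_expand': "X \<in> LA \<Longrightarrow> X = (\<Sum>i=1..n. fun_scale (complex_of_real (E_coeff i X)) (E i))"
  unfolding real_fun_sum by (rule LA_expand)

lemma LA_subspace: "real_fun.subspace LA"
proof (rule real_fun.subspaceI)
  have s: "(\<lambda>p f. X p f + complex_of_real k * Y p f) \<in> LA" if X: "X \<in> LA" and Y: "Y \<in> LA" for X Y k
  proof -
    have X': "smooth_vfield A X" "\<And>p. X p \<in> tangent A p" "left_inv X" using X LA_iff by blast+
    have Y': "smooth_vfield A Y" "\<And>p. Y p \<in> tangent A p" "left_inv Y" using Y LA_iff by blast+
    have "smooth_vfield A (\<lambda>p f. \<Sum>i\<in>{True, False}. (if i then 1 else complex_of_real k) * (if i then X else Y) p f)"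
      by (rule vfield_sum) (use X' Y' smooth_at_const in auto)
    then have "smooth_vfield A (\<lambda>p f. X p f + complex_of_real k * Y p f)" by simp
    moreover have "(\<lambda>f. X p f + complex_of_real k * Y p f) \<in> tangent A p" for p
      by (rule tangent_lin) (use X' Y' in auto)
    moreover have "left_inv (\<lambda>p f. X p f + complex_of_real k * Y p f)"
      using X'(3) Y'(3) unfolding left_inv_def by (simp add: AA.push_lin)
    ultimately show ?thesis unfolding LA_iff by blast
  qed
  have z: "(\<lambda>p f. 0) \<in> LA"
  proof -
    have "smooth_vfield A (\<lambda>p f. 0)" unfolding smooth_vfield_def smooth_near_iff using ctangent_zero smooth_at_const by blast
    moreover have "left_inv (\<lambda>p f. 0)" unfolding left_inv_def by (auto simp: push_forward_def)
    ultimately show ?thesis unfolding LA_iff using tangent_zero by blast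
  qed
  then show "0 \<in> LA" by (simp add: zero_fun_def)
  show "X + Y \<in> LA" if "X \<in> LA" "Y \<in> LA" for X Y
    using s[OF that, of 1] by (simp add: plus_fun_def)
  show "fun_scale (complex_of_real k) X \<in> LA" if "X \<in> LA" for k X
    using s[OF z that, of k] by (simp add: fun_scale_def)
qed

lemma E_span: "real_fun.span (E ` {1..n}) = LA"
proof
  show "real_fun.span (E ` {1..n}) \<subseteq> LA"
    by (rule real_fun.span_minimal[OF _ LA_subspace]) (use E_LA in blast)
  show "LA \<subseteq> real_fun.span (E ` {1..n})"
  proof
    fix X assume "X \<in> LA"
    then show "X \<in> real_fun.span (E ` {1..n})"
      by (subst LA_expand', assumption)
        (rule real_fun.span_sum, rule real_fun.span_scale, rule real_fun.span_base, rule imageI)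
  qed
qed

lemma E_coeff_sum:
  assumes "\<And>b. b \<in> B \<Longrightarrow> X b \<in> LA" "i \<in> {1..n}"
  shows "E_coeff i (\<Sum>b\<in>B. fun_scale (complex_of_real (r b)) (X b)) = (\<Sum>b\<in>B. r b * E_coeff i (X b))"
proof -
  have "e i one [\<lambda>f. \<Sum>b\<in>B. complex_of_real (r b) * X b one f] = (\<Sum>b\<in>B. complex_of_real (r b) * e i one [X b one])"
    by (rule alt1_sum[OF e_alt[OF assms(2)]]) (use assms(1) tangent_subset in \<open>auto simp: LA_iff\<close>)
  then show ?thesis unfolding E_coeff_def real_fun_sum by simp
qed

text \<open>The trace is defined by an unspecified basis \<open>B\<close>. Expanding
  \<open>T b\<close> through the frame and each \<open>T (E i)\<close> through \<open>B\<close>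
  gives a double sum; read in the other order it is the sum of the diagonal coefficients in the
  frame.\<close>

lemma real_trace_LA:
  assumes T: "\<And>X. X \<in> LA \<Longrightarrow> T X \<in> LA"
    and lin: "\<And>X. X \<in> LA \<Longrightarrow> T X = (\<Sum>i=1..n. fun_scale (complex_of_real (E_coeff i X)) (T (E i)))"
  shows "real_trace LA T = (\<Sum>i=1..n. E_coeff i (T (E i)))"
proof -
  let ?P = "\<lambda>B. real_fun.independent B \<and> real_fun.span B = LA"
  define B where "B = (SOME B. ?P B)"
  obtain B0 where "B0 \<subseteq> LA" "real_fun.independent B0" "real_fun.span B0 = LA"
    using real_fun.basis_exists[of LA] real_fun.span_eq_iff LA_subspace
    by (metis real_fun.span_minimal real_fun.span_mono subset_antisym)
  then have "\<exists>B. ?P B" by blast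
  then have ind: "real_fun.independent B" and sp: "real_fun.span B = LA"
    unfolding B_def using someI_ex[of ?P] by blast+
  have BLA: "b \<in> LA" if "b \<in> B" for b using sp real_fun.span_base that by blast
  have finB: "finite B"
    using real_fun.independent_span_bound[of "E ` {1..n}" B] ind BLA E_span by blast
  let ?r = "real_fun.representation B"
  have TE: "T (E i) \<in> LA" if "i \<in> {1..n}" for i by (rule T[OF E_LA[OF that]])
  have rep: "?r (T b) b = (\<Sum>i=1..n. E_coeff i b * ?r (T (E i)) b)" if "b \<in> B" for b
  proof -
    have "?r (T b) = ?r (\<Sum>i=1..n. fun_scale (complex_of_real (E_coeff i b)) (T (E i)))"
      using lin[OF BLA[OF that]] by simp
    also have "\<dots> = (\<lambda>b'. \<Sum>i=1..n. ?r (fun_scale (complex_of_real (E_coeff i b)) (T (E i))) b')"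
      by (rule real_fun.representation_sum[OF ind]) (use TE sp LA_subspace real_fun.subspace_scale in blast)
    finally show ?thesis using TE sp by (simp add: real_fun.representation_scale[OF ind])
  qed
  have "real_trace LA T = (\<Sum>b\<in>B. \<Sum>i=1..n. E_coeff i b * ?r (T (E i)) b)"
    unfolding real_trace_def B_def[symmetric] Let_def using rep by simp
  also have "\<dots> = (\<Sum>i=1..n. \<Sum>b\<in>B. ?r (T (E i)) b * E_coeff i b)"
    by (subst sum.swap) (simp add: mult.commute)
  also have "\<dots> = (\<Sum>i=1..n. E_coeff i (T (E i)))"
  proof (rule sum.cong[OF refl])
    fix i assume i: "i \<in> {1..n}"
    have "(\<Sum>b\<in>B. fun_scale (complex_of_real (?r (T (E i)) b)) b) = T (E i)"
      by (rule real_fun.sum_representation_eq[OF ind _ finB]) (use TE[OF i] sp in auto)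
    then show "(\<Sum>b\<in>B. ?r (T (E i)) b * E_coeff i b) = E_coeff i (T (E i))"
      using E_coeff_sum[of B "\<lambda>b. b" i "?r (T (E i))"] BLA i by simp
  qed
  finally show ?thesis .
qed

lemma E_coeff_bracket: "i \<in> {1..n} \<Longrightarrow> k \<in> {1..n} \<Longrightarrow> complex_of_real (E_coeff i (bracket A (E k) (E i))) = C k i i"
  unfolding E_coeff_def C_def[symmetric] using C_real[of k i i] by simp

text \<open>The trace of \<open>ad Y\<close> is linear in \<open>Y\<close>, so it is enough to test
  the frame vectors.\<close>

lemma unimodular_iff: "unimodular A G \<longleftrightarrow> (\<forall>k\<in>{1..n}. (\<Sum>i=1..n. C k i i) = 0)"
proof -
  have tr: "real_trace LA (bracket A Y) = (\<Sum>i=1..n. E_coeff i (bracket A Y (E i)))" if Y: "Y \<in> LA" for Y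
  proof (rule real_trace_LA)
    show "bracket A Y X \<in> LA" if "X \<in> LA" for X by (rule bracket_LA[OF Y that])
    show "bracket A Y X = (\<Sum>i=1..n. fun_scale (complex_of_real (E_coeff i X)) (bracket A Y (E i)))" if "X \<in> LA" for X
      unfolding real_fun_sum
      by (subst LA_expand[OF that], intro ext, rule bracket_sum_right) (use Y E_smooth LA_iff in auto)
  qed
  have trE: "complex_of_real (real_trace LA (bracket A (E k))) = (\<Sum>i=1..n. C k i i)" if "k \<in> {1..n}" for k
    unfolding tr[OF E_LA[OF that]] using that by (simp add: E_coeff_bracket)
  show ?thesis
  proof
    assume "unimodular A G"
    then show "\<forall>k\<in>{1..n}. (\<Sum>i=1..n. C k i i) = 0"
      unfolding unimodular_def using trE E_LA by (metis of_real_0)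
  next
    assume z: "\<forall>k\<in>{1..n}. (\<Sum>i=1..n. C k i i) = 0"
    have "real_trace LA (bracket A Y) = 0" if Y: "Y \<in> LA" for Y
    proof -
      have b: "bracket A Y (E i) = (\<Sum>k=1..n. fun_scale (complex_of_real (E_coeff k Y)) (bracket A (E k) (E i)))"
        if "i \<in> {1..n}" for i
        unfolding real_fun_sum
        by (subst LA_expand[OF Y], intro ext, rule bracket_sum_left) (use that E_smooth in auto)
      have "E_coeff i (bracket A Y (E i)) = (\<Sum>k=1..n. E_coeff k Y * E_coeff i (bracket A (E k) (E i)))" if "i \<in> {1..n}" for i
        unfolding b[OF that] by (rule E_coeff_sum) (use that E_LA bracket_LA in auto)
      then have "real_trace LA (bracket A Y) = (\<Sum>i=1..n. \<Sum>k=1..n. E_coeff k Y * E_coeff i (bracket A (E k) (E i)))"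
        unfolding tr[OF Y] by simp
      also have "\<dots> = (\<Sum>k=1..n. E_coeff k Y * (\<Sum>i=1..n. E_coeff i (bracket A (E k) (E i))))"
        by (subst sum.swap) (simp add: sum_distrib_left)
      also have "\<dots> = (\<Sum>k=1..n. E_coeff k Y * real_trace LA (bracket A (E k)))"
        by (rule sum.cong) (simp_all add: tr[OF E_LA])
      also have "\<dots> = 0"
      proof (rule sum.neutral, rule ballI)
        fix k assume k: "k \<in> {1..n}"
        then have "complex_of_real (real_trace LA (bracket A (E k))) = 0" using trE z by simp
        then show "E_coeff k Y * real_trace LA (bracket A (E k)) = 0" by simp
      qed
      finally show ?thesis .
    qed
    then show "unimodular A G" unfolding unimodular_def by blast
  qed
qed

end

section \<open>Invariant frames on the product\<close>

context smooth_manifold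
begin

lemma alt1I:
  assumes "\<And>u v k. u \<in> ctangent A p \<Longrightarrow> v \<in> ctangent A p \<Longrightarrow> g (\<lambda>f. u f + k * v f) = g u + k * g v"
  shows "(\<lambda>vs. if vs \<in> tvecs A 1 p then g (hd vs) else 0) \<in> alt_forms A 1 p"
  by (auto simp: alt_forms_def tvecs_def length_Suc_conv ctangent_lin assms)

text \<open>Real vectors take real values on coordinate functions, so real and imaginary parts can
  be compared there. Used to read off \<open>J\<close> on real vectors from one complex
  equation.\<close>

lemma tangent_complex_unique:
  assumes "u \<in> tangent A p" "v \<in> tangent A p" "u' \<in> tangent A p" "v' \<in> tangent A p"
    and eq: "\<And>f. u f + \<i> * v f = u' f + \<i> * v' f"
  shows "u = u' \<and> v = v'"
proof -
  obtain c where c: "c \<in> A" "p \<in> fst c" by (rule chart_at)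
  have r: "w (coord c b) \<in> \<real>" if "w \<in> tangent A p" for w b
    by (rule ctangent_real[OF that]) (simp add: coord_def)
  have "u (coord c b) = u' (coord c b) \<and> v (coord c b) = v' (coord c b)" for b
    using r[OF assms(1), of b] r[OF assms(2), of b] r[OF assms(3), of b] r[OF assms(4), of b] eq[of "coord c b"]
    by (auto simp: complex_is_Real_iff complex_eq_iff)
  moreover have "u \<in> ctangent A p" "v \<in> ctangent A p" "u' \<in> ctangent A p" "v' \<in> ctangent A p"
    using assms(1-4) tangent_subset by blast+
  ultimately show ?thesis using ctangent_eqI[OF c] by metis
qed

end

context lie_grp
begin

definition lift1 :: "'g vfield \<Rightarrow> ('g \<times> 'g) vfield" where
  "lift1 X z = push_forward M (\<lambda>x. (x, snd z)) (fst z) (X (fst z))"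

definition lift2 :: "'g vfield \<Rightarrow> ('g \<times> 'g) vfield" where
  "lift2 X z = push_forward M (\<lambda>y. (fst z, y)) (snd z) (X (snd z))"

lemma lift_apply:
  assumes "smooth_at M z f"
  shows "lift1 X z f = X (fst z) (\<lambda>x. f (x, snd z))" "lift2 X z f = X (snd z) (\<lambda>y. f (fst z, y))"
  unfolding lift1_def lift2_def
  using AM.push_apply[of "\<lambda>x. (x, snd z)" "fst z" f] AM.push_apply[of "\<lambda>y. (fst z, y)" "snd z" f] assms by simp_all

lemma lift_ct: "X (fst z) \<in> ctangent A (fst z) \<Longrightarrow> lift1 X z \<in> ctangent M z"
    "X (snd z) \<in> ctangent A (snd z) \<Longrightarrow> lift2 X z \<in> ctangent M z"
  unfolding lift1_def lift2_def
  using AM.push_ct[OF AA.smooth_map_at_slice(1)[of "fst z" "snd z"]] AM.push_ct[OF AA.smooth_map_at_slice(2)[of "snd z" "fst z"]]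
  by auto

lemma lift_tangent: "X (fst z) \<in> tangent A (fst z) \<Longrightarrow> lift1 X z \<in> tangent M z"
    "X (snd z) \<in> tangent A (snd z) \<Longrightarrow> lift2 X z \<in> tangent M z"
  unfolding lift1_def lift2_def
  using AM.push_tangent[OF AA.smooth_map_at_slice(1)[of "fst z" "snd z"]] AM.push_tangent[OF AA.smooth_map_at_slice(2)[of "snd z" "fst z"]]
  by auto

lemma smooth_at_slice: "smooth_at M z f \<Longrightarrow> smooth_at A (fst z) (\<lambda>x. f (x, snd z))" "smooth_at M z f \<Longrightarrow> smooth_at A (snd z) (\<lambda>y. f (fst z, y))"
  using AM.smooth_at_comp[OF AA.smooth_map_at_slice(1)[of "fst z" "snd z"]] AM.smooth_at_comp[OF AA.smooth_map_at_slice(2)[of "snd z" "fst z"]]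
  by auto

lemma lift_fst_snd:
  assumes X: "smooth_vfield A X"
  shows "smooth_at A (fst z) h \<Longrightarrow> lift1 X z (\<lambda>w. h (fst w)) = X (fst z) h"
    and "smooth_at A (snd z) h \<Longrightarrow> lift1 X z (\<lambda>w. h (snd w)) = 0"
    and "smooth_at A (fst z) h \<Longrightarrow> lift2 X z (\<lambda>w. h (fst w)) = 0"
    and "smooth_at A (snd z) h \<Longrightarrow> lift2 X z (\<lambda>w. h (snd w)) = X (snd z) h"
  using lift_apply[OF MA.smooth_at_comp[OF AA.smooth_map_at_fst]] lift_apply[OF MA.smooth_at_comp[OF AA.smooth_map_at_snd]] ctangent_const[OF vfield_ct[OF X]]
  by auto

lemma prod_chart_at:
  obtains c d where "c \<in> A" "d \<in> A" "fst z \<in> fst c" "snd z \<in> fst d" "prod_chart c d \<in> M" "z \<in> fst (prod_chart c d)"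
proof -
  obtain c where c: "c \<in> A" "fst z \<in> fst c" by (rule chart_at)
  obtain d where d: "d \<in> A" "snd z \<in> fst d" by (rule chart_at)
  show ?thesis using that[OF c(1) d(1) c(2) d(2)] prod_chart_in[OF c(1) d(1)] c d by (simp add: mem_Times_iff)
qed

lemma Basis_prod_cases:
  assumes "b \<in> (Basis :: ('e \<times> 'e) set)"
  obtains b1 where "b1 \<in> Basis" "b = (b1, 0)" | b2 where "b2 \<in> Basis" "b = (0, b2)"
  using assms unfolding Basis_prod_def by blast

lemma lift_smooth:
  assumes X: "smooth_vfield A X"
  shows "smooth_vfield M (lift1 X)" "smooth_vfield M (lift2 X)"
proof -
  have *: "\<exists>c\<in>M. z \<in> fst c \<and> (\<forall>b\<in>Basis. smooth_at M z (\<lambda>q. lift1 X q (coord c b)) \<and> smooth_at M z (\<lambda>q. lift2 X q (coord c b)))" for z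
  proof -
    obtain c d where cd: "c \<in> A" "d \<in> A" "fst z \<in> fst c" "snd z \<in> fst d" "prod_chart c d \<in> M" "z \<in> fst (prod_chart c d)"
      by (rule prod_chart_at)
    note ev = AA.P.chart_eventually[OF cd(5,6)]
    have "smooth_at M z (\<lambda>q. lift1 X q (coord (prod_chart c d) b)) \<and> smooth_at M z (\<lambda>q. lift2 X q (coord (prod_chart c d) b))"
      if "b \<in> Basis" for b
      using that
    proof (cases rule: Basis_prod_cases)
      case (1 b1)
      have "smooth_at M z (\<lambda>q. X (fst q) (coord c b1))"
        by (rule MA.smooth_at_comp[OF AA.smooth_map_at_fst vfield_sm[OF X smooth_at_coord[OF cd(1,3)]]])
      note s = this
      have "\<forall>\<^sub>F q in nhds z. X (fst q) (coord c b1) = lift1 X q (\<lambda>w. coord c b1 (fst w))"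
        "\<forall>\<^sub>F q in nhds z. 0 = lift2 X q (\<lambda>w. coord c b1 (fst w))"
        using ev by (eventually_elim, use smooth_at_coord[OF cd(1)] lift_fst_snd[OF X] in auto)+
      from AA.P.smooth_at_cong[OF s this(1)] AA.P.smooth_at_cong[OF AA.P.smooth_at_const this(2)]
      show ?thesis unfolding 1 coord_prod_chart by (rule conjI)
    next
      case (2 b2)
      have "smooth_at M z (\<lambda>q. X (snd q) (coord d b2))"
        by (rule MA.smooth_at_comp[OF AA.smooth_map_at_snd vfield_sm[OF X smooth_at_coord[OF cd(2,4)]]])
      note s = this
      have "\<forall>\<^sub>F q in nhds z. X (snd q) (coord d b2) = lift2 X q (\<lambda>w. coord d b2 (snd w))"
        "\<forall>\<^sub>F q in nhds z. 0 = lift1 X q (\<lambda>w. coord d b2 (snd w))"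
        using ev by (eventually_elim, use smooth_at_coord[OF cd(2)] lift_fst_snd[OF X] in auto)+
      from AA.P.smooth_at_cong[OF AA.P.smooth_at_const this(2)] AA.P.smooth_at_cong[OF s this(1)]
      show ?thesis unfolding 2 coord_prod_chart by (rule conjI)
    qed
    then show ?thesis using cd(5,6) by blast
  qed
  show "smooth_vfield M (lift1 X)" "smooth_vfield M (lift2 X)"
    by (rule AA.P.smooth_vfieldI, rule lift_ct, rule vfield_ct[OF X], use * in blast)+
qed

text \<open>Every coordinate function of a product chart is pulled back from one of the two
  factors.\<close>

lemma M_eqI:
  assumes u: "u \<in> ctangent M z" "v \<in> ctangent M z"
    and "\<And>h. smooth_at A (fst z) h \<Longrightarrow> u (\<lambda>w. h (fst w)) = v (\<lambda>w. h (fst w))"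
    and "\<And>h. smooth_at A (snd z) h \<Longrightarrow> u (\<lambda>w. h (snd w)) = v (\<lambda>w. h (snd w))"
  shows "u = v"
proof -
  obtain c d where cd: "c \<in> A" "d \<in> A" "fst z \<in> fst c" "snd z \<in> fst d" "prod_chart c d \<in> M" "z \<in> fst (prod_chart c d)"
    by (rule prod_chart_at)
  show ?thesis
  proof (rule AA.P.ctangent_eqI[OF cd(5,6) u])
    fix b :: "'e \<times> 'e" assume "b \<in> Basis"
    then show "u (coord (prod_chart c d) b) = v (coord (prod_chart c d) b)"
    proof (cases rule: Basis_prod_cases)
      case (1 b1)
      show ?thesis unfolding 1 coord_prod_chart by (rule assms(3)[OF smooth_at_coord[OF cd(1,3)]])
    next
      case (2 b2)
      show ?thesis unfolding 2 coord_prod_chart by (rule assms(4)[OF smooth_at_coord[OF cd(2,4)]])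
    qed
  qed
qed

lemma smooth_at_fst_snd: "smooth_at A (fst z) h \<Longrightarrow> smooth_at M z (\<lambda>w. h (fst w))" "smooth_at A (snd z) h \<Longrightarrow> smooth_at M z (\<lambda>w. h (snd w))"
  by (rule MA.smooth_at_comp[OF AA.smooth_map_at_fst], assumption) (rule MA.smooth_at_comp[OF AA.smooth_map_at_snd])

lemma smooth_at_fst_snd_eventually:
  "smooth_at A (fst z) h \<Longrightarrow> \<forall>\<^sub>F w in nhds z. smooth_at A (fst w) h" "smooth_at A (snd z) h \<Longrightarrow> \<forall>\<^sub>F w in nhds z. smooth_at A (snd w) h"
  by (erule eventually_compose_filterlim[OF smooth_at_eventually MA.smooth_map_at_tendsto[OF AA.smooth_map_at_fst]],
      erule eventually_compose_filterlim[OF smooth_at_eventually MA.smooth_map_at_tendsto[OF AA.smooth_map_at_snd]])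

text \<open>On a function of one factor, one lift is zero and the other yields a function of the
  same factor, so both composites vanish.\<close>

lemma bracket_lift12:
  assumes X: "smooth_vfield A X" and Y: "smooth_vfield A Y"
  shows "bracket M (lift1 X) (lift2 Y) z = (\<lambda>f. 0)"
proof (rule M_eqI[OF AA.P.bracket_ct[OF lift_smooth(1)[OF X] lift_smooth(2)[OF Y]] AA.P.ctangent_zero])
  note X' = AA.P.vfield_ct[OF lift_smooth(1)[OF X]] and Y' = AA.P.vfield_ct[OF lift_smooth(2)[OF Y]]
  fix h :: "'g \<Rightarrow> complex"
  show "bracket M (lift1 X) (lift2 Y) z (\<lambda>w. h (fst w)) = 0" if h: "smooth_at A (fst z) h"
  proof -
    have "lift1 X z (\<lambda>w. lift2 Y w (\<lambda>w. h (fst w))) = lift1 X z (\<lambda>w. 0)"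
      by (rule AA.P.ctangent_cong[OF X'], use smooth_at_fst_snd_eventually(1)[OF h] in eventually_elim)
        (rule lift_fst_snd(3)[OF Y])
    moreover have "lift2 Y z (\<lambda>w. lift1 X w (\<lambda>w. h (fst w))) = lift2 Y z (\<lambda>w. X (fst w) h)"
      by (rule AA.P.ctangent_cong[OF Y'], use smooth_at_fst_snd_eventually(1)[OF h] in eventually_elim)
        (rule lift_fst_snd(1)[OF X])
    ultimately show ?thesis
      by (simp add: AA.P.bracket_apply smooth_at_fst_snd(1)[OF h] AA.P.ctangent_const[OF X'] lift_fst_snd(3)[OF Y vfield_sm[OF X h]])
  qed
  show "bracket M (lift1 X) (lift2 Y) z (\<lambda>w. h (snd w)) = 0" if h: "smooth_at A (snd z) h"
  proof -
    have "lift1 X z (\<lambda>w. lift2 Y w (\<lambda>w. h (snd w))) = lift1 X z (\<lambda>w. Y (snd w) h)"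
      by (rule AA.P.ctangent_cong[OF X'], use smooth_at_fst_snd_eventually(2)[OF h] in eventually_elim)
        (rule lift_fst_snd(4)[OF Y])
    moreover have "lift2 Y z (\<lambda>w. lift1 X w (\<lambda>w. h (snd w))) = lift2 Y z (\<lambda>w. 0)"
      by (rule AA.P.ctangent_cong[OF Y'], use smooth_at_fst_snd_eventually(2)[OF h] in eventually_elim)
        (rule lift_fst_snd(2)[OF X])
    ultimately show ?thesis
      by (simp add: AA.P.bracket_apply smooth_at_fst_snd(2)[OF h] AA.P.ctangent_const[OF Y'] lift_fst_snd(2)[OF X vfield_sm[OF Y h]])
  qed
qed

lemma bracket_lift:
  assumes X: "smooth_vfield A X" and Y: "smooth_vfield A Y"
  shows "bracket M (lift1 X) (lift1 Y) z = lift1 (bracket A X Y) z" (is ?t1)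
    and "bracket M (lift2 X) (lift2 Y) z = lift2 (bracket A X Y) z" (is ?t2)
proof -
  note XY = bracket_smooth[OF X Y]
  show ?t1
  proof (rule M_eqI)
    show "bracket M (lift1 X) (lift1 Y) z \<in> ctangent M z" "lift1 (bracket A X Y) z \<in> ctangent M z"
      by (intro AA.P.bracket_ct lift_smooth X Y lift_ct vfield_ct XY)+
    fix h :: "'g \<Rightarrow> complex"
    have 1: "lift1 X z (\<lambda>w. lift1 Y w (\<lambda>w. h (fst w))) = X (fst z) (\<lambda>w. Y w h)"
      if h: "smooth_at A (fst z) h" and X: "smooth_vfield A X" and Y: "smooth_vfield A Y" for X Y
    proof -
      have "lift1 X z (\<lambda>w. lift1 Y w (\<lambda>w. h (fst w))) = lift1 X z (\<lambda>w. Y (fst w) h)"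
        by (rule AA.P.ctangent_cong[OF AA.P.vfield_ct[OF lift_smooth(1)[OF X]]], use smooth_at_fst_snd_eventually(1)[OF h] in eventually_elim)
          (rule lift_fst_snd(1)[OF Y])
      then show ?thesis using lift_fst_snd(1)[OF X vfield_sm[OF Y h]] by simp
    qed
    have 2: "lift1 X z (\<lambda>w. lift1 Y w (\<lambda>w. h (snd w))) = 0"
      if h: "smooth_at A (snd z) h" and X: "smooth_vfield A X" and Y: "smooth_vfield A Y" for X Y
    proof -
      have "lift1 X z (\<lambda>w. lift1 Y w (\<lambda>w. h (snd w))) = lift1 X z (\<lambda>w. 0)"
        by (rule AA.P.ctangent_cong[OF AA.P.vfield_ct[OF lift_smooth(1)[OF X]]], use smooth_at_fst_snd_eventually(2)[OF h] in eventually_elim)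
          (rule lift_fst_snd(2)[OF Y])
      then show ?thesis using AA.P.ctangent_const[OF AA.P.vfield_ct[OF lift_smooth(1)[OF X]]] by simp
    qed
    show "bracket M (lift1 X) (lift1 Y) z (\<lambda>w. h (fst w)) = lift1 (bracket A X Y) z (\<lambda>w. h (fst w))" if h: "smooth_at A (fst z) h"
      by (simp add: AA.P.bracket_apply smooth_at_fst_snd(1)[OF h] 1[OF h X Y] 1[OF h Y X] lift_fst_snd(1)[OF XY h] bracket_apply[OF h])
    show "bracket M (lift1 X) (lift1 Y) z (\<lambda>w. h (snd w)) = lift1 (bracket A X Y) z (\<lambda>w. h (snd w))" if h: "smooth_at A (snd z) h"
      by (simp add: AA.P.bracket_apply smooth_at_fst_snd(2)[OF h] 2[OF h X Y] 2[OF h Y X] lift_fst_snd(2)[OF XY h])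
  qed
  show ?t2
  proof (rule M_eqI)
    show "bracket M (lift2 X) (lift2 Y) z \<in> ctangent M z" "lift2 (bracket A X Y) z \<in> ctangent M z"
      by (intro AA.P.bracket_ct lift_smooth X Y lift_ct vfield_ct XY)+
    fix h :: "'g \<Rightarrow> complex"
    have 1: "lift2 X z (\<lambda>w. lift2 Y w (\<lambda>w. h (snd w))) = X (snd z) (\<lambda>w. Y w h)"
      if h: "smooth_at A (snd z) h" and X: "smooth_vfield A X" and Y: "smooth_vfield A Y" for X Y
    proof -
      have "lift2 X z (\<lambda>w. lift2 Y w (\<lambda>w. h (snd w))) = lift2 X z (\<lambda>w. Y (snd w) h)"
        by (rule AA.P.ctangent_cong[OF AA.P.vfield_ct[OF lift_smooth(2)[OF X]]], use smooth_at_fst_snd_eventually(2)[OF h] in eventually_elim)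
          (rule lift_fst_snd(4)[OF Y])
      then show ?thesis using lift_fst_snd(4)[OF X vfield_sm[OF Y h]] by simp
    qed
    have 2: "lift2 X z (\<lambda>w. lift2 Y w (\<lambda>w. h (fst w))) = 0"
      if h: "smooth_at A (fst z) h" and X: "smooth_vfield A X" and Y: "smooth_vfield A Y" for X Y
    proof -
      have "lift2 X z (\<lambda>w. lift2 Y w (\<lambda>w. h (fst w))) = lift2 X z (\<lambda>w. 0)"
        by (rule AA.P.ctangent_cong[OF AA.P.vfield_ct[OF lift_smooth(2)[OF X]]], use smooth_at_fst_snd_eventually(1)[OF h] in eventually_elim)
          (rule lift_fst_snd(3)[OF Y])
      then show ?thesis using AA.P.ctangent_const[OF AA.P.vfield_ct[OF lift_smooth(2)[OF X]]] by simp
    qed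
    show "bracket M (lift2 X) (lift2 Y) z (\<lambda>w. h (snd w)) = lift2 (bracket A X Y) z (\<lambda>w. h (snd w))" if h: "smooth_at A (snd z) h"
      by (simp add: AA.P.bracket_apply smooth_at_fst_snd(2)[OF h] 1[OF h X Y] 1[OF h Y X] lift_fst_snd(4)[OF XY h] bracket_apply[OF h])
    show "bracket M (lift2 X) (lift2 Y) z (\<lambda>w. h (fst w)) = lift2 (bracket A X Y) z (\<lambda>w. h (fst w))" if h: "smooth_at A (fst z) h"
      by (simp add: AA.P.bracket_apply smooth_at_fst_snd(1)[OF h] 2[OF h X Y] 2[OF h Y X] lift_fst_snd(3)[OF XY h])
  qed
qed

lemma push_fst_snd_ct:
  assumes "u \<in> ctangent M z"
  shows "push_forward A fst z u \<in> ctangent A (fst z)" "push_forward A snd z u \<in> ctangent A (snd z)"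
  using MA.push_ct[OF AA.smooth_map_at_fst assms] MA.push_ct[OF AA.smooth_map_at_snd assms] by auto

lemma push_lift:
  assumes X: "smooth_vfield A X"
  shows "push_forward A fst z (lift1 X z) = X (fst z)" "push_forward A snd z (lift1 X z) = (\<lambda>f. 0)"
    "push_forward A fst z (lift2 X z) = (\<lambda>f. 0)" "push_forward A snd z (lift2 X z) = X (snd z)"
  using lift_fst_snd[OF X] ctangent_not_sm[OF vfield_ct[OF X]]
  by (auto simp: push_forward_def smooth_near_iff comp_def fun_eq_iff)

end

section \<open>The lifted coframe and the frame \<open>Z\<close>, \<open>Zb\<close>\<close>

context lie_coframe
begin

definition th1 :: "nat \<Rightarrow> ('g \<times> 'g) form" where "th1 i = pullback M A fst (e i)"
definition th2 :: "nat \<Rightarrow> ('g \<times> 'g) form" where "th2 i = pullback M A snd (e i)"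

lemma th_apply:
  assumes "u \<in> ctangent M z"
  shows "th1 i z [u] = e i (fst z) [push_forward A fst z u]" "th2 i z [u] = e i (snd z) [push_forward A snd z u]"
  using assms by (simp_all add: th1_def th2_def pullback_def)

lemma th_lin:
  assumes i: "i \<in> {1..n}" and u: "u \<in> ctangent M z" "v \<in> ctangent M z"
  shows "th1 i z [\<lambda>f. u f + k * v f] = th1 i z [u] + k * th1 i z [v]"
    "th2 i z [\<lambda>f. u f + k * v f] = th2 i z [u] + k * th2 i z [v]"
  unfolding th_apply[OF u(1)] th_apply[OF u(2)] th_apply[OF AA.P.ctangent_lin[OF u]] MA.push_lin
  using alt1_lin[OF e_alt[OF i]] push_fst_snd_ct u by auto

lemma th_lift:
  assumes i: "i \<in> {1..n}" and X: "smooth_vfield A X"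
  shows "th1 i z [lift1 X z] = e i (fst z) [X (fst z)]" "th2 i z [lift1 X z] = 0"
    "th1 i z [lift2 X z] = 0" "th2 i z [lift2 X z] = e i (snd z) [X (snd z)]"
  using th_apply[OF lift_ct(1)[of X z, OF vfield_ct[OF X]], of i] th_apply[OF lift_ct(2)[of X z, OF vfield_ct[OF X]], of i]
    push_lift[OF X] alt1_zero[OF e_alt[OF i]] by auto

lemma th_expand:
  assumes u: "u \<in> ctangent M z"
  shows "u f = (\<Sum>i=1..n. th1 i z [u] * lift1 (E i) z f) + (\<Sum>i=1..n. th2 i z [u] * lift2 (E i) z f)"
proof -
  let ?v = "\<lambda>f. (\<Sum>i=1..n. th1 i z [u] * lift1 (E i) z f) + (\<Sum>i=1..n. th2 i z [u] * lift2 (E i) z f)"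
  have "u = ?v"
  proof (rule M_eqI[OF u])
    show "?v \<in> ctangent M z"
      by (intro AA.P.ctangent_add AA.P.ctangent_sum lift_ct E_ct)
    fix h :: "'g \<Rightarrow> complex"
    show "u (\<lambda>w. h (fst w)) = ?v (\<lambda>w. h (fst w))" if h: "smooth_at A (fst z) h"
    proof -
      have "u (\<lambda>w. h (fst w)) = push_forward A fst z u h" by (rule MA.push_apply[symmetric, of fst z h u, OF h])
      also have "\<dots> = (\<Sum>i=1..n. th1 i z [u] * E i (fst z) h)"
        unfolding th_apply[OF u] by (rule E_expand[OF push_fst_snd_ct(1)[OF u]])
      finally show ?thesis by (simp add: lift_fst_snd(1,3)[OF E_smooth h])
    qed
    show "u (\<lambda>w. h (snd w)) = ?v (\<lambda>w. h (snd w))" if h: "smooth_at A (snd z) h"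
    proof -
      have "u (\<lambda>w. h (snd w)) = push_forward A snd z u h" by (rule MA.push_apply[symmetric, of snd z h u, OF h])
      also have "\<dots> = (\<Sum>i=1..n. th2 i z [u] * E i (snd z) h)"
        unfolding th_apply[OF u] by (rule E_expand[OF push_fst_snd_ct(2)[OF u]])
      finally show ?thesis by (simp add: lift_fst_snd(2,4)[OF E_smooth h])
    qed
  qed
  then show ?thesis by (rule fun_cong)
qed

lemma th_smooth:
  assumes i: "i \<in> {1..n}" and X: "smooth_vfield M X"
  shows "smooth_at M z (\<lambda>w. th1 i w [X w])" "smooth_at M z (\<lambda>w. th2 i w [X w])"
proof -
  note Xc = AA.P.vfield_ct[OF X]
  obtain c where c: "c \<in> A" "fst z \<in> fst c" by (rule chart_at)
  obtain d where d: "d \<in> A" "snd z \<in> fst d" by (rule chart_at)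
  have ec: "e i p [u] = (\<Sum>b\<in>Basis. u (coord c b) * e i p [chart_vec A c p b])"
    if c: "c \<in> A" "p \<in> fst c" and u: "u \<in> ctangent A p" for c p u
  proof -
    have "e i p [u] = e i p [\<lambda>f. \<Sum>b\<in>Basis. u (coord c b) * chart_vec A c p b f]"
      using ctangent_iff[OF c, THEN iffD1, OF u] by (rule arg_cong)
    also have "\<dots> = (\<Sum>b\<in>Basis. u (coord c b) * e i p [chart_vec A c p b])"
      by (rule alt1_sum[OF e_alt[OF i]]) (use chart_vec_tangent[OF c] tangent_subset in blast)
    finally show ?thesis .
  qed
  have "smooth_at M z (\<lambda>w. \<Sum>b\<in>Basis. X w (\<lambda>w'. coord c b (fst w')) * e i (fst w) [chart_vec A c (fst w) b])"
    by (intro AA.P.smooth_at_sum AA.P.smooth_at_mult AA.P.vfield_sm[OF X] smooth_at_fst_snd(1) smooth_at_coord[OF c]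
       left_inv_form_smooth[OF e_left[OF i] e_alt[OF i] c])
  moreover have "\<forall>\<^sub>F w in nhds z. fst w \<in> fst c"
    by (rule eventually_compose_filterlim[OF chart_eventually[OF c] MA.smooth_map_at_tendsto[OF AA.smooth_map_at_fst]])
  then have "\<forall>\<^sub>F w in nhds z. (\<Sum>b\<in>Basis. X w (\<lambda>w'. coord c b (fst w')) * e i (fst w) [chart_vec A c (fst w) b]) = th1 i w [X w]"
  proof eventually_elim
    fix w :: "'g \<times> 'g" assume w: "fst w \<in> fst c"
    show "(\<Sum>b\<in>Basis. X w (\<lambda>w'. coord c b (fst w')) * e i (fst w) [chart_vec A c (fst w) b]) = th1 i w [X w]"
      unfolding th_apply[OF Xc] ec[OF c(1) w push_fst_snd_ct(1)[OF Xc]]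
        MA.push_apply[of fst w "coord c _" "X w", OF smooth_at_coord[OF c(1) w]] ..
  qed
  ultimately show "smooth_at M z (\<lambda>w. th1 i w [X w])" by (rule AA.P.smooth_at_cong)
  have "smooth_at M z (\<lambda>w. \<Sum>b\<in>Basis. X w (\<lambda>w'. coord d b (snd w')) * e i (snd w) [chart_vec A d (snd w) b])"
    by (intro AA.P.smooth_at_sum AA.P.smooth_at_mult AA.P.vfield_sm[OF X] smooth_at_fst_snd(2) smooth_at_coord[OF d]
       left_inv_form_smooth[OF e_left[OF i] e_alt[OF i] d])
  moreover have "\<forall>\<^sub>F w in nhds z. snd w \<in> fst d"
    by (rule eventually_compose_filterlim[OF chart_eventually[OF d] MA.smooth_map_at_tendsto[OF AA.smooth_map_at_snd]])
  then have "\<forall>\<^sub>F w in nhds z. (\<Sum>b\<in>Basis. X w (\<lambda>w'. coord d b (snd w')) * e i (snd w) [chart_vec A d (snd w) b]) = th2 i w [X w]"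
  proof eventually_elim
    fix w :: "'g \<times> 'g" assume w: "snd w \<in> fst d"
    show "(\<Sum>b\<in>Basis. X w (\<lambda>w'. coord d b (snd w')) * e i (snd w) [chart_vec A d (snd w) b]) = th2 i w [X w]"
      unfolding th_apply[OF Xc] ec[OF d(1) w push_fst_snd_ct(2)[OF Xc]]
        MA.push_apply[of snd w "coord d _" "X w", OF smooth_at_coord[OF d(1) w]] ..
  qed
  ultimately show "smooth_at M z (\<lambda>w. th2 i w [X w])" by (rule AA.P.smooth_at_cong)
qed

definition Z :: "nat \<Rightarrow> ('g \<times> 'g) vfield" where
  "Z i = (\<lambda>z f. lift1 (E i) z f / 2 - \<i> * lift2 (E i) z f / 2)"
definition Zb :: "nat \<Rightarrow> ('g \<times> 'g) vfield" where
  "Zb i = (\<lambda>z f. lift1 (E i) z f / 2 + \<i> * lift2 (E i) z f / 2)"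
definition phb :: "nat \<Rightarrow> ('g \<times> 'g) form" where
  "phb i = (\<lambda>z vs. th1 i z vs - \<i> * th2 i z vs)"

lemma phi_eq: "phi A e i = (\<lambda>z vs. th1 i z vs + \<i> * th2 i z vs)"
  by (simp add: phi_def th1_def th2_def)

text \<open>Rewritten as sums over \<open>bool\<close> with constant coefficients, the shape to
  which the rules for sums of fields and for brackets of sums apply.\<close>

lemma Z_sums:
  "Z i = (\<lambda>z f. \<Sum>s\<in>UNIV. (if s then 1 / 2 else - \<i> / 2) * (if s then lift1 (E i) else lift2 (E i)) z f)"
  "Zb i = (\<lambda>z f. \<Sum>s\<in>UNIV. (if s then 1 / 2 else \<i> / 2) * (if s then lift1 (E i) else lift2 (E i)) z f)"
  by (simp_all add: Z_def Zb_def UNIV_bool fun_eq_iff)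

lemma Z_smooth:
  assumes i: "i \<in> {1..n}"
  shows "smooth_vfield M (Z i)" "smooth_vfield M (Zb i)"
  unfolding Z_sums by (intro AA.P.vfield_sum AA.P.smooth_at_const; use lift_smooth[OF E_smooth[OF i]] in simp)+

lemma phi_expand:
  assumes u: "u \<in> ctangent M z"
  shows "u f = (\<Sum>i=1..n. phi A e i z [u] * Z i z f) + (\<Sum>i=1..n. phb i z [u] * Zb i z f)"
  unfolding th_expand[OF u, of f] phi_eq phb_def Z_def Zb_def
  by (simp add: algebra_simps add_divide_distrib diff_divide_distrib sum.distrib sum_subtractf flip: sum_divide_distrib)

lemma phi_lin:
  assumes i: "i \<in> {1..n}" and u: "u \<in> ctangent M z" "v \<in> ctangent M z"
  shows "phi A e i z [\<lambda>f. u f + k * v f] = phi A e i z [u] + k * phi A e i z [v]"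
    "phb i z [\<lambda>f. u f + k * v f] = phb i z [u] + k * phb i z [v]"
  unfolding phi_eq phb_def th_lin[OF assms] by (simp_all add: algebra_simps)

lemma phi_smooth:
  assumes i: "i \<in> {1..n}" and X: "smooth_vfield M X"
  shows "smooth_at M z (\<lambda>w. phi A e i w [X w])" "smooth_at M z (\<lambda>w. phb i w [X w])"
  unfolding phi_eq phb_def by (intro AA.P.smooth_at_add AA.P.smooth_at_diff AA.P.smooth_at_cmult th_smooth[OF i X])+

lemma phi_off: "vs \<notin> tvecs M 1 z \<Longrightarrow> i \<in> {1..n} \<Longrightarrow> phi A e i z vs = 0"
proof -
  assume vs: "vs \<notin> tvecs M 1 z" and i: "i \<in> {1..n}"
  have off: "e i p ws = 0" if "length ws \<noteq> 1" for p ws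
    using e_alt[OF i, of p] that by (auto simp: alt_forms_def tvecs_def)
  show "phi A e i z vs = 0"
    using vs off by (auto simp: phi_def pullback_def tvecs_def)
qed

lemma phi_alt:
  assumes i: "i \<in> {1..n}"
  shows "phi A e i z \<in> alt_forms M 1 z"
proof -
  have "(\<lambda>vs. if vs \<in> tvecs M 1 z then phi A e i z [hd vs] else 0) \<in> alt_forms M 1 z"
    by (rule AA.P.alt1I) (rule phi_lin(1)[OF i])
  moreover have "(\<lambda>vs. if vs \<in> tvecs M 1 z then phi A e i z [hd vs] else 0) = phi A e i z"
    using phi_off[OF _ i] by (auto simp: fun_eq_iff tvecs_def length_Suc_conv)
  ultimately show ?thesis by simp
qed

lemma phi_dual:
  assumes i: "i \<in> {1..n}" and j: "j \<in> {1..n}"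
  shows "phi A e j z [Z i z] = (if i = j then 1 else 0)" "phi A e j z [Zb i z] = 0"
    "phb j z [Z i z] = 0" "phb j z [Zb i z] = (if i = j then 1 else 0)"
proof -
  let ?u = "lift1 (E i) z" and ?v = "lift2 (E i) z"
  have u: "?u \<in> ctangent M z" and v: "?v \<in> ctangent M z" by (intro lift_ct E_ct[OF i])+
  have z: "(\<lambda>f. 0) \<in> ctangent M z" by (rule AA.P.ctangent_zero)
  have Zi: "Z i z = (\<lambda>f. (\<lambda>f. 0 + (1/2) * ?u f) f + (- \<i> / 2) * ?v f)"
    "Zb i z = (\<lambda>f. (\<lambda>f. 0 + (1/2) * ?u f) f + (\<i> / 2) * ?v f)"
    by (simp_all add: Z_def Zb_def)
  have th0: "th1 j z [\<lambda>f. 0] = 0" "th2 j z [\<lambda>f. 0] = 0"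
    using th_lin[OF j z z, of "-1"] by simp_all
  have u2: "(\<lambda>f. 0 + (1/2) * ?u f) \<in> ctangent M z" by (rule AA.P.ctangent_lin[OF z u])
  have th: "th1 j z [\<lambda>f. (\<lambda>f. 0 + (1/2) * ?u f) f + k * ?v f] = (if i = j then 1 / 2 else 0)"
    "th2 j z [\<lambda>f. (\<lambda>f. 0 + (1/2) * ?u f) f + k * ?v f] = (if i = j then k else 0)" for k
    unfolding th_lin[OF j u2 v] th_lin[OF j z u] th0 th_lift[OF j E_smooth[OF i]] E_dual[OF i j] by auto
  show "phi A e j z [Z i z] = (if i = j then 1 else 0)" "phi A e j z [Zb i z] = 0"
    "phb j z [Z i z] = 0" "phb j z [Zb i z] = (if i = j then 1 else 0)"
    unfolding Zi phi_eq phb_def th by auto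
qed

text \<open>The mixed brackets vanish, and the remaining coefficients are
  \<open>1/2 \<cdot> 1/2\<close> and \<open>\<i>/2 \<cdot> (-\<i>/2)\<close>, both equal to
  \<open>1/4\<close>. So the bracket is a quarter of the sum of the two lifts of
  \<open>[E l, E k]\<close>, on which the two parts of \<open>phi\<close> contribute the factors 1
  and \<open>\<i>\<close>.\<close>

lemma bracket_Zb_Z:
  assumes l: "l \<in> {1..n}" and k: "k \<in> {1..n}" and m: "m \<in> {1..n}"
  shows "phi A e m z [bracket M (Zb l) (Z k) z] = (1 + \<i>) / 4 * C l k m"
proof -
  let ?L = "\<lambda>s i. if s then lift1 (E i) else lift2 (E i)"
  let ?B = "bracket A (E l) (E k)"
  have L: "smooth_vfield M (?L s i)" if "i \<in> {1..n}" for s i using lift_smooth[OF E_smooth[OF that]] by simp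
  have B: "smooth_vfield A ?B" by (rule bracket_smooth[OF E_smooth[OF l] E_smooth[OF k]])
  have 21: "bracket M (lift2 (E l)) (lift1 (E k)) z f = 0" for f
    using bracket_lift12[OF E_smooth[OF k] E_smooth[OF l], of z] AA.P.bracket_anticomm[of "lift2 (E l)"] by simp
  have "bracket M (Zb l) (Z k) z f = (\<Sum>s\<in>UNIV. (if s then 1 / 2 else \<i> / 2) *
      (\<Sum>s'\<in>UNIV. (if s' then 1 / 2 else - \<i> / 2) * bracket M (?L s l) (?L s' k) z f))" for f
    unfolding Z_sums(2)
    by (subst AA.P.bracket_sum_left[OF L[OF l] Z_smooth(1)[OF k]], unfold Z_sums(1),
        subst AA.P.bracket_sum_right[OF L[OF k] L[OF l]]) simp
  then have br: "bracket M (Zb l) (Z k) z =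
      (\<lambda>f. (\<lambda>f. (\<lambda>f. 0) f + (1/4) * lift1 ?B z f) f + (1/4) * lift2 ?B z f)"
    by (intro ext) (simp add: UNIV_bool 21 bracket_lift12[OF E_smooth[OF l] E_smooth[OF k]]
      bracket_lift[OF E_smooth[OF l] E_smooth[OF k]] field_simps)
  have z: "(\<lambda>f. 0) \<in> ctangent M z" by (rule AA.P.ctangent_zero)
  have u: "lift1 ?B z \<in> ctangent M z" and v: "lift2 ?B z \<in> ctangent M z" by (intro lift_ct vfield_ct[OF B])+
  have u2: "(\<lambda>f. (\<lambda>f. 0) f + (1/4) * lift1 ?B z f) \<in> ctangent M z" by (rule AA.P.ctangent_lin[OF z u])
  have p0: "phi A e m z [\<lambda>f. 0] = 0" using phi_lin(1)[OF m z z, of "-1"] by simp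
  show ?thesis
    unfolding br phi_lin(1)[OF m u2 v] phi_lin(1)[OF m z u] p0
    unfolding phi_eq th_lift[OF m B] bracket_E_coeff[OF l k m] by (simp add: algebra_simps)
qed

end

section \<open>The almost complex structure in the lifted frame\<close>

locale almost_complex_product = lie_coframe G A n e
  for G :: "('g::topological_space) monoid" and A :: "('g, 'e::euclidean_space) chart set"
    and n :: nat and e :: "nat \<Rightarrow> 'g form" +
  fixes J :: "'g \<times> 'g \<Rightarrow> ('g \<times> 'g) tvec \<Rightarrow> ('g \<times> 'g) tvec"
  assumes acs: "almost_complex M J"
    and pq10: "\<And>p. pq_forms M J 1 0 p = {\<lambda>vs. \<Sum>i=1..n. c i * phi A e i p vs | c. True}"
begin

lemma J_tangent: "u \<in> tangent M z \<Longrightarrow> J z u \<in> tangent M z"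
  and J_lin: "u \<in> ctangent M z \<Longrightarrow> v \<in> ctangent M z \<Longrightarrow> J z (\<lambda>f. u f + k * v f) = (\<lambda>f. J z u f + k * J z v f)"
  and J_J: "u \<in> ctangent M z \<Longrightarrow> J z (J z u) = (\<lambda>f. - u f)"
  using acs unfolding almost_complex_def by blast+

lemma J_ct:
  assumes "u \<in> ctangent M z"
  shows "J z u \<in> ctangent M z"
proof -
  obtain v w where vw: "v \<in> tangent M z" "w \<in> tangent M z" "u = (\<lambda>f. v f + \<i> * w f)"
    by (rule AA.P.ctangent_split[OF assms])
  have c: "v \<in> ctangent M z" "w \<in> ctangent M z" "J z v \<in> ctangent M z" "J z w \<in> ctangent M z"
    using vw(1,2) J_tangent[OF vw(1)] J_tangent[OF vw(2)] AA.P.tangent_subset by blast+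
  show ?thesis unfolding vw(3) J_lin[OF c(1,2)] by (rule AA.P.ctangent_lin[OF c(3,4)])
qed

lemma proj_eq:
  "proj10 J z u = (\<lambda>f. (\<lambda>f. 0 + (1/2) * u f) f + (- \<i> / 2) * J z u f)"
  "proj01 J z u = (\<lambda>f. (\<lambda>f. 0 + (1/2) * u f) f + (\<i> / 2) * J z u f)"
  by (auto simp: proj10_def proj01_def fun_eq_iff field_simps)

lemma proj_ct:
  assumes u: "u \<in> ctangent M z"
  shows "proj10 J z u \<in> ctangent M z" "proj01 J z u \<in> ctangent M z"
  unfolding proj_eq by (intro AA.P.ctangent_lin AA.P.ctangent_zero u J_ct)+

lemma proj_lin:
  assumes "u \<in> ctangent M z" "v \<in> ctangent M z"
  shows "proj10 J z (\<lambda>f. u f + k * v f) = (\<lambda>f. proj10 J z u f + k * proj10 J z v f)"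
    "proj01 J z (\<lambda>f. u f + k * v f) = (\<lambda>f. proj01 J z u f + k * proj01 J z v f)"
  unfolding proj10_def proj01_def J_lin[OF assms] by (auto simp: fun_eq_iff field_simps)

text \<open>For a fixed test function \<open>h\<close>, the value at \<open>h\<close> of the
  (1,0)-part of a vector defines a (1,0)-covector. By hypothesis it is a combination of the
  \<open>phi A e i\<close>, so it vanishes on \<open>u\<close>.\<close>

lemma phi_zero_proj10:
  assumes u: "u \<in> ctangent M z" and z: "\<And>i. i \<in> {1..n} \<Longrightarrow> phi A e i z [u] = 0"
  shows "proj10 J z u = (\<lambda>f. 0)"
proof
  fix h
  define a where "a vs = (if vs \<in> tvecs M 1 z then proj10 J z (hd vs) h else 0)" for vs
  have alt: "a \<in> alt_forms M 1 z"
    unfolding a_def[abs_def] by (rule AA.P.alt1I) (simp add: proj_lin)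
  have pp: "proj10 J z (proj10 J z v) = proj10 J z v" if v: "v \<in> ctangent M z" for v
  proof -
    have c: "(\<lambda>f. 0 + (1/2) * v f) \<in> ctangent M z" by (intro AA.P.ctangent_lin AA.P.ctangent_zero v)
    have 0: "J z (\<lambda>f. 0) = (\<lambda>f. 0)" using J_lin[OF AA.P.ctangent_zero AA.P.ctangent_zero, of z "-1"] by simp
    have "J z (proj10 J z v) = (\<lambda>f. \<i> * proj10 J z v f)"
      unfolding proj_eq J_lin[OF c J_ct[OF v]] J_lin[OF AA.P.ctangent_zero v] J_J[OF v] 0
      by (auto simp: fun_eq_iff field_simps)
    then show ?thesis unfolding proj10_def[of J z "proj10 J z v"] by (auto simp: fun_eq_iff)
  qed
  have S1: "{S. S \<subseteq> {..<Suc 0} \<and> card S = Suc 0} = {{0}}"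
    by (auto simp: lessThan_Suc card_1_singleton_iff)
  have "pq_part M J 1 0 z a = a"
  proof
    fix vs
    show "pq_part M J 1 0 z a vs = a vs"
    proof (cases "vs \<in> tvecs M 1 z")
      case True
      then obtain v where v: "vs = [v]" "v \<in> ctangent M z" by (auto simp: tvecs_def length_Suc_conv)
      then have "[proj10 J z v] \<in> tvecs M 1 z" "[v] \<in> tvecs M 1 z" using proj_ct by (auto simp: tvecs_def)
      then show ?thesis using S1 v pp[OF v(2)] by (simp add: pq_part_def a_def)
    qed (simp add: pq_part_def a_def)
  qed
  then have "a \<in> pq_forms M J 1 0 z" using alt by (simp add: pq_forms_def)
  then obtain c where c: "a = (\<lambda>vs. \<Sum>i=1..n. c i * phi A e i z vs)" unfolding pq10 by blast
  have "proj10 J z u h = a [u]" using u by (simp add: a_def tvecs_def)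
  also have "\<dots> = 0" unfolding c using z by simp
  finally show "proj10 J z u h = 0" .
qed

text \<open>The vector \<open>?w\<close>, which is twice \<open>Zb i z\<close>, is annihilated by
  every \<open>phi\<close>, so its (1,0)-part is zero and \<open>?w = \<i> J ?w\<close>. The real
  and imaginary parts of this equation are the two claims.\<close>

lemma J_lift:
  assumes i: "i \<in> {1..n}"
  shows "J z (lift1 (E i) z) = lift2 (E i) z" "J z (lift2 (E i) z) = (\<lambda>f. - lift1 (E i) z f)"
proof -
  let ?u = "lift1 (E i) z" and ?v = "lift2 (E i) z"
  have t: "?u \<in> tangent M z" "?v \<in> tangent M z" by (intro lift_tangent E_tangent[OF i])+
  then have c: "?u \<in> ctangent M z" "?v \<in> ctangent M z" using AA.P.tangent_subset by blast+
  let ?w = "\<lambda>f. ?u f + \<i> * ?v f"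
  have w: "?w \<in> ctangent M z" by (rule AA.P.ctangent_lin[OF c])
  have "phi A e j z [?w] = 0" if j: "j \<in> {1..n}" for j
    unfolding phi_lin(1)[OF j c] unfolding phi_eq th_lift[OF j E_smooth[OF i]] E_dual[OF i j] by simp
  then have p: "proj10 J z ?w = (\<lambda>f. 0)" by (rule phi_zero_proj10[OF w])
  have "?w f = \<i> * J z ?w f" for f using fun_cong[OF p, of f] unfolding proj10_def by simp
  then have "?u f + \<i> * ?v f = \<i> * (J z ?u f + \<i> * J z ?v f)" for f unfolding J_lin[OF c] .
  then have eq: "(\<lambda>f. 0 + (-1) * J z ?v f) f + \<i> * J z ?u f = ?u f + \<i> * ?v f" for f
    by (simp add: algebra_simps)
  have "(\<lambda>f. 0 + (-1) * J z ?v f) = ?u \<and> J z ?u = ?v"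
    by (rule AA.P.tangent_complex_unique[OF _ _ t eq])
      (intro AA.P.tangent_lin AA.P.tangent_zero J_tangent t; simp)+
  then have uv: "(\<lambda>f. 0 + (-1) * J z ?v f) = ?u" "J z ?u = ?v" by blast+
  show "J z ?u = ?v" by (rule uv(2))
  show "J z ?v = (\<lambda>f. - ?u f)"
  proof
    fix f show "J z ?v f = - ?u f" using fun_cong[OF uv(1), of f] by (simp add: minus_equation_iff[of "J z ?v f"])
  qed
qed

lemma proj_Z:
  assumes i: "i \<in> {1..n}"
  shows "proj10 J z (Z i z) = Z i z" "proj01 J z (Z i z) = (\<lambda>f. 0)"
    "proj10 J z (Zb i z) = (\<lambda>f. 0)" "proj01 J z (Zb i z) = Zb i z"
proof -
  let ?u = "lift1 (E i) z" and ?v = "lift2 (E i) z"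
  have c: "?u \<in> ctangent M z" "?v \<in> ctangent M z" by (intro lift_ct E_ct[OF i])+
  have c2: "(\<lambda>f. 0 + (1/2) * ?u f) \<in> ctangent M z" by (rule AA.P.ctangent_lin[OF AA.P.ctangent_zero c(1)])
  have 0: "J z (\<lambda>f. 0) = (\<lambda>f. 0)" using J_lin[OF AA.P.ctangent_zero AA.P.ctangent_zero, of z "-1"] by simp
  have Zi: "Z i z = (\<lambda>f. (\<lambda>f. 0 + (1/2) * ?u f) f + (- \<i> / 2) * ?v f)"
    "Zb i z = (\<lambda>f. (\<lambda>f. 0 + (1/2) * ?u f) f + (\<i> / 2) * ?v f)"
    by (simp_all add: Z_def Zb_def)
  have "J z (Z i z) = (\<lambda>f. \<i> * Z i z f)" "J z (Zb i z) = (\<lambda>f. - \<i> * Zb i z f)"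
    unfolding Zi J_lin[OF c2 c(2)] J_lin[OF AA.P.ctangent_zero c(1)] 0 J_lift[OF i]
    by (auto simp: fun_eq_iff field_simps)
  then show "proj10 J z (Z i z) = Z i z" "proj01 J z (Z i z) = (\<lambda>f. 0)"
    "proj10 J z (Zb i z) = (\<lambda>f. 0)" "proj01 J z (Zb i z) = Zb i z"
    unfolding proj10_def proj01_def by (auto simp: fun_eq_iff)
qed

end

section \<open>Alternating forms\<close>

lemma length_delete_nth: "i < length xs \<Longrightarrow> length (delete_nth i xs) = length xs - 1"
  by (simp add: delete_nth_def)

lemma nth_delete_nth:
  "i < length xs \<Longrightarrow> j < length xs - 1 \<Longrightarrow> delete_nth i xs ! j = xs ! (if j < i then j else Suc j)"
  by (auto simp: delete_nth_def nth_append min_def)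

lemma set_delete_nth: "set (delete_nth i xs) \<subseteq> set xs"
  by (auto simp: delete_nth_def dest: in_set_takeD in_set_dropD)

lemma map_delete_nth: "map f (delete_nth i xs) = delete_nth i (map f xs)"
  by (simp add: delete_nth_def take_map drop_map)

lemma delete_nth_Cons_0 [simp]: "delete_nth 0 (x # xs) = xs"
  by (simp add: delete_nth_def)

lemma delete_nth_update_same [simp]: "delete_nth i (xs[i := x]) = delete_nth i xs"
  by (simp add: delete_nth_def)

lemma delete_nth_update:
  assumes "i < length xs" "k < length xs" "i \<noteq> k"
  shows "delete_nth i (xs[k := x]) = (delete_nth i xs)[(if k < i then k else k - 1) := x]"
  using assms by (intro nth_equalityI) (auto simp: length_delete_nth nth_delete_nth nth_list_update)

lemma delete_nth_delete_nth:
  assumes "i < k" "k < length xs"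
  shows "delete_nth i (delete_nth k xs) = delete_nth (k - 1) (delete_nth i xs)"
  using assms by (intro nth_equalityI) (auto simp: length_delete_nth nth_delete_nth)

context smooth_manifold
begin

lemma tvecs_update: "vs \<in> tvecs A k p \<Longrightarrow> u \<in> ctangent A p \<Longrightarrow> vs[i := u] \<in> tvecs A k p"
  by (auto simp: tvecs_def dest: subsetD[OF set_update_subset_insert])

lemma tvecs_nth: "vs \<in> tvecs A k p \<Longrightarrow> i < k \<Longrightarrow> vs ! i \<in> ctangent A p"
  by (auto simp: tvecs_def)

lemma tvecs_delete: "vs \<in> tvecs A (Suc k) p \<Longrightarrow> i < Suc k \<Longrightarrow> delete_nth i vs \<in> tvecs A k p"
  using set_delete_nth by (fastforce simp: tvecs_def length_delete_nth)

lemma tvecs_Cons: "v # vs \<in> tvecs A (Suc k) p \<longleftrightarrow> v \<in> ctangent A p \<and> vs \<in> tvecs A k p"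
  by (auto simp: tvecs_def)

lemma map_tvecs: "(\<And>i. i < k \<Longrightarrow> g i \<in> ctangent A p) \<Longrightarrow> map g [0..<k] \<in> tvecs A k p"
  by (auto simp: tvecs_def)

lemma alt_off: "a \<in> alt_forms A k p \<Longrightarrow> vs \<notin> tvecs A k p \<Longrightarrow> a vs = 0"
  by (simp add: alt_forms_def)

lemma alt_lin:
  "a \<in> alt_forms A k p \<Longrightarrow> vs \<in> tvecs A k p \<Longrightarrow> i < k \<Longrightarrow> u \<in> ctangent A p \<Longrightarrow> v \<in> ctangent A p \<Longrightarrow>
    a (vs[i := (\<lambda>f. u f + c * v f)]) = a (vs[i := u]) + c * a (vs[i := v])"
  by (simp add: alt_forms_def)

lemma alt_eq:
  "a \<in> alt_forms A k p \<Longrightarrow> vs \<in> tvecs A k p \<Longrightarrow> i < k \<Longrightarrow> j < k \<Longrightarrow> i \<noteq> j \<Longrightarrow> vs ! i = vs ! j \<Longrightarrow> a vs = 0"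
  by (simp add: alt_forms_def)

lemma alt_zero:
  assumes "a \<in> alt_forms A k p" "vs \<in> tvecs A k p" "i < k"
  shows "a (vs[i := (\<lambda>f. 0)]) = 0"
  using alt_lin[OF assms ctangent_zero ctangent_zero, of "-1"] by simp

lemma alt_sum:
  assumes "a \<in> alt_forms A k p" "vs \<in> tvecs A k p" "i < k" "\<And>j. j \<in> I \<Longrightarrow> u j \<in> ctangent A p"
  shows "a (vs[i := (\<lambda>f. \<Sum>j\<in>I. c j * u j f)]) = (\<Sum>j\<in>I. c j * a (vs[i := u j]))"
  using assms(4)
proof (induction I rule: infinite_finite_induct)
  case (insert j I)
  have "a (vs[i := (\<lambda>f. (\<Sum>j\<in>I. c j * u j f) + c j * u j f)]) = a (vs[i := (\<lambda>f. \<Sum>j\<in>I. c j * u j f)]) + c j * a (vs[i := u j])"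
    by (rule alt_lin[OF assms(1-3)]) (use insert.prems ctangent_sum[of I u] in auto)
  then show ?case using insert by (simp add: add.commute)
qed (simp_all add: alt_zero[OF assms(1-3)])

text \<open>Alternation is defined as vanishing on repeated arguments; antisymmetry follows by
  polarisation, with \<open>x + y\<close> put into both slots. The factor 1 in \<open>?s\<close>
  keeps the shape of the linearity rule.\<close>

lemma alt_swap:
  assumes a: "a \<in> alt_forms A k p" and vs: "vs \<in> tvecs A k p" and ij: "i < k" "j < k" "i \<noteq> j"
  shows "a (vs[i := vs ! j, j := vs ! i]) = - a vs"
proof -
  let ?x = "vs ! i" and ?y = "vs ! j"
  have x: "?x \<in> ctangent A p" and y: "?y \<in> ctangent A p" using tvecs_nth[OF vs] ij by auto
  let ?s = "\<lambda>f. ?x f + 1 * ?y f"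
  have s: "?s \<in> ctangent A p" by (rule ctangent_lin[OF x y])
  have len: "length vs = k" using vs by (simp add: tvecs_def)
  have z: "a (vs[i := u, j := u]) = 0" if "u \<in> ctangent A p" for u
    by (rule alt_eq[OF a tvecs_update[OF tvecs_update[OF vs that] that] ij]) (use ij len in auto)
  have e: "vs[j := w, i := u] = vs[i := u, j := w]" for u w by (rule list_update_swap[OF ij(3)[symmetric]])
  have "a (vs[i := ?s, j := ?s]) = a (vs[i := ?s, j := ?x]) + a (vs[i := ?s, j := ?y])"
    using alt_lin[OF a tvecs_update[OF vs s] ij(2) x y, of i 1] by (simp only: mult_1)
  also have "a (vs[i := ?s, j := ?x]) = a (vs[i := ?x, j := ?x]) + a (vs[i := ?y, j := ?x])"
    using alt_lin[OF a tvecs_update[OF vs x, of j] ij(1) x y, of 1] by (simp only: mult_1 e)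
  also have "a (vs[i := ?s, j := ?y]) = a (vs[i := ?x, j := ?y]) + a (vs[i := ?y, j := ?y])"
    using alt_lin[OF a tvecs_update[OF vs y, of j] ij(1) x y, of 1] by (simp only: mult_1 e)
  finally have "0 = a (vs[i := ?y, j := ?x]) + a (vs[i := ?x, j := ?y])"
    unfolding z[OF s] z[OF x] z[OF y] by (simp only: add_0_left add_0_right)
  moreover have "vs[i := ?x, j := ?y] = vs" by simp
  ultimately show ?thesis by (simp add: eq_neg_iff_add_eq_0)
qed

lemma alt_move_front:
  assumes a: "a \<in> alt_forms A k p" and "xs @ u # zs \<in> tvecs A k p"
  shows "a (xs @ u # zs) = (-1) ^ length xs * a (u # xs @ zs)"
  using assms(2)
proof (induction xs arbitrary: zs rule: rev_induct)
  case (snoc x xs)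
  let ?l = "xs @ u # x # zs" and ?m = "length xs"
  have l: "?l \<in> tvecs A k p" using snoc.prems by (auto simp: tvecs_def)
  then have m: "?m < k" "Suc ?m < k" by (auto simp: tvecs_def)
  have "?l[?m := ?l ! Suc ?m, Suc ?m := ?l ! ?m] = xs @ x # u # zs"
    by (simp add: list_update_append nth_append)
  then have "a (xs @ x # u # zs) = - a ?l" using alt_swap[OF a l m] by simp
  also have "a ?l = (-1) ^ ?m * a (u # xs @ x # zs)" by (rule snoc.IH[OF l])
  finally show ?case by simp
qed simp

text \<open>The Koszul formula places a bracket in front of the remaining arguments. This rule puts
  it back into the slot that it came from, at the cost of the sign for passing \<open>j\<close>
  arguments.\<close>

lemma alt_update_front:
  assumes a: "a \<in> alt_forms A k p" and vs: "vs \<in> tvecs A k p" and j: "j < k" and u: "u \<in> ctangent A p"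
  shows "a (vs[j := u]) = (-1) ^ j * a (u # delete_nth j vs)"
proof -
  have len: "length vs = k" using vs by (simp add: tvecs_def)
  have eq: "vs[j := u] = take j vs @ u # drop (Suc j) vs" using j len by (simp add: upd_conv_take_nth_drop)
  have "take j vs @ u # drop (Suc j) vs \<in> tvecs A k p" using tvecs_update[OF vs u, of j] eq by simp
  from alt_move_front[OF a this] show ?thesis using eq j len by (simp add: delete_nth_def)
qed

lemma alt_forms_lin:
  assumes "a \<in> alt_forms A k p" "b \<in> alt_forms A k p"
  shows "(\<lambda>vs. a vs + c * b vs) \<in> alt_forms A k p"
proof -
  have "(a (vs[i := (\<lambda>f. u f + d * v f)]) + c * b (vs[i := (\<lambda>f. u f + d * v f)])) =
     (a (vs[i := u]) + c * b (vs[i := u])) + d * (a (vs[i := v]) + c * b (vs[i := v]))"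
    if "vs \<in> tvecs A k p" "i < k" "u \<in> ctangent A p" "v \<in> ctangent A p" for vs i u v d
    unfolding alt_lin[OF assms(1) that] alt_lin[OF assms(2) that] by (simp add: algebra_simps)
  moreover have "a vs + c * b vs = 0" if "vs \<in> tvecs A k p" "i < k" "j < k" "i \<noteq> j" "vs ! i = vs ! j" for vs i j
    using alt_eq[OF assms(1) that] alt_eq[OF assms(2) that] by simp
  ultimately show ?thesis
    using alt_off[OF assms(1)] alt_off[OF assms(2)] unfolding alt_forms_def by simp
qed

lemma alt_forms_cmult:
  assumes "a \<in> alt_forms A k p"
  shows "(\<lambda>vs. c * a vs) \<in> alt_forms A k p"
proof -
  have "(\<lambda>vs. 0) \<in> alt_forms A k p" by (simp add: alt_forms_def)
  from alt_forms_lin[OF this assms, of c] show ?thesis by simp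
qed

lemma wedge_list_apply:
  "vs \<in> tvecs A (length fs) p \<Longrightarrow> wedge_list A fs p vs = (\<Sum>\<sigma> | \<sigma> permutes {..<length fs}.
     of_int (sign \<sigma>) * (\<Prod>i<length fs. (fs ! i) p [vs ! \<sigma> i]))"
  by (simp add: wedge_list_def)

lemma wedge_list_alt:
  assumes alt: "\<And>i. i < length fs \<Longrightarrow> (fs ! i) p \<in> alt_forms A 1 p"
  shows "wedge_list A fs p \<in> alt_forms A (length fs) p"
proof -
  let ?n = "length fs"
  let ?w = "wedge_list A fs p"
  have lin: "?w (vs[i := (\<lambda>f. u f + c * v f)]) = ?w (vs[i := u]) + c * ?w (vs[i := v])"
    if vs: "vs \<in> tvecs A ?n p" and i: "i < ?n" and u: "u \<in> ctangent A p" and v: "v \<in> ctangent A p" for vs i u v c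
  proof -
    have len: "length vs = ?n" using vs by (simp add: tvecs_def)
    \<comment> \<open>In the term of \<open>\<sigma>\<close> slot \<open>i\<close> is seen only by
      the factor with index \<open>inv_into UNIV \<sigma> i\<close>; isolating this factor makes
      each term linear in the slot.\<close>
    have split: "(\<Prod>j<?n. (fs ! j) p [vs[i := x] ! \<sigma> j]) =
       (fs ! inv_into UNIV \<sigma> i) p [x] * (\<Prod>j\<in>{..<?n} - {inv_into UNIV \<sigma> i}. (fs ! j) p [vs ! \<sigma> j])" and inv: "inv_into UNIV \<sigma> i < ?n"
      if s: "\<sigma> permutes {..<?n}" for \<sigma> x
    proof -
      show inv: "inv_into UNIV \<sigma> i < ?n" using permutes_in_image[OF permutes_inv[OF s]] i by simp
      have ne: "\<sigma> j \<noteq> i" if "j \<noteq> inv_into UNIV \<sigma> i" for j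
        using permutes_inverses(2)[OF s, of j] that by auto
      have "(\<Prod>j\<in>{..<?n} - {inv_into UNIV \<sigma> i}. (fs ! j) p [vs[i := x] ! \<sigma> j]) =
          (\<Prod>j\<in>{..<?n} - {inv_into UNIV \<sigma> i}. (fs ! j) p [vs ! \<sigma> j])"
      proof (rule prod.cong[OF refl])
        fix j assume "j \<in> {..<?n} - {inv_into UNIV \<sigma> i}"
        then have "\<sigma> j \<noteq> i" using ne by blast
        then show "(fs ! j) p [vs[i := x] ! \<sigma> j] = (fs ! j) p [vs ! \<sigma> j]" by simp
      qed
      moreover have "vs[i := x] ! \<sigma> (inv_into UNIV \<sigma> i) = x" using permutes_inverses[OF s] i len by simp
      ultimately show "(\<Prod>j<?n. (fs ! j) p [vs[i := x] ! \<sigma> j]) =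
         (fs ! inv_into UNIV \<sigma> i) p [x] * (\<Prod>j\<in>{..<?n} - {inv_into UNIV \<sigma> i}. (fs ! j) p [vs ! \<sigma> j])"
        using inv by (subst prod.remove[of _ "inv_into UNIV \<sigma> i"]) auto
    qed
    show ?thesis
      unfolding wedge_list_apply[OF tvecs_update[OF vs ctangent_lin[OF u v]]] wedge_list_apply[OF tvecs_update[OF vs u]]
        wedge_list_apply[OF tvecs_update[OF vs v]] sum_distrib_left sum.distrib[symmetric]
    proof (rule sum.cong[OF refl])
      fix \<sigma> assume "\<sigma> \<in> {\<sigma>. \<sigma> permutes {..<?n}}"
      then have s: "\<sigma> permutes {..<?n}" by simp
      show "of_int (sign \<sigma>) * (\<Prod>j<?n. (fs ! j) p [vs[i := (\<lambda>f. u f + c * v f)] ! \<sigma> j]) =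
         of_int (sign \<sigma>) * (\<Prod>j<?n. (fs ! j) p [vs[i := u] ! \<sigma> j]) +
         c * (of_int (sign \<sigma>) * (\<Prod>j<?n. (fs ! j) p [vs[i := v] ! \<sigma> j]))"
        unfolding split[OF s] alt1_lin[OF alt[OF inv[OF s]] u v] by (simp add: algebra_simps)
    qed
  qed
  have eq: "?w vs = 0" if vs: "vs \<in> tvecs A ?n p" and ij: "i < ?n" "j < ?n" "i \<noteq> j" "vs ! i = vs ! j" for vs i j
  proof -
    let ?F = "\<lambda>\<sigma>. of_int (sign \<sigma>) * (\<Prod>k<?n. (fs ! k) p [vs ! \<sigma> k])"
    \<comment> \<open>Reindexing by the transposition of the two equal slots reverses the sign of
      every term, so the sum equals its own negative.\<close>
    let ?t = "Transposition.transpose i j"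
    have t: "?t permutes {..<?n}" using ij by (intro permutes_swap_id) auto
    have "sum ?F {\<sigma>. \<sigma> permutes {..<?n}} = (\<Sum>\<sigma> | \<sigma> permutes {..<?n}. ?F (?t \<circ> \<sigma>))"
      by (rule setum_permutations_compose_left[OF t])
    also have "\<dots> = (\<Sum>\<sigma> | \<sigma> permutes {..<?n}. - ?F \<sigma>)"
    proof (rule sum.cong[OF refl])
      fix \<sigma> assume "\<sigma> \<in> {\<sigma>. \<sigma> permutes {..<?n}}"
      then have s: "\<sigma> permutes {..<?n}" by simp
      have "sign (?t \<circ> \<sigma>) = - sign \<sigma>"
        using sign_compose[OF permutation_swap_id, of \<sigma> i j] permutes_imp_permutation[OF _ s] ij
        by (simp add: sign_swap_id)
      moreover have "vs ! (?t \<circ> \<sigma>) k = vs ! \<sigma> k" for k using ij by (auto simp: Transposition.transpose_def)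
      ultimately show "?F (?t \<circ> \<sigma>) = - ?F \<sigma>" by simp
    qed
    finally have "sum ?F {\<sigma>. \<sigma> permutes {..<?n}} = 0" by (simp add: sum_negf)
    then show ?thesis unfolding wedge_list_apply[OF vs] .
  qed
  show ?thesis unfolding alt_forms_def using lin eq by (auto simp: wedge_list_def)
qed

text \<open>A determinant with a zero column vanishes.\<close>

lemma wedge_list_kill:
  assumes "vs \<in> tvecs A (length fs) p" "k < length fs" "\<And>i. i < length fs \<Longrightarrow> (fs ! i) p [vs ! k] = 0"
  shows "wedge_list A fs p vs = 0"
  unfolding wedge_list_apply[OF assms(1)]
proof (rule sum.neutral, rule ballI)
  fix \<sigma> assume "\<sigma> \<in> {\<sigma>. \<sigma> permutes {..<length fs}}"
  then have s: "\<sigma> permutes {..<length fs}" by simp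
  have "inv_into UNIV \<sigma> k < length fs" using permutes_in_image[OF permutes_inv[OF s]] assms(2) by simp
  moreover have "\<sigma> (inv_into UNIV \<sigma> k) = k" by (rule permutes_inverses(1)[OF s])
  ultimately have "(\<Prod>i<length fs. (fs ! i) p [vs ! \<sigma> i]) = 0"
    using assms(3) by (intro prod_zero) (auto intro!: bexI[of _ "inv_into UNIV \<sigma> k"])
  then show "of_int (sign \<sigma>) * (\<Prod>i<length fs. (fs ! i) p [vs ! \<sigma> i]) = 0" by simp
qed

text \<open>The two points may differ. This is what makes the wedge product constant along fields
  with constant coefficients in the frame.\<close>

lemma wedge_list_cong:
  assumes "vs \<in> tvecs A (length fs) p" "ws \<in> tvecs A (length fs) q"
    "\<And>i j. i < length fs \<Longrightarrow> j < length fs \<Longrightarrow> (fs ! i) p [vs ! j] = (fs ! i) q [ws ! j]"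
  shows "wedge_list A fs p vs = wedge_list A fs q ws"
  unfolding wedge_list_apply[OF assms(1)] wedge_list_apply[OF assms(2)]
proof (rule sum.cong[OF refl])
  fix \<sigma> assume "\<sigma> \<in> {\<sigma>. \<sigma> permutes {..<length fs}}"
  then have s: "\<sigma> permutes {..<length fs}" by simp
  have "(\<Prod>i<length fs. (fs ! i) p [vs ! \<sigma> i]) = (\<Prod>i<length fs. (fs ! i) q [ws ! \<sigma> i])"
    by (rule prod.cong[OF refl]) (use assms(3) permutes_in_image[OF s] in auto)
  then show "of_int (sign \<sigma>) * (\<Prod>i<length fs. (fs ! i) p [vs ! \<sigma> i]) =
    of_int (sign \<sigma>) * (\<Prod>i<length fs. (fs ! i) q [ws ! \<sigma> i])" by simp
qed

end

section \<open>Complex frames\<close>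

text \<open>What is kept of the group: a global frame of type (1,0) and (0,1) with its dual forms,
  where the (1,0)-components of the brackets of \<open>Zb\<close> with \<open>Z\<close> are
  constants \<open>t\<close>. Everything about dbar and the pluricanonical sections is derived from
  this alone.\<close>

locale complex_frame = smooth_manifold A
  for A :: "('m::topological_space, 'e::euclidean_space) chart set" +
  fixes J :: "'m \<Rightarrow> 'm tvec \<Rightarrow> 'm tvec" and n :: nat
    and Z Zb :: "nat \<Rightarrow> 'm vfield" and ph phb :: "nat \<Rightarrow> 'm form"
    and t :: "nat \<Rightarrow> nat \<Rightarrow> nat \<Rightarrow> complex"
  assumes cdim: "cdim A = n"
    and Z_smooth: "\<And>i. i \<in> {1..n} \<Longrightarrow> smooth_vfield A (Z i)" "\<And>i. i \<in> {1..n} \<Longrightarrow> smooth_vfield A (Zb i)"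
    and ph_alt: "\<And>i p. i \<in> {1..n} \<Longrightarrow> ph i p \<in> alt_forms A 1 p"
    and phb_lin: "\<And>i p u v k. i \<in> {1..n} \<Longrightarrow> u \<in> ctangent A p \<Longrightarrow> v \<in> ctangent A p \<Longrightarrow>
        phb i p [\<lambda>f. u f + k * v f] = phb i p [u] + k * phb i p [v]"
    and ph_smooth: "\<And>i X p. i \<in> {1..n} \<Longrightarrow> smooth_vfield A X \<Longrightarrow> smooth_at A p (\<lambda>q. ph i q [X q])"
      "\<And>i X p. i \<in> {1..n} \<Longrightarrow> smooth_vfield A X \<Longrightarrow> smooth_at A p (\<lambda>q. phb i q [X q])"
    and expand: "\<And>u p f. u \<in> ctangent A p \<Longrightarrow>
        u f = (\<Sum>i=1..n. ph i p [u] * Z i p f) + (\<Sum>i=1..n. phb i p [u] * Zb i p f)"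
    and ph_dual: "\<And>i j p. i \<in> {1..n} \<Longrightarrow> j \<in> {1..n} \<Longrightarrow> ph j p [Z i p] = (if i = j then 1 else 0)"
      "\<And>i j p. i \<in> {1..n} \<Longrightarrow> j \<in> {1..n} \<Longrightarrow> ph j p [Zb i p] = 0"
      "\<And>i j p. i \<in> {1..n} \<Longrightarrow> j \<in> {1..n} \<Longrightarrow> phb j p [Z i p] = 0"
      "\<And>i j p. i \<in> {1..n} \<Longrightarrow> j \<in> {1..n} \<Longrightarrow> phb j p [Zb i p] = (if i = j then 1 else 0)"
    and proj_ct: "\<And>u p. u \<in> ctangent A p \<Longrightarrow> proj10 J p u \<in> ctangent A p"
      "\<And>u p. u \<in> ctangent A p \<Longrightarrow> proj01 J p u \<in> ctangent A p"
    and proj_lin: "\<And>u v p k. u \<in> ctangent A p \<Longrightarrow> v \<in> ctangent A p \<Longrightarrow>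
        proj10 J p (\<lambda>f. u f + k * v f) = (\<lambda>f. proj10 J p u f + k * proj10 J p v f)"
      "\<And>u v p k. u \<in> ctangent A p \<Longrightarrow> v \<in> ctangent A p \<Longrightarrow>
        proj01 J p (\<lambda>f. u f + k * v f) = (\<lambda>f. proj01 J p u f + k * proj01 J p v f)"
    and proj_Z: "\<And>i p. i \<in> {1..n} \<Longrightarrow> proj10 J p (Z i p) = Z i p"
      "\<And>i p. i \<in> {1..n} \<Longrightarrow> proj01 J p (Z i p) = (\<lambda>f. 0)"
      "\<And>i p. i \<in> {1..n} \<Longrightarrow> proj10 J p (Zb i p) = (\<lambda>f. 0)"
      "\<And>i p. i \<in> {1..n} \<Longrightarrow> proj01 J p (Zb i p) = Zb i p"
    and bracket_frame: "\<And>l k m p. l \<in> {1..n} \<Longrightarrow> k \<in> {1..n} \<Longrightarrow> m \<in> {1..n} \<Longrightarrow>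
        ph m p [bracket A (Zb l) (Z k) p] = t l k m"
begin

lemma Z_ct: "i \<in> {1..n} \<Longrightarrow> Z i p \<in> ctangent A p" "i \<in> {1..n} \<Longrightarrow> Zb i p \<in> ctangent A p"
  using Z_smooth vfield_ct by blast+

lemma ph_sum:
  assumes "i \<in> {1..n}" "\<And>j. j \<in> I \<Longrightarrow> u j \<in> ctangent A p"
  shows "ph i p [\<lambda>f. \<Sum>j\<in>I. k j * u j f] = (\<Sum>j\<in>I. k j * ph i p [u j])"
  by (rule alt1_sum[OF ph_alt[OF assms(1)] assms(2)])

lemma phb_sum:
  assumes i: "i \<in> {1..n}" and u: "\<And>j. j \<in> I \<Longrightarrow> u j \<in> ctangent A p"
  shows "phb i p [\<lambda>f. \<Sum>j\<in>I. k j * u j f] = (\<Sum>j\<in>I. k j * phb i p [u j])"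
  using u
proof (induction I rule: infinite_finite_induct)
  case (insert j I)
  have "phb i p [\<lambda>f. (\<Sum>j\<in>I. k j * u j f) + k j * u j f] = phb i p [\<lambda>f. \<Sum>j\<in>I. k j * u j f] + k j * phb i p [u j]"
    by (rule phb_lin[OF i]) (use insert.prems ctangent_sum[of I u] in auto)
  then show ?case using insert by (simp add: add.commute)
qed (use phb_lin[OF i ctangent_zero ctangent_zero, of p "-1"] in simp_all)

lemma ph_Z_sum:
  assumes "m \<in> {1..n}"
  shows "ph m p [\<lambda>f. \<Sum>i=1..n. k i * Z i p f] = k m" "ph m p [\<lambda>f. \<Sum>i=1..n. k i * Zb i p f] = 0"
    "phb m p [\<lambda>f. \<Sum>i=1..n. k i * Z i p f] = 0" "phb m p [\<lambda>f. \<Sum>i=1..n. k i * Zb i p f] = k m"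
proof -
  have s: "(\<Sum>i=1..n. k i * (if i = m then 1 else 0)) = k m"
  proof -
    have "(\<Sum>i=1..n. k i * (if i = m then 1 else 0)) = (\<Sum>i=1..n. if i = m then k i else 0)"
      by (rule sum.cong) auto
    then show ?thesis using assms by simp
  qed
  have "(\<Sum>i=1..n. k i * ph m p [Z i p]) = (\<Sum>i=1..n. k i * (if i = m then 1 else 0))"
    "(\<Sum>i=1..n. k i * phb m p [Zb i p]) = (\<Sum>i=1..n. k i * (if i = m then 1 else 0))"
    by (intro sum.cong refl; simp only: ph_dual[OF _ assms])+
  then show "ph m p [\<lambda>f. \<Sum>i=1..n. k i * Z i p f] = k m" "phb m p [\<lambda>f. \<Sum>i=1..n. k i * Zb i p f] = k m"
    unfolding s by (simp_all only: ph_sum[OF assms Z_ct(1)] phb_sum[OF assms Z_ct(2)])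
  have "(\<Sum>i=1..n. k i * ph m p [Zb i p]) = 0" "(\<Sum>i=1..n. k i * phb m p [Z i p]) = 0"
    by (intro sum.neutral ballI; simp only: ph_dual[OF _ assms] mult_zero_right)+
  then show "ph m p [\<lambda>f. \<Sum>i=1..n. k i * Zb i p f] = 0" "phb m p [\<lambda>f. \<Sum>i=1..n. k i * Z i p f] = 0"
    by (simp_all only: ph_sum[OF assms Z_ct(2)] phb_sum[OF assms Z_ct(1)])
qed

lemma proj_sum:
  assumes "\<And>j. j \<in> I \<Longrightarrow> u j \<in> ctangent A p"
  shows "proj10 J p (\<lambda>f. \<Sum>j\<in>I. k j * u j f) = (\<lambda>f. \<Sum>j\<in>I. k j * proj10 J p (u j) f)"
    "proj01 J p (\<lambda>f. \<Sum>j\<in>I. k j * u j f) = (\<lambda>f. \<Sum>j\<in>I. k j * proj01 J p (u j) f)"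
proof -
  have z: "proj10 J p (\<lambda>f. 0) = (\<lambda>f. 0)" "proj01 J p (\<lambda>f. 0) = (\<lambda>f. 0)"
    using proj_lin[OF ctangent_zero ctangent_zero, of p "-1"] by simp_all
  have "proj10 J p (\<lambda>f. \<Sum>j\<in>I. k j * u j f) = (\<lambda>f. \<Sum>j\<in>I. k j * proj10 J p (u j) f) \<and>
    proj01 J p (\<lambda>f. \<Sum>j\<in>I. k j * u j f) = (\<lambda>f. \<Sum>j\<in>I. k j * proj01 J p (u j) f)"
    using assms
  proof (induction I rule: infinite_finite_induct)
    case (insert j I)
    have c: "(\<lambda>f. \<Sum>j\<in>I. k j * u j f) \<in> ctangent A p" "u j \<in> ctangent A p"
      using insert.prems by (auto intro: ctangent_sum)
    have "(\<lambda>f. \<Sum>j\<in>insert j I. k j * u j f) = (\<lambda>f. (\<Sum>j\<in>I. k j * u j f) + k j * u j f)"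
      using insert.hyps by (simp add: add.commute)
    then show ?case using insert proj_lin[OF c, of "k j"] by (simp add: add.commute)
  qed (simp_all add: z)
  then show "proj10 J p (\<lambda>f. \<Sum>j\<in>I. k j * u j f) = (\<lambda>f. \<Sum>j\<in>I. k j * proj10 J p (u j) f)"
    "proj01 J p (\<lambda>f. \<Sum>j\<in>I. k j * u j f) = (\<lambda>f. \<Sum>j\<in>I. k j * proj01 J p (u j) f)" by blast+
qed

text \<open>The redundant factor 1 gives the expansion the form \<open>u f + k * v f\<close> for
  which linearity is stated.\<close>

lemma expand':
  "u \<in> ctangent A p \<Longrightarrow> u = (\<lambda>f. (\<lambda>f. \<Sum>i=1..n. ph i p [u] * Z i p f) f + 1 * (\<lambda>f. \<Sum>i=1..n. phb i p [u] * Zb i p f) f)"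
  by (rule ext) (simp add: expand[of u])

lemma proj_expand:
  assumes u: "u \<in> ctangent A p"
  shows "proj10 J p u = (\<lambda>f. \<Sum>i=1..n. ph i p [u] * Z i p f)"
    "proj01 J p u = (\<lambda>f. \<Sum>i=1..n. phb i p [u] * Zb i p f)"
proof -
  have c: "(\<lambda>f. \<Sum>i=1..n. ph i p [u] * Z i p f) \<in> ctangent A p" "(\<lambda>f. \<Sum>i=1..n. phb i p [u] * Zb i p f) \<in> ctangent A p"
    by (intro ctangent_sum Z_ct; assumption)+
  have z: "proj10 J p (\<lambda>f. \<Sum>i=1..n. ph i p [u] * Z i p f) = (\<lambda>f. \<Sum>i=1..n. ph i p [u] * Z i p f)"
    "proj10 J p (\<lambda>f. \<Sum>i=1..n. phb i p [u] * Zb i p f) = (\<lambda>f. \<Sum>i=1..n. phb i p [u] * 0)"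
    "proj01 J p (\<lambda>f. \<Sum>i=1..n. ph i p [u] * Z i p f) = (\<lambda>f. \<Sum>i=1..n. ph i p [u] * 0)"
    "proj01 J p (\<lambda>f. \<Sum>i=1..n. phb i p [u] * Zb i p f) = (\<lambda>f. \<Sum>i=1..n. phb i p [u] * Zb i p f)"
    by (subst proj_sum, rule Z_ct, assumption, rule ext, rule sum.cong[OF refl], simp only: proj_Z)+
  show "proj10 J p u = (\<lambda>f. \<Sum>i=1..n. ph i p [u] * Z i p f)"
    by (subst expand'[OF u], subst proj_lin(1)[OF c]) (simp only: z mult_zero_right sum.neutral_const add_0_right mult_1)
  show "proj01 J p u = (\<lambda>f. \<Sum>i=1..n. phb i p [u] * Zb i p f)"
    by (subst expand'[OF u], subst proj_lin(2)[OF c]) (simp only: z mult_zero_right sum.neutral_const add_0_left mult_1)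
qed

lemma ph_proj:
  assumes u: "u \<in> ctangent A p" and m: "m \<in> {1..n}"
  shows "ph m p [proj10 J p u] = ph m p [u]" "ph m p [proj01 J p u] = 0"
    "phb m p [proj01 J p u] = phb m p [u]"
  unfolding proj_expand[OF u] by (rule ph_Z_sum[OF m])+

lemma proj_proj:
  assumes u: "u \<in> ctangent A p"
  shows "proj10 J p (proj10 J p u) = proj10 J p u" "proj10 J p (proj01 J p u) = (\<lambda>f. 0)"
    "proj01 J p (proj01 J p u) = proj01 J p u"
  unfolding proj_expand[OF proj_ct(1)[OF u]] proj_expand[OF proj_ct(2)[OF u]]
  by (simp_all add: ph_proj[OF u] flip: proj_expand[OF u] del: One_nat_def)

text \<open>Lists count from 0 and the frame from 1, so entry \<open>i\<close> is
  \<open>Z (Suc i)\<close>.\<close>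

definition Zs :: "'m vfield list" where "Zs = map Z [1..<Suc n]"

lemma Zs_facts: "length Zs = n" "i < n \<Longrightarrow> Zs ! i = Z (Suc i)" "X \<in> set Zs \<Longrightarrow> smooth_vfield A X"
  using Z_smooth by (auto simp: Zs_def simp del: upt_Suc)

lemma Zs_at: "length (at_point Zs p) = n" "i < n \<Longrightarrow> at_point Zs p ! i = Z (Suc i) p"
  by (simp_all add: Zs_facts)

lemma Zs_tvecs: "at_point Zs p \<in> tvecs A n p"
  using Zs_facts vfield_ct by (auto simp: tvecs_def)

definition Phi :: "'m form" where "Phi = wedge_list A (map ph [1..<Suc n])"

lemma Phi_list: "length (map ph [1..<Suc n]) = n" "i < n \<Longrightarrow> map ph [1..<Suc n] ! i = ph (Suc i)"
  by (simp_all del: upt_Suc)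

lemma Phi_alt: "Phi p \<in> alt_forms A n p"
  using wedge_list_alt[of "map ph [1..<Suc n]" p] ph_alt unfolding Phi_def Phi_list
  by (simp add: Phi_list del: upt_Suc)

lemma Phi_kill:
  assumes "vs \<in> tvecs A n p" "k < n" "\<And>i. i \<in> {1..n} \<Longrightarrow> ph i p [vs ! k] = 0"
  shows "Phi p vs = 0"
  unfolding Phi_def by (rule wedge_list_kill[where k = k]) (use assms in \<open>simp_all add: Phi_list del: upt_Suc\<close>)

lemma Phi_cong:
  assumes "vs \<in> tvecs A n p" "ws \<in> tvecs A n q"
    "\<And>i j. i \<in> {1..n} \<Longrightarrow> j < n \<Longrightarrow> ph i p [vs ! j] = ph i q [ws ! j]"
  shows "Phi p vs = Phi q ws"
  unfolding Phi_def by (rule wedge_list_cong) (use assms in \<open>simp_all add: Phi_list del: upt_Suc\<close>)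

text \<open>The matrix of values is the identity, so only the identity permutation
  contributes.\<close>

lemma Phi_Zs: "Phi p (at_point Zs p) = 1"
proof -
  have p: "(\<Prod>i<n. ph (Suc i) p [at_point Zs p ! \<sigma> i]) = (if \<sigma> = id then 1 else 0)" if s: "\<sigma> permutes {..<n}" for \<sigma>
  proof -
    have f: "ph (Suc i) p [at_point Zs p ! \<sigma> i] = (if \<sigma> i = i then 1 else 0)" if i: "i < n" for i
    proof -
      have "\<sigma> i < n" using permutes_in_image[OF s] i by simp
      then show ?thesis using i by (simp add: Zs_at ph_dual)
    qed
    show ?thesis
    proof (cases "\<sigma> = id")
      case False
      then obtain i where "\<sigma> i \<noteq> i" by (metis eq_id_iff ext)
      moreover then have "i < n" using permutes_not_in[OF s] by fastforce
      ultimately show ?thesis using False f by (auto intro!: prod_zero bexI[of _ i])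
    qed (use f in simp)
  qed
  have "Phi p (at_point Zs p) = (\<Sum>\<sigma> | \<sigma> permutes {..<n}. of_int (sign \<sigma>) * (\<Prod>i<n. ph (Suc i) p [at_point Zs p ! \<sigma> i]))"
    unfolding Phi_def using wedge_list_apply[of "at_point Zs p" "map ph [1..<Suc n]" p] Zs_tvecs
    by (simp add: Phi_list del: upt_Suc)
  also have "\<dots> = (\<Sum>\<sigma> | \<sigma> permutes {..<n}. if \<sigma> = id then 1 else 0)"
    by (rule sum.cong) (auto simp: p)
  also have "\<dots> = 1" using permutes_id[of "{..<n}"] by (simp add: finite_permutations)
  finally show ?thesis .
qed

lemma Phi_smooth:
  assumes "length Xs = n" "\<And>X. X \<in> set Xs \<Longrightarrow> smooth_vfield A X"
  shows "smooth_at A p (\<lambda>q. Phi q (at_point Xs q))"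
proof -
  have t: "at_point Xs q \<in> tvecs A n q" for q using assms vfield_ct by (auto simp: tvecs_def)
  have "smooth_at A p (\<lambda>q. \<Sum>\<sigma> | \<sigma> permutes {..<n}. of_int (sign \<sigma>) * (\<Prod>i<n. ph (Suc i) q [(Xs ! \<sigma> i) q]))"
  proof (intro smooth_at_sum smooth_at_cmult smooth_at_prod ph_smooth(1))
    fix \<sigma> i assume "\<sigma> \<in> {\<sigma>. \<sigma> permutes {..<n}}" "i \<in> {..<n}"
    then have "\<sigma> i < n" "i < n" using permutes_in_image[of \<sigma> "{..<n}" i] by auto
    then show "Suc i \<in> {1..n}" "smooth_vfield A (Xs ! \<sigma> i)" using assms by auto
  qed
  moreover have "(\<lambda>q. \<Sum>\<sigma> | \<sigma> permutes {..<n}. of_int (sign \<sigma>) * (\<Prod>i<n. ph (Suc i) q [(Xs ! \<sigma> i) q])) = (\<lambda>q. Phi q (at_point Xs q))"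
  proof
    fix q
    have "Phi q (at_point Xs q) = (\<Sum>\<sigma> | \<sigma> permutes {..<n}. of_int (sign \<sigma>) * (\<Prod>i<n. ph (Suc i) q [at_point Xs q ! \<sigma> i]))"
      unfolding Phi_def using wedge_list_apply[of "at_point Xs q" "map ph [1..<Suc n]" q] t
      by (simp add: Phi_list del: upt_Suc)
    also have "\<dots> = (\<Sum>\<sigma> | \<sigma> permutes {..<n}. of_int (sign \<sigma>) * (\<Prod>i<n. ph (Suc i) q [(Xs ! \<sigma> i) q]))"
    proof (intro sum.cong refl arg_cong2[where f = "(*)"] prod.cong)
      fix \<sigma> i assume "\<sigma> \<in> {\<sigma>. \<sigma> permutes {..<n}}" "i \<in> {..<n}"
      then have "\<sigma> i < n" using permutes_in_image[of \<sigma> "{..<n}" i] by auto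
      then show "ph (Suc i) q [at_point Xs q ! \<sigma> i] = ph (Suc i) q [(Xs ! \<sigma> i) q]" using assms by simp
    qed
    finally show "(\<Sum>\<sigma> | \<sigma> permutes {..<n}. of_int (sign \<sigma>) * (\<Prod>i<n. ph (Suc i) q [(Xs ! \<sigma> i) q])) = Phi q (at_point Xs q)" ..
  qed
  ultimately show ?thesis by simp
qed

text \<open>Expanding one slot in the frame leaves only the vectors \<open>Z k\<close>, since a
  \<open>Zb k\<close> in any slot kills the form. Once every slot holds some \<open>Z k\<close>, a
  repeated index gives 0 and distinct indices give a permutation of \<open>Zs\<close>.\<close>

lemma alt_unique:
  assumes a: "a \<in> alt_forms A n p"
    and kill: "\<And>vs i k. vs \<in> tvecs A n p \<Longrightarrow> i < n \<Longrightarrow> k \<in> {1..n} \<Longrightarrow> a (vs[i := Zb k p]) = 0"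
    and Zs: "a (at_point Zs p) = 0"
  shows "a vs = 0"
proof -
  have perm: "a (map (\<lambda>i. Z (Suc (\<pi> i)) p) [0..<n]) = 0" if "\<pi> permutes {..<n}" for \<pi>
    using finite_lessThan[of n] that
  proof (induction rule: permutes_rev_induct)
    case id
    have "map (\<lambda>i. Z (Suc (id i)) p) [0..<n] = at_point Zs p"
      by (rule nth_equalityI) (auto simp: Zs_at Zs_facts)
    then show ?case using Zs by simp
  next
    case (swap x y \<pi>)
    let ?l = "map (\<lambda>i. Z (Suc (\<pi> i)) p) [0..<n]"
    have "\<pi> i < n" if "i < n" for i using permutes_in_image[OF swap(4), of i] that by simp
    then have l: "?l \<in> tvecs A n p" by (intro map_tvecs Z_ct) (simp add: Suc_le_eq)
    have xy: "x < n" "y < n" "x \<noteq> y" using swap(1-3) by auto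
    have "?l[x := ?l ! y, y := ?l ! x] = map (\<lambda>i. Z (Suc ((\<pi> \<circ> Transposition.transpose x y) i)) p) [0..<n]"
      by (rule nth_equalityI) (use xy in \<open>auto simp: nth_list_update Transposition.transpose_def\<close>)
    then show ?case using alt_swap[OF a l xy] swap(5) by simp
  qed
  have basis: "a (map (\<lambda>i. Z (Suc (\<pi> i)) p) [0..<n]) = 0" if r: "\<And>i. i < n \<Longrightarrow> \<pi> i < n" for \<pi>
  proof (cases "inj_on \<pi> {..<n}")
    case True
    let ?\<pi> = "\<lambda>i. if i < n then \<pi> i else i"
    have "bij_betw ?\<pi> {..<n} {..<n}"
    proof -
      have inj: "inj_on ?\<pi> {..<n}" using True by (auto simp: inj_on_def)
      have "?\<pi> ` {..<n} \<subseteq> {..<n}" using r by auto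
      then show ?thesis using endo_inj_surj[OF finite_lessThan _ inj] inj by (simp add: bij_betw_def)
    qed
    then have "?\<pi> permutes {..<n}" by (rule bij_imp_permutes) auto
    moreover have "map (\<lambda>i. Z (Suc (?\<pi> i)) p) [0..<n] = map (\<lambda>i. Z (Suc (\<pi> i)) p) [0..<n]"
      by (rule map_cong[OF refl]) simp
    ultimately show ?thesis using perm[of ?\<pi>] by metis
  next
    case False
    then obtain i j where ij: "i < n" "j < n" "i \<noteq> j" "\<pi> i = \<pi> j" by (auto simp: inj_on_def)
    have "map (\<lambda>i. Z (Suc (\<pi> i)) p) [0..<n] \<in> tvecs A n p"
      by (intro map_tvecs Z_ct) (simp add: r Suc_le_eq)
    from alt_eq[OF a this ij(1-3)] ij show ?thesis by simp
  qed
  \<comment> \<open>Here \<open>m\<close> counts the leading slots that are still arbitrary; from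
    slot \<open>m\<close> on the entries are vectors \<open>Z k\<close>.\<close>
  have "m \<le> n \<Longrightarrow> vs \<in> tvecs A n p \<Longrightarrow> (\<forall>i<n. m \<le> i \<longrightarrow> (\<exists>k<n. vs ! i = Z (Suc k) p)) \<Longrightarrow> a vs = 0" for m vs
  proof (induction m arbitrary: vs)
    case 0
    define \<pi> where "\<pi> i = (SOME k. k < n \<and> vs ! i = Z (Suc k) p)" for i
    have \<pi>: "\<pi> i < n \<and> vs ! i = Z (Suc (\<pi> i)) p" if "i < n" for i
      unfolding \<pi>_def by (rule someI_ex) (use 0(3) that in simp)
    have "vs = map (\<lambda>i. Z (Suc (\<pi> i)) p) [0..<n]"
      using 0(2) \<pi> by (intro nth_equalityI) (auto simp: tvecs_def)
    then show ?case using basis[of \<pi>] \<pi> by simp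
  next
    case (Suc m)
    have m: "m < n" using Suc.prems by simp
    let ?u = "vs ! m"
    have u: "?u \<in> ctangent A p" by (rule tvecs_nth[OF Suc.prems(2) m])
    have len: "length vs = n" using Suc.prems(2) by (simp add: tvecs_def)
    have c: "(\<lambda>f. \<Sum>i=1..n. ph i p [?u] * Z i p f) \<in> ctangent A p" "(\<lambda>f. \<Sum>i=1..n. phb i p [?u] * Zb i p f) \<in> ctangent A p"
      by (intro ctangent_sum Z_ct; assumption)+
    have "a vs = a (vs[m := ?u])" by simp
    also have "\<dots> = a (vs[m := (\<lambda>f. (\<lambda>f. \<Sum>i=1..n. ph i p [?u] * Z i p f) f + 1 * (\<lambda>f. \<Sum>i=1..n. phb i p [?u] * Zb i p f) f)])"
      by (subst expand'[OF u]) (rule refl)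
    also have "\<dots> = a (vs[m := \<lambda>f. \<Sum>i=1..n. ph i p [?u] * Z i p f]) + 1 * a (vs[m := \<lambda>f. \<Sum>i=1..n. phb i p [?u] * Zb i p f])"
      by (rule alt_lin[OF a Suc.prems(2) m c])
    also have "\<dots> = (\<Sum>i=1..n. ph i p [?u] * a (vs[m := Z i p])) + (\<Sum>i=1..n. phb i p [?u] * a (vs[m := Zb i p]))"
      by (simp only: alt_sum[OF a Suc.prems(2) m Z_ct(1)] alt_sum[OF a Suc.prems(2) m Z_ct(2)] mult_1)
    also have "\<dots> = 0"
    proof -
      have "a (vs[m := Z i p]) = 0" if i: "i \<in> {1..n}" for i
      proof (rule Suc.IH)
        show "m \<le> n" using m by simp
        show "vs[m := Z i p] \<in> tvecs A n p" by (rule tvecs_update[OF Suc.prems(2) Z_ct(1)[OF i]])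
        show "\<forall>j<n. m \<le> j \<longrightarrow> (\<exists>k<n. vs[m := Z i p] ! j = Z (Suc k) p)"
        proof (intro allI impI)
          fix j assume j: "j < n" "m \<le> j"
          show "\<exists>k<n. vs[m := Z i p] ! j = Z (Suc k) p"
          proof (cases "j = m")
            case True
            then show ?thesis using i m len by (intro exI[of _ "i - 1"]) auto
          qed (use j Suc.prems(3) in auto)
        qed
      qed
      moreover have "a (vs[m := Zb i p]) = 0" if i: "i \<in> {1..n}" for i by (rule kill[OF Suc.prems(2) m i])
      ultimately show ?thesis by simp
    qed
    finally show ?case .
  qed
  from this[of n vs] show ?thesis using alt_off[OF a, of vs] by auto
qed

text \<open>The endomorphism that sends \<open>Z k\<close> to \<open>B k\<close> and each
  \<open>Zb k\<close> to 0 acts on forms as a derivation, and on the line spanned by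
  \<open>Phi\<close> this is multiplication by its trace. Both sides alternate and vanish on the
  \<open>Zb k\<close>, so \<open>alt_unique\<close> leaves only a comparison on
  \<open>Zs\<close>.\<close>

lemma Phi_trace:
  assumes B: "\<And>k. k \<in> {1..n} \<Longrightarrow> B k \<in> ctangent A p" and vs: "vs \<in> tvecs A n p"
  shows "(\<Sum>i<n. Phi p (vs[i := (\<lambda>f. \<Sum>k=1..n. ph k p [vs ! i] * B k f)])) = (\<Sum>k=1..n. ph k p [B k]) * Phi p vs"
proof -
  define T where "T v = (\<lambda>f. \<Sum>k=1..n. ph k p [v] * B k f)" for v
  define tr where "tr = (\<Sum>k=1..n. ph k p [B k])"
  have Tc: "T v \<in> ctangent A p" for v unfolding T_def by (rule ctangent_sum[OF B])
  have Tlin: "T (\<lambda>f. u f + c * v f) = (\<lambda>f. T u f + c * T v f)" if "u \<in> ctangent A p" "v \<in> ctangent A p" for u v c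
    unfolding T_def
    by (rule ext) (simp add: alt1_lin[OF ph_alt that] distrib_right sum.distrib sum_distrib_left mult.assoc)
  define D where "D vs = (if vs \<in> tvecs A n p then (\<Sum>i<n. Phi p (vs[i := T (vs ! i)])) else 0)" for vs
  have Dalt: "D \<in> alt_forms A n p"
  proof -
    have lin: "D (vs[j := (\<lambda>f. u f + c * v f)]) = D (vs[j := u]) + c * D (vs[j := v])"
      if vs: "vs \<in> tvecs A n p" and j: "j < n" and u: "u \<in> ctangent A p" and v: "v \<in> ctangent A p" for vs j u v c
    proof -
      have len: "length vs = n" using vs by (simp add: tvecs_def)
      have "Phi p (vs[j := (\<lambda>f. u f + c * v f), i := T (vs[j := (\<lambda>f. u f + c * v f)] ! i)]) =
          Phi p (vs[j := u, i := T (vs[j := u] ! i)]) + c * Phi p (vs[j := v, i := T (vs[j := v] ! i)])" if i: "i < n" for i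
      proof (cases "i = j")
        case True
        then show ?thesis using alt_lin[OF Phi_alt vs j Tc Tc, of u c v] j len by (simp add: Tlin[OF u v])
      next
        case False
        then have "vs[j := w, i := T (vs[j := w] ! i)] = vs[i := T (vs ! i), j := w]" for w
          by (simp add: list_update_swap)
        then show ?thesis using alt_lin[OF Phi_alt tvecs_update[OF vs Tc] j u v] by simp
      qed
      then show ?thesis
        unfolding D_def using tvecs_update[OF vs] u v ctangent_lin[OF u v, of c]
        by (simp add: sum.distrib sum_distrib_left)
    qed
    have eq: "D vs = 0" if vs: "vs \<in> tvecs A n p" and ij: "i < n" "j < n" "i \<noteq> j" "vs ! i = vs ! j" for vs i j
    proof -
      have len: "length vs = n" using vs by (simp add: tvecs_def)
      \<comment> \<open>Terms that modify neither of the two equal slots still have a repeated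
        argument and vanish; the other two differ by one swap.\<close>
      let ?F = "\<lambda>k. Phi p (vs[k := T (vs ! k)])"
      have "?F k = 0" if "k < n" "k \<noteq> i" "k \<noteq> j" for k
        by (rule alt_eq[OF Phi_alt tvecs_update[OF vs Tc] ij(1-3)]) (use that ij in auto)
      then have "(\<Sum>k\<in>{..<n} - {i, j}. ?F k) = 0" by (intro sum.neutral) auto
      then have "(\<Sum>k<n. ?F k) = (\<Sum>k\<in>{i, j}. ?F k)"
        using sum.subset_diff[of "{i, j}" "{..<n}" ?F] ij by simp
      also have "\<dots> = ?F i + ?F j" using ij by simp
      also have "?F j = - ?F i"
      proof -
        let ?w = "vs[i := T (vs ! i)]"
        have "?w[i := ?w ! j, j := ?w ! i] = vs[j := T (vs ! j)]"
          using ij len by (intro nth_equalityI) (auto simp: nth_list_update)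
        then show ?thesis using alt_swap[OF Phi_alt tvecs_update[OF vs Tc] ij(1-3), of i "vs ! i"] by simp
      qed
      finally show ?thesis unfolding D_def using vs by simp
    qed
    show ?thesis unfolding alt_forms_def using lin eq by (auto simp: D_def)
  qed
  have Talt: "(\<lambda>vs. D vs + (- tr) * Phi p vs) \<in> alt_forms A n p" by (rule alt_forms_lin[OF Dalt Phi_alt])
  have "D vs + (- tr) * Phi p vs = 0" for vs
  proof (rule alt_unique[OF Talt])
    fix vs i k assume vs: "vs \<in> tvecs A n p" and i: "i < n" and k: "k \<in> {1..n}"
    let ?w = "vs[i := Zb k p]"
    have len: "length vs = n" using vs by (simp add: tvecs_def)
    have w: "?w \<in> tvecs A n p" by (rule tvecs_update[OF vs Z_ct(2)[OF k]])
    have z: "ph m p [?w ! i] = 0" if m: "m \<in> {1..n}" for m using i len ph_dual(2)[OF k m] by simp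
    have "Phi p (?w[j := T (?w ! j)]) = 0" if j: "j < n" for j
    proof (rule Phi_kill[OF tvecs_update[OF w Tc] i])
      fix m assume m: "m \<in> {1..n}"
      have "T (?w ! i) = (\<lambda>f. 0)" unfolding T_def using z by simp
      then show "ph m p [?w[j := T (?w ! j)] ! i] = 0"
        using z[OF m] i len alt1_zero[OF ph_alt[OF m]] by (cases "j = i") auto
    qed
    moreover have "Phi p ?w = 0" by (rule Phi_kill[OF w i]) (rule z)
    ultimately show "D ?w + (- tr) * Phi p ?w = 0" unfolding D_def using w by simp
  next
    let ?z = "at_point Zs p"
    \<comment> \<open>Of the components of \<open>B (Suc i)\<close> only the one along
      \<open>Z (Suc i)\<close> counts: the other \<open>Z j\<close> repeat an argument and the
      \<open>Zb j\<close> are annihilated.\<close>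
    have "Phi p (?z[i := T (?z ! i)]) = ph (Suc i) p [B (Suc i)]" if i: "i < n" for i
    proof -
      have Si: "Suc i \<in> {1..n}" using i by simp
      have "T (?z ! i) = (\<lambda>f. \<Sum>k=1..n. (if Suc i = k then 1 else 0) * B k f)"
        unfolding T_def Zs_at(2)[OF i] by (rule ext, rule sum.cong[OF refl]) (simp only: ph_dual(1)[OF Si])
      also have "\<dots> = B (Suc i)"
      proof
        fix f
        have "(\<Sum>k=1..n. (if Suc i = k then 1 else 0) * B k f) = (\<Sum>k=1..n. if k = Suc i then B k f else 0)"
          by (rule sum.cong) auto
        then show "(\<Sum>k=1..n. (if Suc i = k then 1 else 0) * B k f) = B (Suc i) f" using Si by simp
      qed
      finally have T: "T (?z ! i) = B (Suc i)" .
      have Bc: "B (Suc i) \<in> ctangent A p" by (rule B[OF Si])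
      have c: "(\<lambda>f. \<Sum>j=1..n. ph j p [B (Suc i)] * Z j p f) \<in> ctangent A p"
        "(\<lambda>f. \<Sum>j=1..n. phb j p [B (Suc i)] * Zb j p f) \<in> ctangent A p"
        by (intro ctangent_sum Z_ct; assumption)+
      have "Phi p (?z[i := B (Suc i)]) = Phi p (?z[i := (\<lambda>f. (\<lambda>f. \<Sum>j=1..n. ph j p [B (Suc i)] * Z j p f) f + 1 * (\<lambda>f. \<Sum>j=1..n. phb j p [B (Suc i)] * Zb j p f) f)])"
        by (subst expand'[OF Bc]) (rule refl)
      also have "\<dots> = Phi p (?z[i := (\<lambda>f. \<Sum>j=1..n. ph j p [B (Suc i)] * Z j p f)]) +
          1 * Phi p (?z[i := (\<lambda>f. \<Sum>j=1..n. phb j p [B (Suc i)] * Zb j p f)])"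
        by (rule alt_lin[OF Phi_alt Zs_tvecs i c])
      also have "\<dots> = (\<Sum>j=1..n. ph j p [B (Suc i)] * Phi p (?z[i := Z j p])) +
          (\<Sum>j=1..n. phb j p [B (Suc i)] * Phi p (?z[i := Zb j p]))"
        by (simp only: alt_sum[OF Phi_alt Zs_tvecs i Z_ct(1)] alt_sum[OF Phi_alt Zs_tvecs i Z_ct(2)] mult_1)
      also have "(\<Sum>j=1..n. phb j p [B (Suc i)] * Phi p (?z[i := Zb j p])) = 0"
      proof (rule sum.neutral, rule ballI)
        fix j assume j: "j \<in> {1..n}"
        have "Phi p (?z[i := Zb j p]) = 0"
          by (rule Phi_kill[OF tvecs_update[OF Zs_tvecs Z_ct(2)[OF j]] i]) (use i j in \<open>simp add: Zs_at Zs_facts ph_dual(2)\<close>)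
        then show "phb j p [B (Suc i)] * Phi p (?z[i := Zb j p]) = 0" by simp
      qed
      also have "(\<Sum>j=1..n. ph j p [B (Suc i)] * Phi p (?z[i := Z j p])) = (\<Sum>j=1..n. if j = Suc i then ph j p [B (Suc i)] else 0)"
      proof (rule sum.cong[OF refl])
        fix j assume j: "j \<in> {1..n}"
        have "Phi p (?z[i := Z j p]) = (if j = Suc i then 1 else 0)"
        proof (cases "j = Suc i")
          case True
          then have "?z[i := Z j p] = ?z" using Zs_at(2)[OF i, of p] by (metis list_update_id)
          then show ?thesis using True Phi_Zs by simp
        next
          case False
          have "Phi p (?z[i := Z j p]) = 0"
            by (rule alt_eq[OF Phi_alt tvecs_update[OF Zs_tvecs Z_ct(1)[OF j]], of i "j - 1"])
              (use i j False in \<open>auto simp: Zs_at Zs_facts nth_list_update\<close>)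
          then show ?thesis using False by simp
        qed
        then show "ph j p [B (Suc i)] * Phi p (?z[i := Z j p]) = (if j = Suc i then ph j p [B (Suc i)] else 0)" by simp
      qed
      finally show ?thesis unfolding T using Si by simp
    qed
    then have "D ?z = (\<Sum>i<n. ph (Suc i) p [B (Suc i)])" unfolding D_def using Zs_tvecs by simp
    also have "\<dots> = tr" unfolding tr_def
      by (rule sum.reindex_bij_witness[of _ "\<lambda>i. i - 1" Suc]) auto
    finally show "D ?z + (- tr) * Phi p ?z = 0" by (simp add: Phi_Zs)
  qed
  then have "D vs = tr * Phi p vs" by simp
  then show ?thesis unfolding D_def tr_def T_def using vs by simp
qed

end

section \<open>The exterior derivative of forms of type (n,0)\<close>

lemma Ball_delete_nth: "\<forall>x\<in>set xs. P x \<Longrightarrow> \<forall>x\<in>set (delete_nth i xs). P x"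
  using set_delete_nth[of i xs] by blast

lemma sum_split_at:
  fixes f :: "nat \<Rightarrow> complex"
  assumes "k < N"
  shows "(\<Sum>i<N. f i) = (\<Sum>i<k. f i) + f k + (\<Sum>i\<in>{k<..<N}. f i)"
proof -
  have "{..<N} = {..<k} \<union> insert k {k<..<N}" using assms by auto
  then have "(\<Sum>i<N. f i) = (\<Sum>i\<in>{..<k} \<union> insert k {k<..<N}. f i)" by (rule arg_cong)
  also have "\<dots> = (\<Sum>i<k. f i) + (\<Sum>i\<in>insert k {k<..<N}. f i)" by (rule sum.union_disjoint) auto
  finally show ?thesis by (simp add: add.assoc)
qed

text \<open>In both applications to the Koszul formula only pairs that involve one distinguished
  slot \<open>k\<close> contribute.\<close>

lemma pair_sum:
  fixes f :: "nat \<Rightarrow> nat \<Rightarrow> complex"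
  assumes k: "k < N" and z: "\<And>i j. i < j \<Longrightarrow> j < N \<Longrightarrow> i \<noteq> k \<Longrightarrow> j \<noteq> k \<Longrightarrow> f i j = 0"
  shows "(\<Sum>(i, j) | i < j \<and> j < N. f i j) = (\<Sum>i<k. f i k) + (\<Sum>j\<in>{k<..<N}. f k j)"
proof -
  let ?P = "{(i, j). i < j \<and> j < N}"
  let ?A = "(\<lambda>i. (i, k)) ` {..<k}" and ?B = "(\<lambda>j. (k, j)) ` {k<..<N}"
  have fin: "finite ?P" by (rule finite_subset[of _ "{..<N} \<times> {..<N}"]) auto
  have "sum (\<lambda>(i, j). f i j) ?P = sum (\<lambda>(i, j). f i j) (?A \<union> ?B)"
  proof (rule sum.mono_neutral_right[OF fin])
    show "?A \<union> ?B \<subseteq> ?P" using k by auto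
    show "\<forall>x\<in>?P - (?A \<union> ?B). (case x of (i, j) \<Rightarrow> f i j) = 0"
    proof
      fix x assume x: "x \<in> ?P - (?A \<union> ?B)"
      obtain i j where ij: "x = (i, j)" by (cases x)
      have "i < j" "j < N" "i \<noteq> k" "j \<noteq> k" using x unfolding ij by auto
      then show "(case x of (i, j) \<Rightarrow> f i j) = 0" unfolding ij by (simp add: z)
    qed
  qed
  also have "\<dots> = sum (\<lambda>(i, j). f i j) ?A + sum (\<lambda>(i, j). f i j) ?B"
    by (rule sum.union_disjoint) auto
  also have "sum (\<lambda>(i, j). f i j) ?A = (\<Sum>i<k. f i k)" by (subst sum.reindex) (auto simp: inj_on_def)
  also have "sum (\<lambda>(i, j). f i j) ?B = (\<Sum>j\<in>{k<..<N}. f k j)" by (subst sum.reindex) (auto simp: inj_on_def)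
  finally show ?thesis .
qed

context smooth_manifold
begin

lemma at_point_tvecs:
  "length Xs = k \<Longrightarrow> \<forall>X\<in>set Xs. smooth_vfield A X \<Longrightarrow> at_point Xs p \<in> tvecs A k p"
  using vfield_ct by (auto simp: tvecs_def)

lemma alt_head_lin:
  assumes a: "a \<in> alt_forms A (Suc k) p" and "u \<in> ctangent A p" "v \<in> ctangent A p" "vs \<in> tvecs A k p"
  shows "a ((\<lambda>f. u f + c * v f) # vs) = a (u # vs) + c * a (v # vs)"
proof -
  have "u # vs \<in> tvecs A (Suc k) p" using assms by (simp add: tvecs_Cons)
  from alt_lin[OF a this zero_less_Suc assms(2,3), of c] show ?thesis by simp
qed

end

context complex_frame
begin

text \<open>One family indexed by \<open>bool \<times> nat\<close>, so that the expansion in the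
  full frame is a single sum.\<close>

definition frame_field :: "bool \<times> nat \<Rightarrow> 'm vfield" where "frame_field j = (if fst j then Z (snd j) else Zb (snd j))"
definition frame_coeff :: "bool \<times> nat \<Rightarrow> 'm form" where "frame_coeff j = (if fst j then ph (snd j) else phb (snd j))"
abbreviation frame_index :: "(bool \<times> nat) set" where "frame_index \<equiv> UNIV \<times> {1..n}"

lemma frame_field_smooth: "j \<in> frame_index \<Longrightarrow> smooth_vfield A (frame_field j)"
  using Z_smooth by (auto simp: frame_field_def)

lemma frame_coeff_smooth: "j \<in> frame_index \<Longrightarrow> smooth_vfield A X \<Longrightarrow> smooth_at A p (\<lambda>q. frame_coeff j q [X q])"
  using ph_smooth by (auto simp: frame_coeff_def)

lemma frame_field_expand:
  assumes "u \<in> ctangent A p"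
  shows "u f = (\<Sum>j\<in>frame_index. frame_coeff j p [u] * frame_field j p f)"
proof -
  have "(\<Sum>j\<in>frame_index. frame_coeff j p [u] * frame_field j p f) = (\<Sum>b\<in>UNIV. \<Sum>i=1..n. frame_coeff (b, i) p [u] * frame_field (b, i) p f)"
    by (simp add: sum.cartesian_product)
  also have "\<dots> = u f" unfolding expand[OF assms, of f] by (simp add: UNIV_bool frame_coeff_def frame_field_def)
  finally show ?thesis ..
qed

text \<open>Write \<open>X - X' = \<Sum>\<^sub>j y\<^sub>j F\<^sub>j\<close> in the frame, with \<open>y\<^sub>j\<close> vanishing at \<open>p\<close>.  Exchanging \<open>X'\<close> for \<open>X\<close> then
  changes both sums of the Koszul formula through the vectors \<open>\<Sum>\<^sub>j W(y\<^sub>j) F\<^sub>j(p)\<close> only, once from the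
  derivative and once from the bracket, and these changes cancel.\<close>

lemma koszul_step:
  assumes s_alt: "\<And>q. s q \<in> alt_forms A k q"
    and s_sm: "\<And>Xs p. length Xs = k \<Longrightarrow> \<forall>X\<in>set Xs. smooth_vfield A X \<Longrightarrow> smooth_at A p (\<lambda>q. s q (at_point Xs q))"
    and Xs: "length Xs = Suc k" "\<forall>X\<in>set Xs. smooth_vfield A X"
    and X: "smooth_vfield A X" and k0: "k0 < Suc k" and Xp: "X p = (Xs ! k0) p"
  shows "koszul A s (Xs[k0 := X]) p = koszul A s Xs p"
proof -
  define X' where "X' = Xs ! k0"
  define Ys where "Ys = Xs[k0 := X]"
  have X': "smooth_vfield A X'" using Xs k0 by (simp add: X'_def)
  define y where "y j q = frame_coeff j q [X q] - frame_coeff j q [X' q]" for j q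
  have ysm: "smooth_at A q (y j)" if "j \<in> frame_index" for j q
    unfolding y_def by (intro smooth_at_diff frame_coeff_smooth that X X')
  have yp: "y j p = 0" for j using Xp by (simp add: y_def X'_def)
  have FFc: "frame_field j q \<in> ctangent A q" if "j \<in> frame_index" for j q using frame_field_smooth[OF that] by (rule vfield_ct)
  have yc: "(\<lambda>f. \<Sum>j\<in>frame_index. y j q * frame_field j q f) \<in> ctangent A q" for q by (rule ctangent_sum[OF FFc])
  have Xexp: "X q = (\<lambda>f. X' q f + 1 * (\<lambda>f. \<Sum>j\<in>frame_index. y j q * frame_field j q f) f)" for q
  proof
    fix f
    show "X q f = X' q f + 1 * (\<lambda>f. \<Sum>j\<in>frame_index. y j q * frame_field j q f) f"
      unfolding frame_field_expand[OF vfield_ct[OF X], of q f] frame_field_expand[OF vfield_ct[OF X'], of q f]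
      by (simp add: y_def left_diff_distrib sum_subtractf)
  qed
  define u where "u W = (\<lambda>f. \<Sum>j\<in>frame_index. W p (y j) * frame_field j p f)" for W :: "'m vfield"
  have uc: "u W \<in> ctangent A p" for W unfolding u_def by (rule ctangent_sum[OF FFc])
  \<comment> \<open>The form is linear over functions, and each \<open>y j\<close> vanishes at
    \<open>p\<close>; the product rule therefore leaves only the terms in which \<open>y j\<close>
    is differentiated.\<close>
  have a: "W p (\<lambda>q. s q (at_point (Ls[i := X]) q)) =
      W p (\<lambda>q. s q (at_point (Ls[i := X']) q)) + s p ((at_point Ls p)[i := u W])"
    if Ls: "length Ls = k" "\<forall>X\<in>set Ls. smooth_vfield A X" and i: "i < k" and W: "smooth_vfield A W" for Ls i W
  proof -
    have Lt: "at_point Ls q \<in> tvecs A k q" for q by (rule at_point_tvecs[OF Ls])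
    note Wc = vfield_ct[OF W, of p]
    have up: "smooth_at A p (\<lambda>q. s q ((at_point Ls q)[i := V q]))" if "smooth_vfield A V" for V
    proof -
      have "\<forall>X\<in>set (Ls[i := V]). smooth_vfield A X" using Ls that set_update_subset_insert by fastforce
      from s_sm[OF _ this, of p] Ls(1) show ?thesis by (simp add: map_update)
    qed
    have sum: "smooth_at A p (\<lambda>q. \<Sum>j\<in>frame_index. y j q * s q ((at_point Ls q)[i := frame_field j q]))"
      by (rule smooth_at_sum) (rule smooth_at_mult[OF ysm up[OF frame_field_smooth]])
    have e: "s q ((at_point Ls q)[i := X q]) =
        s q ((at_point Ls q)[i := X' q]) + (\<Sum>j\<in>frame_index. y j q * s q ((at_point Ls q)[i := frame_field j q]))" for q
      by (subst Xexp, subst alt_lin[OF s_alt Lt i vfield_ct[OF X'] yc])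
        (simp only: alt_sum[OF s_alt Lt i FFc] mult_1)
    have "W p (\<lambda>q. s q (at_point (Ls[i := X]) q)) =
        W p (\<lambda>q. s q ((at_point Ls q)[i := X' q]) + (\<Sum>j\<in>frame_index. y j q * s q ((at_point Ls q)[i := frame_field j q])))"
      unfolding map_update e ..
    also have "\<dots> = W p (\<lambda>q. s q ((at_point Ls q)[i := X' q])) + W p (\<lambda>q. \<Sum>j\<in>frame_index. y j q * s q ((at_point Ls q)[i := frame_field j q]))"
      by (rule ctangent_fun_add[OF Wc up[OF X'] sum])
    also have "W p (\<lambda>q. \<Sum>j\<in>frame_index. y j q * s q ((at_point Ls q)[i := frame_field j q])) =
        (\<Sum>j\<in>frame_index. W p (\<lambda>q. y j q * s q ((at_point Ls q)[i := frame_field j q])))"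
      by (rule ctangent_fun_sum[OF Wc]) (rule smooth_at_mult[OF ysm up[OF frame_field_smooth]])
    also have "\<dots> = (\<Sum>j\<in>frame_index. W p (y j) * s p ((at_point Ls p)[i := frame_field j p]))"
    proof (rule sum.cong[OF refl])
      fix j assume j: "j \<in> frame_index"
      show "W p (\<lambda>q. y j q * s q ((at_point Ls q)[i := frame_field j q])) = W p (y j) * s p ((at_point Ls p)[i := frame_field j p])"
        using ctangent_fun_mult[OF Wc ysm[OF j] up[OF frame_field_smooth[OF j]]] yp[of j] by simp
    qed
    also have "\<dots> = s p ((at_point Ls p)[i := u W])"
      unfolding u_def by (rule alt_sum[OF s_alt Lt i FFc, symmetric])
    finally show ?thesis unfolding map_update .
  qed
  have b: "bracket A W X p = (\<lambda>f. bracket A W X' p f + 1 * u W f)"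
    "bracket A X W p = (\<lambda>f. bracket A X' W p f + (-1) * u W f)" if W: "smooth_vfield A W" for W
  proof -
    note Wc = vfield_ct[OF W, of p]
    have *: "bracket A W X p f = bracket A W X' p f + u W f" for f
    proof (cases "smooth_at A p f")
      case True
      have "W p (\<lambda>q. X q f) = W p (\<lambda>q. X' q f + (\<Sum>j\<in>frame_index. y j q * frame_field j q f))"
        by (subst Xexp) (simp only: mult_1)
      also have "\<dots> = W p (\<lambda>q. X' q f) + (\<Sum>j\<in>frame_index. W p (\<lambda>q. y j q * frame_field j q f))"
        using ctangent_fun_add[OF Wc vfield_sm[OF X' True] smooth_at_sum[of frame_index p "\<lambda>j q. y j q * frame_field j q f"]]
          ctangent_fun_sum[OF Wc, of frame_index "\<lambda>j q. y j q * frame_field j q f"] smooth_at_mult[OF ysm vfield_sm[OF frame_field_smooth True]] by simp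
      also have "(\<Sum>j\<in>frame_index. W p (\<lambda>q. y j q * frame_field j q f)) = u W f"
        unfolding u_def
      proof (rule sum.cong[OF refl])
        fix j assume j: "j \<in> frame_index"
        show "W p (\<lambda>q. y j q * frame_field j q f) = W p (y j) * frame_field j p f"
          using ctangent_fun_mult[OF Wc ysm[OF j] vfield_sm[OF frame_field_smooth[OF j] True]] yp[of j] by simp
      qed
      finally show ?thesis unfolding bracket_apply[OF True] using Xp by (simp add: X'_def)
    next
      case False
      then show ?thesis by (simp add: bracket_def smooth_near_iff ctangent_not_sm[OF uc])
    qed
    show "bracket A W X p = (\<lambda>f. bracket A W X' p f + 1 * u W f)"
      by (rule ext) (simp add: *)
    show "bracket A X W p = (\<lambda>f. bracket A X' W p f + (-1) * u W f)"
      by (rule ext) (simp add: bracket_anticomm[of X] bracket_anticomm[of X'] *)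
  qed
  have Xsm: "smooth_vfield A (Xs ! i)" if "i < Suc k" for i using Xs that by simp
  have Yat: "at_point Ys p = at_point Xs p"
    using k0 Xs Xp by (intro nth_equalityI) (auto simp: Ys_def nth_list_update)
  have Ys: "length Ys = Suc k" by (simp add: Ys_def Xs)
  have Ynth: "Ys ! i = (if i = k0 then X else Xs ! i)" if "i < Suc k" for i
    using that k0 Xs by (simp add: Ys_def nth_list_update)
  define a1 where "a1 Xs i = (-1) ^ i * (Xs ! i) p (\<lambda>q. s q (at_point (delete_nth i Xs) q))" for Xs i
  define a2 where "a2 Xs i j = (-1) ^ (i + j) *
        s p (bracket A (Xs ! i) (Xs ! j) p # at_point (delete_nth i (delete_nth j Xs)) p)" for Xs i j
  have kz: "koszul A s Xs p = (\<Sum>i<Suc k. a1 Xs i) + (\<Sum>(i, j) | i < j \<and> j < Suc k. a2 Xs i j)"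
    if "length Xs = Suc k" for Xs unfolding koszul_def a1_def a2_def that ..
  have dat: "at_point (delete_nth i (delete_nth j Ys)) p = at_point (delete_nth i (delete_nth j Xs)) p" for i j
    unfolding map_delete_nth Yat ..
  have dsub: "\<forall>X\<in>set (delete_nth i Xs). smooth_vfield A X" for i by (rule Ball_delete_nth[OF Xs(2)])
  define w where "w i = s p (u (Xs ! i) # at_point (delete_nth i (delete_nth k0 Xs)) p)" for i
  define w' where "w' i = s p (u (Xs ! i) # at_point (delete_nth k0 (delete_nth i Xs)) p)" for i
  have d1: "a1 Ys k0 - a1 Xs k0 = 0" unfolding a1_def using Ynth[OF k0] Xp by (simp add: Ys_def)
  \<comment> \<open>\<open>k'\<close> is the position of slot \<open>k0\<close> after slot
    \<open>i\<close> has been deleted.\<close>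
  have d1': "a1 Ys i - a1 Xs i = (-1) ^ i * (-1) ^ k' * s p (u (Xs ! i) # delete_nth k' (at_point (delete_nth i Xs) p))"
    if i: "i < Suc k" "i \<noteq> k0" and k': "k' = (if k0 < i then k0 else k0 - 1)" for i k'
  proof -
    have len: "length (delete_nth i Xs) = k" using i Xs by (simp add: length_delete_nth)
    have kk: "k' < k" using i k0 k' by (auto split: if_splits)
    have "(if k' < i then k' else Suc k') = k0" using i k0 k' by auto
    then have "delete_nth i Xs ! k' = X'" using i kk Xs by (simp add: nth_delete_nth X'_def)
    then have e': "delete_nth i Xs = (delete_nth i Xs)[k' := X']" by (metis list_update_id)
    have e: "delete_nth i Ys = (delete_nth i Xs)[k' := X]"
      unfolding Ys_def k' by (rule delete_nth_update) (use i k0 Xs in auto)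
    have "(Xs ! i) p (\<lambda>q. s q (at_point (delete_nth i Ys) q)) =
       (Xs ! i) p (\<lambda>q. s q (at_point (delete_nth i Xs) q)) + s p ((at_point (delete_nth i Xs) p)[k' := u (Xs ! i)])"
      using a[OF len dsub kk Xsm[OF i(1)]] e e' by simp
    also have "s p ((at_point (delete_nth i Xs) p)[k' := u (Xs ! i)]) =
        (-1) ^ k' * s p (u (Xs ! i) # delete_nth k' (at_point (delete_nth i Xs) p))"
      by (rule alt_update_front[OF s_alt at_point_tvecs[OF len dsub] kk uc])
    finally show ?thesis unfolding a1_def using Ynth[OF i(1)] i(2) by (simp add: algebra_simps)
  qed
  \<comment> \<open>Deleting an earlier slot moves slot \<open>k0\<close> down by one, so the
    derivative term has the sign \<open>(-1) ^ (i + k0 - 1)\<close>, opposite to the sign of the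
    bracket term.\<close>
  have c1: "(a1 Ys i - a1 Xs i) + (a2 Ys i k0 - a2 Xs i k0) = 0" if i: "i < k0" for i
  proof -
    have i': "i < Suc k" "i \<noteq> k0" using i k0 by auto
    have k1: "k = Suc (k - 1)" using i k0 by simp
    have "a1 Ys i - a1 Xs i = (-1) ^ i * (-1) ^ (k0 - 1) * w i"
      unfolding d1'[OF i' refl] w_def delete_nth_delete_nth[OF i k0[folded Xs(1)]] using i by (simp add: map_delete_nth)
    moreover have "a2 Ys i k0 - a2 Xs i k0 = (-1) ^ (i + k0) * w i"
    proof -
      have L: "at_point (delete_nth i (delete_nth k0 Xs)) p \<in> tvecs A (k - 1) p"
        by (rule at_point_tvecs[OF _ Ball_delete_nth[OF dsub]]) (use i k0 Xs in \<open>simp add: length_delete_nth\<close>)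
      have alt: "s p \<in> alt_forms A (Suc (k - 1)) p" using s_alt[of p] k1 by simp
      have e: "s p (bracket A (Xs ! i) X p # at_point (delete_nth i (delete_nth k0 Xs)) p) =
          s p (bracket A (Xs ! i) X' p # at_point (delete_nth i (delete_nth k0 Xs)) p) + 1 * w i"
        unfolding w_def b(1)[OF Xsm[OF i'(1)]]
        by (rule alt_head_lin[OF alt bracket_ct[OF Xsm[OF i'(1)] X'] uc L])
      have "c * s p (bracket A (Xs ! i) X p # at_point (delete_nth i (delete_nth k0 Xs)) p) -
          c * s p (bracket A (Xs ! i) X' p # at_point (delete_nth i (delete_nth k0 Xs)) p) = c * w i" for c
        unfolding e by (simp add: algebra_simps)
      then show ?thesis unfolding a2_def dat Ynth[OF i'(1)] Ynth[OF k0] X'_def using i'(2) by simp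
    qed
    moreover have "(-1 :: complex) ^ (k0 - 1) = - ((-1) ^ k0)" using i by (cases k0) auto
    ultimately show ?thesis by (simp add: power_add)
  qed
  \<comment> \<open>Deleting a later slot leaves the position \<open>k0\<close> unchanged; here the
    opposite sign comes from the bracket, in which the exchanged field stands first.\<close>
  have c2: "(a1 Ys j - a1 Xs j) + (a2 Ys k0 j - a2 Xs k0 j) = 0" if j: "k0 < j" "j < Suc k" for j
  proof -
    have j': "j < Suc k" "j \<noteq> k0" using j by auto
    have k1: "k = Suc (k - 1)" using j by simp
    have "a1 Ys j - a1 Xs j = (-1) ^ j * (-1) ^ k0 * w' j"
      unfolding d1'[OF j' refl] w'_def using j by (simp add: map_delete_nth)
    moreover have "a2 Ys k0 j - a2 Xs k0 j = - ((-1) ^ (k0 + j) * w' j)"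
    proof -
      have L: "at_point (delete_nth k0 (delete_nth j Xs)) p \<in> tvecs A (k - 1) p"
        by (rule at_point_tvecs[OF _ Ball_delete_nth[OF dsub]]) (use j Xs in \<open>simp add: length_delete_nth\<close>)
      have alt: "s p \<in> alt_forms A (Suc (k - 1)) p" using s_alt[of p] k1 by simp
      have e: "s p (bracket A X (Xs ! j) p # at_point (delete_nth k0 (delete_nth j Xs)) p) =
          s p (bracket A X' (Xs ! j) p # at_point (delete_nth k0 (delete_nth j Xs)) p) + (-1) * w' j"
        unfolding w'_def b(2)[OF Xsm[OF j'(1)]]
        by (rule alt_head_lin[OF alt bracket_ct[OF X' Xsm[OF j'(1)]] uc L])
      have "c * s p (bracket A X (Xs ! j) p # at_point (delete_nth k0 (delete_nth j Xs)) p) -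
          c * s p (bracket A X' (Xs ! j) p # at_point (delete_nth k0 (delete_nth j Xs)) p) = - (c * w' j)" for c
        unfolding e by (simp add: algebra_simps)
      then show ?thesis unfolding a2_def dat Ynth[OF j'(1)] Ynth[OF k0] X'_def using j'(2) by simp
    qed
    ultimately show ?thesis by (simp add: power_add)
  qed
  have c3: "a2 Ys i j - a2 Xs i j = 0" if "i < j" "j < Suc k" "i \<noteq> k0" "j \<noteq> k0" for i j
    unfolding a2_def dat using that Ynth[of i] Ynth[of j] by simp
  have ps: "(\<Sum>(i, j) | i < j \<and> j < Suc k. a2 Ys i j - a2 Xs i j) =
      (\<Sum>i<k0. a2 Ys i k0 - a2 Xs i k0) + (\<Sum>j\<in>{k0<..<Suc k}. a2 Ys k0 j - a2 Xs k0 j)"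
    by (rule pair_sum[OF k0]) (rule c3)
  have "koszul A s Ys p - koszul A s Xs p =
     (\<Sum>i<Suc k. a1 Ys i - a1 Xs i) + (\<Sum>(i, j) | i < j \<and> j < Suc k. a2 Ys i j - a2 Xs i j)"
    unfolding kz[OF Ys] kz[OF Xs(1)] by (simp add: sum_subtractf case_prod_unfold)
  also have "\<dots> = (\<Sum>i<k0. (a1 Ys i - a1 Xs i) + (a2 Ys i k0 - a2 Xs i k0)) +
      (\<Sum>j\<in>{k0<..<Suc k}. (a1 Ys j - a1 Xs j) + (a2 Ys k0 j - a2 Xs k0 j))"
    unfolding ps sum_split_at[OF k0] d1 by (simp add: sum.distrib)
  also have "\<dots> = 0" using c1 c2 by simp
  finally show ?thesis by (simp add: Ys_def)
qed

text \<open>The fields are exchanged one at a time; every intermediate list has the same values at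
  \<open>p\<close>, as \<open>koszul_step\<close> requires.\<close>

lemma koszul_cong:
  assumes s_alt: "\<And>q. s q \<in> alt_forms A k q"
    and s_sm: "\<And>Xs p. length Xs = k \<Longrightarrow> \<forall>X\<in>set Xs. smooth_vfield A X \<Longrightarrow> smooth_at A p (\<lambda>q. s q (at_point Xs q))"
    and Xs: "length Xs = Suc k" "\<forall>X\<in>set Xs. smooth_vfield A X"
    and Ys: "length Ys = Suc k" "\<forall>X\<in>set Ys. smooth_vfield A X"
    and eq: "at_point Xs p = at_point Ys p"
  shows "koszul A s Xs p = koszul A s Ys p"
proof -
  have eqn: "(Xs ! i) p = (Ys ! i) p" if "i < Suc k" for i
    using arg_cong[OF eq, of "\<lambda>l. l ! i"] that Xs Ys by simp
  have "m \<le> Suc k \<Longrightarrow> koszul A s (take m Ys @ drop m Xs) p = koszul A s Xs p" for m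
  proof (induction m)
    case (Suc m)
    let ?L = "take m Ys @ drop m Xs"
    have m: "m < Suc k" using Suc.prems by simp
    have Lm: "?L ! m = Xs ! m" using m Xs Ys by (simp add: nth_append)
    have e: "?L[m := Ys ! m] = take (Suc m) Ys @ drop (Suc m) Xs"
      using m Xs Ys by (intro nth_equalityI) (auto simp: nth_list_update nth_append min_def less_Suc_eq)
    have "koszul A s (?L[m := Ys ! m]) p = koszul A s ?L p"
    proof (rule koszul_step[OF s_alt s_sm])
      show "length ?L = Suc k" using m Xs Ys by simp
      show "\<forall>X\<in>set ?L. smooth_vfield A X" using Xs Ys by (auto dest: in_set_takeD in_set_dropD)
      show "smooth_vfield A (Ys ! m)" using m Ys by simp
      show "(Ys ! m) p = (?L ! m) p" unfolding Lm using eqn[OF m] by simp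
    qed (use m in auto)
    then show ?case using Suc e by simp
  qed simp
  from this[of "Suc k"] show ?thesis using Xs Ys by simp
qed

text \<open>Removes the choice in \<open>ext_d\<close>: any smooth extension of the arguments may be
  used, in particular one with constant coefficients in the frame.\<close>

lemma ext_d_eq:
  assumes s_alt: "\<And>q. s q \<in> alt_forms A k q"
    and s_sm: "\<And>Xs p. length Xs = k \<Longrightarrow> \<forall>X\<in>set Xs. smooth_vfield A X \<Longrightarrow> smooth_at A p (\<lambda>q. s q (at_point Xs q))"
    and Ys: "length Ys = Suc k" "\<forall>X\<in>set Ys. smooth_vfield A X"
  shows "ext_d A k s p (at_point Ys p) = koszul A s Ys p"
proof -
  let ?P = "\<lambda>Xs. length Xs = Suc k \<and> (\<forall>X\<in>set Xs. smooth_vfield A X) \<and> at_point Xs p = at_point Ys p"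
  have "?P (SOME Xs. ?P Xs)" by (rule someI[of ?P Ys]) (use Ys in blast)
  then have "koszul A s (SOME Xs. ?P Xs) p = koszul A s Ys p"
    using koszul_cong[OF s_alt s_sm _ _ Ys] by blast
  then show ?thesis using at_point_tvecs[OF Ys] by (simp add: ext_d_def)
qed

text \<open>In the frame of the product this is \<open>(1 + \<i>) / 4\<close> times the trace of
  \<open>ad (E l)\<close>.\<close>

definition tau :: "nat \<Rightarrow> complex" where "tau l = (\<Sum>m=1..n. t l m m)"

lemma gPhi_alt: "(\<lambda>vs. g q * Phi q vs) \<in> alt_forms A n q"
  by (rule alt_forms_cmult[OF Phi_alt])

lemma gPhi_sm:
  assumes "\<And>p. smooth_at A p g" "length Xs = n" "\<forall>X\<in>set Xs. smooth_vfield A X"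
  shows "smooth_at A p (\<lambda>q. g q * Phi q (at_point Xs q))"
  by (rule smooth_at_mult[OF assms(1) Phi_smooth]) (use assms in auto)

text \<open>With constant coefficients \<open>Phi\<close> is constant along the fields and vanishes
  as soon as the (0,1)-field \<open>W\<close> is among its arguments. Hence the only derivative left
  is that of \<open>g\<close> along \<open>W\<close>, and the only brackets left are those with
  \<open>W\<close>, which \<open>Phi_trace\<close> adds up to a trace.\<close>

lemma koszul_const:
  assumes g: "\<And>p. smooth_at A p g" and j0: "j0 < Suc n"
    and Xs: "length Xs = Suc n"
    and XZ: "\<And>i. i < Suc n \<Longrightarrow> i \<noteq> j0 \<Longrightarrow> Xs ! i = (\<lambda>q f. \<Sum>l=1..n. \<alpha> i l * Z l q f)"
    and W: "Xs ! j0 = (\<lambda>q f. \<Sum>l=1..n. \<beta> l * Zb l q f)"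
  shows "koszul A (\<lambda>q vs. g q * Phi q vs) Xs p =
    (-1) ^ j0 * ((Xs ! j0) p g - (\<Sum>l=1..n. \<beta> l * tau l) * g p) * Phi p (at_point (delete_nth j0 Xs) p)"
proof -
  define W where "W = Xs ! j0"
  define Ys where "Ys = delete_nth j0 Xs"
  let ?s = "\<lambda>q vs. g q * Phi q vs"
  have XsZ: "smooth_vfield A (\<lambda>q f. \<Sum>l=1..n. k l * Z l q f)" "smooth_vfield A (\<lambda>q f. \<Sum>l=1..n. k l * Zb l q f)" for k
    by (intro vfield_sum Z_smooth smooth_at_const; assumption)+
  have smooth_at: "smooth_vfield A (Xs ! i)" if "i < Suc n" for i
    using XZ[OF that] assms(5) XsZ by (cases "i = j0") simp_all
  then have Xsm: "\<forall>X\<in>set Xs. smooth_vfield A X" using Xs by (metis in_set_conv_nth)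
  have Wsm: "smooth_vfield A W" unfolding W_def by (rule smooth_at[OF j0])
  have phW: "ph m q [W q] = 0" if "m \<in> {1..n}" for m q
    unfolding W_def assms(5) by (rule ph_Z_sum(2)[OF that])
  have dsm: "\<forall>X\<in>set (delete_nth i Xs). smooth_vfield A X" for i by (rule Ball_delete_nth[OF Xsm])
  have lenY: "length Ys = n" using j0 Xs by (simp add: Ys_def length_delete_nth)
  have Ysm: "\<forall>X\<in>set Ys. smooth_vfield A X" unfolding Ys_def by (rule dsm)
  define \<gamma> where "\<gamma> i = \<alpha> (if i < j0 then i else Suc i)" for i
  have Ynth: "Ys ! i = Xs ! (if i < j0 then i else Suc i)" if "i < n" for i
    unfolding Ys_def using that j0 Xs by (simp add: nth_delete_nth)
  have YZ: "Ys ! i = (\<lambda>q f. \<Sum>l=1..n. \<gamma> i l * Z l q f)" if "i < n" for i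
    unfolding Ynth[OF that] \<gamma>_def using that j0 by (intro XZ) auto
  have phY: "ph m q [(Ys ! i) q] = \<gamma> i m" if "i < n" "m \<in> {1..n}" for i m q
    unfolding YZ[OF that(1)] by (rule ph_Z_sum(1)[OF that(2)])
  have Yt: "at_point Ys q \<in> tvecs A n q" for q by (rule at_point_tvecs[OF lenY Ysm])
  define \<kappa> where "\<kappa> = Phi p (at_point Ys p)"
  have PhiY: "Phi q (at_point Ys q) = \<kappa>" for q
    unfolding \<kappa>_def by (rule Phi_cong[OF Yt Yt]) (use lenY phY in simp)
  have first: "(-1) ^ i * (Xs ! i) p (\<lambda>q. ?s q (at_point (delete_nth i Xs) q)) =
      (if i = j0 then (-1) ^ j0 * W p g * Phi p (at_point Ys p) else 0)" if i: "i < Suc n" for i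
  proof (cases "i = j0")
    case True
    have "W p (\<lambda>q. g q * Phi q (at_point Ys q)) = W p (\<lambda>q. \<kappa> * g q)"
      unfolding PhiY by (simp only: mult.commute)
    also have "\<dots> = \<kappa> * W p g" by (rule ctangent_fun_cmult[OF vfield_ct[OF Wsm] g])
    finally have "W p (\<lambda>q. g q * Phi q (at_point Ys q)) = Phi p (at_point Ys p) * W p g" unfolding \<kappa>_def .
    then show ?thesis using True by (simp add: W_def Ys_def)
  next
    case False
    have len: "length (delete_nth i Xs) = n" using i Xs by (simp add: length_delete_nth)
    let ?k = "if j0 < i then j0 else j0 - 1"
    have k: "?k < n" using False i j0 by auto
    have "(if ?k < i then ?k else Suc ?k) = j0" using i j0 False by auto
    then have nth: "delete_nth i Xs ! ?k = W" using i k Xs nth_delete_nth[of i Xs ?k] by (simp only: W_def)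
    have "?s q (at_point (delete_nth i Xs) q) = 0" for q
      using Phi_kill[OF at_point_tvecs[OF len dsm] k] nth len k phW by simp
    then have "(\<lambda>q. ?s q (at_point (delete_nth i Xs) q)) = (\<lambda>q. 0)" by (rule ext)
    then have "(Xs ! i) p (\<lambda>q. ?s q (at_point (delete_nth i Xs) q)) = 0"
      by (simp only: ctangent_const[OF vfield_ct[OF smooth_at[OF i]]])
    then show ?thesis using False by simp
  qed
  define h where "h i = Phi p ((at_point Ys p)[i := bracket A W (Ys ! i) p])" for i
  have front: "?s p (v # delete_nth i (at_point Ys p)) = (-1) ^ i * g p * Phi p ((at_point Ys p)[i := v])"
    if "i < n" "v \<in> ctangent A p" for i v
    using alt_update_front[OF Phi_alt Yt that] by simp
  define f where "f i j = (-1) ^ (i + j) * ?s p (bracket A (Xs ! i) (Xs ! j) p # at_point (delete_nth i (delete_nth j Xs)) p)" for i j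
  \<comment> \<open>A bracket of two other fields leaves \<open>W\<close> among the arguments of
    \<open>Phi\<close>.\<close>
  have f0: "f i j = 0" if ij: "i < j" "j < Suc n" "i \<noteq> j0" "j \<noteq> j0" for i j
  proof -
    let ?L = "delete_nth i (delete_nth j Xs)"
    have lj: "length (delete_nth j Xs) = n" using ij Xs by (simp add: length_delete_nth)
    have L: "length ?L = n - 1" using ij lj by (simp add: length_delete_nth)
    have Lsm: "\<forall>X\<in>set ?L. smooth_vfield A X" by (rule Ball_delete_nth[OF dsm])
    \<comment> \<open>\<open>k1\<close> and then \<open>k2\<close> locate \<open>W\<close> after the
      deletion of slot \<open>j\<close> and then of slot \<open>i\<close>.\<close>
    define k1 where "k1 = (if j0 < j then j0 else j0 - 1)"
    have k1: "k1 < n" "k1 \<noteq> i" "(if k1 < j then k1 else Suc k1) = j0" using ij j0 by (auto simp: k1_def)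
    then have k1W: "delete_nth j Xs ! k1 = W" using ij Xs nth_delete_nth[of j Xs k1] by (simp add: W_def)
    define k2 where "k2 = (if k1 < i then k1 else k1 - 1)"
    have k2': "k2 < n - 1" "(if k2 < i then k2 else Suc k2) = k1" using ij k1 by (auto simp: k2_def)
    then have k2: "k2 < n - 1" "?L ! k2 = W" using ij lj nth_delete_nth[of i "delete_nth j Xs" k2] k1W by simp_all
    have n1: "n = Suc (n - 1)" using ij by simp
    have "bracket A (Xs ! i) (Xs ! j) p # at_point ?L p \<in> tvecs A (Suc (n - 1)) p"
      unfolding tvecs_Cons using bracket_ct[OF smooth_at smooth_at] ij at_point_tvecs[OF L Lsm] by simp
    then have tv: "bracket A (Xs ! i) (Xs ! j) p # at_point ?L p \<in> tvecs A n p" using n1 by simp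
    have "Phi p (bracket A (Xs ! i) (Xs ! j) p # at_point ?L p) = 0"
      by (rule Phi_kill[OF tv, of "Suc k2"]) (use k2 L phW in auto)
    then show ?thesis by (simp add: f_def)
  qed
  \<comment> \<open>Moving the bracket back to slot \<open>i\<close> cancels
    \<open>(-1) ^ i\<close>; the minus sign comes from turning \<open>[Xs ! i, W]\<close> into
    \<open>[W, Xs ! i]\<close>.\<close>
  have f1: "f i j0 = - ((-1) ^ j0) * g p * h i" if i: "i < j0" for i
  proof -
    have i': "i < n" "i < Suc n" using i j0 by auto
    have Yi: "Ys ! i = Xs ! i" using Ynth[OF i'(1)] i by simp
    have br: "bracket A (Xs ! i) W p = (\<lambda>f. (-1) * bracket A W (Ys ! i) p f)"
      unfolding Yi by (rule ext) (simp add: bracket_anticomm[of "Xs ! i"])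
    have c: "bracket A W (Ys ! i) p \<in> ctangent A p" unfolding Yi by (rule bracket_ct[OF Wsm smooth_at[OF i'(2)]])
    have "f i j0 = (-1) ^ (i + j0) * ?s p (bracket A (Xs ! i) W p # delete_nth i (at_point Ys p))"
      unfolding f_def W_def Ys_def map_delete_nth ..
    also have "?s p (bracket A (Xs ! i) W p # delete_nth i (at_point Ys p)) =
        (-1) ^ i * g p * Phi p ((at_point Ys p)[i := (\<lambda>f. (\<lambda>f. 0) f + (-1) * bracket A W (Ys ! i) p f)])"
      unfolding br by (subst front[OF i'(1) ctangent_cmult[OF c]]) simp
    also have "Phi p ((at_point Ys p)[i := (\<lambda>f. (\<lambda>f. 0) f + (-1) * bracket A W (Ys ! i) p f)]) = - h i"
      unfolding alt_lin[OF Phi_alt Yt i'(1) ctangent_zero c] alt_zero[OF Phi_alt Yt i'(1)] h_def by simp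
    finally show ?thesis by (simp add: power_add algebra_simps flip: power_mult_distrib)
  qed
  \<comment> \<open>Without \<open>W\<close> the field \<open>Xs ! j\<close> sits at position
    \<open>j - 1\<close>; this shift produces the minus sign here.\<close>
  have f2: "f j0 j = - ((-1) ^ j0) * g p * h (j - 1)" if j: "j0 < j" "j < Suc n" for j
  proof -
    have j': "j - 1 < n" using j by simp
    have Yj: "Ys ! (j - 1) = Xs ! j" using Ynth[OF j'] j by auto
    have c: "bracket A W (Ys ! (j - 1)) p \<in> ctangent A p" unfolding Yj by (rule bracket_ct[OF Wsm smooth_at[OF j(2)]])
    have "f j0 j = (-1) ^ (j0 + j) * ?s p (bracket A W (Ys ! (j - 1)) p # delete_nth (j - 1) (at_point Ys p))"
      unfolding f_def delete_nth_delete_nth[OF j(1) j(2)[folded Xs]] Yj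
      by (simp only: W_def Ys_def map_delete_nth)
    also have "?s p (bracket A W (Ys ! (j - 1)) p # delete_nth (j - 1) (at_point Ys p)) = (-1) ^ (j - 1) * g p * h (j - 1)"
      unfolding h_def by (rule front[OF j' c])
    also have "(-1 :: complex) ^ (j0 + j) = - ((-1) ^ j0 * (-1) ^ (j - 1))"
      using j by (cases j) (auto simp: power_add)
    finally show ?thesis by (simp add: algebra_simps flip: power_mult_distrib)
  qed
  \<comment> \<open>\<open>Phi_trace\<close> is applied to \<open>B k = [W, Z k]\<close>, whose
    trace is a combination of the numbers \<open>tau l\<close>.\<close>
  have hsum: "(\<Sum>i<n. h i) = (\<Sum>l=1..n. \<beta> l * tau l) * Phi p (at_point Ys p)"
  proof -
    define B where "B k = bracket A W (Z k) p" for k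
    have Bc: "B k \<in> ctangent A p" if "k \<in> {1..n}" for k unfolding B_def by (rule bracket_ct[OF Wsm Z_smooth(1)[OF that]])
    have "h i = Phi p ((at_point Ys p)[i := (\<lambda>f. \<Sum>k=1..n. ph k p [at_point Ys p ! i] * B k f)])" if i: "i < n" for i
    proof -
      have "bracket A W (Ys ! i) p = (\<lambda>f. \<Sum>k=1..n. \<gamma> i k * B k f)"
        unfolding YZ[OF i] B_def by (rule ext) (rule bracket_sum_right[OF Z_smooth(1) Wsm])
      also have "\<dots> = (\<lambda>f. \<Sum>k=1..n. ph k p [at_point Ys p ! i] * B k f)"
        by (intro ext sum.cong refl) (simp only: nth_map[OF i[folded lenY]] phY[OF i])
      finally show ?thesis by (simp only: h_def)
    qed
    then have "(\<Sum>i<n. h i) = (\<Sum>k=1..n. ph k p [B k]) * Phi p (at_point Ys p)"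
      using Phi_trace[OF Bc Yt] by simp
    also have "(\<Sum>k=1..n. ph k p [B k]) = (\<Sum>k=1..n. \<Sum>l=1..n. \<beta> l * t l k k)"
    proof (rule sum.cong[OF refl])
      fix k assume k: "k \<in> {1..n}"
      have "B k = (\<lambda>f. \<Sum>l=1..n. \<beta> l * bracket A (Zb l) (Z k) p f)"
        unfolding B_def W_def assms(5) by (rule ext) (rule bracket_sum_left[OF Z_smooth(2) Z_smooth(1)[OF k]])
      then have "ph k p [B k] = (\<Sum>l=1..n. \<beta> l * ph k p [bracket A (Zb l) (Z k) p])"
        by (simp only: ph_sum[OF k bracket_ct[OF Z_smooth(2) Z_smooth(1)[OF k]]])
      also have "\<dots> = (\<Sum>l=1..n. \<beta> l * t l k k)"
        by (rule sum.cong[OF refl]) (simp only: bracket_frame[OF _ k k])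
      finally show "ph k p [B k] = (\<Sum>l=1..n. \<beta> l * t l k k)" .
    qed
    also have "\<dots> = (\<Sum>l=1..n. \<beta> l * tau l)"
      by (subst sum.swap) (simp add: tau_def sum_distrib_left)
    finally show ?thesis .
  qed
  have "(\<Sum>(i, j) | i < j \<and> j < Suc n. f i j) = (\<Sum>i<j0. f i j0) + (\<Sum>j\<in>{j0<..<Suc n}. f j0 j)"
    by (rule pair_sum[OF j0 f0])
  also have "\<dots> = - ((-1) ^ j0) * g p * ((\<Sum>i<j0. h i) + (\<Sum>j\<in>{j0<..<Suc n}. h (j - 1)))"
    by (simp add: f1 f2 sum_distrib_left distrib_left)
  also have "(\<Sum>j\<in>{j0<..<Suc n}. h (j - 1)) = (\<Sum>i\<in>{j0..<n}. h i)"
    by (rule sum.reindex_bij_witness[of _ Suc "\<lambda>j. j - 1"]) auto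
  also have "(\<Sum>i<j0. h i) + (\<Sum>i\<in>{j0..<n}. h i) = (\<Sum>i<n. h i)"
  proof -
    have "{..<n} = {..<j0} \<union> {j0..<n}" using j0 by auto
    then have "(\<Sum>i<n. h i) = (\<Sum>i\<in>{..<j0} \<union> {j0..<n}. h i)" by (rule arg_cong)
    also have "\<dots> = (\<Sum>i<j0. h i) + (\<Sum>i\<in>{j0..<n}. h i)" by (rule sum.union_disjoint) auto
    finally show ?thesis ..
  qed
  finally have second: "(\<Sum>(i, j) | i < j \<and> j < Suc n. f i j) =
     - ((-1) ^ j0) * g p * ((\<Sum>l=1..n. \<beta> l * tau l) * Phi p (at_point Ys p))" unfolding hsum .
  have "(\<Sum>i<Suc n. (-1) ^ i * (Xs ! i) p (\<lambda>q. ?s q (at_point (delete_nth i Xs) q))) =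
      (\<Sum>i<Suc n. if i = j0 then (-1) ^ j0 * W p g * Phi p (at_point Ys p) else 0)"
    by (rule sum.cong[OF refl]) (simp only: first lessThan_iff)
  also have "\<dots> = (-1) ^ j0 * W p g * Phi p (at_point Ys p)" using j0 by simp
  finally have "koszul A ?s Xs p = (-1) ^ j0 * W p g * Phi p (at_point Ys p) +
      (\<Sum>(i, j) | i < j \<and> j < Suc n. f i j)"
    unfolding koszul_def Xs f_def by simp
  then show ?thesis unfolding second W_def Ys_def by (simp add: algebra_simps)
qed

text \<open>An \<open>n\<close>-element subset of \<open>n + 1\<close> slots omits one slot
  \<open>j\<close>, which receives the (0,1)-part while the other slots receive (1,0)-parts. Each
  such term is evaluated by \<open>koszul_const\<close>.\<close>

lemma dbar_Phi:
  assumes g: "\<And>p. smooth_at A p g" and vs: "vs \<in> tvecs A (Suc n) p"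
  shows "dbar A J n 0 (\<lambda>q vs. g q * Phi q vs) p vs =
    (\<Sum>j<Suc n. (-1) ^ j * (proj01 J p (vs ! j) g - (\<Sum>l=1..n. phb l p [vs ! j] * tau l) * g p) * Phi p (delete_nth j vs))"
proof -
  let ?s = "\<lambda>q vs. g q * Phi q vs"
  have len: "length vs = Suc n" using vs by (simp add: tvecs_def)
  have S: "{S. S \<subseteq> {..<Suc n} \<and> card S = n} = (\<lambda>j. {..<Suc n} - {j}) ` {..<Suc n}"
  proof (intro equalityI subsetI)
    fix S assume "S \<in> {S. S \<subseteq> {..<Suc n} \<and> card S = n}"
    then have S: "S \<subseteq> {..<Suc n}" "card S = n" by auto
    then have "card ({..<Suc n} - S) = 1" by (simp add: card_Diff_subset finite_subset[OF S(1)])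
    then obtain j where j: "{..<Suc n} - S = {j}" by (auto simp: card_1_singleton_iff)
    then have "S = {..<Suc n} - {j}" "j \<in> {..<Suc n}" using S by auto
    then show "S \<in> (\<lambda>j. {..<Suc n} - {j}) ` {..<Suc n}" by blast
  qed auto
  have inj: "inj_on (\<lambda>j. {..<Suc n} - {j}) {..<Suc n}" by (auto simp: inj_on_def)
  let ?us = "\<lambda>j. map (\<lambda>i. if i \<in> {..<Suc n} - {j} then proj10 J p (vs ! i) else proj01 J p (vs ! i)) [0..<Suc n]"
  have trm: "ext_d A n ?s p (?us j) =
     (-1) ^ j * (proj01 J p (vs ! j) g - (\<Sum>l=1..n. phb l p [vs ! j] * tau l) * g p) * Phi p (delete_nth j vs)"
    if j: "j < Suc n" for j
  proof -
    \<comment> \<open>Extensions of the projected vectors whose coefficients in the frame are frozen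
      at \<open>p\<close>.\<close>
    define Xs where "Xs = map (\<lambda>i. if i \<noteq> j then (\<lambda>q f. \<Sum>l=1..n. ph l p [vs ! i] * Z l q f)
        else (\<lambda>q f. \<Sum>l=1..n. phb l p [vs ! j] * Zb l q f)) [0..<Suc n]"
    have lenX: "length Xs = Suc n" by (simp add: Xs_def)
    have XZ: "Xs ! i = (\<lambda>q f. \<Sum>l=1..n. ph l p [vs ! i] * Z l q f)" if "i < Suc n" "i \<noteq> j" for i
      using that by (simp add: Xs_def del: upt_Suc)
    have W: "Xs ! j = (\<lambda>q f. \<Sum>l=1..n. phb l p [vs ! j] * Zb l q f)"
      using j by (simp add: Xs_def del: upt_Suc)
    have smZ: "smooth_vfield A (\<lambda>q f. \<Sum>l=1..n. k l * Z l q f)" "smooth_vfield A (\<lambda>q f. \<Sum>l=1..n. k l * Zb l q f)" for k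
      by (intro vfield_sum Z_smooth smooth_at_const; assumption)+
    have Xsm: "\<forall>X\<in>set Xs. smooth_vfield A X" unfolding Xs_def using smZ by auto
    have vi: "vs ! i \<in> ctangent A p" if "i < Suc n" for i by (rule tvecs_nth[OF vs that])
    have at: "at_point Xs p = ?us j"
    proof (rule nth_equalityI)
      fix i assume "i < length (at_point Xs p)"
      then have i: "i < Suc n" using lenX by simp
      show "at_point Xs p ! i = ?us j ! i"
        using i XZ[OF i] W lenX proj_expand[OF vi[OF i]] by (cases "i = j") (simp_all del: upt_Suc)
    qed (simp add: lenX del: upt_Suc)
    have "ext_d A n ?s p (?us j) = koszul A ?s Xs p"
      unfolding at[symmetric]
      by (rule ext_d_eq[where s = ?s and k = n, OF _ _ lenX Xsm], rule gPhi_alt, rule gPhi_sm[OF g], assumption+)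
    also have "\<dots> = (-1) ^ j * ((Xs ! j) p g - (\<Sum>l=1..n. phb l p [vs ! j] * tau l) * g p) * Phi p (at_point (delete_nth j Xs) p)"
      by (rule koszul_const[OF g j lenX XZ W])
    also have "(Xs ! j) p = proj01 J p (vs ! j)" unfolding W proj_expand[OF vi[OF j]] ..
    also have "Phi p (at_point (delete_nth j Xs) p) = Phi p (delete_nth j vs)"
    proof (rule Phi_cong)
      have lj: "length (delete_nth j Xs) = n" using j lenX by (simp add: length_delete_nth)
      have "\<forall>X\<in>set (delete_nth j Xs). smooth_vfield A X" by (rule Ball_delete_nth[OF Xsm])
      then show "at_point (delete_nth j Xs) p \<in> tvecs A n p" by (rule at_point_tvecs[OF lj])
      show "delete_nth j vs \<in> tvecs A n p" by (rule tvecs_delete[OF vs j])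
      fix m k assume m: "m \<in> {1..n}" and k: "k < n"
      let ?k = "if k < j then k else Suc k"
      have k': "?k < Suc n" "?k \<noteq> j" using k by auto
      have "at_point (delete_nth j Xs) p ! k = (Xs ! ?k) p"
        using nth_map[of k "delete_nth j Xs" "\<lambda>X. X p"] nth_delete_nth[of j Xs k] lj k j lenX by simp
      moreover have "delete_nth j vs ! k = vs ! ?k" using nth_delete_nth[of j vs k] k j len by simp
      ultimately show "ph m p [at_point (delete_nth j Xs) p ! k] = ph m p [delete_nth j vs ! k]"
        using XZ[OF k'] ph_Z_sum(1)[OF m] by simp
    qed
    finally show ?thesis .
  qed
  have "dbar A J n 0 ?s p vs = (\<Sum>S | S \<subseteq> {..<Suc n} \<and> card S = n.
      ext_d A n ?s p (map (\<lambda>i. if i \<in> S then proj10 J p (vs ! i) else proj01 J p (vs ! i)) [0..<Suc n]))"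
    unfolding dbar_def pq_part_def using vs by (simp del: upt_Suc)
  also have "\<dots> = (\<Sum>j<Suc n. ext_d A n ?s p (?us j))"
    unfolding S by (subst sum.reindex[OF inj]) (simp only: o_def)
  also have "\<dots> = (\<Sum>j<Suc n. (-1) ^ j * (proj01 J p (vs ! j) g - (\<Sum>l=1..n. phb l p [vs ! j] * tau l) * g p) * Phi p (delete_nth j vs))"
    by (rule sum.cong[OF refl], rule trm) simp
  finally show ?thesis .
qed

lemma dbar_off: "vs \<notin> tvecs A (Suc n) p \<Longrightarrow> dbar A J n 0 s p vs = 0"
  by (simp add: dbar_def pq_part_def)

lemma dbar_Phi_zero_iff:
  "dbar A J n 0 Phi = (\<lambda>p vs. 0) \<longleftrightarrow> (\<forall>l\<in>{1..n}. tau l = 0)"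
proof -
  have P: "Phi = (\<lambda>q vs. 1 * Phi q vs)" by simp
  have d: "dbar A J n 0 Phi p vs = (\<Sum>j<Suc n. (-1) ^ j * (- (\<Sum>l=1..n. phb l p [vs ! j] * tau l)) * Phi p (delete_nth j vs))"
    if "vs \<in> tvecs A (Suc n) p" for p vs
  proof -
    have "proj01 J p (vs ! j) (\<lambda>q. 1) = 0" if "j < Suc n" for j
      by (rule ctangent_const[OF proj_ct(2)[OF tvecs_nth[OF \<open>vs \<in> tvecs A (Suc n) p\<close> that]]])
    then show ?thesis
      using dbar_Phi[OF smooth_at_const that, of 1] by (simp del: sum.lessThan_Suc)
  qed
  show ?thesis
  proof
    assume z: "dbar A J n 0 Phi = (\<lambda>p vs. 0)"
    show "\<forall>l\<in>{1..n}. tau l = 0"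
    proof
      fix l assume l: "l \<in> {1..n}"
      \<comment> \<open>On \<open>(Zb l, Z 1, \<dots>, Z n)\<close> the value is
        \<open>- tau l\<close>, because deleting any slot but the first leaves \<open>Zb l\<close>
        as an argument of \<open>Phi\<close>. Any point serves, hence
        \<open>undefined\<close>.\<close>
      define vs where "vs = Zb l undefined # at_point Zs undefined"
      let ?p = "undefined :: 'm"
      have vs: "vs \<in> tvecs A (Suc n) ?p" unfolding vs_def tvecs_Cons using Z_ct(2)[OF l] Zs_tvecs by blast
      have "(-1) ^ j * (- (\<Sum>l=1..n. phb l ?p [vs ! j] * tau l)) * Phi ?p (delete_nth j vs) = (if j = 0 then - tau l else 0)"
        if j: "j < Suc n" for j
      proof (cases "j = 0")
        case True
        have "(\<Sum>k=1..n. phb k ?p [Zb l ?p] * tau k) = (\<Sum>k=1..n. if k = l then tau k else 0)"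
          by (rule sum.cong[OF refl]) (simp only: ph_dual(4)[OF l], auto)
        also have "\<dots> = tau l" using l by simp
        finally show ?thesis using True by (simp add: vs_def Phi_Zs)
      next
        case False
        have "Phi ?p (delete_nth j vs) = 0"
        proof (rule Phi_kill[OF tvecs_delete[OF vs j]])
          show "0 < n" using l by auto
          fix i assume i: "i \<in> {1..n}"
          have "delete_nth j vs ! 0 = Zb l ?p" using False by (cases j) (simp_all add: vs_def delete_nth_def)
          then show "ph i ?p [delete_nth j vs ! 0] = 0" using ph_dual(2)[OF l i] by simp
        qed
        then show ?thesis using False by simp
      qed
      then have "dbar A J n 0 Phi ?p vs = (\<Sum>j<Suc n. if j = 0 then - tau l else 0)"
        unfolding d[OF vs] by (intro sum.cong refl) (simp only: lessThan_iff)
      then show "tau l = 0" using z by (simp del: sum.lessThan_Suc)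
    qed
  next
    assume z: "\<forall>l\<in>{1..n}. tau l = 0"
    show "dbar A J n 0 Phi = (\<lambda>p vs. 0)"
    proof (intro ext)
      fix p vs
      show "dbar A J n 0 Phi p vs = 0"
      proof (cases "vs \<in> tvecs A (Suc n) p")
        case True
        have "(\<Sum>l=1..n. phb l p [vs ! j] * tau l) = 0" for j using z by (intro sum.neutral) simp
        then show ?thesis unfolding d[OF True] by simp
      qed (rule dbar_off)
    qed
  qed
qed

text \<open>Of the terms of \<open>dbar_Phi\<close> only the one that deletes the front slot
  survives, since otherwise the (0,1)-vector in front remains an argument of \<open>Phi\<close>. The
  operator is thus reduced to the scalar dbar of the coefficient.\<close>

lemma dbar_canonical_gPhi:
  assumes g: "\<And>p. smooth_at A p g" and w: "w \<in> ctangent A p" and z: "\<forall>l\<in>{1..n}. tau l = 0"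
  shows "dbar_canonical A J (\<lambda>q vs. g q * Phi q vs) p w = (\<lambda>vs. proj01 J p w g * Phi p vs)"
proof
  fix vs
  let ?w = "proj01 J p w"
  have wc: "?w \<in> ctangent A p" by (rule proj_ct(2)[OF w])
  show "dbar_canonical A J (\<lambda>q vs. g q * Phi q vs) p w vs = ?w g * Phi p vs"
  proof (cases "vs \<in> tvecs A n p")
    case True
    have tv: "?w # vs \<in> tvecs A (Suc n) p" using wc True by (simp add: tvecs_Cons)
    have z': "(\<Sum>l=1..n. phb l p [x] * tau l) = 0" for x using z by (intro sum.neutral) simp
    have "(-1) ^ j * (proj01 J p ((?w # vs) ! j) g - (\<Sum>l=1..n. phb l p [(?w # vs) ! j] * tau l) * g p) * Phi p (delete_nth j (?w # vs)) =
      (if j = 0 then ?w g * Phi p vs else 0)" if j: "j < Suc n" for j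
    proof (cases "j = 0")
      case True
      then show ?thesis by (simp add: z' proj_proj(3)[OF w] del: One_nat_def)
    next
      case False
      have "Phi p (delete_nth j (?w # vs)) = 0"
      proof (rule Phi_kill[OF tvecs_delete[OF tv j]])
        show "0 < n" using False j by simp
        fix i assume i: "i \<in> {1..n}"
        have "delete_nth j (?w # vs) ! 0 = ?w" using False by (cases j) (simp_all add: delete_nth_def)
        then show "ph i p [delete_nth j (?w # vs) ! 0] = 0" using ph_proj(2)[OF w i] by simp
      qed
      then show ?thesis using False by simp
    qed
    then have "dbar A J n 0 (\<lambda>q vs. g q * Phi q vs) p (?w # vs) = (\<Sum>j<Suc n. if j = 0 then ?w g * Phi p vs else 0)"
      unfolding dbar_Phi[OF g tv] by (intro sum.cong refl) (simp only: lessThan_iff)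
    then show ?thesis using w by (simp add: dbar_canonical_def cdim del: sum.lessThan_Suc)
  next
    case False
    then have "?w # vs \<notin> tvecs A (Suc n) p" by (simp add: tvecs_Cons)
    then show ?thesis using alt_off[OF Phi_alt False] by (simp add: dbar_canonical_def cdim dbar_off)
  qed
qed

end

section \<open>Pluricanonical sections\<close>

context smooth_manifold
begin

lemma smooth_fun_iff: "smooth_fun A f \<longleftrightarrow> (\<forall>p. smooth_at A p f)"
  by (simp add: smooth_fun_def smooth_near_iff)

text \<open>Has the shape of the Leibniz sum in \<open>dbar_power_graph\<close>, so that this sum
  can be recognised as one derivative.\<close>

lemma ctangent_fun_prod:
  assumes "u \<in> ctangent A p" "finite I" "\<And>i. i \<in> I \<Longrightarrow> smooth_at A p (g i)"
  shows "u (\<lambda>q. \<Prod>i\<in>I. g i q) = (\<Sum>i\<in>I. u (g i) * (\<Prod>j\<in>I - {i}. g j p))"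
  using assms(2,3)
proof (induction I rule: finite_induct)
  case empty
  then show ?case using ctangent_const[OF assms(1)] by simp
next
  case (insert i I)
  have g: "smooth_at A p (g i)" "smooth_at A p (\<lambda>q. \<Prod>j\<in>I. g j q)" using insert.prems by (auto intro: smooth_at_prod)
  have "u (\<lambda>q. \<Prod>j\<in>insert i I. g j q) = u (\<lambda>q. g i q * (\<Prod>j\<in>I. g j q))" using insert.hyps by simp
  also have "\<dots> = g i p * u (\<lambda>q. \<Prod>j\<in>I. g j q) + u (g i) * (\<Prod>j\<in>I. g j p)" by (rule ctangent_fun_mult[OF assms(1) g])
  also have "u (\<lambda>q. \<Prod>j\<in>I. g j q) = (\<Sum>k\<in>I. u (g k) * (\<Prod>j\<in>I - {k}. g j p))"
    using insert.IH insert.prems by simp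
  also have "g i p * (\<Sum>k\<in>I. u (g k) * (\<Prod>j\<in>I - {k}. g j p)) = (\<Sum>k\<in>I. u (g k) * (\<Prod>j\<in>insert i I - {k}. g j p))"
    unfolding sum_distrib_left
  proof (rule sum.cong[OF refl])
    fix k assume k: "k \<in> I"
    then have "insert i I - {k} = insert i (I - {k})" using insert.hyps by auto
    then show "g i p * (u (g k) * (\<Prod>j\<in>I - {k}. g j p)) = u (g k) * (\<Prod>j\<in>insert i I - {k}. g j p)"
      using insert.hyps by simp
  qed
  finally show ?case using insert.hyps by (simp add: add.commute)
qed

end

lemma replicate_drop_update:
  "i < length xs \<Longrightarrow> (replicate i a @ drop i xs)[i := a] = replicate (Suc i) a @ drop (Suc i) xs"
  by (simp add: list_update_append replicate_app_Cons_same flip: Cons_nth_drop_Suc)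

lemma sum_fun_scale_apply: "(\<Sum>i\<in>I. fun_scale (c i) (X i)) p x = (\<Sum>i\<in>I. c i * X i p x)"
  by (induction I rule: infinite_finite_induct) (auto simp: fun_scale_def)

context complex_frame
begin

lemma pq_n0_part:
  assumes vs: "vs \<in> tvecs A n p"
  shows "pq_part A J n 0 p a vs = a (map (proj10 J p) vs)"
proof -
  have "{S. S \<subseteq> {..<n} \<and> card S = n} = {{..<n}}"
    using card_subset_eq[OF finite_lessThan[of n]] by auto
  moreover have "map (\<lambda>i. if i \<in> {..<n} then proj10 J p (vs ! i) else proj01 J p (vs ! i)) [0..<n] = map (proj10 J p) vs"
    using vs by (intro nth_equalityI) (auto simp: tvecs_def)
  ultimately show ?thesis using vs by (simp add: pq_part_def)
qed

lemma map_proj_tvecs: "vs \<in> tvecs A n p \<Longrightarrow> map (proj10 J p) vs \<in> tvecs A n p"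
  using proj_ct by (auto simp: tvecs_def)

lemma pq_formsD:
  assumes "a \<in> pq_forms A J n 0 p"
  shows "a \<in> alt_forms A n p" "vs \<in> tvecs A n p \<Longrightarrow> a vs = a (map (proj10 J p) vs)"
proof -
  show "a \<in> alt_forms A n p" using assms by (simp add: pq_forms_def)
  have "pq_part A J n 0 p a = a" using assms by (simp add: pq_forms_def)
  then show "vs \<in> tvecs A n p \<Longrightarrow> a vs = a (map (proj10 J p) vs)" using pq_n0_part by metis
qed

lemma cPhi_pq: "(\<lambda>vs. c * Phi p vs) \<in> pq_forms A J n 0 p"
proof -
  have a: "(\<lambda>vs. c * Phi p vs) \<in> alt_forms A n p" by (rule alt_forms_cmult[OF Phi_alt])
  have "pq_part A J n 0 p (\<lambda>vs. c * Phi p vs) vs = c * Phi p vs" for vs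
  proof (cases "vs \<in> tvecs A n p")
    case True
    have "Phi p (map (proj10 J p) vs) = Phi p vs"
    proof (rule Phi_cong[OF map_proj_tvecs[OF True] True])
      fix i j assume i: "i \<in> {1..n}" and j: "j < n"
      have "length vs = n" using True by (simp add: tvecs_def)
      then show "ph i p [map (proj10 J p) vs ! j] = ph i p [vs ! j]"
        using ph_proj(1)[OF tvecs_nth[OF True j] i] j by simp
    qed
    then show ?thesis unfolding pq_n0_part[OF True] by simp
  next
    case False
    then show ?thesis using alt_off[OF Phi_alt False] by (simp add: pq_part_def)
  qed
  then show ?thesis using a by (auto simp: pq_forms_def)
qed

text \<open>An (n,0)-form depends only on the (1,0)-parts of its arguments and so is killed by each
  \<open>Zb k\<close>; \<open>alt_unique\<close> applies to the difference of the two sides.\<close>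

lemma pq_eq:
  assumes a: "a \<in> pq_forms A J n 0 p"
  shows "a vs = a (at_point Zs p) * Phi p vs"
proof -
  note alt = pq_formsD(1)[OF a]
  have "a vs + (- a (at_point Zs p)) * Phi p vs = 0"
  proof (rule alt_unique[OF alt_forms_lin[OF alt Phi_alt]])
    fix vs i k assume vs: "vs \<in> tvecs A n p" and i: "i < n" and k: "k \<in> {1..n}"
    have len: "length vs = n" using vs by (simp add: tvecs_def)
    have w: "vs[i := Zb k p] \<in> tvecs A n p" by (rule tvecs_update[OF vs Z_ct(2)[OF k]])
    have "a (vs[i := Zb k p]) = a ((map (proj10 J p) vs)[i := (\<lambda>f. 0)])"
      unfolding pq_formsD(2)[OF a w] map_update proj_Z(3)[OF k] ..
    also have "\<dots> = 0" by (rule alt_zero[OF alt map_proj_tvecs[OF vs] i])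
    finally have "a (vs[i := Zb k p]) = 0" .
    moreover have "Phi p (vs[i := Zb k p]) = 0"
      by (rule Phi_kill[OF w i]) (use i len k in \<open>simp add: ph_dual(2)\<close>)
    ultimately show "a (vs[i := Zb k p]) + (- a (at_point Zs p)) * Phi p (vs[i := Zb k p]) = 0" by simp
  qed (simp add: Phi_Zs)
  then show ?thesis by simp
qed

lemma canonical_gPhi:
  assumes g: "\<And>p. smooth_at A p g"
  shows "canonical_section A J (\<lambda>q vs. g q * Phi q vs)"
  unfolding canonical_section_def cdim smooth_form_def smooth_fun_iff
  using cPhi_pq gPhi_alt gPhi_sm[OF g] by blast

lemma canonicalD:
  assumes "canonical_section A J s"
  shows "s = (\<lambda>q vs. s q (at_point Zs q) * Phi q vs)" "smooth_at A p (\<lambda>q. s q (at_point Zs q))"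
proof -
  show "s = (\<lambda>q vs. s q (at_point Zs q) * Phi q vs)"
    by (intro ext pq_eq) (use assms in \<open>simp add: canonical_section_def cdim\<close>)
  have "smooth_form A n s" using assms by (simp add: canonical_section_def cdim)
  then show "smooth_at A p (\<lambda>q. s q (at_point Zs q))"
    using Zs_facts unfolding smooth_form_def smooth_fun_iff by blast
qed

text \<open>The isomorphism takes a form to its coefficient with respect to \<open>Phi\<close>, that
  is, to its value on \<open>Zs\<close>.\<close>

lemma trivialI:
  assumes z: "\<forall>l\<in>{1..n}. tau l = 0"
  shows "pseudoholomorphically_trivial A J"
  unfolding pseudoholomorphically_trivial_def cdim
proof (intro exI[of _ "\<lambda>p a. a (at_point Zs p)"] conjI allI ballI impI)
  fix p
  show "bij_betw (\<lambda>a. a (at_point Zs p)) (pq_forms A J n 0 p) UNIV"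
  proof (rule bij_betw_byWitness[where f' = "\<lambda>c vs. c * Phi p vs"])
    show "\<forall>a\<in>pq_forms A J n 0 p. (\<lambda>vs. a (at_point Zs p) * Phi p vs) = a"
      using pq_eq by (intro ballI ext) (rule sym)
  qed (use cPhi_pq Phi_Zs in auto)
next
  fix s assume s: "\<forall>p. s p \<in> pq_forms A J n 0 p"
  show "canonical_section A J s \<longleftrightarrow> smooth_fun A (\<lambda>p. s p (at_point Zs p))"
  proof
    assume "canonical_section A J s"
    then show "smooth_fun A (\<lambda>p. s p (at_point Zs p))" unfolding smooth_fun_iff using canonicalD(2) by blast
  next
    assume "smooth_fun A (\<lambda>p. s p (at_point Zs p))"
    then have "canonical_section A J (\<lambda>q vs. s q (at_point Zs q) * Phi q vs)"
      unfolding smooth_fun_iff by (intro canonical_gPhi) blast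
    moreover have "(\<lambda>q vs. s q (at_point Zs q) * Phi q vs) = s"
      by (intro ext pq_eq[symmetric]) (use s in blast)
    ultimately show "canonical_section A J s" by simp
  qed
next
  fix s p w assume s: "canonical_section A J s" and w: "w \<in> ctangent A p"
  let ?g = "\<lambda>q. s q (at_point Zs q)"
  have "dbar_canonical A J (\<lambda>q vs. ?g q * Phi q vs) p w = (\<lambda>vs. proj01 J p w ?g * Phi p vs)"
    by (rule dbar_canonical_gPhi[OF canonicalD(2)[OF s] w z])
  then show "dbar_canonical A J s p w (at_point Zs p) = proj01 J p w ?g"
    unfolding canonicalD(1)[OF s, symmetric] by (simp add: Phi_Zs)
qed (rule refl)

text \<open>The section \<open>g\<close> times the \<open>m\<close>-th tensor power of
  \<open>Phi\<close>. Only the length is tested, as in \<open>tensor\<close>; blocks that are not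
  lists of \<open>n\<close> tangent vectors give 0 because \<open>Phi\<close> does.\<close>

definition Phi_power :: "nat \<Rightarrow> ('m \<Rightarrow> complex) \<Rightarrow> 'm power_section" where
  "Phi_power m g = (\<lambda>p vss. if length vss = m then g p * (\<Prod>j<m. Phi p (vss ! j)) else 0)"

text \<open>The value of \<open>dbar_power\<close> on \<open>Phi_power m g\<close> when all
  \<open>tau l\<close> vanish: only \<open>g\<close> is differentiated. The zero cases match those
  of \<open>dbar_canonical\<close> and of the Leibniz rule, since equality is required as HOL
  functions.\<close>

definition dbar_Phi_power :: "nat \<Rightarrow> ('m \<Rightarrow> complex) \<Rightarrow> 'm \<Rightarrow> 'm tvec \<Rightarrow> 'm tvec list list \<Rightarrow> complex" where
  "dbar_Phi_power m g = (\<lambda>p w vss. if length vss = m then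
     (if w \<in> ctangent A p then proj01 J p w g * (\<Prod>j<m. Phi p (vss ! j)) else 0) else 0)"

definition pseudoholomorphic :: "('m \<Rightarrow> complex) \<Rightarrow> bool" where
  "pseudoholomorphic g \<longleftrightarrow> (\<forall>p. smooth_at A p g) \<and> (\<forall>p. \<forall>w\<in>ctangent A p. proj01 J p w g = 0)"

abbreviation Zrep :: "nat \<Rightarrow> 'm \<Rightarrow> 'm tvec list list" where "Zrep m p \<equiv> replicate m (at_point Zs p)"

lemma Phi_power_Zrep: "Phi_power m g p (Zrep m p) = g p"
  by (simp add: Phi_power_def Phi_Zs)

lemma Phi_power_inj: "Phi_power m g = Phi_power m h \<Longrightarrow> g = h"
  by (rule ext) (metis Phi_power_Zrep)

lemma dbar_Phi_power_Zrep: "w \<in> ctangent A p \<Longrightarrow> dbar_Phi_power m g p w (Zrep m p) = proj01 J p w g"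
  by (simp add: dbar_Phi_power_def Phi_Zs)

text \<open>The blocks are replaced by \<open>Zs\<close> one after the other; since the section is
  an (n,0)-form in each block, every replacement splits off a factor \<open>Phi\<close>.\<close>

lemma power_eq:
  assumes s: "canonical_power_section A J m s"
  shows "s = Phi_power m (\<lambda>p. s p (Zrep m p))" "smooth_at A p (\<lambda>p. s p (Zrep m p))"
proof -
  have pq: "(\<lambda>vs. s p (vss[i := vs])) \<in> pq_forms A J n 0 p" if "vss \<in> blocks A m p" "i < m" for p vss i
    using s that unfolding canonical_power_section_def cdim by blast
  show "s = Phi_power m (\<lambda>p. s p (Zrep m p))"
  proof (intro ext)
    fix p vss
    show "s p vss = Phi_power m (\<lambda>p. s p (Zrep m p)) p vss"
    proof (cases "vss \<in> blocks A m p")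
      case True
      then have len: "length vss = m" and sub: "set vss \<subseteq> tvecs A n p" by (auto simp: blocks_def cdim)
      have "i \<le> m \<Longrightarrow> s p vss = (\<Prod>j<i. Phi p (vss ! j)) * s p (Zrep i p @ drop i vss)" for i
      proof (induction i)
        case (Suc i)
        have i: "i < m" using Suc.prems by simp
        let ?L = "Zrep i p @ drop i vss"
        have L: "?L \<in> blocks A m p"
          using i len sub Zs_tvecs[of p] by (auto simp: blocks_def cdim dest: in_set_dropD)
        have Li: "?L ! i = vss ! i" using i len by (simp add: nth_append)
        have upd: "?L[i := at_point Zs p] = Zrep (Suc i) p @ drop (Suc i) vss"
          by (rule replicate_drop_update) (use i len in simp)
        have "s p ?L = s p (?L[i := vss ! i])" using Li by (metis list_update_id)
        also have "\<dots> = s p (?L[i := at_point Zs p]) * Phi p (vss ! i)"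
          by (rule pq_eq[OF pq[OF L i]])
        finally show ?case using Suc i unfolding upd by simp
      qed simp
      from this[of m] show ?thesis using len by (simp add: Phi_power_def)
    next
      case False
      then have z: "s p vss = 0" using s by (simp add: canonical_power_section_def)
      show ?thesis
      proof (cases "length vss = m")
        case True
        then obtain j where j: "j < m" "vss ! j \<notin> tvecs A n p"
          using False by (auto simp: blocks_def cdim set_conv_nth subset_iff)
        then have "(\<Prod>j<m. Phi p (vss ! j)) = 0"
          using alt_off[OF Phi_alt j(2)] by (intro prod_zero) auto
        then show ?thesis using z by (simp add: Phi_power_def)
      qed (simp add: Phi_power_def z)
    qed
  qed
  have "\<forall>Xss. length Xss = m \<and> (\<forall>Xs\<in>set Xss. length Xs = n \<and> (\<forall>X\<in>set Xs. smooth_vfield A X)) \<longrightarrow>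
        smooth_fun A (\<lambda>p. s p (map (\<lambda>Xs. at_point Xs p) Xss))"
    using s unfolding canonical_power_section_def cdim by (elim conjE) assumption
  then have "smooth_fun A (\<lambda>p. s p (map (\<lambda>Xs. at_point Xs p) (replicate m Zs)))"
    by (rule allE[where x = "replicate m Zs"]) (use Zs_facts in simp)
  then show "smooth_at A p (\<lambda>p. s p (Zrep m p))" by (simp add: smooth_fun_iff map_replicate)
qed

lemma Phi_power_canonical:
  assumes g: "\<And>p. smooth_at A p g"
  shows "canonical_power_section A J m (Phi_power m g)"
  unfolding canonical_power_section_def cdim
proof (intro conjI allI impI ballI)
  fix p vss assume vss: "vss \<notin> blocks A m p"
  show "Phi_power m g p vss = 0"
  proof (cases "length vss = m")
    case True
    then obtain j where j: "j < m" "vss ! j \<notin> tvecs A n p"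
      using vss by (auto simp: blocks_def cdim set_conv_nth subset_iff)
    then have "(\<Prod>j<m. Phi p (vss ! j)) = 0"
      using alt_off[OF Phi_alt j(2)] by (intro prod_zero) auto
    then show ?thesis by (simp add: Phi_power_def)
  qed (simp add: Phi_power_def)
next
  fix p vss i assume vss: "vss \<in> blocks A m p" and i: "i < m"
  then have len: "length vss = m" by (simp add: blocks_def)
  let ?c = "g p * (\<Prod>j\<in>{..<m} - {i}. Phi p (vss ! j))"
  have "Phi_power m g p (vss[i := vs]) = ?c * Phi p vs" for vs
  proof -
    have "(\<Prod>j<m. Phi p (vss[i := vs] ! j)) = Phi p (vss[i := vs] ! i) * (\<Prod>j\<in>{..<m} - {i}. Phi p (vss[i := vs] ! j))"
      using i by (intro prod.remove) auto
    also have "(\<Prod>j\<in>{..<m} - {i}. Phi p (vss[i := vs] ! j)) = (\<Prod>j\<in>{..<m} - {i}. Phi p (vss ! j))"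
      by (rule prod.cong) auto
    finally show ?thesis using len i by (simp add: Phi_power_def)
  qed
  then have "(\<lambda>vs. Phi_power m g p (vss[i := vs])) = (\<lambda>vs. ?c * Phi p vs)" by (rule ext)
  then show "(\<lambda>vs. Phi_power m g p (vss[i := vs])) \<in> pq_forms A J n 0 p" using cPhi_pq by simp
next
  fix Xss assume X: "length Xss = m \<and> (\<forall>Xs\<in>set Xss. length Xs = n \<and> (\<forall>X\<in>set Xs. smooth_vfield A X))"
  have "smooth_at A p (\<lambda>p. g p * (\<Prod>j<m. Phi p (at_point (Xss ! j) p)))" for p
    by (intro smooth_at_mult g smooth_at_prod Phi_smooth) (use X in auto)
  moreover have "Phi_power m g p (map (\<lambda>Xs. at_point Xs p) Xss) = g p * (\<Prod>j<m. Phi p (at_point (Xss ! j) p))" for p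
    using X by (simp add: Phi_power_def)
  ultimately show "smooth_fun A (\<lambda>p. Phi_power m g p (map (\<lambda>Xs. at_point Xs p) Xss))" by (simp add: smooth_fun_iff)
qed

text \<open>Every factor is a function times \<open>Phi\<close>, so the Leibniz sum becomes the
  derivative of the product of these functions.\<close>

lemma tensor_Phi_power:
  assumes as: "length fs = m" "\<forall>\<alpha>\<in>set fs. canonical_section A J \<alpha>" and z: "\<forall>l\<in>{1..n}. tau l = 0"
    and g_def: "g = (\<lambda>q. \<Prod>j<m. (fs ! j) q (at_point Zs q))"
  shows "tensor fs = Phi_power m g"
    and "(\<lambda>p w vss. if length vss = m
         then (\<Sum>i<m. dbar_canonical A J (fs ! i) p w (vss ! i) *
                (\<Prod>j\<in>{..<m} - {i}. (fs ! j) p (vss ! j))) else 0) = dbar_Phi_power m g"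
    and "smooth_at A p g"
proof -
  let ?g = "\<lambda>j q. (fs ! j) q (at_point Zs q)"
  have can: "canonical_section A J (fs ! j)" if "j < m" for j using as that by simp
  have f: "(fs ! j) p vs = ?g j p * Phi p vs" if "j < m" for j p vs
    using canonicalD(1)[OF can[OF that]] by metis
  have gs: "smooth_at A p (?g j)" if "j < m" for j p using canonicalD(2)[OF can[OF that]] .
  show "smooth_at A p g" for p unfolding g_def by (intro smooth_at_prod gs) simp
  show "tensor fs = Phi_power m g"
  proof (intro ext)
    fix p vss
    have "(\<Prod>j<m. (fs ! j) p (vss ! j)) = (\<Prod>j<m. ?g j p * Phi p (vss ! j))"
      by (rule prod.cong[OF refl]) (rule f, simp)
    then show "tensor fs p vss = Phi_power m g p vss" by (simp add: tensor_def Phi_power_def as(1) g_def prod.distrib)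
  qed
  show "(\<lambda>p w vss. if length vss = m
         then (\<Sum>i<m. dbar_canonical A J (fs ! i) p w (vss ! i) *
                (\<Prod>j\<in>{..<m} - {i}. (fs ! j) p (vss ! j))) else 0) = dbar_Phi_power m g"
  proof (intro ext)
    fix p w vss
    have "(\<Sum>i<m. dbar_canonical A J (fs ! i) p w (vss ! i) * (\<Prod>j\<in>{..<m} - {i}. (fs ! j) p (vss ! j))) =
       (if w \<in> ctangent A p then proj01 J p w g * (\<Prod>j<m. Phi p (vss ! j)) else 0)"
    proof (cases "w \<in> ctangent A p")
      case True
      have dc: "dbar_canonical A J (fs ! i) p w vs = proj01 J p w (?g i) * Phi p vs" if "i < m" for i vs
      proof -
        have "fs ! i = (\<lambda>q vs. ?g i q * Phi q vs)" by (rule canonicalD(1)[OF can[OF that]])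
        then have "dbar_canonical A J (fs ! i) p w = dbar_canonical A J (\<lambda>q vs. ?g i q * Phi q vs) p w" by (rule arg_cong)
        also have "\<dots> = (\<lambda>vs. proj01 J p w (?g i) * Phi p vs)" by (rule dbar_canonical_gPhi[OF gs[OF that] True z])
        finally show ?thesis by (rule fun_cong)
      qed
      have "dbar_canonical A J (fs ! i) p w (vss ! i) * (\<Prod>j\<in>{..<m} - {i}. (fs ! j) p (vss ! j)) =
          (proj01 J p w (?g i) * (\<Prod>j\<in>{..<m} - {i}. ?g j p)) * (\<Prod>j<m. Phi p (vss ! j))" if i: "i < m" for i
      proof -
        have "(\<Prod>j\<in>{..<m} - {i}. (fs ! j) p (vss ! j)) = (\<Prod>j\<in>{..<m} - {i}. ?g j p * Phi p (vss ! j))"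
          by (rule prod.cong[OF refl]) (rule f, simp)
        moreover have "(\<Prod>j<m. Phi p (vss ! j)) = Phi p (vss ! i) * (\<Prod>j\<in>{..<m} - {i}. Phi p (vss ! j))"
          using i by (intro prod.remove) auto
        ultimately show ?thesis unfolding dc[OF i] by (simp add: prod.distrib)
      qed
      then have "(\<Sum>i<m. dbar_canonical A J (fs ! i) p w (vss ! i) * (\<Prod>j\<in>{..<m} - {i}. (fs ! j) p (vss ! j))) =
         (\<Sum>i<m. proj01 J p w (?g i) * (\<Prod>j\<in>{..<m} - {i}. ?g j p)) * (\<Prod>j<m. Phi p (vss ! j))"
        by (simp add: sum_distrib_right)
      also have "(\<Sum>i<m. proj01 J p w (?g i) * (\<Prod>j\<in>{..<m} - {i}. ?g j p)) = proj01 J p w g"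
        unfolding g_def by (rule ctangent_fun_prod[OF proj_ct(2)[OF True], symmetric]) (simp_all add: gs)
      finally show ?thesis using True by simp
    next
      case False
      then show ?thesis by (simp add: dbar_canonical_def)
    qed
    then show "(if length vss = m
         then (\<Sum>i<m. dbar_canonical A J (fs ! i) p w (vss ! i) *
                (\<Prod>j\<in>{..<m} - {i}. (fs ! j) p (vss ! j))) else 0) = dbar_Phi_power m g p w vss"
      by (simp add: dbar_Phi_power_def)
  qed
qed

text \<open>A section can be a sum of tensors in many ways, but its image depends only on the
  function \<open>g\<close>, which \<open>Phi_power_inj\<close> recovers from the section. Hence the
  graph is single-valued, as the \<open>THE\<close> in \<open>dbar_power\<close> demands.\<close>

lemma graph_char:
  assumes z: "\<forall>l\<in>{1..n}. tau l = 0"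
  shows "dbar_power_graph A J m s t' \<Longrightarrow> \<exists>g. (\<forall>p. smooth_at A p g) \<and> s = Phi_power m g \<and> t' = dbar_Phi_power m g"
proof (induction rule: dbar_power_graph.induct)
  case (leibniz \<alpha>s)
  note T = tensor_Phi_power[OF leibniz z refl]
  show ?case by (rule exI, intro conjI allI, rule T(3), rule T(1), rule T(2))
next
  case (add s t s' t')
  then obtain g h where g: "\<forall>p. smooth_at A p g" "s = Phi_power m g" "t = dbar_Phi_power m g" and h: "\<forall>p. smooth_at A p h" "s' = Phi_power m h" "t' = dbar_Phi_power m h"
    by blast
  have "(\<lambda>p vss. s p vss + s' p vss) = Phi_power m (\<lambda>q. g q + h q)"
    unfolding g h by (simp add: Phi_power_def fun_eq_iff distrib_right)
  moreover have "(\<lambda>p w vss. t p w vss + t' p w vss) = dbar_Phi_power m (\<lambda>q. g q + h q)"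
  proof (intro ext)
    fix p w vss
    show "t p w vss + t' p w vss = dbar_Phi_power m (\<lambda>q. g q + h q) p w vss"
    proof (cases "w \<in> ctangent A p")
      case True
      have "smooth_at A p g" "smooth_at A p h" using g h by blast+
      from ctangent_fun_add[OF proj_ct(2)[OF True] this] show ?thesis
        unfolding g h by (simp add: dbar_Phi_power_def distrib_right)
    qed (simp add: g h dbar_Phi_power_def)
  qed
  moreover have "\<forall>p. smooth_at A p (\<lambda>q. g q + h q)" using g(1) h(1) by (intro allI smooth_at_add) (rule spec, assumption)+
  ultimately show ?case by (intro exI[of _ "\<lambda>q. g q + h q"] conjI)
qed

lemma graph_Phi_power:
  assumes z: "\<forall>l\<in>{1..n}. tau l = 0" and g: "\<And>p. smooth_at A p g" and m: "m \<ge> 1"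
  shows "dbar_power_graph A J m (Phi_power m g) (dbar_Phi_power m g)"
proof -
  let ?s = "\<lambda>g q vs. g q * Phi q vs"
  \<comment> \<open>All of \<open>g\<close> is put into the first factor and the other factors are
    \<open>Phi\<close>; this requires at least one factor.\<close>
  let ?as = "map (\<lambda>i. if i = 0 then ?s g else ?s (\<lambda>q. 1)) [0..<m]"
  have len: "length ?as = m" by simp
  have can: "\<forall>\<alpha>\<in>set ?as. canonical_section A J \<alpha>"
    using canonical_gPhi[of g] canonical_gPhi[of "\<lambda>q. 1"] g smooth_at_const by auto
  have "(\<Prod>j<m. (?as ! j) q (at_point Zs q)) = (\<Prod>j<m. if j = 0 then g q else 1)" for q
    by (rule prod.cong[OF refl]) (simp add: Phi_Zs)
  also have "\<dots> q = g q" for q using m by (simp add: prod.delta)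
  finally have ge: "g = (\<lambda>q. \<Prod>j<m. (?as ! j) q (at_point Zs q))" by (intro ext) (rule sym)
  note T = tensor_Phi_power[OF len can z ge]
  show ?thesis using dbar_power_graph.leibniz[OF len can] unfolding T(1,2) .
qed

lemma dbar_power_Phi_power:
  assumes z: "\<forall>l\<in>{1..n}. tau l = 0" and g: "\<And>p. smooth_at A p g" and m: "m \<ge> 1"
  shows "dbar_power A J m (Phi_power m g) = dbar_Phi_power m g"
  unfolding dbar_power_def
proof (rule the_equality)
  show "dbar_power_graph A J m (Phi_power m g) (dbar_Phi_power m g)" by (rule graph_Phi_power[OF assms])
  fix t' assume "dbar_power_graph A J m (Phi_power m g) t'"
  then obtain h where h: "Phi_power m g = Phi_power m h" "t' = dbar_Phi_power m h" using graph_char[OF z] by blast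
  then show "t' = dbar_Phi_power m g" using Phi_power_inj[OF h(1)] by simp
qed

lemma H0_eq:
  assumes z: "\<forall>l\<in>{1..n}. tau l = 0" and m: "m \<ge> 1"
  shows "H0 A J m = Phi_power m ` {g. pseudoholomorphic g}"
proof -
  have Q: "dbar_Phi_power m g = (\<lambda>p w vss. 0) \<longleftrightarrow> (\<forall>p. \<forall>w\<in>ctangent A p. proj01 J p w g = 0)" for g
  proof
    assume Q0: "dbar_Phi_power m g = (\<lambda>p w vss. 0)"
    show "\<forall>p. \<forall>w\<in>ctangent A p. proj01 J p w g = 0"
    proof (intro allI ballI)
      fix p w assume "w \<in> ctangent A p"
      from dbar_Phi_power_Zrep[OF this, of m g] show "proj01 J p w g = 0" unfolding Q0 by simp
    qed
  qed (auto simp: dbar_Phi_power_def fun_eq_iff)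
  show ?thesis
  proof (intro equalityI subsetI)
    fix s assume "s \<in> H0 A J m"
    then have s: "canonical_power_section A J m s" "dbar_power A J m s = (\<lambda>p w vss. 0)" by (auto simp: H0_def)
    define g where "g p = s p (Zrep m p)" for p
    have sg: "s = Phi_power m g" "\<And>p. smooth_at A p g" using power_eq[OF s(1)] by (simp_all add: g_def[abs_def])
    have "dbar_Phi_power m g = (\<lambda>p w vss. 0)" using dbar_power_Phi_power[OF z sg(2) m] s(2) sg(1) by simp
    then have "pseudoholomorphic g" unfolding Q pseudoholomorphic_def using sg(2) by blast
    then show "s \<in> Phi_power m ` {g. pseudoholomorphic g}" using sg(1) by blast
  next
    fix s assume "s \<in> Phi_power m ` {g. pseudoholomorphic g}"
    then obtain g where g: "pseudoholomorphic g" "s = Phi_power m g" by blast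
    then have smooth_at: "\<And>p. smooth_at A p g" by (simp add: pseudoholomorphic_def)
    have "dbar_Phi_power m g = (\<lambda>p w vss. 0)" unfolding Q using g(1) by (simp add: pseudoholomorphic_def)
    then show "s \<in> H0 A J m"
      using Phi_power_canonical[OF smooth_at] dbar_power_Phi_power[OF z smooth_at m] g(2) by (simp add: H0_def)
  qed
qed

lemma pseudoholomorphic_const: "pseudoholomorphic (\<lambda>q. c)"
  unfolding pseudoholomorphic_def using smooth_at_const ctangent_const proj_ct(2) by blast

lemma pseudoholomorphic_power:
  assumes "pseudoholomorphic g"
  shows "pseudoholomorphic (\<lambda>q. g q ^ k)"
proof (induction k)
  case 0
  then show ?case using pseudoholomorphic_const[of 1] by simp
next
  case (Suc k)
  have s: "smooth_at A p g" "smooth_at A p (\<lambda>q. g q ^ k)" for p using assms Suc by (simp_all add: pseudoholomorphic_def)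
  have d: "proj01 J p w g = 0" "proj01 J p w (\<lambda>q. g q ^ k) = 0" if "w \<in> ctangent A p" for p w
    using assms Suc that by (simp_all add: pseudoholomorphic_def)
  show ?case
    unfolding pseudoholomorphic_def power_Suc
  proof (intro conjI allI ballI)
    fix p show "smooth_at A p (\<lambda>q. g q * g q ^ k)" by (rule smooth_at_mult[OF s])
    fix w assume w: "w \<in> ctangent A p"
    show "proj01 J p w (\<lambda>q. g q * g q ^ k) = 0"
      unfolding ctangent_fun_mult[OF proj_ct(2)[OF w] s] d[OF w] by simp
  qed
qed

lemma Phi_power_scale: "Phi_power m (\<lambda>q. c) = fun_scale c (Phi_power m (\<lambda>q. 1))"
  by (auto simp: Phi_power_def fun_scale_def fun_eq_iff)

lemma kod_zeroI:
  assumes z: "\<forall>l\<in>{1..n}. tau l = 0" and const: "\<And>g. pseudoholomorphic g \<Longrightarrow> \<exists>c. g = (\<lambda>p. c)"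
  shows "kod A J = 0"
proof -
  let ?P = "\<lambda>m. Phi_power m (\<lambda>q. 1)"
  have ne: "?P m \<noteq> 0" for m
  proof
    assume "?P m = 0"
    then have "?P m undefined (Zrep m undefined) = 0" by (simp add: zero_fun_def)
    then show False unfolding Phi_power_Zrep by simp
  qed
  have H: "H0 A J m = complex_fun.span {?P m}" if m: "m \<ge> 1" for m
  proof -
    have "{g. pseudoholomorphic g} = range (\<lambda>c q. c)" using const pseudoholomorphic_const by blast
    then have "H0 A J m = range (\<lambda>c. Phi_power m (\<lambda>q. c))" unfolding H0_eq[OF z m] by (simp add: image_image)
    also have "(\<lambda>c. Phi_power m (\<lambda>q. c)) = (\<lambda>c. fun_scale c (?P m))" by (rule ext) (rule Phi_power_scale)
    also have "range (\<lambda>c. fun_scale c (?P m)) = complex_fun.span {?P m}" unfolding complex_fun.span_singleton ..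
    finally show ?thesis .
  qed
  have ld: "log_dim (H0 A J m) = 0" if m: "m \<ge> 1" for m
  proof -
    have "finite_dim (H0 A J m)" unfolding finite_dim_def H[OF m] by (intro exI[of _ "{?P m}"]) simp
    moreover have "complex_fun.dim (H0 A J m) = 1"
      unfolding H[OF m] using complex_fun.dim_span_eq_card_independent[of "{?P m}"] ne by simp
    ultimately show ?thesis by (simp add: log_dim_def)
  qed
  have "?P 1 \<in> H0 A J 1" using H[of 1] complex_fun.span_base by blast
  then have "H0 A J 1 \<noteq> {\<lambda>p vss. 0}" using ne[of 1] by (auto simp: zero_fun_def)
  then have "\<not> (\<forall>m\<ge>1. H0 A J m = {\<lambda>p vss. 0})" by blast
  then have "kod A J = limsup (\<lambda>m. log_dim (H0 A J m) / ereal (ln (real m)))" unfolding kod_def by (rule if_not_P)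
  also have "\<dots> = limsup (\<lambda>m. 0 :: ereal)"
  proof (rule Limsup_eq)
    show "\<forall>\<^sub>F m in sequentially. log_dim (H0 A J m) / ereal (ln (real m)) = 0"
      \<comment> \<open>From \<open>m = 2\<close> on the denominator \<open>ln m\<close> is
        positive.\<close>
      using eventually_ge_at_top[of 2]
    proof eventually_elim
      fix m :: nat assume "2 \<le> m"
      then show "log_dim (H0 A J m) / ereal (ln (real m)) = 0" using ld[of m] by simp
    qed
  qed
  also have "\<dots> = 0" by (rule Limsup_const) simp
  finally show ?thesis .
qed

lemma pseudoholomorphic_finite_dim_const:
  assumes z: "\<forall>l\<in>{1..n}. tau l = 0" and conn: "connected (UNIV :: 'm set)"
    and fd: "finite_dim (H0 A J 1)" and g: "pseudoholomorphic g"
  shows "\<exists>c. g = (\<lambda>p. c)"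
proof -
  obtain B where B: "finite B" "H0 A J 1 \<subseteq> complex_fun.span B" using fd by (auto simp: finite_dim_def)
  define N where "N = card B"
  define V where "V k = Phi_power 1 (\<lambda>q. g q ^ k)" for k
  have VB: "V k \<in> complex_fun.span B" for k
    using B(2) pseudoholomorphic_power[OF g, of k] H0_eq[OF z, of 1] by (auto simp: V_def)
  have Vg: "V k p (Zrep 1 p) = g p ^ k" for k p unfolding V_def by (rule Phi_power_Zrep)
  \<comment> \<open>At most \<open>N\<close> vectors span the \<open>N + 1\<close> powers of
    \<open>g\<close>, so these satisfy a nontrivial linear relation. If two powers coincide as
    sections, their difference is the relation.\<close>
  have "\<exists>c. (\<exists>k\<le>N. c k \<noteq> 0) \<and> (\<forall>p. (\<Sum>k\<le>N. c k * g p ^ k) = 0)"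
  proof (cases "inj_on V {..N}")
    case True
    have "complex_fun.dependent (V ` {..N})"
    proof (rule ccontr)
      assume "complex_fun.independent (V ` {..N})"
      moreover have "V ` {..N} \<subseteq> complex_fun.span B" using VB by blast
      ultimately have "card (V ` {..N}) \<le> card B"
        using complex_fun.independent_span_bound[OF B(1)] by blast
      then show False using card_image[OF True] by (simp add: N_def)
    qed
    then obtain u where u: "\<exists>v\<in>V ` {..N}. u v \<noteq> 0" "(\<Sum>v\<in>V ` {..N}. fun_scale (u v) v) = 0"
      using complex_fun.dependent_finite[of "V ` {..N}"] by auto
    have "(\<Sum>k\<le>N. fun_scale (u (V k)) (V k)) = 0" using u(2) by (simp add: sum.reindex[OF True])
    then have uz: "(\<Sum>k\<le>N. u (V k) * V k p x) = 0" for p x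
      using sum_fun_scale_apply[of "\<lambda>k. u (V k)" V "{..N}" p x] by (simp add: zero_fun_def)
    have "(\<Sum>k\<le>N. u (V k) * g p ^ k) = 0" for p using uz[of p "Zrep 1 p"] by (simp only: Vg)
    then show ?thesis using u(1) by (intro exI[of _ "\<lambda>k. u (V k)"]) auto
  next
    case False
    then obtain i j where ij: "i \<le> N" "j \<le> N" "i \<noteq> j" "V i = V j" by (auto simp: inj_on_def)
    let ?c = "\<lambda>k. (if k = i then 1 else 0) - (if k = j then 1 else 0) :: complex"
    have "(\<Sum>k\<le>N. ?c k * g p ^ k) = 0" for p
    proof -
      have "(\<Sum>k\<le>N. ?c k * g p ^ k) = (\<Sum>k\<le>N. (if k = i then g p ^ k else 0)) - (\<Sum>k\<le>N. (if k = j then g p ^ k else 0))"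
        unfolding sum_subtractf[symmetric] by (rule sum.cong) auto
      also have "\<dots> = g p ^ i - g p ^ j" using ij by simp
      also have "\<dots> = 0" unfolding Vg[symmetric] ij(4) by simp
      finally show ?thesis .
    qed
    then show ?thesis using ij by (intro exI[of _ ?c]) auto
  qed
  then obtain c where c: "\<exists>k\<le>N. c k \<noteq> 0" "\<And>p. (\<Sum>k\<le>N. c k * g p ^ k) = 0" by blast
  have "finite {x. (\<Sum>k\<le>N. c k * x ^ k) = 0}" using polyfun_finite_roots[of c N] c(1) by blast
  then have fin: "finite (range g)" by (rule finite_subset[rotated]) (use c(2) in auto)
  have "continuous_on UNIV g"
    unfolding continuous_on_def
  proof
    fix p
    have "(g \<longlongrightarrow> g p) (nhds p)" using g by (intro smooth_at_tendsto) (simp add: pseudoholomorphic_def)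
    then show "(g \<longlongrightarrow> g p) (at p within UNIV)" by (rule filterlim_mono) (simp_all add: at_within_def)
  qed
  then have "connected (range g)" by (rule connected_continuous_image[OF _ conn])
  then obtain a where "range g = {a}" using connected_finite_iff_sing[of "range g"] fin by blast
  then show ?thesis by (intro exI[of _ a] ext) blast
qed

end

section \<open>The compact case\<close>

text \<open>Were \<open>l\<close> positive, the first derivative would be positive just to the right
  of 0, and by the mean value theorem \<open>\<psi>\<close> would exceed its maximum.\<close>

lemma second_derivative_at_max:
  fixes \<psi> \<psi>' :: "real \<Rightarrow> real"
  assumes e: "\<epsilon> > 0" and d: "\<And>t. \<bar>t\<bar> < \<epsilon> \<Longrightarrow> (\<psi> has_real_derivative \<psi>' t) (at t)"
    and d2: "(\<psi>' has_real_derivative l) (at 0)" and max: "\<And>t. \<bar>t\<bar> < \<epsilon> \<Longrightarrow> \<psi> t \<le> \<psi> 0"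
  shows "\<psi>' 0 = 0" "l \<le> 0"
proof -
  show z: "\<psi>' 0 = 0"
    by (rule DERIV_local_max[OF d[of 0] e]) (use e max in auto)
  show "l \<le> 0"
  proof (rule ccontr)
    assume "\<not> l \<le> 0"
    then obtain r where r: "r > 0" "\<And>h. 0 < h \<Longrightarrow> h < r \<Longrightarrow> \<psi>' 0 < \<psi>' (0 + h)"
      using DERIV_pos_inc_right[OF d2] by auto
    define t where "t = min r \<epsilon> / 2"
    have t: "0 < t" "t < r" "t < \<epsilon>" using r e by (auto simp: t_def)
    have "\<exists>s>0. s < t \<and> \<psi> t - \<psi> 0 = (t - 0) * \<psi>' s"
      by (rule MVT2[OF t(1)]) (use t in \<open>auto intro!: d\<close>)
    then obtain s where s: "0 < s" "s < t" "\<psi> t - \<psi> 0 = (t - 0) * \<psi>' s" by blast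
    have "0 < \<psi>' s" using r(2)[of s] s t z by simp
    then have "\<psi> t - \<psi> 0 > 0" using s t by simp
    moreover have "\<psi> t \<le> \<psi> 0" using max[of t] t by simp
    ultimately show False by simp
  qed
qed

context smooth_manifold
begin

text \<open>The one-variable test along the straight coordinate line in direction \<open>v\<close>,
  on which differentiating twice is applying \<open>chart_vec\<close> in direction \<open>v\<close>
  twice.\<close>

lemma chart_vec_at_max:
  assumes c: "c \<in> A" "m \<in> fst c" and h: "\<And>q. smooth_at A q h"
    and max: "\<And>q. Re (h q) \<le> Re (h m)"
  shows "Re (chart_vec A c m v h) = 0" "Re (chart_vec A c m v (\<lambda>q. chart_vec A c q v h)) \<le> 0"
proof -
  let ?a = "\<lambda>t::real. snd c m + t *\<^sub>R v"
  have "open (?a -` (snd c ` fst c))"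
    by (rule open_vimage[OF chart_open_img[OF c(1)]]) (intro continuous_intros)
  moreover have "0 \<in> ?a -` (snd c ` fst c)" using c by simp
  ultimately obtain \<epsilon> where e: "\<epsilon> > 0" "ball 0 \<epsilon> \<subseteq> ?a -` (snd c ` fst c)"
    using open_contains_ball by metis
  have I: "?a t \<in> snd c ` fst c" if "\<bar>t\<bar> < \<epsilon>" for t
    using subsetD[OF e(2), of t] that by (simp add: dist_real_def)
  define \<gamma> where "\<gamma> t = cinv c (?a t)" for t
  have \<gamma>: "\<gamma> t \<in> fst c" "snd c (\<gamma> t) = ?a t" if "\<bar>t\<bar> < \<epsilon>" for t
    using cinv_in[OF c(1) I[OF that]] snd_cinv[OF c(1) I[OF that]] by (simp_all add: \<gamma>_def)
  have \<gamma>0: "\<gamma> 0 = m" using cinv_snd[OF c] by (simp add: \<gamma>_def)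
  have D: "((\<lambda>t. Re (f (\<gamma> t))) has_real_derivative Re (chart_vec A c (\<gamma> t) v f)) (at t)"
    if t: "\<bar>t\<bar> < \<epsilon>" and f: "smooth_at A (\<gamma> t) f" for t f
  proof -
    have a: "(?a has_derivative (\<lambda>h. h *\<^sub>R v)) (at t)" by (auto intro!: derivative_eq_intros)
    have "((\<lambda>t. (f \<circ> cinv c) (?a t)) has_derivative (\<lambda>h. chart_vec A c (\<gamma> t) (h *\<^sub>R v) f)) (at t)"
      by (rule has_derivative_compose[OF a]) (use chart_vec_has_derivative[OF c(1) \<gamma>(1)[OF t] f] \<gamma>(2)[OF t] in \<open>simp add: comp_def\<close>)
    then have "((\<lambda>t. Re ((f \<circ> cinv c) (?a t))) has_derivative (\<lambda>h. Re (chart_vec A c (\<gamma> t) (h *\<^sub>R v) f))) (at t)"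
      by (rule bounded_linear.has_derivative[OF bounded_linear_Re])
    then show ?thesis
      unfolding has_field_derivative_def chart_vec_linear[OF c(1) \<gamma>(1)[OF t]]
      by (simp add: \<gamma>_def mult_commute_abs)
  qed
  have D1: "((\<lambda>t. Re (h (\<gamma> t))) has_real_derivative Re (chart_vec A c (\<gamma> t) v h)) (at t)" if "\<bar>t\<bar> < \<epsilon>" for t
    by (rule D[OF that h])
  have D2: "((\<lambda>t. Re (chart_vec A c (\<gamma> t) v h)) has_real_derivative Re (chart_vec A c m v (\<lambda>q. chart_vec A c q v h))) (at 0)"
    using D[of 0 "\<lambda>q. chart_vec A c q v h"] e(1) smooth_at_chart_vec[OF c h] \<gamma>0 by simp
  have mx: "Re (h (\<gamma> t)) \<le> Re (h (\<gamma> 0))" if "\<bar>t\<bar> < \<epsilon>" for t unfolding \<gamma>0 by (rule max)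
  from second_derivative_at_max[OF e(1) D1 D2 mx]
  show "Re (chart_vec A c m v h) = 0" "Re (chart_vec A c m v (\<lambda>q. chart_vec A c q v h)) \<le> 0" unfolding \<gamma>0 by auto
qed

text \<open>At a maximum the first-order part of the composite vanishes. What remains is the second
  derivative in the constant coordinate direction that represents \<open>F m\<close>.\<close>

lemma vfield_second_order_at_max:
  assumes F: "smooth_vfield A F" "\<And>p. F p \<in> tangent A p"
    and h: "\<And>q. smooth_at A q h" "\<And>q. h q \<in> \<real>" and max: "\<And>q. Re (h q) \<le> Re (h m)"
  shows "Re (F m (\<lambda>q. F q h)) \<le> 0"
proof -
  obtain c where c: "c \<in> A" "m \<in> fst c" by (rule chart_at)
  obtain v where v: "F m = chart_vec A c m v" using F(2)[of m] unfolding tangent_eq[OF c] by (rule rangeE)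
  have "chart_vec A c m b h = 0" for b
    using chart_vec_at_max(1)[OF c h(1) max, of b] chart_vec_real[OF c, of h b] h(2)
    by (auto simp: complex_is_Real_iff complex_eq_iff)
  then have "F m (\<lambda>q. F q h) =
      (\<Sum>b\<in>Basis. \<Sum>d\<in>Basis. F m (coord c b) * F m (coord c d) * chart_vec A c m d (\<lambda>q. chart_vec A c q b h))"
    using vfield_second_order[OF F(1) F(1) c h(1)] by simp
  also have "\<dots> = (\<Sum>b\<in>Basis. complex_of_real (v \<bullet> b) * chart_vec A c m v (\<lambda>q. chart_vec A c q b h))"
    unfolding v chart_vec_coord[OF c] chart_vec_Basis[OF c, of v "\<lambda>q. chart_vec A c q _ h"]
    by (simp add: sum_distrib_left mult.assoc)
  also have "\<dots> = chart_vec A c m v (\<lambda>q. \<Sum>b\<in>Basis. complex_of_real (v \<bullet> b) * chart_vec A c q b h)"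
  proof -
    have vc: "chart_vec A c m v \<in> ctangent A m" using chart_vec_tangent[OF c] tangent_subset by blast
    show ?thesis
      using ctangent_fun_sum[OF vc, of Basis "\<lambda>b q. complex_of_real (v \<bullet> b) * chart_vec A c q b h"]
        ctangent_fun_cmult[OF vc smooth_at_chart_vec[OF c h(1)]] smooth_at_cmult[OF smooth_at_chart_vec[OF c h(1)]] by simp
  qed
  also have "\<dots> = chart_vec A c m v (\<lambda>q. chart_vec A c q v h)"
  proof (rule chart_vec_cong[OF c])
    show "\<forall>\<^sub>F q in nhds m. (\<Sum>b\<in>Basis. complex_of_real (v \<bullet> b) * chart_vec A c q b h) = chart_vec A c q v h"
      using chart_eventually[OF c] by eventually_elim (rule chart_vec_Basis[OF c(1), symmetric])
  qed
  finally show ?thesis using chart_vec_at_max(2)[OF c h(1) max] by simp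
qed

lemma continuous_on_sm: "(\<And>p. smooth_at A p f) \<Longrightarrow> continuous_on UNIV f"
  unfolding continuous_on_def
proof
  fix p assume "\<And>p. smooth_at A p f"
  then have "(f \<longlongrightarrow> f p) (nhds p)" by (intro smooth_at_tendsto)
  then show "(f \<longlongrightarrow> f p) (at p within UNIV)" by (rule filterlim_mono) (simp_all add: at_within_def)
qed

lemma derivative_zero_const:
  assumes g: "\<And>p. smooth_at A p g" and z: "\<And>p w. w \<in> ctangent A p \<Longrightarrow> w g = 0"
    and conn: "connected (UNIV :: 'm set)"
  shows "\<exists>c :: complex. g = (\<lambda>p. c)"
proof -
  have loc: "\<forall>\<^sub>F q in nhds p. g p = g q" for p
  proof -
    obtain c where c: "c \<in> A" "p \<in> fst c" by (rule chart_at)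
    obtain r where r: "r > 0" "ball (snd c p) r \<subseteq> snd c ` fst c"
      using chart_open_img[OF c(1)] c(2) open_contains_ball by (metis imageI)
    have dd: "((g \<circ> cinv c) has_derivative (\<lambda>h. 0)) (at x within ball (snd c p) r)" if x: "x \<in> ball (snd c p) r" for x
    proof -
      have xin: "x \<in> snd c ` fst c" using x r by blast
      have y: "cinv c x \<in> fst c" "snd c (cinv c x) = x" by (rule cinv_in[OF c(1) xin], rule snd_cinv[OF c(1) xin])
      have "chart_vec A c (cinv c x) v g = 0" for v
        by (rule z[of _ "cinv c x"]) (use chart_vec_tangent[OF c(1) y(1)] tangent_subset in blast)
      then have "((g \<circ> cinv c) has_derivative (\<lambda>v. 0)) (at x)"
        using chart_vec_has_derivative[OF c(1) y(1) g] y(2) by simp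
      then show ?thesis by (rule has_derivative_at_withinI)
    qed
    have "\<exists>k. \<forall>x\<in>ball (snd c p) r. (g \<circ> cinv c) x = k"
      by (rule has_derivative_zero_constant[OF convex_ball dd])
    then obtain k where k: "\<forall>x\<in>ball (snd c p) r. (g \<circ> cinv c) x = k" by (rule exE)
    have "open (fst c \<inter> snd c -` ball (snd c p) r)" by (rule chart_preimage_open[OF c(1) open_ball])
    moreover have gk: "g q = k" if "q \<in> fst c \<inter> snd c -` ball (snd c p) r" for q
      using bspec[OF k, of "snd c q"] that cinv_snd[OF c(1), of q] by simp
    moreover have pin: "p \<in> fst c \<inter> snd c -` ball (snd c p) r" using c r by simp
    moreover have "g p = g q" if "q \<in> fst c \<inter> snd c -` ball (snd c p) r" for q
      unfolding gk[OF that] gk[OF pin] ..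
    ultimately show ?thesis unfolding eventually_nhds
      by (intro exI[of _ "fst c \<inter> snd c -` ball (snd c p) r"] conjI ballI)
  qed
  have "g p = g q" for p q
  proof (rule connected_local_const[OF conn UNIV_I UNIV_I], rule ballI)
    fix a show "\<forall>\<^sub>F b in at a. g a = g b"
      using loc[of a] by (simp add: eventually_at_filter eventually_mono)
  qed
  then show ?thesis by (intro exI[of _ "g undefined"] ext)
qed

lemma ctangent_Re:
  assumes u: "u \<in> tangent A p" and f: "smooth_at A p f"
  shows "u (\<lambda>q. complex_of_real (Re (f q))) = complex_of_real (Re (u f))"
proof -
  have uc: "u \<in> ctangent A p" using u tangent_subset by blast
  have r: "smooth_at A p (\<lambda>q. complex_of_real (Re (f q)))" "smooth_at A p (\<lambda>q. complex_of_real (Im (f q)))"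
    by (intro smooth_at_bounded_linear[OF bounded_linear_of_real] smooth_at_bounded_linear[OF bounded_linear_Re]
      smooth_at_bounded_linear[OF bounded_linear_Im] f)+
  have "f = (\<lambda>q. complex_of_real (Re (f q)) + \<i> * complex_of_real (Im (f q)))" by (simp add: complex_eq[symmetric])
  then have "u f = u (\<lambda>q. complex_of_real (Re (f q)) + \<i> * complex_of_real (Im (f q)))" by (rule arg_cong)
  also have "\<dots> = u (\<lambda>q. complex_of_real (Re (f q))) + \<i> * u (\<lambda>q. complex_of_real (Im (f q)))"
    unfolding ctangent_fun_add[OF uc r(1) smooth_at_cmult[OF r(2)]] ctangent_fun_cmult[OF uc r(2)] ..
  finally have e: "u f = u (\<lambda>q. complex_of_real (Re (f q))) + \<i> * u (\<lambda>q. complex_of_real (Im (f q)))" .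
  have "u (\<lambda>q. complex_of_real (Re (f q))) \<in> \<real>" "u (\<lambda>q. complex_of_real (Im (f q))) \<in> \<real>"
    by (rule ctangent_real[OF u], simp)+
  then show ?thesis unfolding e by (auto simp: complex_is_Real_iff complex_eq_iff)
qed

lemma smooth_at_Re: "smooth_at A p f \<Longrightarrow> smooth_at A p (\<lambda>q. complex_of_real (Re (f q)))"
  by (intro smooth_at_bounded_linear[OF bounded_linear_of_real] smooth_at_bounded_linear[OF bounded_linear_Re])

end

section \<open>Translations of the product and harmonic functions\<close>

context lie_grp
begin

definition trans2 :: "'g \<times> 'g \<Rightarrow> 'g \<times> 'g \<Rightarrow> 'g \<times> 'g" where
  "trans2 a z = (fst a \<odot> fst z, snd a \<odot> snd z)"

lemma smooth_map_at_trans2: "smooth_map_at M M z (trans2 a)"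
  unfolding trans2_def[abs_def]
  by (intro smooth_map_at_Pair AA.P.smooth_manifold_axioms)
    (rule smooth_map_at_compose[OF MA.two_manifolds_axioms smooth_manifold_axioms AA.smooth_map_at_fst smooth_map_at_L],
     rule smooth_map_at_compose[OF MA.two_manifolds_axioms smooth_manifold_axioms AA.smooth_map_at_snd smooth_map_at_L])

sublocale MM: two_manifolds M M ..

lemma lift_trans2:
  assumes X: "left_inv X" and h: "smooth_at M (trans2 a z) h"
  shows "lift1 X z (\<lambda>w. h (trans2 a w)) = lift1 X (trans2 a z) h"
    "lift2 X z (\<lambda>w. h (trans2 a w)) = lift2 X (trans2 a z) h"
proof -
  have s: "smooth_at M z (\<lambda>w. h (trans2 a w))" by (rule MM.smooth_at_comp[OF smooth_map_at_trans2 h])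
  show "lift1 X z (\<lambda>w. h (trans2 a w)) = lift1 X (trans2 a z) h"
    unfolding lift_apply(1)[OF s] lift_apply(1)[OF h]
    using left_inv_apply[OF X, of "fst a" "fst z" "\<lambda>x. h (x, snd a \<odot> snd z)"] smooth_at_slice(1)[OF h]
    by (simp add: trans2_def)
  show "lift2 X z (\<lambda>w. h (trans2 a w)) = lift2 X (trans2 a z) h"
    unfolding lift_apply(2)[OF s] lift_apply(2)[OF h]
    using left_inv_apply[OF X, of "snd a" "snd z" "\<lambda>x. h (fst a \<odot> fst z, x)"] smooth_at_slice(2)[OF h]
    by (simp add: trans2_def)
qed

lemma trans2_transitive: "\<exists>a. trans2 a z = w"
  by (rule exI[of _ "(fst w \<odot> inv\<^bsub>G\<^esub> fst z, snd w \<odot> inv\<^bsub>G\<^esub> snd z)"])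
    (simp add: trans2_def mul_assoc inv_mul mul_one)

text \<open>If \<open>u\<close> is harmonic for \<open>X\<^sup>2 + Y\<^sup>2\<close> and not annihilated by \<open>X\<close> and \<open>Y\<close>, then finitely many translates
  of \<open>u\<^sup>2\<close> add up to a function with positive Laplacian on the compact manifold, which contradicts
  the second derivative test at its maximum.\<close>

lemma harmonic_annihilated:
  assumes X: "smooth_vfield A X" "\<And>p. X p \<in> tangent A p" "left_inv X"
    and u: "\<And>z. smooth_at M z u" "\<And>z. u z \<in> \<real>"
    and harm: "\<And>z. lift1 X z (\<lambda>w. lift1 X w u) + lift2 X z (\<lambda>w. lift2 X w u) = 0"
    and comp: "compact (UNIV :: ('g \<times> 'g) set)"
  shows "lift1 X z0 u = 0 \<and> lift2 X z0 u = 0"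
proof (rule ccontr)
  assume ne: "\<not> (lift1 X z0 u = 0 \<and> lift2 X z0 u = 0)"
  define L where "L h z = lift1 X z (\<lambda>w. lift1 X w h) + lift2 X z (\<lambda>w. lift2 X w h)" for h z
  note sX = lift_smooth[OF X(1)] and cX = lift_smooth[OF X(1), THEN AA.P.vfield_ct]
  have rX: "lift1 X z \<in> tangent M z" "lift2 X z \<in> tangent M z" for z
    using lift_tangent X(2) by blast+
  have Lsm: "smooth_at M z (L h)" if "\<And>z. smooth_at M z h" for h z
    unfolding L_def by (intro AA.P.smooth_at_add AA.P.vfield_sm[OF sX(1)] AA.P.vfield_sm[OF sX(2)] that)
  have Ltr: "L (\<lambda>w. h (trans2 a w)) z = L h (trans2 a z)" if h: "\<And>z. smooth_at M z h" for h a z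
    unfolding L_def lift_trans2[OF X(3) h]
      lift_trans2(1)[OF X(3) AA.P.vfield_sm[OF sX(1) h]] lift_trans2(2)[OF X(3) AA.P.vfield_sm[OF sX(2) h]] ..
  have Lsum: "L (\<lambda>w. \<Sum>a\<in>D. h a w) z = (\<Sum>a\<in>D. L (h a) z)" if h: "\<And>a z. smooth_at M z (h a)" for h D z
    unfolding L_def AA.P.ctangent_fun_sum[OF cX(1) h] AA.P.ctangent_fun_sum[OF cX(2) h]
      AA.P.ctangent_fun_sum[OF cX(1) AA.P.vfield_sm[OF sX(1) h]] AA.P.ctangent_fun_sum[OF cX(2) AA.P.vfield_sm[OF sX(2) h]]
      sum.distrib ..
  let ?v = "\<lambda>w. u w * u w"
  have vsm: "smooth_at M z ?v" for z by (rule AA.P.smooth_at_mult[OF u(1) u(1)])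
  \<comment> \<open>The product rule applied twice to the square of \<open>u\<close>; summed over
    the two lifts, the terms with the factor \<open>u\<close> cancel by \<open>harm\<close>.\<close>
  have sq: "F z (\<lambda>w. F w ?v) = 2 * (F z u)\<^sup>2 + 2 * u z * F z (\<lambda>w. F w u)"
    if F: "smooth_vfield M F" for F z
  proof -
    note Fc = AA.P.vfield_ct[OF F]
    have Fu: "smooth_at M z (\<lambda>w. F w u)" for z by (rule AA.P.vfield_sm[OF F u(1)])
    have "F w ?v = 2 * (u w * F w u)" for w using AA.P.ctangent_fun_mult[OF Fc u(1) u(1)] by simp
    then have "F z (\<lambda>w. F w ?v) = F z (\<lambda>w. 2 * (u w * F w u))" by (simp only:)
    also have "\<dots> = 2 * (u z * F z (\<lambda>w. F w u) + F z u * F z u)"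
      unfolding AA.P.ctangent_fun_cmult[OF Fc AA.P.smooth_at_mult[OF u(1) Fu]] AA.P.ctangent_fun_mult[OF Fc u(1) Fu] ..
    finally show ?thesis by (simp add: power2_eq_square algebra_simps)
  qed
  have Lv: "L ?v z = 2 * (lift1 X z u)\<^sup>2 + 2 * (lift2 X z u)\<^sup>2" for z
  proof -
    have "L ?v z = 2 * (lift1 X z u)\<^sup>2 + 2 * (lift2 X z u)\<^sup>2 +
      2 * u z * (lift1 X z (\<lambda>w. lift1 X w u) + lift2 X z (\<lambda>w. lift2 X w u))"
      unfolding L_def sq[OF sX(1)] sq[OF sX(2)] by (simp add: algebra_simps)
    then show ?thesis unfolding harm by simp
  qed
  have real: "lift1 X z u \<in> \<real>" "lift2 X z u \<in> \<real>" for z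
    using AA.P.ctangent_real[OF rX(1)] AA.P.ctangent_real[OF rX(2)] u(2) by simp_all
  have ReLv: "Re (L ?v z) = 2 * (Re (lift1 X z u))\<^sup>2 + 2 * (Re (lift2 X z u))\<^sup>2" for z
    unfolding Lv using real[of z] by (auto simp: complex_is_Real_iff power2_eq_square)
  have pos: "0 \<le> Re (L ?v z)" for z unfolding ReLv by simp
  have pos0: "0 < Re (L ?v z0)"
  proof -
    have "Re (lift1 X z0 u) \<noteq> 0 \<or> Re (lift2 X z0 u) \<noteq> 0"
      using ne real[of z0] by (auto simp: complex_is_Real_iff complex_eq_iff)
    then show ?thesis unfolding ReLv by (auto intro: add_pos_nonneg add_nonneg_pos)
  qed
  \<comment> \<open>Translations act transitively, so every point can be moved to \<open>z0\<close>,
    where \<open>L ?v\<close> is positive. These open sets cover the compact product, and a finite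
    subcover selects the translates that are added.\<close>
  define U where "U a = {z. 0 < Re (L ?v (trans2 a z))}" for a
  have Uopen: "open (U a)" for a
  proof -
    have "smooth_at M z (\<lambda>z. L ?v (trans2 a z))" for z by (rule MM.smooth_at_comp[OF smooth_map_at_trans2 Lsm[OF vsm]])
    then have "continuous_on UNIV (\<lambda>z. L ?v (trans2 a z))" by (rule AA.P.continuous_on_sm)
    then have "continuous_on UNIV (\<lambda>z. Re (L ?v (trans2 a z)))" by (rule continuous_on_Re)
    from open_Collect_less[OF continuous_on_const this] show ?thesis by (simp add: U_def)
  qed
  have cover: "UNIV \<subseteq> (\<Union>a\<in>UNIV. U a)"
  proof
    fix z :: "'g \<times> 'g"
    obtain a where "trans2 a z = z0" using trans2_transitive by blast
    then have "z \<in> U a" using pos0 by (simp add: U_def)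
    then show "z \<in> (\<Union>a\<in>UNIV. U a)" by blast
  qed
  obtain D where D: "finite D" "UNIV \<subseteq> (\<Union>a\<in>D. U a)"
    by (rule compactE_image[OF comp Uopen cover])
  define h where "h z = (\<Sum>a\<in>D. ?v (trans2 a z))" for z
  have tsm: "smooth_at M z (\<lambda>w. ?v (trans2 a w))" for z a by (rule MM.smooth_at_comp[OF smooth_map_at_trans2 vsm])
  have hsm: "smooth_at M z h" for z unfolding h_def[abs_def] by (rule AA.P.smooth_at_sum) (rule tsm)
  have hreal: "h z \<in> \<real>" for z unfolding h_def by (intro sum_in_Reals Reals_mult u(2))
  have Lh: "Re (L h z) > 0" for z
  proof -
    have "L h z = (\<Sum>a\<in>D. L ?v (trans2 a z))"
      unfolding h_def[abs_def] Lsum[OF tsm] Ltr[OF vsm] ..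
    then have e: "Re (L h z) = (\<Sum>a\<in>D. Re (L ?v (trans2 a z)))" by simp
    obtain a where a: "a \<in> D" "z \<in> U a" using D(2) by blast
    show ?thesis unfolding e
      by (rule sum_pos2[OF D(1) a(1)]) (use a(2) pos in \<open>simp_all add: U_def\<close>)
  qed
  have "continuous_on UNIV (\<lambda>z. Re (h z))"
    by (rule continuous_on_Re[OF AA.P.continuous_on_sm[OF hsm]])
  then obtain m where m: "\<And>z. Re (h z) \<le> Re (h m)"
    using continuous_attains_sup[OF comp, of "\<lambda>z. Re (h z)"] by auto
  have "Re (lift1 X m (\<lambda>w. lift1 X w h)) \<le> 0" "Re (lift2 X m (\<lambda>w. lift2 X w h)) \<le> 0"
    using AA.P.vfield_second_order_at_max[OF sX(1) rX(1) hsm hreal m]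
      AA.P.vfield_second_order_at_max[OF sX(2) rX(2) hsm hreal m] by blast+
  then show False using Lh[of m] by (simp add: L_def)
qed

end

section \<open>Pseudoholomorphic functions on the product and the conclusion\<close>

context almost_complex_product
begin

sublocale CF: complex_frame M J n Z Zb "phi A e" phb "\<lambda>l k m. (1 + \<i>) / 4 * C l k m"
proof unfold_locales
  show "cdim M = n" using n_DIM by (simp add: cdim_def)
qed (fact Z_smooth phi_alt phi_lin(2) phi_smooth phi_expand phi_dual proj_ct proj_lin proj_Z bracket_Zb_Z)+

lemma Phi_eq: "wedge_list M (map (phi A e) [1..<Suc n]) = CF.Phi"
  by (simp only: CF.Phi_def)

text \<open>The factor \<open>(1 + \<i>) / 4\<close> between the \<open>tau l\<close> and the traces
  is not zero.\<close>

lemma unimodular_tau: "unimodular A G \<longleftrightarrow> (\<forall>l\<in>{1..n}. CF.tau l = 0)"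
proof -
  have te: "CF.tau l = (1 + \<i>) / 4 * (\<Sum>m=1..n. C l m m)" for l
    by (simp only: CF.tau_def sum_distrib_left)
  have "(1 + \<i>) / 4 \<noteq> (0 :: complex)" by (simp add: complex_eq_iff)
  then show ?thesis unfolding unimodular_iff te mult_eq_0_iff by blast
qed

text \<open>That \<open>Zb i\<close> annihilates \<open>g\<close> is the Cauchy-Riemann equation
  \<open>X g = - \<i> Y g\<close> for the two lifts of \<open>E i\<close>. As the lifts commute,
  \<open>g\<close> is harmonic for \<open>X^2 + Y^2\<close>, and so is its real part because the
  lifts are real.\<close>

lemma pseudoholomorphic_compact_Re:
  assumes comp: "compact (UNIV :: ('g \<times> 'g) set)" and g: "CF.pseudoholomorphic g" and i: "i \<in> {1..n}"
  shows "Re (lift1 (E i) z g) = 0" "Re (lift2 (E i) z g) = 0"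
proof -
  let ?X = "lift1 (E i)" and ?Y = "lift2 (E i)"
  have smooth_at: "\<And>z. smooth_at M z g" by (rule g[unfolded CF.pseudoholomorphic_def, THEN conjunct1, THEN spec])
  note sX = lift_smooth[OF E_smooth[OF i]] and cX = lift_smooth[OF E_smooth[OF i], THEN AA.P.vfield_ct]
  have rX: "?X z \<in> tangent M z" "?Y z \<in> tangent M z" for z
    by (intro lift_tangent E_tangent[OF i])+
  have XY: "?X z g = - \<i> * ?Y z g" for z
  proof -
    have "Zb i z \<in> ctangent M z" by (rule CF.Z_ct(2)[OF i])
    then have "proj01 J z (Zb i z) g = 0" using g unfolding CF.pseudoholomorphic_def by blast
    then have "?X z g / 2 + \<i> * ?Y z g / 2 = 0" unfolding proj_Z(4)[OF i] by (simp add: Zb_def)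
    then show ?thesis by (simp add: eq_neg_iff_add_eq_0 add_divide_distrib[symmetric])
  qed
  have Ysm: "smooth_at M z (\<lambda>w. ?Y w g)" "smooth_at M z (\<lambda>w. ?X w g)" for z
    by (intro AA.P.vfield_sm[OF sX(2) smooth_at] AA.P.vfield_sm[OF sX(1) smooth_at])+
  have comm: "?X z (\<lambda>w. ?Y w g) = ?Y z (\<lambda>w. ?X w g)" for z
    using fun_cong[OF bracket_lift12[OF E_smooth[OF i] E_smooth[OF i]], of z g] AA.P.bracket_apply[OF smooth_at] by simp
  have harm: "?X z (\<lambda>w. ?X w g) + ?Y z (\<lambda>w. ?Y w g) = 0" for z
  proof -
    have "?X z (\<lambda>w. ?X w g) = ?X z (\<lambda>w. - \<i> * ?Y w g)" by (simp only: XY)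
    also have "\<dots> = - \<i> * ?Y z (\<lambda>w. ?X w g)" unfolding AA.P.ctangent_fun_cmult[OF cX(1) Ysm(1)] comm ..
    also have "?Y z (\<lambda>w. ?X w g) = - \<i> * ?Y z (\<lambda>w. ?Y w g)" unfolding XY AA.P.ctangent_fun_cmult[OF cX(2) Ysm(1)] ..
    finally show ?thesis by simp
  qed
  let ?u = "\<lambda>w. complex_of_real (Re (g w))"
  have Xu: "?X z ?u = complex_of_real (Re (?X z g))" "?Y z ?u = complex_of_real (Re (?Y z g))" for z
    by (rule AA.P.ctangent_Re[OF rX(1) smooth_at], rule AA.P.ctangent_Re[OF rX(2) smooth_at])
  have harmu: "?X z (\<lambda>w. ?X w ?u) + ?Y z (\<lambda>w. ?Y w ?u) = 0" for z
    unfolding Xu AA.P.ctangent_Re[OF rX(1) Ysm(2)] AA.P.ctangent_Re[OF rX(2) Ysm(1)]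
    using arg_cong[OF harm[of z], of Re] by (simp flip: of_real_add)
  have "?X z ?u = 0 \<and> ?Y z ?u = 0" for z
    by (rule harmonic_annihilated[OF E_smooth[OF i] E_tangent[OF i] E_left[OF i] AA.P.smooth_at_Re[OF smooth_at] Reals_of_real harmu comp])
  then show "Re (?X z g) = 0" "Re (?Y z g) = 0" unfolding Xu by simp_all
qed

lemma pseudoholomorphic_compact_const:
  assumes comp: "compact (UNIV :: ('g \<times> 'g) set)" and conn: "connected (UNIV :: ('g \<times> 'g) set)"
    and g: "CF.pseudoholomorphic g"
  shows "\<exists>c. g = (\<lambda>z. c)"
proof (rule AA.P.derivative_zero_const[OF _ _ conn])
  show smooth_at: "smooth_at M z g" for z by (rule g[unfolded CF.pseudoholomorphic_def, THEN conjunct1, THEN spec])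
  fix z w assume w: "w \<in> ctangent M z"
  \<comment> \<open>The real part of a derivative of \<open>\<i> * g\<close> is minus the imaginary
    part of that derivative of \<open>g\<close>, so the previous result covers the imaginary part
    too.\<close>
  have ig: "CF.pseudoholomorphic (\<lambda>q. \<i> * g q)"
    unfolding CF.pseudoholomorphic_def
  proof (intro conjI allI ballI)
    fix p show "smooth_at M p (\<lambda>q. \<i> * g q)" by (rule AA.P.smooth_at_cmult[OF smooth_at])
    fix v assume v: "v \<in> ctangent M p"
    show "proj01 J p v (\<lambda>q. \<i> * g q) = 0"
      unfolding AA.P.ctangent_fun_cmult[OF proj_ct(2)[OF v] smooth_at]
        g[unfolded CF.pseudoholomorphic_def, THEN conjunct2, THEN spec, THEN bspec, OF v] by simp
  qed
  have "lift1 (E i) z g = 0 \<and> lift2 (E i) z g = 0" if i: "i \<in> {1..n}" for i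
  proof -
    note c = lift_smooth[OF E_smooth[OF i], THEN AA.P.vfield_ct]
    show ?thesis
      using pseudoholomorphic_compact_Re[OF comp g i, of z] pseudoholomorphic_compact_Re[OF comp ig i, of z]
      unfolding AA.P.ctangent_fun_cmult[OF c(1) smooth_at] AA.P.ctangent_fun_cmult[OF c(2) smooth_at] by (simp add: complex_eq_iff)
  qed
  then show "w g = 0" unfolding th_expand[OF w, of g] by simp
qed

lemma dbar_Phi_iff_unimodular:
  "unimodular A G \<longleftrightarrow> dbar M J n 0 (wedge_list M (map (phi A e) [1..<Suc n])) = (\<lambda>p vs. 0)"
  unfolding Phi_eq CF.dbar_Phi_zero_iff unimodular_tau ..

lemma unimodular_imp_trivial: "unimodular A G \<Longrightarrow> pseudoholomorphically_trivial M J"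
  unfolding unimodular_tau by (rule CF.trivialI)

lemma unimodular_imp_kod_zero:
  assumes uni: "unimodular A G" and conn: "connected (UNIV :: ('g \<times> 'g) set)"
    and fin: "compact (UNIV :: ('g \<times> 'g) set) \<or> (\<forall>m\<ge>1. finite_dim (H0 M J m))"
  shows "kod M J = 0"
proof -
  have z: "\<forall>l\<in>{1..n}. CF.tau l = 0" using uni unfolding unimodular_tau .
  show ?thesis
  proof (rule CF.kod_zeroI[OF z])
    fix g assume g: "CF.pseudoholomorphic g"
    show "\<exists>c. g = (\<lambda>p. c)"
      using fin
    proof
      assume "compact (UNIV :: ('g \<times> 'g) set)"
      then show ?thesis using conn g by (rule pseudoholomorphic_compact_const)
    next
      assume "\<forall>m\<ge>1. finite_dim (H0 M J m)"
      then have "finite_dim (H0 M J 1)" by simp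
      then show ?thesis by (rule CF.pseudoholomorphic_finite_dim_const[OF z conn _ g])
    qed
  qed
qed

lemma canonical_bundle_product:
  assumes conn: "connected (UNIV :: 'g set)"
  shows "unimodular A G \<longleftrightarrow> dbar M J n 0 (wedge_list M (map (phi A e) [1..<Suc n])) = (\<lambda>p vs. 0)"
    and "unimodular A G \<Longrightarrow> pseudoholomorphically_trivial M J \<and>
      ((compact (UNIV :: ('g \<times> 'g) set) \<or> (\<forall>m\<ge>1. finite_dim (H0 M J m))) \<longrightarrow> kod M J = 0)"
proof -
  have "connected (UNIV :: ('g \<times> 'g) set)"
    using connected_Times[OF conn conn] by (simp add: UNIV_Times_UNIV)
  then show "unimodular A G \<Longrightarrow> pseudoholomorphically_trivial M J \<and>
      ((compact (UNIV :: ('g \<times> 'g) set) \<or> (\<forall>m\<ge>1. finite_dim (H0 M J m))) \<longrightarrow> kod M J = 0)"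
    using unimodular_imp_trivial unimodular_imp_kod_zero by blast
qed (rule dbar_Phi_iff_unimodular)

end

theorem theorem5p6:
  fixes G :: "'g::{t2_space, second_countable_topology} monoid"
    and A :: "('g, 'e::euclidean_space) chart set"
    and n :: nat
    and e :: "nat \<Rightarrow> 'g form"
    and J :: "'g \<times> 'g \<Rightarrow> ('g \<times> 'g) tvec \<Rightarrow> ('g \<times> 'g) tvec"
  assumes "lie_group A G"
    and "connected (UNIV :: 'g set)"
    and "n = DIM('e)"
    and "left_invariant_coframe A G n e"
    and "almost_complex (prod_atlas A A) J"
    and "left_invariant_endo (prod_atlas A A) (G \<times>\<times> G) J"
    and "\<And>p. pq_forms (prod_atlas A A) J 1 0 p =
              {\<lambda>vs. \<Sum>i=1..n. c i * phi A e i p vs | c. True}"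
  shows "(unimodular A G \<longleftrightarrow>
           dbar (prod_atlas A A) J n 0 (wedge_list (prod_atlas A A) (map (phi A e) [1..<Suc n]))
             = (\<lambda>p vs. 0)) \<and>
         (unimodular A G \<longrightarrow>
           pseudoholomorphically_trivial (prod_atlas A A) J \<and>
           (compact (UNIV :: ('g \<times> 'g) set) \<or>
              (\<forall>m\<ge>1. finite_dim (H0 (prod_atlas A A) J m)) \<longrightarrow>
            kod (prod_atlas A A) J = 0))"
proof -
  interpret almost_complex_product G A n e J
    by unfold_locales (fact assms)+
  show ?thesis using canonical_bundle_product[OF assms(2)] by blast
qed

end
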